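(* Let $(X_s)_{s\ge0}$ be a Banach scale with smoothing projectors and $F:[0,\varepsilon_* )\times\mathcal I\times X_{s_0+\nu}\to X_{s_0}$ a parameter family of $C^2$ maps satisfying (F0)-(F4) of the context. Then, for all $\tau>0$, $\delta\in(0,1/4)$, $\sigma$, $s_1>s_0$, $S<S'$ satisfying $$\sigma\ge\max\{2(\tau+\delta s_1)+3\nu+2,\ 4(\tau+\delta s_1+\nu)\},\qquad 2\big(2(\tau+\delta s_1)+\nu+3+\sigma\big)\le S-s_1\le4(\sigma+1),$$ there are $c,\bar N_0,K_0>0$ such that, for all $N_0\ge\bar N_0$ and $\varepsilon_0\in(0,\varepsilon_*]$ small enough that $\varepsilon_0N_0^S\le c$, and for all $\varepsilon\in[0,\varepsilon_0)$, there is a sequence $\{u_n=u_n(\varepsilon,\cdot)\}_{n\ge0}\subset C^1(\mathcal I,X_{s_1+\nu})$ such that, with $N_n:=N_0^{2^n}$, $E_n:=E^{(N_n)}$, $\Pi_n:=\Pi^{(N_n)}$, $\mu:=\tau+\delta s_1$, for all $n\geq 0$: (S1)$_n$ $u_n(\varepsilon,\lambda)\in E_n$, $u_n(0,\lambda)=0$, $\|u_n\|_{s_1}\le1$ and $\|\partial_\lambda u_n\|_{s_1}\le K_0N_0^{\sigma/2}$. ($\widehat{\mathrm{S1}}$)$_n$ If there are closed subspaces $\widehat X_s\subset X_s$, $s\ge0$, such that $F(\varepsilon,\lambda,\cdot):\widehat X_{s+\nu}\to\widehat X_s$, then $u_n(\varepsilon,\lambda)\in E_n\cap\widehat X_s$.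 (S2)$_n$ For all $1\le i\le n$: $\|u_i-u_{i-1}\|_{s_1}\le N_i^{-\sigma-1}$ and $\|\partial_\lambda(u_i-u_{i-1})\|_{s_1}\le N_i^{-1-\nu}$. (S3)$_n$ Set $u_{-1}:=0$ and $A_n:=\bigcap_{i=0}^n\mathtt G^{(N_i)}_{\tau,\delta}(u_{i-1})$. For $\lambda\in\mathcal N(A_n,N_n^{-\sigma/2})$ the function $u_n(\varepsilon,\lambda)$ solves $\Pi_nF(\varepsilon,\lambda,u)=0$. (S4)$_n$ Setting $B_n:=1+\|u_n\|_S$ and $B_n':=\|\partial_\lambda u_n\|_S$, one has $B_n\le2N_{n+1}^p$ with $p:=\mu+\frac\nu2+1$, and $B_n'\le2N_{n+1}^q$ with $q:=2\mu+\nu+2+\frac\sigma2$. As a consequence, for all $\varepsilon\in[0,\varepsilon_0)$ the sequence $\{u_n(\varepsilon,\cdot)\}_{n\ge0}$ converges uniformly in $C^1(\mathcal I,X_{s_1+\nu})$ to $u_\varepsilon$ with $u_0(\lambda)\equiv0$, at the superexponential rate $$\|u_\varepsilon(\lambda)-u_n(\lambda)\|_{s_1}\le N_{n+1}^{-\sigma-1}\qquad\forall\lambda\in\mathcal I,$$ and for all $\lambda\in A_\infty:=\bigcap_{n\ge0}A_n$ one has $F(\varepsilon,\lambda,u_\varepsilon(\lambda))=0$. Finally, if subspaces $\widehat X_s$ as in ($\widehat{\mathrm{S1}}$)$_n$ exist, then $u_\varepsilon(\lambda)\in\widehat X_{s_1+\nu}$.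
   Context: **Scale.** $(X_s,\|\cdot\|_s)_{s\ge0}$ are Banach spaces with $X_{s'}\subseteq X_s$ and $\|u\|_s\le\|u\|_{s'}$ for $s\le s'$, $u\in X_{s'}$; $X:=\bigcap_{s\ge0}X_s$. There is a non-decreasing family $(E^{(N)})_{N\ge0}$ of subspaces of $X$ with $\bigcup_NE^{(N)}$ dense in every $X_s$, and projectors $\Pi^{(N)}:X_0\to E^{(N)}$ such that for any $s\ge0$, $\nu'\ge0$ there is $C=C(s,\nu')>0$ with (P1) $\|\Pi^{(N)}u\|_{s+\nu'}\le CN^{\nu'}\|u\|_s$ for all $u\in X_s$; (P2) $\|(\mathbb 1-\Pi^{(N)})u\|_s\le CN^{-\nu'}\|u\|_{s+\nu'}$ for all $u\in X_{s+\nu'}$. **Map.** $s_0\ge0$, $\nu>0$, $\mathcal I\subset\mathbb R$ is an interval, $\varepsilon_*>0$, $S'>s_0$. Assumptions: (F0) $F(0,\lambda,0)=0$ for any $\lambda\in\mathcal I$; and for all $s\in[s_0,S')$, $\|u\|_{s_0}\le1$, $(\varepsilon,\lambda)\in[0,\varepsilon_* )\times\mathcal I$: (F1) $\|\partial_\lambda F(\varepsilon,\lambda,u)\|_s\le C(s)(1+\|u\|_{s+\nu})$; (F2) $\|D_uF(\varepsilon,\lambda,0)[h]\|_s\le C(s)\|h\|_{s+\nu}$; (F3) $\|D_u^2F(\varepsilon,\lambda,u)[h,v]\|_s\le C(s)(\|u\|_{s+\nu}\|h\|_{s_0}\|v\|_{s_0}+\|h\|_{s+\nu}\|v\|_{s_0}+\|h\|_{s_0}\|v\|_{s+\nu})$;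 (F4) $\|\partial_\lambda D_uF(\varepsilon,\lambda,u)[h]\|_s\le C(s)(\|h\|_{s+\nu}+\|u\|_{s+\nu}\|h\|_{s_0})$. **Good sets.** $L^{(N)}(\varepsilon,\lambda,u):=\Pi^{(N)}D_uF(\varepsilon,\lambda,u)|_{E^{(N)}}$. For fixed constants $C(s)$, $s\in[s_1,S]$ (on which $c,\bar N_0,K_0$ may depend), $J^{(N)}_{\tau,\delta}$ is the set of $(\lambda,u)\in\mathcal I\times E^{(N)}$ such that $\|u\|_{s_1}\le1$, $L^{(N)}(\varepsilon,\lambda,u)$ is invertible and, for all $s\in[s_1,S]$, $\varepsilon\in[0,\varepsilon_0)$, $$\|L^{(N)}(\varepsilon,\lambda,u)^{-1}[h]\|_s\le C(s)N^\mu\big(\|h\|_s+N^{\delta(s-s_1)}\|u\|_s\|h\|_{s_1}\big),\qquad\mu:=\tau+\delta s_1 .$$ For $u\in C^1(\mathcal I,E^{(N)})$, $\mathtt G^{(N)}_{\tau,\delta}(u):=\{\lambda\in\mathcal I:(\lambda,u(\lambda))\in J^{(N)}_{\tau,\delta}\}$. For a set $A$ and $\eta>0$, $\mathcal N(A,\eta)$ is the open neighbourhood of $A$ of width $\eta$. Norms of $u_n,\partial_\lambda u_n$ are understood uniformly in $\lambda\in\mathcal I$.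
   Formalization: Adds ‖F(ε,λ,0)‖_s ≤ C(s)ε for s in [s_0,S'), without which (S1) can fail, and, in the claims on X̂_s only, that Π^(N) maps X̂_s into itself and E^(N)∩X̂_s is finite-dimensional (N ≥ 1), without which these claims can fail. *)

theory Defs
  imports "HOL-Analysis.Analysis"
begin

text \<open>
  A scale of Banach spaces is a family of spaces indexed by a real number, so the spaces are modelled
  as subspaces \<open>X s\<close> of one ambient real vector space, each with its own norm \<open>nrm s\<close>; the
  value of \<open>nrm s\<close> outside \<open>X s\<close> is irrelevant.
\<close>

definition normed_on :: "'a::real_vector set \<Rightarrow> ('a \<Rightarrow> real) \<Rightarrow> bool" where
  "normed_on V n \<longleftrightarrow> subspace V \<and>
     (\<forall>x\<in>V. 0 \<le> n x \<and> (n x = 0 \<longleftrightarrow> x = 0)) \<and>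
     (\<forall>c. \<forall>x\<in>V. n (c *\<^sub>R x) = \<bar>c\<bar> * n x) \<and>
     (\<forall>x\<in>V. \<forall>y\<in>V. n (x + y) \<le> n x + n y)"

text \<open>The value 0 off the carrier is what the global axioms of \<^locale>\<open>Metric_space\<close> call for.\<close>

definition ndist :: "'a::real_vector set \<Rightarrow> ('a \<Rightarrow> real) \<Rightarrow> 'a \<Rightarrow> 'a \<Rightarrow> real" where
  "ndist V n x y = (if x \<in> V \<and> y \<in> V then n (x - y) else 0)"

abbreviation ntopology :: "'a::real_vector set \<Rightarrow> ('a \<Rightarrow> real) \<Rightarrow> 'a topology" where
  "ntopology V n \<equiv> Metric_space.mtopology V (ndist V n)"

lemma Metric_space_ndist:
  assumes "normed_on V n"
  shows "Metric_space V (ndist V n)"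
proof
  have V: "subspace V" and nn: "\<And>x. x \<in> V \<Longrightarrow> 0 \<le> n x \<and> (n x = 0 \<longleftrightarrow> x = 0)"
    and sc: "\<And>c x. x \<in> V \<Longrightarrow> n (c *\<^sub>R x) = \<bar>c\<bar> * n x"
    and tri: "\<And>x y. x \<in> V \<Longrightarrow> y \<in> V \<Longrightarrow> n (x + y) \<le> n x + n y"
    using assms by (auto simp: normed_on_def)
  show "0 \<le> ndist V n x y" for x y
    using nn subspace_diff[OF V] by (auto simp: ndist_def)
  show "ndist V n x y = ndist V n y x" for x y
  proof (cases "x \<in> V \<and> y \<in> V")
    case True
    then have "n ((-1) *\<^sub>R (y - x)) = n (y - x)"
      using sc[of "y - x" "-1"] subspace_diff[OF V] by simp
    with True show ?thesis by (simp add: ndist_def)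
  qed (auto simp: ndist_def)
  show "ndist V n x y = 0 \<longleftrightarrow> x = y" if "x \<in> V" "y \<in> V" for x y
    using that nn[of "x - y"] subspace_diff[OF V] by (auto simp: ndist_def)
  show "ndist V n x z \<le> ndist V n x y + ndist V n y z" if "x \<in> V" "y \<in> V" "z \<in> V" for x y z
    using that tri[of "x - y" "y - z"] subspace_diff[OF V] by (auto simp: ndist_def)
qed

definition banach_on :: "'a::real_vector set \<Rightarrow> ('a \<Rightarrow> real) \<Rightarrow> bool" where
  "banach_on V n \<longleftrightarrow> normed_on V n \<and> Metric_space.mcomplete V (ndist V n)"

locale banach_scale =
  fixes X :: "real \<Rightarrow> 'a::real_vector set" and nrm :: "real \<Rightarrow> 'a \<Rightarrow> real"
  assumes banach: "0 \<le> s \<Longrightarrow> banach_on (X s) (nrm s)"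
    and X_antimono: "0 \<le> s \<Longrightarrow> s \<le> s' \<Longrightarrow> X s' \<subseteq> X s"
    and nrm_mono: "0 \<le> s \<Longrightarrow> s \<le> s' \<Longrightarrow> u \<in> X s' \<Longrightarrow> nrm s u \<le> nrm s' u"

text \<open>
  The estimates \<open>P1\<close>, \<open>P2\<close> are only required for \<open>N \<ge> 1\<close>. For \<open>N = 0\<close> the powers are degenerate,
  and for \<open>0 < N < 1\<close> already the Fourier projectors (which keep the zero mode) violate \<open>P1\<close>. Only
  large \<open>N\<close> matter, and the weaker requirement makes the results stronger.
\<close>

locale smoothing_scale = banach_scale X nrm
  for X :: "real \<Rightarrow> 'a::real_vector set" and nrm :: "real \<Rightarrow> 'a \<Rightarrow> real" +
  fixes E :: "real \<Rightarrow> 'a set" and P :: "real \<Rightarrow> 'a \<Rightarrow> 'a"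
  assumes E_subspace: "0 \<le> N \<Longrightarrow> subspace (E N)"
    and E_subset: "0 \<le> N \<Longrightarrow> 0 \<le> s \<Longrightarrow> E N \<subseteq> X s"
    and E_mono: "0 \<le> N \<Longrightarrow> N \<le> N' \<Longrightarrow> E N \<subseteq> E N'"
    and E_dense: "0 \<le> s \<Longrightarrow> ntopology (X s) (nrm s) closure_of (\<Union>N\<in>{0..}. E N) = X s"
    and P_add: "0 \<le> N \<Longrightarrow> u \<in> X 0 \<Longrightarrow> v \<in> X 0 \<Longrightarrow> P N (u + v) = P N u + P N v"
    and P_scale: "0 \<le> N \<Longrightarrow> u \<in> X 0 \<Longrightarrow> P N (a *\<^sub>R u) = a *\<^sub>R P N u"
    and P_range: "0 \<le> N \<Longrightarrow> u \<in> X 0 \<Longrightarrow> P N u \<in> E N"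
    and P_id: "0 \<le> N \<Longrightarrow> u \<in> E N \<Longrightarrow> P N u = u"
    and P1: "0 \<le> s \<Longrightarrow> 0 \<le> \<nu>' \<Longrightarrow>
      \<exists>C>0. \<forall>N\<ge>1. \<forall>u\<in>X s. nrm (s + \<nu>') (P N u) \<le> C * N powr \<nu>' * nrm s u"
    and P2: "0 \<le> s \<Longrightarrow> 0 \<le> \<nu>' \<Longrightarrow>
      \<exists>C>0. \<forall>N\<ge>1. \<forall>u\<in>X (s + \<nu>'). nrm s (u - P N u) \<le> C * N powr (-\<nu>') * nrm (s + \<nu>') u"

definition bounded_linear_on ::
  "'b::real_vector set \<Rightarrow> ('b \<Rightarrow> real) \<Rightarrow> 'c::real_vector set \<Rightarrow> ('c \<Rightarrow> real) \<Rightarrow> ('b \<Rightarrow> 'c) \<Rightarrow> bool" where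
  "bounded_linear_on V n W m A \<longleftrightarrow>
     (\<forall>x\<in>V. A x \<in> W) \<and>
     (\<forall>x\<in>V. \<forall>y\<in>V. A (x + y) = A x + A y) \<and>
     (\<forall>c. \<forall>x\<in>V. A (c *\<^sub>R x) = c *\<^sub>R A x) \<and>
     (\<exists>K. \<forall>x\<in>V. m (A x) \<le> K * n x)"

definition bounded_bilinear_on ::
  "'b::real_vector set \<Rightarrow> ('b \<Rightarrow> real) \<Rightarrow> 'c::real_vector set \<Rightarrow> ('c \<Rightarrow> real) \<Rightarrow> ('b \<Rightarrow> 'b \<Rightarrow> 'c) \<Rightarrow> bool" where
  "bounded_bilinear_on V n W m B \<longleftrightarrow>
     (\<forall>x\<in>V. bounded_linear_on V n W m (B x)) \<and>
     (\<forall>y\<in>V. bounded_linear_on V n W m (\<lambda>x. B x y)) \<and>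
     (\<exists>K. \<forall>x\<in>V. \<forall>y\<in>V. m (B x y) \<le> K * n x * n y)"

text \<open>
  \<open>f\<close> is twice continuously Frechet differentiable on \<open>D \<subseteq> V\<close>, as a map between the normed spaces
  \<open>(V, n)\<close> and \<open>(W, m)\<close>, with derivatives \<open>f1\<close> and \<open>f2\<close>. The bounds uniform in \<open>h\<close> (and \<open>k\<close>) are
  bounds in the operator norm; \<open>f2 p k h\<close> is the derivative in direction \<open>k\<close> of \<open>p \<mapsto> f1 p h\<close>.
\<close>

definition C2_on ::
  "'b::real_vector set \<Rightarrow> ('b \<Rightarrow> real) \<Rightarrow> 'c::real_vector set \<Rightarrow> ('c \<Rightarrow> real) \<Rightarrow> 'b set \<Rightarrow>
   ('b \<Rightarrow> 'c) \<Rightarrow> ('b \<Rightarrow> 'b \<Rightarrow> 'c) \<Rightarrow> ('b \<Rightarrow> 'b \<Rightarrow> 'b \<Rightarrow> 'c) \<Rightarrow> bool" where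
  "C2_on V n W m D f f1 f2 \<longleftrightarrow> (\<forall>p\<in>D.
     f p \<in> W \<and> bounded_linear_on V n W m (f1 p) \<and> bounded_bilinear_on V n W m (f2 p) \<and>
     (\<forall>e>0. \<exists>d>0. \<forall>q\<in>D. n (q - p) < d \<longrightarrow>
        m (f q - f p - f1 p (q - p)) \<le> e * n (q - p)) \<and>
     (\<forall>e>0. \<exists>d>0. \<forall>q\<in>D. n (q - p) < d \<longrightarrow>
        (\<forall>h\<in>V. m (f1 q h - f1 p h - f2 p (q - p) h) \<le> e * n (q - p) * n h)) \<and>
     (\<forall>e>0. \<exists>d>0. \<forall>q\<in>D. n (q - p) < d \<longrightarrow>
        (\<forall>k\<in>V. \<forall>h\<in>V. m (f2 q k h - f2 p k h) \<le> e * n k * n h)))"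

text \<open>
  For each \<open>\<epsilon>\<close> the map \<open>F \<epsilon>\<close> is of class C2 jointly in \<open>(\<lambda>, u)\<close>, with first and second derivatives
  \<open>DF \<epsilon>\<close> and \<open>D2F \<epsilon>\<close>. So \<open>DF \<epsilon> (\<lambda>, u) (1, 0)\<close> is the partial derivative in \<open>\<lambda>\<close>,
  \<open>DF \<epsilon> (\<lambda>, u) (0, h)\<close> the one in \<open>u\<close> applied to \<open>h\<close>, and likewise for \<open>D2F\<close>. An estimate of
  \<open>nrm s y\<close> in the hypotheses tacitly says that \<open>y\<close> belongs to \<open>X s\<close>. The interval \<open>J\<close> of parameters
  is nondegenerate, so that derivatives with respect to \<open>\<lambda>\<close> are unique.
\<close>

locale tame_family = banach_scale X nrm
  for X :: "real \<Rightarrow> 'a::real_vector set" and nrm :: "real \<Rightarrow> 'a \<Rightarrow> real" +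
  fixes s0 \<nu> \<epsilon>s S' :: real and J :: "real set"
    and F :: "real \<Rightarrow> real \<Rightarrow> 'a \<Rightarrow> 'a"
    and DF :: "real \<Rightarrow> real \<times> 'a \<Rightarrow> real \<times> 'a \<Rightarrow> 'a"
    and D2F :: "real \<Rightarrow> real \<times> 'a \<Rightarrow> real \<times> 'a \<Rightarrow> real \<times> 'a \<Rightarrow> 'a"
  assumes s0_nonneg: "0 \<le> s0" and \<nu>_pos: "0 < \<nu>" and \<epsilon>s_pos: "0 < \<epsilon>s" and s0_less: "s0 < S'"
    and J_interval: "is_interval J" and J_nondegenerate: "interior J \<noteq> {}"
    and C2: "0 \<le> \<epsilon> \<Longrightarrow> \<epsilon> < \<epsilon>s \<Longrightarrow>
      C2_on (UNIV \<times> X (s0 + \<nu>)) (\<lambda>(l, u). \<bar>l\<bar> + nrm (s0 + \<nu>) u) (X s0) (nrm s0)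
        (J \<times> X (s0 + \<nu>)) (\<lambda>(l, u). F \<epsilon> l u) (DF \<epsilon>) (D2F \<epsilon>)"
    and F0: "l \<in> J \<Longrightarrow> F 0 l 0 = 0"
    and F1: "s0 \<le> s \<Longrightarrow> s < S' \<Longrightarrow>
      \<exists>C. \<forall>\<epsilon>\<in>{0..<\<epsilon>s}. \<forall>l\<in>J. \<forall>u\<in>X (s + \<nu>). nrm s0 u \<le> 1 \<longrightarrow>
        DF \<epsilon> (l, u) (1, 0) \<in> X s \<and>
        nrm s (DF \<epsilon> (l, u) (1, 0)) \<le> C * (1 + nrm (s + \<nu>) u)"
    and F2: "s0 \<le> s \<Longrightarrow> s < S' \<Longrightarrow>
      \<exists>C. \<forall>\<epsilon>\<in>{0..<\<epsilon>s}. \<forall>l\<in>J. \<forall>h\<in>X (s + \<nu>).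
        DF \<epsilon> (l, 0) (0, h) \<in> X s \<and>
        nrm s (DF \<epsilon> (l, 0) (0, h)) \<le> C * nrm (s + \<nu>) h"
    and F3: "s0 \<le> s \<Longrightarrow> s < S' \<Longrightarrow>
      \<exists>C. \<forall>\<epsilon>\<in>{0..<\<epsilon>s}. \<forall>l\<in>J. \<forall>u\<in>X (s + \<nu>). nrm s0 u \<le> 1 \<longrightarrow>
        (\<forall>h\<in>X (s + \<nu>). \<forall>v\<in>X (s + \<nu>).
          D2F \<epsilon> (l, u) (0, h) (0, v) \<in> X s \<and>
          nrm s (D2F \<epsilon> (l, u) (0, h) (0, v)) \<le>
            C * (nrm (s + \<nu>) u * nrm s0 h * nrm s0 v + nrm (s + \<nu>) h * nrm s0 v
                 + nrm s0 h * nrm (s + \<nu>) v))"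
    and F4: "s0 \<le> s \<Longrightarrow> s < S' \<Longrightarrow>
      \<exists>C. \<forall>\<epsilon>\<in>{0..<\<epsilon>s}. \<forall>l\<in>J. \<forall>u\<in>X (s + \<nu>). nrm s0 u \<le> 1 \<longrightarrow>
        (\<forall>h\<in>X (s + \<nu>).
          D2F \<epsilon> (l, u) (1, 0) (0, h) \<in> X s \<and>
          nrm s (D2F \<epsilon> (l, u) (1, 0) (0, h)) \<le>
            C * (nrm (s + \<nu>) h + nrm (s + \<nu>) u * nrm s0 h))"

text \<open>
  \<open>F0\<close>-\<open>F4\<close> do not control how \<open>F \<epsilon> l 0\<close> depends on \<open>\<epsilon>\<close>, nor its regularity beyond \<open>X s0\<close>: with
  all \<open>X s\<close> and \<open>J\<close> equal to the real line, \<open>F \<epsilon> l u = u - 2 * sin (\<epsilon> * l)\<close> satisfies \<open>F0\<close>-\<open>F4\<close>, but its zero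
  does not stay in the unit ball, however small \<open>\<epsilon> > 0\<close> is. Nash-Moser iteration starts from
  the following bound, which by \<open>F0\<close> is implied by the analogue of \<open>F1\<close> for the partial derivative
  in \<open>\<epsilon>\<close>.
\<close>

definition small_at_zero ::
  "(real \<Rightarrow> 'a::real_vector set) \<Rightarrow> (real \<Rightarrow> 'a \<Rightarrow> real) \<Rightarrow> real \<Rightarrow> real \<Rightarrow> real \<Rightarrow> real set \<Rightarrow>
   (real \<Rightarrow> real \<Rightarrow> 'a \<Rightarrow> 'a) \<Rightarrow> bool" where
  "small_at_zero X nrm s0 \<epsilon>s S' J F \<longleftrightarrow>
     (\<forall>s\<in>{s0..<S'}. \<exists>C. \<forall>\<epsilon>\<in>{0..<\<epsilon>s}. \<forall>l\<in>J. F \<epsilon> l 0 \<in> X s \<and> nrm s (F \<epsilon> l 0) \<le> C * \<epsilon>)"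

definition galerkin_lin ::
  "(real \<Rightarrow> 'a \<Rightarrow> 'a) \<Rightarrow> (real \<Rightarrow> real \<times> 'a \<Rightarrow> real \<times> 'a \<Rightarrow> 'a::real_vector) \<Rightarrow>
   real \<Rightarrow> real \<Rightarrow> real \<Rightarrow> 'a \<Rightarrow> 'a \<Rightarrow> 'a" where
  "galerkin_lin P DF N \<epsilon> l u h = P N (DF \<epsilon> (l, u) (0, h))"

text \<open>The set depends on \<open>\<epsilon>0\<close> and the constants \<open>CJ\<close>, but not on a single value of \<open>\<epsilon>\<close>.\<close>

definition good_pairs ::
  "(real \<Rightarrow> 'a \<Rightarrow> real) \<Rightarrow> (real \<Rightarrow> 'a set) \<Rightarrow> (real \<Rightarrow> 'a \<Rightarrow> 'a) \<Rightarrow> real set \<Rightarrow>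
   (real \<Rightarrow> real \<times> 'a \<Rightarrow> real \<times> 'a \<Rightarrow> 'a::real_vector) \<Rightarrow> (real \<Rightarrow> real) \<Rightarrow>
   real \<Rightarrow> real \<Rightarrow> real \<Rightarrow> real \<Rightarrow> real \<Rightarrow> real \<Rightarrow> (real \<times> 'a) set" where
  "good_pairs nrm E P J DF CJ s1 S \<epsilon>0 \<tau> \<delta> N =
     {(l, u). l \<in> J \<and> u \<in> E N \<and> nrm s1 u \<le> 1 \<and>
        (\<forall>\<epsilon>\<in>{0..<\<epsilon>0}. bij_betw (galerkin_lin P DF N \<epsilon> l u) (E N) (E N) \<and>
          (\<forall>s\<in>{s1..S}. \<forall>h\<in>E N.
            nrm s (inv_into (E N) (galerkin_lin P DF N \<epsilon> l u) h) \<le>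
              CJ s * N powr (\<tau> + \<delta> * s1) *
                (nrm s h + N powr (\<delta> * (s - s1)) * nrm s u * nrm s1 h)))}"

definition good_params ::
  "(real \<Rightarrow> 'a \<Rightarrow> real) \<Rightarrow> (real \<Rightarrow> 'a set) \<Rightarrow> (real \<Rightarrow> 'a \<Rightarrow> 'a) \<Rightarrow> real set \<Rightarrow>
   (real \<Rightarrow> real \<times> 'a \<Rightarrow> real \<times> 'a \<Rightarrow> 'a::real_vector) \<Rightarrow> (real \<Rightarrow> real) \<Rightarrow>
   real \<Rightarrow> real \<Rightarrow> real \<Rightarrow> real \<Rightarrow> real \<Rightarrow> real \<Rightarrow> (real \<Rightarrow> 'a) \<Rightarrow> real set" where
  "good_params nrm E P J DF CJ s1 S \<epsilon>0 \<tau> \<delta> N u =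
     {l \<in> J. (l, u l) \<in> good_pairs nrm E P J DF CJ s1 S \<epsilon>0 \<tau> \<delta> N}"

definition open_nbhd :: "real set \<Rightarrow> real \<Rightarrow> real set" where
  "open_nbhd A \<eta> = (\<Union>a\<in>A. ball a \<eta>)"

definition C1_curve ::
  "real set \<Rightarrow> 'a::real_vector set \<Rightarrow> ('a \<Rightarrow> real) \<Rightarrow> (real \<Rightarrow> 'a) \<Rightarrow> (real \<Rightarrow> 'a) \<Rightarrow> bool" where
  "C1_curve J V n u u' \<longleftrightarrow> (\<forall>l\<in>J. u l \<in> V \<and> u' l \<in> V \<and>
     ((\<lambda>t. n ((1 / (t - l)) *\<^sub>R (u t - u l) - u' l)) \<longlongrightarrow> 0) (at l within J) \<and>
     ((\<lambda>t. n (u' t - u' l)) \<longlongrightarrow> 0) (at l within J))"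

text \<open>
  Closed subspaces \<open>Xh s\<close> of the \<open>X s\<close> that are invariant under \<open>F \<epsilon> l\<close>, which is only defined on
  \<open>X (s0 + \<nu>)\<close>. They have to be compatible with the Galerkin projections: if the projectors do not
  preserve \<open>Xh s\<close>, or if the Galerkin spaces are infinite-dimensional, then solutions of the projected
  equation leave \<open>Xh s\<close> even for \<open>F \<epsilon> l u = T u - \<epsilon> *\<^sub>R v\<close> with \<open>T\<close> an invertible isometry preserving
  \<open>Xh s\<close> (in the first case even with \<open>T\<close> the identity).
\<close>

definition invariant_subscale ::
  "(real \<Rightarrow> 'a::real_vector set) \<Rightarrow> (real \<Rightarrow> 'a \<Rightarrow> real) \<Rightarrow> (real \<Rightarrow> 'a set) \<Rightarrow> (real \<Rightarrow> 'a \<Rightarrow> 'a) \<Rightarrow>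
   real \<Rightarrow> real \<Rightarrow> real set \<Rightarrow> (real \<Rightarrow> 'a \<Rightarrow> 'a) \<Rightarrow> (real \<Rightarrow> 'a set) \<Rightarrow> bool" where
  "invariant_subscale X nrm E P s0 \<nu> J f Xh \<longleftrightarrow> (\<forall>s\<ge>0.
     subspace (Xh s) \<and> Xh s \<subseteq> X s \<and> closedin (ntopology (X s) (nrm s)) (Xh s) \<and>
     (\<forall>l\<in>J. \<forall>u \<in> Xh (s + \<nu>) \<inter> X (s0 + \<nu>). f l u \<in> Xh s) \<and>
     (\<forall>N\<ge>1. (\<forall>u\<in>Xh s. P N u \<in> Xh s) \<and> (\<exists>B. finite B \<and> E N \<inter> Xh s \<subseteq> span B)))"

end

theory Submission
  imports Defs
begin

text \<open>
  The approximate solutions solve the Galerkin equations \<open>P (N n) (F \<epsilon> l u) = 0\<close> at the scales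
  \<open>N n = N0 ^ 2 ^ n\<close>. Passing to the next scale \<open>M\<close>, the new residual at \<open>u n\<close> is a high-frequency
  remainder, so the high norm of \<open>u n\<close> bounds it by a negative power of \<open>M\<close>. A good parameter \<open>a\<close>
  provides an inverse of the linearized operator at \<open>(a, u n a)\<close>, and for all \<open>l\<close> close to \<open>a\<close> it
  serves as a fixed approximate inverse in a quasi-Newton iteration, whose limit is the correction; the
  same perturbation argument inverts the linearization at the new solution and thereby yields the
  derivative in \<open>l\<close> and the bounds in the high norm. A cutoff in \<open>l\<close> extends the correction to all
  parameters.

  The unit balls of \<open>X s\<close> need not be closed in \<open>X s0\<close>, so the tame bounds on derivatives of \<open>F\<close> cannot
  be integrated along segments in the norm of \<open>X s\<close>. They can after composition with an operator that
  maps \<open>X s0\<close> continuously into a smoother space, such as a projector, and only such compositions occur.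
  Likewise the projectors are not assumed to commute, and residuals are estimated through
  \<open>P M \<circ> (1 - P N)\<close>.
\<close>

section \<open>Calculus in normed carriers\<close>

text \<open>Smallness is measured at \<open>s1\<close>, while the norm at \<open>S\<close> may grow.
  Let \<open>M\<close> be the new scale, so the old one is \<open>M powr (1/2)\<close>.

  The remainder gains \<open>M powr (-(S - s1)/2)\<close> and loses the size
  \<open>M powr (\<nu>/2 + p)\<close> of the old solution at \<open>S + \<nu>\<close>. The lower
  bound on \<open>S - s1\<close> leaves \<open>M powr (-2 - \<sigma> - \<mu>)\<close>; the inverse,
  of size \<open>M powr \<mu>\<close>, turns this into a correction below
  \<open>M powr (-\<sigma> - 1)\<close>. At \<open>S\<close> the correction has exponent
  \<open>2 * p - 1\<close>, and the next scale admits \<open>2 * p\<close>.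

  The bound \<open>4 * (\<mu> + \<nu>) \<le> \<sigma>\<close> pays for freezing the inverse: within
  \<open>M powr (-\<sigma>/2)\<close> of a good parameter a curve of speed
  \<open>M powr (\<sigma>/4)\<close> drifts by \<open>M powr (-\<sigma>/4)\<close>, the
  linearization loses \<open>M powr \<nu>\<close>, and the product must stay below
  \<open>M powr (-\<mu>)\<close>. Equality is allowed, so the induction carries the speed
  \<open>N0 powr (\<sigma>/2 - \<nu>)\<close> instead of the claimed
  \<open>N0 powr (\<sigma>/2)\<close>: this opens the margin that absorbs constants.\<close>

context
  fixes V :: "'b::real_vector set" and n :: "'b \<Rightarrow> real"
  assumes V: "normed_on V n"
begin

lemma normed_subspace: "subspace V"
  using V by (simp add: normed_on_def)

lemma normed_mem [intro]:
  shows normed_zero_mem: "0 \<in> V"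
    and normed_add_mem: "x \<in> V \<Longrightarrow> y \<in> V \<Longrightarrow> x + y \<in> V"
    and normed_diff_mem: "x \<in> V \<Longrightarrow> y \<in> V \<Longrightarrow> x - y \<in> V"
    and normed_scale_mem: "x \<in> V \<Longrightarrow> c *\<^sub>R x \<in> V"
    and normed_minus_mem: "x \<in> V \<Longrightarrow> - x \<in> V"
  using normed_subspace
  by (auto intro: subspace_0 subspace_add subspace_diff subspace_scale subspace_neg)

lemma normed_nonneg: "x \<in> V \<Longrightarrow> 0 \<le> n x"
  using V by (simp add: normed_on_def)

lemma normed_eq_0: "x \<in> V \<Longrightarrow> n x = 0 \<longleftrightarrow> x = 0"
  using V by (simp add: normed_on_def)

lemma normed_zero: "n 0 = 0"
  using normed_eq_0[of 0] normed_zero_mem by simp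

lemma normed_scale: "x \<in> V \<Longrightarrow> n (c *\<^sub>R x) = \<bar>c\<bar> * n x"
  using V by (simp add: normed_on_def)

lemma normed_triangle: "x \<in> V \<Longrightarrow> y \<in> V \<Longrightarrow> n (x + y) \<le> n x + n y"
  using V by (simp add: normed_on_def)

lemma normed_minus: "x \<in> V \<Longrightarrow> n (- x) = n x"
  using normed_scale[of x "-1"] by simp

lemma normed_diff_le: "x \<in> V \<Longrightarrow> y \<in> V \<Longrightarrow> n (x - y) \<le> n x + n y"
  using normed_triangle[of x "-y"] normed_minus[of y] normed_minus_mem[of y] by simp

lemma normed_commute: "x \<in> V \<Longrightarrow> y \<in> V \<Longrightarrow> n (x - y) = n (y - x)"
  using normed_minus[of "x - y"] normed_diff_mem[of x y] by simp

lemma normed_triangle_mid: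
  "x \<in> V \<Longrightarrow> y \<in> V \<Longrightarrow> z \<in> V \<Longrightarrow> n (x - z) \<le> n (x - y) + n (y - z)"
  using normed_triangle[of "x - y" "y - z"] normed_diff_mem by simp

lemma normed_le_add_diff: "x \<in> V \<Longrightarrow> y \<in> V \<Longrightarrow> n x \<le> n y + n (x - y)"
  using normed_triangle[of y "x - y"] normed_diff_mem by simp

end

section \<open>Derivatives and continuity of curves with respect to a norm on a carrier\<close>

definition nderiv ::
  "('b::real_vector \<Rightarrow> real) \<Rightarrow> (real \<Rightarrow> 'b) \<Rightarrow> 'b \<Rightarrow> real \<Rightarrow> real set \<Rightarrow> bool" where
  "nderiv n g g' t I \<longleftrightarrow>
     (\<forall>e>0. \<forall>\<^sub>F r in at t within I. n (g r - g t - (r - t) *\<^sub>R g') \<le> e * \<bar>r - t\<bar>)"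

definition ncont :: "('b::real_vector \<Rightarrow> real) \<Rightarrow> (real \<Rightarrow> 'b) \<Rightarrow> real \<Rightarrow> real set \<Rightarrow> bool" where
  "ncont n g t I \<longleftrightarrow> (\<forall>e>0. \<forall>\<^sub>F r in at t within I. n (g r - g t) \<le> e)"

lemma nderivD:
  "nderiv n g g' t I \<Longrightarrow> e > 0 \<Longrightarrow> \<forall>\<^sub>F r in at t within I. n (g r - g t - (r - t) *\<^sub>R g') \<le> e * \<bar>r - t\<bar>"
  by (simp add: nderiv_def)

lemma ncontD: "ncont n g t I \<Longrightarrow> e > 0 \<Longrightarrow> \<forall>\<^sub>F r in at t within I. n (g r - g t) \<le> e"
  by (simp add: ncont_def)

lemma nderiv_subset: "nderiv n g g' t I \<Longrightarrow> I' \<subseteq> I \<Longrightarrow> nderiv n g g' t I'"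
  unfolding nderiv_def by (meson at_le filter_leD)

lemma eventually_in_within: "\<forall>\<^sub>F r in at t within I. r \<in> I"
  by (simp add: eventually_at_filter)

lemma nderiv_cong:
  assumes "nderiv n g g' t I" "\<forall>\<^sub>F r in at t within I. f r = g r" "f t = g t"
  shows "nderiv n f g' t I"
  unfolding nderiv_def
proof (intro allI impI)
  fix e :: real assume "e > 0"
  from nderivD[OF assms(1) this] assms(2)
  show "\<forall>\<^sub>F r in at t within I. n (f r - f t - (r - t) *\<^sub>R g') \<le> e * \<bar>r - t\<bar>"
    by eventually_elim (simp add: assms(3))
qed

lemma ncont_cong:
  assumes "ncont n g t I" "\<forall>\<^sub>F r in at t within I. f r = g r" "f t = g t"
  shows "ncont n f t I"
  unfolding ncont_def
proof (intro allI impI)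
  fix e :: real assume "e > 0"
  from ncontD[OF assms(1) this] assms(2)
  show "\<forall>\<^sub>F r in at t within I. n (f r - f t) \<le> e"
    by eventually_elim (simp add: assms(3))
qed

text \<open>Differentiability only sees the norms of remainders, so it passes to every curve and
  norm whose remainders are dominated by those of \<open>g\<close>. This carries derivatives from
  one norm of the scale to another along a Galerkin space, and through bounded operators.\<close>

lemma nderiv_mono_norm:
  assumes "nderiv n g g' t I" "C \<ge> 0"
    "\<And>r. r \<in> I \<Longrightarrow> m (f r - f t - (r - t) *\<^sub>R f') \<le> C * n (g r - g t - (r - t) *\<^sub>R g')"
  shows "nderiv m f f' t I"
  unfolding nderiv_def
proof (intro allI impI)
  fix e :: real assume "e > 0"
  then have "e / (C + 1) > 0" using assms(2) by simp
  from nderivD[OF assms(1) this] eventually_in_within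
  show "\<forall>\<^sub>F r in at t within I. m (f r - f t - (r - t) *\<^sub>R f') \<le> e * \<bar>r - t\<bar>"
  proof eventually_elim
    case (elim r)
    have "m (f r - f t - (r - t) *\<^sub>R f') \<le> C * (e / (C + 1) * \<bar>r - t\<bar>)"
      using assms(3)[OF elim(2)] mult_left_mono[OF elim(1) assms(2)] by linarith
    also have "\<dots> = (C / (C + 1)) * (e * \<bar>r - t\<bar>)" by simp
    also have "\<dots> \<le> 1 * (e * \<bar>r - t\<bar>)"
      using assms(2) \<open>e > 0\<close> by (intro mult_right_mono) auto
    finally show ?case by simp
  qed
qed

lemma ncont_mono_norm:
  assumes "ncont n g t I" "C \<ge> 0" "\<And>r. r \<in> I \<Longrightarrow> m (f r - f t) \<le> C * n (g r - g t)"
  shows "ncont m f t I"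
  unfolding ncont_def
proof (intro allI impI)
  fix e :: real assume "e > 0"
  then have "e / (C + 1) > 0" using assms(2) by simp
  from ncontD[OF assms(1) this] eventually_in_within
  show "\<forall>\<^sub>F r in at t within I. m (f r - f t) \<le> e"
  proof eventually_elim
    case (elim r)
    have "m (f r - f t) \<le> C * (e / (C + 1))"
      using assms(3)[OF elim(2)] mult_left_mono[OF elim(1) assms(2)] by linarith
    also have "\<dots> = (C / (C + 1)) * e" by simp
    also have "\<dots> \<le> 1 * e"
      using assms(2) \<open>e > 0\<close> by (intro mult_right_mono) auto
    finally show ?case by simp
  qed
qed

lemma nderiv_add:
  assumes V: "normed_on V n" and f: "nderiv n f f' t I" and g: "nderiv n g g' t I"
    and mem: "\<And>r. r \<in> insert t I \<Longrightarrow> f r \<in> V \<and> g r \<in> V" "f' \<in> V" "g' \<in> V"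
  shows "nderiv n (\<lambda>r. f r + g r) (f' + g') t I"
  unfolding nderiv_def
proof (intro allI impI)
  fix e :: real assume "e > 0"
  then have "e / 2 > 0" by simp
  from nderivD[OF f this] nderivD[OF g this] eventually_in_within
  show "\<forall>\<^sub>F r in at t within I. n (f r + g r - (f t + g t) - (r - t) *\<^sub>R (f' + g')) \<le> e * \<bar>r - t\<bar>"
  proof eventually_elim
    case (elim r)
    have "f r + g r - (f t + g t) - (r - t) *\<^sub>R (f' + g')
        = (f r - f t - (r - t) *\<^sub>R f') + (g r - g t - (r - t) *\<^sub>R g')"
      by (simp add: algebra_simps)
    moreover have "n \<dots> \<le> n (f r - f t - (r - t) *\<^sub>R f') + n (g r - g t - (r - t) *\<^sub>R g')"
      by (intro normed_triangle[OF V] normed_mem[OF V]) (use mem elim in auto)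
    ultimately show ?case using elim by (simp add: field_simps)
  qed
qed

lemma ncont_add:
  assumes V: "normed_on V n" and f: "ncont n f t I" and g: "ncont n g t I"
    and mem: "\<And>r. r \<in> insert t I \<Longrightarrow> f r \<in> V \<and> g r \<in> V"
  shows "ncont n (\<lambda>r. f r + g r) t I"
  unfolding ncont_def
proof (intro allI impI)
  fix e :: real assume "e > 0"
  then have "e / 2 > 0" by simp
  from ncontD[OF f this] ncontD[OF g this] eventually_in_within
  show "\<forall>\<^sub>F r in at t within I. n (f r + g r - (f t + g t)) \<le> e"
  proof eventually_elim
    case (elim r)
    have eq: "f r + g r - (f t + g t) = (f r - f t) + (g r - g t)" by simp
    have "n ((f r - f t) + (g r - g t)) \<le> n (f r - f t) + n (g r - g t)"
      by (intro normed_triangle[OF V] normed_mem[OF V]) (use mem elim in auto)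
    then show ?case using elim unfolding eq by simp
  qed
qed

lemma nderiv_imp_ncont:
  assumes V: "normed_on V n" and g: "nderiv n g g' t I"
    and mem: "\<And>r. r \<in> insert t I \<Longrightarrow> g r \<in> V" "g' \<in> V"
  shows "ncont n g t I"
  unfolding ncont_def
proof (intro allI impI)
  fix e :: real assume "e > 0"
  have "((\<lambda>r. (n g' + 1) * \<bar>r - t\<bar>) \<longlongrightarrow> (n g' + 1) * \<bar>t - t\<bar>) (at t within I)"
    by (intro tendsto_intros)
  then have "\<forall>\<^sub>F r in at t within I. (n g' + 1) * \<bar>r - t\<bar> < e"
    using \<open>e > 0\<close> by (auto dest: order_tendstoD(2))
  with nderivD[OF g zero_less_one] eventually_in_within
  show "\<forall>\<^sub>F r in at t within I. n (g r - g t) \<le> e"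
  proof eventually_elim
    case (elim r)
    have "n (g r - g t) \<le> n ((r - t) *\<^sub>R g') + n (g r - g t - (r - t) *\<^sub>R g')"
      by (intro normed_le_add_diff[OF V] normed_mem[OF V]) (use mem elim in auto)
    also have "n ((r - t) *\<^sub>R g') = \<bar>r - t\<bar> * n g'" by (rule normed_scale[OF V mem(2)])
    finally show ?case using elim by (simp add: field_simps)
  qed
qed

lemma nderiv_cmul:
  assumes V: "normed_on V n" and f: "nderiv n f f' t I" and mem: "\<And>r. r \<in> insert t I \<Longrightarrow> f r \<in> V" "f' \<in> V"
  shows "nderiv n (\<lambda>r. c *\<^sub>R f r) (c *\<^sub>R f') t I"
proof (rule nderiv_mono_norm[OF f, of "\<bar>c\<bar>"])
  fix r assume r: "r \<in> I"
  have "c *\<^sub>R f r - c *\<^sub>R f t - (r - t) *\<^sub>R c *\<^sub>R f' = c *\<^sub>R (f r - f t - (r - t) *\<^sub>R f')"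
    by (simp add: algebra_simps)
  moreover have "n \<dots> = \<bar>c\<bar> * n (f r - f t - (r - t) *\<^sub>R f')"
    by (intro normed_scale[OF V] normed_mem[OF V]) (use mem r in auto)
  ultimately show "n (c *\<^sub>R f r - c *\<^sub>R f t - (r - t) *\<^sub>R c *\<^sub>R f')
    \<le> \<bar>c\<bar> * n (f r - f t - (r - t) *\<^sub>R f')" by simp
qed simp

lemma nderiv_scaleR_fun:
  assumes V: "normed_on V n" and f: "nderiv n f f' t I" and a: "(a has_real_derivative a') (at t)"
    and mem: "\<And>r. r \<in> insert t I \<Longrightarrow> f r \<in> V" "f' \<in> V"
  shows "nderiv n (\<lambda>r. a r *\<^sub>R f r) (a' *\<^sub>R f t + a t *\<^sub>R f') t I"
  unfolding nderiv_def
proof (intro allI impI)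
  fix e :: real assume e: "e > 0"
  define C where "C = \<bar>a t\<bar> + 1"
  define d1 where "d1 = e / (3 * C)"
  define d2 where "d2 = e / (3 * (n (f t) + 1))"
  define d3 where "d3 = e / (3 * (\<bar>a'\<bar> + 1))"
  have nf: "n (f t) \<ge> 0" using mem normed_nonneg[OF V] by auto
  have C: "C > 0" and pos: "d1 > 0" "d2 > 0" "d3 > 0"
    using e nf by (auto simp: C_def d1_def d2_def d3_def)
  have cf: "ncont n f t I" by (rule nderiv_imp_ncont[OF V f mem])
  have ca: "(a \<longlongrightarrow> a t) (at t within I)"
    using DERIV_isCont[OF a] by (meson continuous_at_imp_continuous_at_within continuous_within)
  have Ca: "\<forall>\<^sub>F r in at t within I. \<bar>a r\<bar> \<le> C"
  proof -
    have "\<forall>\<^sub>F r in at t within I. dist (a r) (a t) < 1" using ca by (rule tendstoD) simp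
    then show ?thesis by eventually_elim (auto simp: C_def dist_real_def)
  qed
  have Da: "\<forall>\<^sub>F r in at t within I. \<bar>a r - a t - (r - t) * a'\<bar> \<le> d2 * \<bar>r - t\<bar>"
  proof -
    have "((\<lambda>r. (a r - a t) / (r - t)) \<longlongrightarrow> a') (at t within I)"
      using has_field_derivative_at_within[OF a] by (simp add: has_field_derivative_iff)
    then have "\<forall>\<^sub>F r in at t within I. dist ((a r - a t) / (r - t)) a' < d2"
      by (rule tendstoD) (use pos in auto)
    moreover have "\<forall>\<^sub>F r in at t within I. r \<noteq> t" by (simp add: eventually_at_filter)
    ultimately show ?thesis
    proof eventually_elim
      case (elim r)
      have "a r - a t - (r - t) * a' = ((a r - a t) / (r - t) - a') * (r - t)"
        using elim(2) by (simp add: field_simps)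
      then have "\<bar>a r - a t - (r - t) * a'\<bar> = \<bar>(a r - a t) / (r - t) - a'\<bar> * \<bar>r - t\<bar>"
        by (simp add: abs_mult)
      also have "\<dots> \<le> d2 * \<bar>r - t\<bar>"
        using elim(1) by (intro mult_right_mono) (auto simp: dist_real_def)
      finally show ?case .
    qed
  qed
  have Cad: "\<forall>\<^sub>F r in at t within I. \<bar>a r - a t\<bar> \<le> e / (3 * (n f' + 1))"
  proof -
    have "e / (3 * (n f' + 1)) > 0" using e normed_nonneg[OF V mem(2)] by simp
    from tendstoD[OF ca this] show ?thesis by eventually_elim (auto simp: dist_real_def)
  qed
  from nderivD[OF f pos(1)] Ca Da Cad eventually_in_within
  show "\<forall>\<^sub>F r in at t within I.
    n (a r *\<^sub>R f r - a t *\<^sub>R f t - (r - t) *\<^sub>R (a' *\<^sub>R f t + a t *\<^sub>R f')) \<le> e * \<bar>r - t\<bar>"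
  proof eventually_elim
    case (elim r)
    let ?A = "a r *\<^sub>R (f r - f t - (r - t) *\<^sub>R f')"
    let ?B = "(a r - a t - (r - t) * a') *\<^sub>R f t"
    let ?D = "((a r - a t) * (r - t)) *\<^sub>R f'"
    have m: "f r \<in> V" "f t \<in> V" "f' \<in> V" using mem elim by auto
    have mV: "f r - f t - (r - t) *\<^sub>R f' \<in> V" by (intro normed_mem[OF V] m)
    \<comment> \<open>The remainder of the product splits into the remainder of \<open>f\<close>,
      the remainder of \<open>a\<close>, and a term of second order.\<close>
    have eq: "a r *\<^sub>R f r - a t *\<^sub>R f t - (r - t) *\<^sub>R (a' *\<^sub>R f t + a t *\<^sub>R f') = (?A + ?B) + ?D"
      by (simp add: algebra_simps)
    have "n ((?A + ?B) + ?D) \<le> n (?A + ?B) + n ?D"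
      by (intro normed_triangle[OF V] normed_mem[OF V] m mV)
    also have "n (?A + ?B) \<le> n ?A + n ?B"
      by (intro normed_triangle[OF V] normed_mem[OF V] m mV)
    also have "n ?A = \<bar>a r\<bar> * n (f r - f t - (r - t) *\<^sub>R f')" by (rule normed_scale[OF V mV])
    also have "n ?B = \<bar>a r - a t - (r - t) * a'\<bar> * n (f t)" by (rule normed_scale[OF V m(2)])
    also have "n ?D = \<bar>a r - a t\<bar> * \<bar>r - t\<bar> * n f'"
      by (subst normed_scale[OF V m(3)]) (simp add: abs_mult)
    finally have "n ((?A + ?B) + ?D) \<le> \<bar>a r\<bar> * n (f r - f t - (r - t) *\<^sub>R f')
       + \<bar>a r - a t - (r - t) * a'\<bar> * n (f t) + \<bar>a r - a t\<bar> * \<bar>r - t\<bar> * n f'" by simp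
    moreover have "\<bar>a r\<bar> * n (f r - f t - (r - t) *\<^sub>R f') \<le> e / 3 * \<bar>r - t\<bar>"
    proof -
      have "\<bar>a r\<bar> * n (f r - f t - (r - t) *\<^sub>R f') \<le> C * (d1 * \<bar>r - t\<bar>)"
        by (rule mult_mono) (use elim C normed_nonneg[OF V mV] in auto)
      also have "\<dots> = e / 3 * \<bar>r - t\<bar>" using C by (simp add: d1_def)
      finally show ?thesis .
    qed
    moreover have "\<bar>a r - a t - (r - t) * a'\<bar> * n (f t) \<le> e / 3 * \<bar>r - t\<bar>"
    proof -
      have "\<bar>a r - a t - (r - t) * a'\<bar> * n (f t) \<le> (d2 * \<bar>r - t\<bar>) * (n (f t) + 1)"
        by (rule mult_mono) (use elim pos nf in auto)
      also have "\<dots> = e / 3 * \<bar>r - t\<bar>" using nf by (simp add: d2_def field_simps)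
      finally show ?thesis .
    qed
    moreover have "\<bar>a r - a t\<bar> * \<bar>r - t\<bar> * n f' \<le> e / 3 * \<bar>r - t\<bar>"
    proof -
      have nf': "n f' \<ge> 0" by (rule normed_nonneg[OF V m(3)])
      have "\<bar>a r - a t\<bar> * n f' \<le> e / (3 * (n f' + 1)) * (n f' + 1)"
        by (rule mult_mono) (use elim e nf' in auto)
      also have "\<dots> = e / 3" using nf' by (simp add: field_simps)
      finally have "\<bar>a r - a t\<bar> * n f' * \<bar>r - t\<bar> \<le> e / 3 * \<bar>r - t\<bar>"
        by (rule mult_right_mono) simp
      then show ?thesis by (simp add: mult_ac)
    qed
    ultimately show ?case unfolding eq by linarith
  qed
qed

lemma ncont_scaleR_fun:
  assumes V: "normed_on V n" and f: "ncont n f t I" and a: "isCont a t"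
    and mem: "\<And>r. r \<in> insert t I \<Longrightarrow> f r \<in> V"
  shows "ncont n (\<lambda>r. a r *\<^sub>R f r) t I"
  unfolding ncont_def
proof (intro allI impI)
  fix e :: real assume e: "e > 0"
  define C where "C = \<bar>a t\<bar> + 1"
  have nf: "n (f t) \<ge> 0" using mem normed_nonneg[OF V] by auto
  have C: "C > 0" by (simp add: C_def)
  have ca: "(a \<longlongrightarrow> a t) (at t within I)"
    using a by (meson continuous_at_imp_continuous_at_within continuous_within)
  have Ca: "\<forall>\<^sub>F r in at t within I. \<bar>a r\<bar> \<le> C"
  proof -
    have "\<forall>\<^sub>F r in at t within I. dist (a r) (a t) < 1" using ca by (rule tendstoD) simp
    then show ?thesis by eventually_elim (auto simp: C_def dist_real_def)
  qed
  have Cad: "\<forall>\<^sub>F r in at t within I. \<bar>a r - a t\<bar> \<le> e / (2 * (n (f t) + 1))"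
  proof -
    have "e / (2 * (n (f t) + 1)) > 0" using e nf by simp
    from tendstoD[OF ca this] show ?thesis by eventually_elim (auto simp: dist_real_def)
  qed
  have "e / (2 * C) > 0" using e C by simp
  from ncontD[OF f this] Ca Cad eventually_in_within
  show "\<forall>\<^sub>F r in at t within I. n (a r *\<^sub>R f r - a t *\<^sub>R f t) \<le> e"
  proof eventually_elim
    case (elim r)
    have m: "f r \<in> V" "f t \<in> V" using mem elim by auto
    have mV: "f r - f t \<in> V" by (intro normed_mem[OF V] m)
    have "a r *\<^sub>R f r - a t *\<^sub>R f t = a r *\<^sub>R (f r - f t) + (a r - a t) *\<^sub>R f t"
      by (simp add: algebra_simps)
    moreover have "n \<dots> \<le> n (a r *\<^sub>R (f r - f t)) + n ((a r - a t) *\<^sub>R f t)"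
      by (intro normed_triangle[OF V] normed_mem[OF V] m mV)
    moreover have "n (a r *\<^sub>R (f r - f t)) \<le> e / 2"
    proof -
      have "\<bar>a r\<bar> * n (f r - f t) \<le> C * (e / (2 * C))"
        by (rule mult_mono) (use elim C normed_nonneg[OF V mV] in auto)
      then show ?thesis using C by (simp add: normed_scale[OF V mV])
    qed
    moreover have "n ((a r - a t) *\<^sub>R f t) \<le> e / 2"
    proof -
      have "\<bar>a r - a t\<bar> * n (f t) \<le> e / (2 * (n (f t) + 1)) * (n (f t) + 1)"
        by (rule mult_mono) (use elim e nf in auto)
      also have "\<dots> = e / 2" using nf by (simp add: field_simps)
      finally show ?thesis by (simp add: normed_scale[OF V m(2)])
    qed
    ultimately show ?case by simp
  qed
qed

text \<open>With slope \<open>B + e\<close> instead of \<open>B\<close> the bound holds near each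
  point by the definition of the derivative. The permitted error is proportional to length, hence
  additive over adjacent intervals, so bisection (\<open>Bolzano\<close>) makes it global. Neither
  integrals nor functionals on the carrier are involved.\<close>

lemma mean_value_normed:
  assumes V: "normed_on V n" and ab: "a \<le> b" and B: "B \<ge> 0"
    and g: "\<And>t. t \<in> {a..b} \<Longrightarrow> g t \<in> V \<and> g' t \<in> V \<and> n (g' t) \<le> B \<and> nderiv n g (g' t) t {a..b}"
  shows "n (g b - g a) \<le> B * (b - a)"
proof (rule field_le_epsilon)
  fix e0 :: real assume e0: "e0 > 0"
  define e where "e = e0 / (b - a + 1)"
  have e: "e > 0" using e0 ab by (simp add: e_def)
  define Q where "Q = (\<lambda>c d. a \<le> c \<and> d \<le> b \<longrightarrow> n (g d - g c) \<le> (B + e) * (d - c))"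
  have "Q a b"
  proof (rule Bolzano[OF ab])
    fix c d f assume *: "Q c d" "Q d f" "c \<le> d" "d \<le> f"
    show "Q c f"
      unfolding Q_def
    proof
      assume "a \<le> c \<and> f \<le> b"
      then have mem: "c \<in> {a..b}" "d \<in> {a..b}" "f \<in> {a..b}" using * by auto
      have "n (g f - g c) \<le> n (g f - g d) + n (g d - g c)"
        by (rule normed_triangle_mid[OF V]) (use g mem in auto)
      also have "\<dots> \<le> (B + e) * (f - d) + (B + e) * (d - c)"
        using * mem unfolding Q_def by (intro add_mono) auto
      finally show "n (g f - g c) \<le> (B + e) * (f - c)" by (simp add: algebra_simps)
    qed
  next
    fix t assume t: "a \<le> t" "t \<le> b"
    then have "nderiv n g (g' t) t {a..b}" using g by auto
    from nderivD[OF this e] obtain \<delta> where \<delta>: "\<delta> > 0"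
      "\<And>r. r \<in> {a..b} \<Longrightarrow> r \<noteq> t \<Longrightarrow> dist r t < \<delta> \<Longrightarrow> n (g r - g t - (r - t) *\<^sub>R g' t) \<le> e * \<bar>r - t\<bar>"
      unfolding eventually_at by blast
    have tV: "g t \<in> V" "g' t \<in> V" "n (g' t) \<le> B" using g t by auto
    have one: "n (g r - g t) \<le> (B + e) * \<bar>r - t\<bar>" if r: "r \<in> {a..b}" "\<bar>r - t\<bar> < \<delta>" for r
    proof (cases "r = t")
      case True then show ?thesis using normed_zero[OF V] by simp
    next
      case False
      have rV: "g r \<in> V" using g r by auto
      have "n (g r - g t) \<le> n ((r - t) *\<^sub>R g' t) + n (g r - g t - (r - t) *\<^sub>R g' t)"
        by (intro normed_le_add_diff[OF V] normed_mem[OF V] rV tV)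
      also have "n ((r - t) *\<^sub>R g' t) = \<bar>r - t\<bar> * n (g' t)" by (rule normed_scale[OF V tV(2)])
      also have "\<dots> \<le> \<bar>r - t\<bar> * B" by (rule mult_left_mono) (use tV in auto)
      also have "n (g r - g t - (r - t) *\<^sub>R g' t) \<le> e * \<bar>r - t\<bar>"
        using \<delta>(2)[of r] r False by (auto simp: dist_real_def)
      finally show ?thesis by (simp add: algebra_simps)
    qed
    \<comment> \<open>The interval contains \<open>t\<close>, so the increment is compared through
      \<open>g t\<close> and the two one-sided lengths add up exactly.\<close>
    show "\<exists>\<delta>>0. \<forall>c d. c \<le> t \<and> t \<le> d \<and> d - c < \<delta> \<longrightarrow> Q c d"
    proof (intro exI conjI allI impI)
      fix c d assume cd: "c \<le> t \<and> t \<le> d \<and> d - c < \<delta>"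
      show "Q c d" unfolding Q_def
      proof
        assume ab': "a \<le> c \<and> d \<le> b"
        have m: "g c \<in> V" "g d \<in> V" using g ab' cd by auto
        have "n (g d - g c) \<le> n (g d - g t) + n (g t - g c)"
          by (rule normed_triangle_mid[OF V m(2) tV(1) m(1)])
        also have "n (g t - g c) = n (g c - g t)" by (rule normed_commute[OF V tV(1) m(1)])
        also have "n (g d - g t) + n (g c - g t) \<le> (B + e) * \<bar>d - t\<bar> + (B + e) * \<bar>c - t\<bar>"
          using ab' cd by (intro add_mono one) auto
        also have "\<dots> = (B + e) * (d - c)" using cd by (simp add: algebra_simps)
        finally show "n (g d - g c) \<le> (B + e) * (d - c)" .
      qed
    qed (rule \<delta>(1))
  qed
  then have "n (g b - g a) \<le> (B + e) * (b - a)" using ab by (simp add: Q_def)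
  also have "\<dots> = B * (b - a) + e0 * ((b - a) / (b - a + 1))"
    by (simp add: e_def algebra_simps)
  also have "e0 * ((b - a) / (b - a + 1)) \<le> e0 * 1"
    using e0 ab by (intro mult_left_mono) auto
  finally show "n (g b - g a) \<le> B * (b - a) + e0" by simp
qed

text \<open>Multiplication by \<open>t - l\<close> turns the difference quotient into the remainder.
  The remainder form needs no division and survives estimates, so all work is done in it;
  \<open>C1_curve\<close> returns only when the iteration is assembled.\<close>

lemma C1_curve_iff:
  assumes V: "normed_on V n"
  shows "C1_curve J V n u u' \<longleftrightarrow>
    (\<forall>l\<in>J. u l \<in> V \<and> u' l \<in> V \<and> nderiv n u (u' l) l J \<and> ncont n u' l J)"
proof -
  have "nderiv n u (u' l) l J \<longleftrightarrow>
      ((\<lambda>t. n ((1 / (t - l)) *\<^sub>R (u t - u l) - u' l)) \<longlongrightarrow> 0) (at l within J)" (is "?L \<longleftrightarrow> ?R")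
    and "ncont n u' l J \<longleftrightarrow> ((\<lambda>t. n (u' t - u' l)) \<longlongrightarrow> 0) (at l within J)" (is "?L' \<longleftrightarrow> ?R'")
    if l: "l \<in> J" and mem: "\<forall>l\<in>J. u l \<in> V \<and> u' l \<in> V" for l
  proof -
    let ?q = "\<lambda>t. (1 / (t - l)) *\<^sub>R (u t - u l) - u' l"
    have qV: "?q t \<in> V" if "t \<in> J" for t
      by (intro normed_mem[OF V]) (use that l mem in auto)
    have eq: "n (u t - u l - (t - l) *\<^sub>R u' l) = \<bar>t - l\<bar> * n (?q t)" if "t \<in> J" "t \<noteq> l" for t
    proof -
      have "u t - u l - (t - l) *\<^sub>R u' l = (t - l) *\<^sub>R ?q t"
        using that by (simp add: algebra_simps)
      then show ?thesis using normed_scale[OF V qV[OF that(1)]] by simp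
    qed
    have ev: "\<forall>\<^sub>F t in at l within J. t \<in> J \<and> t \<noteq> l" by (simp add: eventually_at_filter)
    show "?L \<longleftrightarrow> ?R"
    proof
      assume L: ?L
      show ?R
      proof (rule tendstoI)
        fix e :: real assume "e > 0"
        then have "e / 2 > 0" by simp
        from nderivD[OF L this] ev show "\<forall>\<^sub>F t in at l within J. dist (n (?q t)) 0 < e"
        proof eventually_elim
          case (elim t)
          then have "n (?q t) * \<bar>t - l\<bar> \<le> e / 2 * \<bar>t - l\<bar>" using eq[of t] by (simp add: mult.commute)
          then have "n (?q t) \<le> e / 2" using elim by simp
          then show ?case using normed_nonneg[OF V qV[of t]] elim \<open>e > 0\<close> by (auto simp: dist_real_def)
        qed
      qed
    next
      assume R: ?R
      show ?L unfolding nderiv_def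
      proof (intro allI impI)
        fix e :: real assume "e > 0"
        from tendstoD[OF R this] ev
        show "\<forall>\<^sub>F t in at l within J. n (u t - u l - (t - l) *\<^sub>R u' l) \<le> e * \<bar>t - l\<bar>"
        proof eventually_elim
          case (elim t)
          then have "n (?q t) \<le> e" by (auto simp: dist_real_def)
          then show ?case using elim eq[of t] mult_left_mono[of "n (?q t)" e "\<bar>t - l\<bar>"]
            by (simp add: mult.commute)
        qed
      qed
    qed
    show "?L' \<longleftrightarrow> ?R'"
    proof
      assume L: ?L'
      show ?R'
      proof (rule tendstoI)
        fix e :: real assume "e > 0"
        then have "e / 2 > 0" by simp
        from ncontD[OF L this] ev show "\<forall>\<^sub>F t in at l within J. dist (n (u' t - u' l)) 0 < e"
        proof eventually_elim
          case (elim t)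
          have "u' t - u' l \<in> V" by (intro normed_mem[OF V]) (use elim mem l in auto)
          from normed_nonneg[OF V this] show ?case using elim \<open>e > 0\<close> by (auto simp: dist_real_def)
        qed
      qed
    next
      assume R: ?R'
      show ?L' unfolding ncont_def
      proof (intro allI impI)
        fix e :: real assume "e > 0"
        from tendstoD[OF R this] ev
        show "\<forall>\<^sub>F t in at l within J. n (u' t - u' l) \<le> e"
          by eventually_elim (auto simp: dist_real_def)
      qed
    qed
  qed
  then show ?thesis unfolding C1_curve_def by blast
qed

lemma curve_lipschitz:
  assumes V: "normed_on V n" and J: "is_interval J" and B: "B \<ge> 0" and ab: "a \<in> J" "b \<in> J"
    and g: "\<And>t. t \<in> J \<Longrightarrow> g t \<in> V \<and> g' t \<in> V \<and> n (g' t) \<le> B \<and> nderiv n g (g' t) t J"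
  shows "n (g b - g a) \<le> B * \<bar>b - a\<bar>"
proof -
  have main: "n (g b - g a) \<le> B * (b - a)" if "a \<in> J" "b \<in> J" "a \<le> b" for a b
  proof (rule mean_value_normed[OF V that(3) B])
    fix t assume t: "t \<in> {a..b}"
    have sub: "{a..b} \<subseteq> J" using J that by (meson atLeastAtMost_iff mem_is_interval_1_I subsetI)
    with t have "t \<in> J" by auto
    with g sub show "g t \<in> V \<and> g' t \<in> V \<and> n (g' t) \<le> B \<and> nderiv n g (g' t) t {a..b}"
      using nderiv_subset by blast
  qed
  show ?thesis
  proof (cases "a \<le> b")
    case True then show ?thesis using main ab by auto
  next
    case False
    have "n (g b - g a) = n (g a - g b)" by (rule normed_commute[OF V]) (use g ab in auto)
    then show ?thesis using main[of b a] ab False by auto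
  qed
qed

section \<open>Frechet derivatives relative to a domain, and the chain rule along curves\<close>

definition fderiv_on ::
  "('b::real_vector \<Rightarrow> real) \<Rightarrow> ('c::real_vector \<Rightarrow> real) \<Rightarrow> 'b set \<Rightarrow> ('b \<Rightarrow> 'c) \<Rightarrow> ('b \<Rightarrow> 'c) \<Rightarrow> 'b \<Rightarrow> bool" where
  "fderiv_on n m D f A p \<longleftrightarrow>
     (\<forall>e>0. \<exists>d>0. \<forall>q\<in>D. n (q - p) < d \<longrightarrow> m (f q - f p - A (q - p)) \<le> e * n (q - p))"

lemma bounded_linear_onD:
  assumes "bounded_linear_on V n W m A"
  shows bounded_linear_on_mem: "x \<in> V \<Longrightarrow> A x \<in> W"
    and bounded_linear_on_add: "x \<in> V \<Longrightarrow> y \<in> V \<Longrightarrow> A (x + y) = A x + A y"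
    and bounded_linear_on_scale: "x \<in> V \<Longrightarrow> A (c *\<^sub>R x) = c *\<^sub>R A x"
  using assms by (auto simp: bounded_linear_on_def)

lemma bounded_linear_on_diff:
  assumes "bounded_linear_on V n W m A" "normed_on V n" "x \<in> V" "y \<in> V"
  shows "A (x - y) = A x - A y"
proof -
  have "A (x + (-1) *\<^sub>R y) = A x + (-1) *\<^sub>R A y"
    using bounded_linear_onD[OF assms(1)] assms(3,4) normed_scale_mem[OF assms(2)] by presburger
  then show ?thesis by simp
qed

lemma bounded_linear_on_bound:
  assumes "bounded_linear_on V n W m A" "normed_on V n"
  obtains K where "K \<ge> 0" "\<And>x. x \<in> V \<Longrightarrow> m (A x) \<le> K * n x"
proof -
  obtain K where K: "\<And>x. x \<in> V \<Longrightarrow> m (A x) \<le> K * n x"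
    using assms(1) unfolding bounded_linear_on_def by blast
  have "m (A x) \<le> \<bar>K\<bar> * n x" if "x \<in> V" for x
    using K[OF that] mult_right_mono[OF abs_ge_self normed_nonneg[OF assms(2) that], of K] by linarith
  then show ?thesis using that[of "\<bar>K\<bar>"] by simp
qed

lemma nderiv_chain:
  assumes V: "normed_on V n" and W: "normed_on W m"
    and f: "fderiv_on n m D f A (c t)" and A: "bounded_linear_on V n W m A"
    and fW: "\<And>q. q \<in> D \<Longrightarrow> f q \<in> W"
    and c: "nderiv n c c' t I" and cD: "\<And>r. r \<in> insert t I \<Longrightarrow> c r \<in> D \<inter> V" and c'V: "c' \<in> V"
  shows "nderiv m (\<lambda>r. f (c r)) (A c') t I"
  unfolding nderiv_def
proof (intro allI impI)
  fix e :: real assume e: "e > 0"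
  obtain K where K: "K \<ge> 0" "\<And>x. x \<in> V \<Longrightarrow> m (A x) \<le> K * n x"
    using bounded_linear_on_bound[OF A V] by blast
  have nc': "n c' \<ge> 0" by (rule normed_nonneg[OF V c'V])
  define e1 where "e1 = e / (2 * (n c' + 1))"
  have e1: "e1 > 0" using e nc' by (simp add: e1_def)
  obtain d where d: "d > 0" "\<And>q. q \<in> D \<Longrightarrow> n (q - c t) < d \<Longrightarrow> m (f q - f (c t) - A (q - c t)) \<le> e1 * n (q - c t)"
    using f e1 unfolding fderiv_on_def by blast
  \<comment> \<open>The cap at 1 bounds the increments of \<open>c\<close> by
    \<open>(n c' + 1) * \<bar>r - t\<bar>\<close>; the other entry makes the image under
    \<open>A\<close> of the inner remainder small.\<close>
  define e2 where "e2 = min 1 (e / (2 * (K + 1)))"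
  have e2: "e2 > 0" "e2 \<le> 1" using e K by (auto simp: e2_def)
  have "ncont n c t I" by (rule nderiv_imp_ncont[OF V c]) (use cD c'V in auto)
  from ncontD[OF this, of "d / 2"] d have ev: "\<forall>\<^sub>F r in at t within I. n (c r - c t) \<le> d / 2" by simp
  from ev nderivD[OF c e2(1)] eventually_in_within
  show "\<forall>\<^sub>F r in at t within I. m (f (c r) - f (c t) - (r - t) *\<^sub>R A c') \<le> e * \<bar>r - t\<bar>"
  proof eventually_elim
    case (elim r)
    have mem: "c r \<in> V" "c t \<in> V" "c r \<in> D" "c t \<in> D" using cD elim by auto
    let ?R = "c r - c t - (r - t) *\<^sub>R c'"
    have RV: "?R \<in> V" by (intro normed_mem[OF V] mem c'V)
    have dV: "c r - c t \<in> V" by (intro normed_mem[OF V] mem)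
    have nR: "n ?R \<le> e2 * \<bar>r - t\<bar>" using elim by simp
    have "n (c r - c t) \<le> n ((r - t) *\<^sub>R c') + n ?R"
      by (intro normed_le_add_diff[OF V] normed_mem[OF V] mem c'V)
    also have "n ((r - t) *\<^sub>R c') = \<bar>r - t\<bar> * n c'" by (rule normed_scale[OF V c'V])
    finally have nd: "n (c r - c t) \<le> (n c' + 1) * \<bar>r - t\<bar>"
      using nR e2 mult_right_mono[of e2 1 "\<bar>r - t\<bar>"] by (simp add: algebra_simps)
    have AR: "A ?R = A (c r - c t) - (r - t) *\<^sub>R A c'"
      by (simp add: bounded_linear_on_diff[OF A V dV normed_scale_mem[OF V c'V]]
          bounded_linear_on_scale[OF A c'V])
    then have eq: "f (c r) - f (c t) - (r - t) *\<^sub>R A c' = (f (c r) - f (c t) - A (c r - c t)) + A ?R"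
      by simp
    have "m ((f (c r) - f (c t) - A (c r - c t)) + A ?R)
        \<le> m (f (c r) - f (c t) - A (c r - c t)) + m (A ?R)"
      by (intro normed_triangle[OF W] normed_mem[OF W] fW mem bounded_linear_on_mem[OF A] RV dV)
    also have "m (f (c r) - f (c t) - A (c r - c t)) \<le> e1 * n (c r - c t)"
      using d elim mem by simp
    also have "\<dots> \<le> e1 * ((n c' + 1) * \<bar>r - t\<bar>)" using nd e1 by simp
    also have "\<dots> = e / 2 * \<bar>r - t\<bar>" using nc' unfolding e1_def by (simp add: divide_simps)
    also have "m (A ?R) \<le> K * (e2 * \<bar>r - t\<bar>)"
      using K(2)[OF RV] mult_left_mono[OF nR K(1)] by linarith
    also have "\<dots> \<le> (K + 1) * ((e / (2 * (K + 1))) * \<bar>r - t\<bar>)"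
      using K e e2 by (intro mult_mono) (auto simp: e2_def)
    also have "\<dots> = e / 2 * \<bar>r - t\<bar>" using K by (simp add: field_simps)
    finally show ?case unfolding eq by (simp add: field_simps)
  qed
qed

lemma nderiv_affine:
  assumes "normed_on V n"
  shows "nderiv n (\<lambda>r. p + r *\<^sub>R k) k t I"
proof -
  have "(p + r *\<^sub>R k) - (p + t *\<^sub>R k) - (r - t) *\<^sub>R k = 0" for r by (simp add: algebra_simps)
  then show ?thesis by (simp add: nderiv_def normed_zero[OF assms])
qed

lemma nderiv_bounded_linear:
  assumes V: "normed_on V n" and A: "bounded_linear_on V n W m A" and g: "nderiv n g g' t I"
    and mem: "\<And>r. r \<in> insert t I \<Longrightarrow> g r \<in> V" "g' \<in> V"
  shows "nderiv m (\<lambda>r. A (g r)) (A g') t I"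
proof -
  obtain K where K: "K \<ge> 0" "\<And>x. x \<in> V \<Longrightarrow> m (A x) \<le> K * n x"
    using bounded_linear_on_bound[OF A V] by blast
  show ?thesis
  proof (rule nderiv_mono_norm[OF g K(1)])
    fix r assume "r \<in> I"
    then have m: "g r \<in> V" "g t \<in> V" "g' \<in> V" using mem by auto
    have "A (g r - g t - (r - t) *\<^sub>R g') = A (g r) - A (g t) - (r - t) *\<^sub>R A g'"
      by (simp add: bounded_linear_on_diff[OF A V] bounded_linear_on_scale[OF A] normed_mem[OF V] m)
    moreover have "m (A (g r - g t - (r - t) *\<^sub>R g')) \<le> K * n (g r - g t - (r - t) *\<^sub>R g')"
      by (intro K normed_mem[OF V] m)
    ultimately show "m (A (g r) - A (g t) - (r - t) *\<^sub>R A g') \<le> K * n (g r - g t - (r - t) *\<^sub>R g')"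
      by simp
  qed
qed

section \<open>Complete sets and quasi-Newton iteration\<close>

text \<open>Completeness of a subset, by sequences in a given norm. Besides the carriers it is
  needed for Galerkin spaces, for closed balls in them, and for the invariant subspaces in which the
  quasi-Newton iteration is also run.\<close>

definition ncomplete :: "('b::real_vector \<Rightarrow> real) \<Rightarrow> 'b set \<Rightarrow> bool" where
  "ncomplete n C \<longleftrightarrow> (\<forall>x :: nat \<Rightarrow> 'b.
     (\<forall>k. x k \<in> C) \<and> (\<forall>e>0. \<exists>k0. \<forall>i\<ge>k0. \<forall>j\<ge>k0. n (x i - x j) < e) \<longrightarrow>
     (\<exists>l\<in>C. (\<lambda>k. n (x k - l)) \<longlonglongrightarrow> 0))"

lemma ncompleteD:
  fixes x :: "nat \<Rightarrow> 'b::real_vector"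
  assumes "ncomplete n C" "\<And>k. x k \<in> C" "\<And>e. e > 0 \<Longrightarrow> \<exists>k0. \<forall>i\<ge>k0. \<forall>j\<ge>k0. n (x i - x j) < e"
  shows "\<exists>l\<in>C. (\<lambda>k. n (x k - l)) \<longlonglongrightarrow> 0"
  using assms unfolding ncomplete_def by blast

text \<open>Since \<open>ndist\<close> is 0 off the carrier, distances say nothing about terms
  outside \<open>V\<close>; membership is therefore a separate conjunct.\<close>

lemma limitin_ntopology:
  assumes V: "normed_on V n"
  shows "limitin (ntopology V n) x l sequentially \<longleftrightarrow>
    l \<in> V \<and> (\<forall>\<^sub>F k in sequentially. x k \<in> V) \<and> (\<lambda>k. if x k \<in> V then n (x k - l) else 0) \<longlonglongrightarrow> 0"
proof -
  interpret Metric_space V "ndist V n" by (rule Metric_space_ndist[OF V])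
  have "(\<lambda>k. ndist V n (x k) l) = (\<lambda>k. if x k \<in> V then n (x k - l) else 0)" if "l \<in> V"
    using that by (auto simp: ndist_def)
  then show ?thesis unfolding limitin_metric_dist_null by auto
qed

lemma banach_ncomplete:
  assumes "banach_on V n"
  shows "ncomplete n V"
  unfolding ncomplete_def
proof (intro allI impI)
  fix x :: "nat \<Rightarrow> 'a"
  assume x: "(\<forall>k. x k \<in> V) \<and> (\<forall>e>0. \<exists>k0. \<forall>i\<ge>k0. \<forall>j\<ge>k0. n (x i - x j) < e)"
  have V: "normed_on V n" using assms by (simp add: banach_on_def)
  interpret Metric_space V "ndist V n" by (rule Metric_space_ndist[OF V])
  have "MCauchy x" using x by (auto simp: MCauchy_def ndist_def)
  moreover have mcomplete using assms by (simp add: banach_on_def)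
  ultimately obtain l where "limitin mtopology x l sequentially"
    unfolding mcomplete_def by blast
  then show "\<exists>l\<in>V. (\<lambda>k. n (x k - l)) \<longlonglongrightarrow> 0"
    unfolding limitin_ntopology[OF V] using x by auto
qed

lemma closedin_ntopology_limit:
  fixes x :: "nat \<Rightarrow> 'a::real_vector"
  assumes V: "normed_on V n" and cl: "closedin (ntopology V n) C" and x: "\<And>k. x k \<in> C"
    and l: "l \<in> V" "(\<lambda>k. n (x k - l)) \<longlonglongrightarrow> 0"
  shows "l \<in> C"
proof -
  interpret Metric_space V "ndist V n" by (rule Metric_space_ndist[OF V])
  have sub: "C \<subseteq> V" using cl closedin_subset by fastforce
  then have "x k \<in> V" for k using x by blast
  then have "limitin mtopology x l sequentially"
    unfolding limitin_ntopology[OF V] using l by simp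
  from limitin_closedin[OF this cl] show ?thesis using x by simp
qed

text \<open>Two points of \<open>C\<close> are at most twice the sum of their defects
  \<open>n (\<Phi> x - x)\<close> apart (\<open>quasi\<close>). The defects of the iterates decay
  geometrically, so the iterates form a Cauchy sequence without summing a series.\<close>

lemma contraction_fixpoint:
  assumes V: "normed_on V n" and C: "C \<subseteq> V" "C \<noteq> {}" "ncomplete n C"
    and \<Phi>: "\<And>x. x \<in> C \<Longrightarrow> \<Phi> x \<in> C"
    and contr: "\<And>x y. x \<in> C \<Longrightarrow> y \<in> C \<Longrightarrow> n (\<Phi> x - \<Phi> y) \<le> 1/2 * n (x - y)"
  shows "\<exists>x\<in>C. \<Phi> x = x"
proof -
  obtain x0 where x0: "x0 \<in> C" using C by blast
  define x where "x k = (\<Phi> ^^ k) x0" for k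
  have xC: "x k \<in> C" for k by (induction k) (auto simp: x_def x0 \<Phi>)
  then have xV: "x k \<in> V" for k using C by auto
  have step: "n (x (Suc k) - x k) \<le> n (x 1 - x 0) / 2 ^ k" for k
  proof (induction k)
    case (Suc k)
    have "n (x (Suc (Suc k)) - x (Suc k)) \<le> 1/2 * n (x (Suc k) - x k)"
      using contr[OF xC[of "Suc k"] xC[of k]] by (simp add: x_def)
    also have "\<dots> \<le> 1/2 * (n (x 1 - x 0) / 2 ^ k)" using Suc by (intro mult_left_mono) auto
    finally show ?case by (simp add: mult.commute)
  qed simp
  have quasi: "n (y - z) \<le> 2 * (n (\<Phi> y - y) + n (\<Phi> z - z))" if yz: "y \<in> C" "z \<in> C" for y z
  proof -
    have m: "y \<in> V" "z \<in> V" "\<Phi> y \<in> V" "\<Phi> z \<in> V" using yz \<Phi> C by auto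
    have "n (y - z) \<le> n (y - \<Phi> y) + n (\<Phi> y - z)" by (rule normed_triangle_mid[OF V m(1) m(3) m(2)])
    also have "n (\<Phi> y - z) \<le> n (\<Phi> y - \<Phi> z) + n (\<Phi> z - z)" by (rule normed_triangle_mid[OF V m(3) m(4) m(2)])
    also have "n (\<Phi> y - \<Phi> z) \<le> 1/2 * n (y - z)" by (rule contr[OF yz])
    also have "n (y - \<Phi> y) = n (\<Phi> y - y)" by (rule normed_commute[OF V m(1) m(3)])
    finally show ?thesis by simp
  qed
  have "(\<lambda>k. n (x 1 - x 0) * (1/2) ^ k) \<longlonglongrightarrow> n (x 1 - x 0) * 0"
    by (intro tendsto_mult tendsto_const LIMSEQ_realpow_zero) auto
  then have lim0: "(\<lambda>k. n (x 1 - x 0) / 2 ^ k) \<longlonglongrightarrow> 0" by (simp add: power_divide)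
  have "\<exists>l\<in>C. (\<lambda>k. n (x k - l)) \<longlonglongrightarrow> 0"
  proof (rule ncompleteD[OF C(3) xC])
    fix e :: real assume "e > 0"
    then have "\<forall>\<^sub>F k in sequentially. n (x 1 - x 0) / 2 ^ k < e / 4"
      using order_tendstoD(2)[OF lim0, of "e / 4"] by simp
    then obtain k0 where k0: "\<And>k. k \<ge> k0 \<Longrightarrow> n (x 1 - x 0) / 2 ^ k < e / 4"
      unfolding eventually_sequentially by blast
    have "n (x i - x j) < e" if "i \<ge> k0" "j \<ge> k0" for i j
    proof -
      have "n (x i - x j) \<le> 2 * (n (x (Suc i) - x i) + n (x (Suc j) - x j))"
        using quasi[OF xC xC, of i j] by (simp add: x_def)
      moreover have "n (x (Suc i) - x i) < e / 4" "n (x (Suc j) - x j) < e / 4"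
        using step k0 that by (meson le_less_trans)+
      ultimately show ?thesis by argo
    qed
    then show "\<exists>k0. \<forall>i\<ge>k0. \<forall>j\<ge>k0. n (x i - x j) < e" by blast
  qed
  then obtain l where l: "l \<in> C" "(\<lambda>k. n (x k - l)) \<longlonglongrightarrow> 0" by blast
  have m: "l \<in> V" "\<Phi> l \<in> V" using l \<Phi> C by auto
  have "n (\<Phi> l - l) \<le> 1/2 * n (x k - l) + n (x (Suc k) - l)" for k
  proof -
    have "n (\<Phi> l - l) \<le> n (\<Phi> l - x (Suc k)) + n (x (Suc k) - l)"
      by (rule normed_triangle_mid[OF V m(2) xV m(1)])
    also have "n (\<Phi> l - x (Suc k)) \<le> 1/2 * n (l - x k)"
      using contr[OF l(1) xC, of k] by (simp add: x_def)
    also have "n (l - x k) = n (x k - l)" by (rule normed_commute[OF V m(1) xV])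
    finally show ?thesis by simp
  qed
  moreover have "(\<lambda>k. 1/2 * n (x k - l) + n (x (Suc k) - l)) \<longlonglongrightarrow> 1/2 * 0 + 0"
    by (intro tendsto_intros l(2) LIMSEQ_Suc)
  ultimately have "n (\<Phi> l - l) \<le> 0" by (intro LIMSEQ_le_const[of _ 0]) auto
  then have "\<Phi> l = l"
    using normed_nonneg[OF V normed_diff_mem[OF V m(2) m(1)]]
      normed_eq_0[OF V normed_diff_mem[OF V m(2) m(1)]] by simp
  with l show ?thesis by blast
qed

lemma ncomplete_ball:
  assumes V: "normed_on V n" and C: "C \<subseteq> V" "ncomplete n C" and u: "u \<in> V"
  shows "ncomplete n {z\<in>C. n (z - u) \<le> \<rho>}"
  unfolding ncomplete_def
proof (intro allI impI)
  fix x :: "nat \<Rightarrow> 'a"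
  assume x: "(\<forall>k. x k \<in> {z\<in>C. n (z - u) \<le> \<rho>}) \<and> (\<forall>e>0. \<exists>k0. \<forall>i\<ge>k0. \<forall>j\<ge>k0. n (x i - x j) < e)"
  then obtain l where l: "l \<in> C" "(\<lambda>k. n (x k - l)) \<longlonglongrightarrow> 0"
    using ncompleteD[OF C(2), of x] by blast
  have "n (l - u) \<le> \<rho> + n (x k - l)" for k
  proof -
    have m: "x k \<in> V" "l \<in> V" using x l C by auto
    have "n (l - u) \<le> n (l - x k) + n (x k - u)" by (rule normed_triangle_mid[OF V m(2) m(1) u])
    also have "n (l - x k) = n (x k - l)" by (rule normed_commute[OF V m(2) m(1)])
    finally have "n (l - u) \<le> n (x k - l) + n (x k - u)" .
    moreover have "n (x k - u) \<le> \<rho>" using x by blast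
    ultimately show ?thesis by linarith
  qed
  moreover have "(\<lambda>k. \<rho> + n (x k - l)) \<longlonglongrightarrow> \<rho> + 0" by (intro tendsto_intros l(2))
  ultimately have "n (l - u) \<le> \<rho>" by (intro LIMSEQ_le_const[of _ \<rho>]) auto
  then show "\<exists>l\<in>{z\<in>C. n (z - u) \<le> \<rho>}. (\<lambda>k. n (x k - l)) \<longlonglongrightarrow> 0" using l by blast
qed

text \<open>\<open>T\<close> plays the role of an approximate inverse of the derivative of \<open>G\<close>.\<close>

lemma quasi_newton_zero:
  assumes V: "normed_on V n" and C: "subspace C" "C \<subseteq> V" "ncomplete n C" and u: "u \<in> C"
    and T: "\<And>y. y \<in> C \<Longrightarrow> T y \<in> C" "\<And>y y'. y \<in> C \<Longrightarrow> y' \<in> C \<Longrightarrow> T (y - y') = T y - T y'"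
      "\<And>y. y \<in> C \<Longrightarrow> T y = 0 \<Longrightarrow> y = 0"
    and G: "\<And>z. z \<in> C \<Longrightarrow> n (z - u) \<le> \<rho> \<Longrightarrow> G z \<in> C"
    and contr: "\<And>z z'. z \<in> C \<Longrightarrow> n (z - u) \<le> \<rho> \<Longrightarrow> z' \<in> C \<Longrightarrow> n (z' - u) \<le> \<rho> \<Longrightarrow>
      n (z - z' - T (G z - G z')) \<le> 1/2 * n (z - z')"
    and start: "n (T (G u)) \<le> \<rho> / 2" and \<rho>: "0 \<le> \<rho>"
  shows "\<exists>z\<in>C. n (z - u) \<le> \<rho> \<and> G z = 0"
proof -
  let ?B = "{z\<in>C. n (z - u) \<le> \<rho>}"
  have uV: "u \<in> V" using u C by auto
  have uu: "n (u - u) = 0" using normed_zero[OF V] by simp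
  have TV: "y \<in> C \<Longrightarrow> T y \<in> V" for y using T C by auto
  have uB: "u \<in> ?B" using u uu \<rho> by simp
  \<comment> \<open>A fixed point satisfies \<open>T (G z) = 0\<close>, and \<open>T\<close> has
    trivial kernel on \<open>C\<close>. The ball is preserved because the contraction contributes
    \<open>\<rho> / 2\<close> and the first step from \<open>u\<close> another
    \<open>\<rho> / 2\<close>.\<close>
  define \<Phi> where "\<Phi> z = z - T (G z)" for z
  have GC: "G z \<in> C" if "z \<in> ?B" for z using G that by auto
  have d: "\<Phi> z - \<Phi> z' = z - z' - T (G z - G z')" if "z \<in> ?B" "z' \<in> ?B" for z z'
    using T(2)[OF GC[OF that(1)] GC[OF that(2)]] by (simp add: \<Phi>_def)
  have "\<exists>z\<in>?B. \<Phi> z = z"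
  proof (rule contraction_fixpoint[OF V])
    show "?B \<subseteq> V" "?B \<noteq> {}" using C uB by auto
    show "ncomplete n ?B" by (rule ncomplete_ball[OF V C(2,3) uV])
    show contr': "n (\<Phi> z - \<Phi> z') \<le> 1/2 * n (z - z')" if "z \<in> ?B" "z' \<in> ?B" for z z'
      unfolding d[OF that] by (rule contr) (use that in auto)
    show "\<Phi> z \<in> ?B" if z: "z \<in> ?B" for z
    proof -
      have \<Phi>C: "\<Phi> z \<in> C" if "z \<in> ?B" for z
        unfolding \<Phi>_def by (intro subspace_diff[OF C(1)] T GC) (use that in auto)
      have "n (\<Phi> z - u) \<le> n (\<Phi> z - \<Phi> u) + n (\<Phi> u - u)"
        by (rule normed_triangle_mid[OF V]) (use \<Phi>C[OF z] \<Phi>C[OF uB] C uV in auto)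
      also have "n (\<Phi> z - \<Phi> u) \<le> 1/2 * n (z - u)" by (rule contr'[OF z uB])
      also have "n (\<Phi> u - u) = n (T (G u))"
        using normed_minus[OF V TV[OF GC[OF uB]]] by (simp add: \<Phi>_def)
      finally show ?thesis using start z \<Phi>C[OF z] by simp
    qed
  qed
  then obtain z where z: "z \<in> ?B" "\<Phi> z = z" by blast
  then have "T (G z) = 0" by (simp add: \<Phi>_def)
  with T(3) GC[OF z(1)] have "G z = 0" by blast
  with z show ?thesis by blast
qed

text \<open>Needed for inverses: if a bijection of a Galerkin space maps a finite-dimensional
  subspace into itself, so does its inverse. As \<open>L\<close> is linear on \<open>V\<close> only,
  a basis of \<open>V\<close> is sent along a linear map \<open>g\<close> of the whole space. The
  image of the basis is independent and of the same size, so a vector of \<open>V\<close> outside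
  its span would give too many independent vectors.\<close>

lemma injective_on_finite_dim_imp_surj:
  fixes V :: "'a::real_vector set"
  assumes V: "subspace V" and B: "finite B" "V \<subseteq> span B"
    and L: "\<And>x. x \<in> V \<Longrightarrow> L x \<in> V" "\<And>x y. x \<in> V \<Longrightarrow> y \<in> V \<Longrightarrow> L (x + y) = L x + L y"
      "\<And>c x. x \<in> V \<Longrightarrow> L (c *\<^sub>R x) = c *\<^sub>R L x" "inj_on L V"
  shows "L ` V = V"
proof
  show "L ` V \<subseteq> V" using L(1) by auto
  obtain C where C: "C \<subseteq> V" "independent C" "V \<subseteq> span C"
    using maximal_independent_subset by blast
  have fin: "finite C" using independent_span_bound[OF B(1) C(2)] C(1) B(2) by auto
  have spanC: "span C = V" using C V by (simp add: span_minimal subset_antisym)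
  obtain g where g: "linear g" "\<And>x. x \<in> C \<Longrightarrow> g x = L x"
    using linear_independent_extend[OF C(2)] by blast
  have gL: "g x = L x" if "x \<in> V" for x
  proof -
    have "L 0 = 0" using L(3)[of 0 0] subspace_0[OF V] by simp
    then have "subspace {x\<in>V. g x = L x}"
      unfolding subspace_def linear_0[OF g(1)] linear_add[OF g(1)] linear_scale[OF g(1)]
      using subspace_0[OF V] subspace_add[OF V] subspace_scale[OF V] L(2,3)
      by (simp add: linear_0[OF g(1)] linear_add[OF g(1)] linear_scale[OF g(1)])
    then have "span C \<subseteq> {x\<in>V. g x = L x}" using C g by (intro span_minimal) auto
    with that spanC have "x \<in> {x\<in>V. g x = L x}" by auto
    then show ?thesis by simp
  qed
  have inj: "inj_on g (span C)" using L(4) gL spanC by (simp add: inj_on_def)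
  have ind: "independent (g ` C)" by (rule linear_independent_injective_image[OF g(1) C(2) inj])
  have card: "card (g ` C) = card C"
    by (rule card_image[OF inj_on_subset[OF inj span_superset]])
  have gC: "g ` C \<subseteq> span C" using C(1) gL L(1) spanC by auto
  show "V \<subseteq> L ` V"
  proof
    fix y assume y: "y \<in> V"
    have "y \<in> span (g ` C)"
    proof (rule ccontr)
      assume ny: "y \<notin> span (g ` C)"
      then have "independent (insert y (g ` C))" using ind by (rule independent_insertI)
      moreover have "insert y (g ` C) \<subseteq> span C" using gC y spanC by auto
      ultimately have "card (insert y (g ` C)) \<le> card C"
        using independent_span_bound[OF fin] by blast
      moreover have "y \<notin> g ` C" using ny span_base by metis
      ultimately show False using card fin by simp
    qed
    then have "y \<in> g ` span C" by (simp add: linear_span_image[OF g(1)])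
    then show "y \<in> L ` V" using spanC gL by auto
  qed
qed

text \<open>
  The cutoff is a difference quotient of an antiderivative of a piecewise linear function of the
  distance to \<open>A\<close>.
\<close>

lemma cutoff_function:
  fixes A :: "real set"
  assumes \<eta>: "\<eta> > 0"
  obtains \<psi> \<psi>' :: "real \<Rightarrow> real" where
    "\<And>x. (\<psi> has_real_derivative \<psi>' x) (at x)" "\<And>x. isCont \<psi>' x"
    "\<And>x. 0 \<le> \<psi> x" "\<And>x. \<psi> x \<le> 1" "\<And>x. \<bar>\<psi>' x\<bar> \<le> 4 / \<eta>"
    "\<And>x. x \<in> open_nbhd A \<eta> \<Longrightarrow> \<psi> x = 1"
    "\<And>x y. x \<notin> open_nbhd A (2 * \<eta>) \<Longrightarrow> \<bar>y - x\<bar> < \<eta> / 4 \<Longrightarrow> \<psi> y = 0"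
\<comment> \<open>The distance to the empty set is 0 by convention, which would count every point as
  near.\<close>
proof (cases "A = {}")
  case True
  show ?thesis
    by (rule that[of "\<lambda>_. 0" "\<lambda>_. 0"]) (use True \<eta> in \<open>auto simp: open_nbhd_def\<close>)
next
  case False
  define d where "d x = infdist x A" for x
  \<comment> \<open>The ramp falls from 1 at distance \<open>5/4 * \<eta>\<close> to 0 at distance
    \<open>3/2 * \<eta>\<close>. Averaging over a window of length \<open>\<eta> / 4\<close> then
    keeps the value 1 up to distance \<open>\<eta>\<close>, and the value 0 within
    \<open>\<eta> / 4\<close> of every point at distance at least \<open>2 * \<eta>\<close>.\<close>
  define f where "f x = max 0 (min 1 (6 - 4 * d x / \<eta>))" for x
  define w where "w = \<eta> / 4"
  have w: "w > 0" using \<eta> by (simp add: w_def)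
  have dlip: "\<bar>d x - d y\<bar> \<le> \<bar>x - y\<bar>" for x y
    using infdist_triangle_abs[of x A y] by (simp add: d_def dist_real_def)
  have cf: "isCont f x" for x
    unfolding f_def d_def using \<eta> by (intro continuous_intros) auto
  have f01: "0 \<le> f x" "f x \<le> 1" for x by (auto simp: f_def)
  have "\<exists>F. \<forall>x::real. -\<infinity> < ereal x \<longrightarrow> ereal x < \<infinity> \<longrightarrow> (F has_vector_derivative f x) (at x)"
    by (rule einterval_antiderivative) (use cf in auto)
  then obtain F where F: "\<And>x. (F has_real_derivative f x) (at x)"
    by (auto simp: has_real_derivative_iff_has_vector_derivative)
  define \<psi> where "\<psi> x = (F (x + w) - F x) / w" for x
  define \<psi>' where "\<psi>' x = (f (x + w) - f x) / w" for x
  have mvt: "\<exists>y. x < y \<and> y < x + w \<and> \<psi> x = f y" for x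
  proof -
    have "\<exists>z>x. z < x + w \<and> F (x + w) - F x = (x + w - x) * f z"
      by (rule MVT2) (use w F in auto)
    then show ?thesis using w by (auto simp: \<psi>_def)
  qed
  have mem: "x \<in> open_nbhd A r \<longleftrightarrow> d x < r" for x r
  proof -
    have "d x < r \<longleftrightarrow> (\<exists>a\<in>A. dist x a < r)"
    proof
      assume "d x < r"
      then show "\<exists>a\<in>A. dist x a < r"
        using cInf_lessD[of "dist x ` A" r] False by (auto simp: d_def infdist_notempty[OF False])
    next
      assume "\<exists>a\<in>A. dist x a < r"
      then show "d x < r" unfolding d_def using infdist_le by (meson le_less_trans)
    qed
    then show ?thesis by (auto simp: open_nbhd_def dist_commute)
  qed
  show ?thesis
  proof (rule that[of \<psi> \<psi>'])
    fix x
    have "((\<lambda>x. F (x + w)) has_real_derivative f (x + w)) (at x)"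
      using F[of "x + w"] by (simp add: DERIV_shift)
    from DERIV_cdivide[OF DERIV_diff[OF this F[of x]], of w]
    show "(\<psi> has_real_derivative \<psi>' x) (at x)"
      unfolding \<psi>_def \<psi>'_def .
    have "isCont (\<lambda>x. f (x + w)) x"
      by (rule isCont_o2[OF _ cf]) simp
    then show "isCont \<psi>' x" unfolding \<psi>'_def using w by (intro continuous_intros cf) auto
    show "0 \<le> \<psi> x" "\<psi> x \<le> 1" using mvt[of x] f01 by metis+
    have "\<bar>f (x + w) - f x\<bar> \<le> 1" using f01[of x] f01[of "x + w"] by (simp add: abs_le_iff)
    then have "\<bar>\<psi>' x\<bar> \<le> 1 / w" using w by (simp add: \<psi>'_def divide_right_mono abs_divide)
    then show "\<bar>\<psi>' x\<bar> \<le> 4 / \<eta>" by (simp add: w_def)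
  next
    fix x assume "x \<in> open_nbhd A \<eta>"
    then have "d x < \<eta>" by (simp add: mem)
    obtain y where y: "x < y" "y < x + w" "\<psi> x = f y" using mvt by blast
    have "d y \<le> 5 / 4 * \<eta>" using dlip[of y x] y \<open>d x < \<eta>\<close> by (simp add: w_def)
    then have "4 * d y / \<eta> \<le> 5" using \<eta> by (simp add: field_simps)
    then show "\<psi> x = 1" using y(3) by (simp add: f_def)
  next
    fix x y assume "x \<notin> open_nbhd A (2 * \<eta>)" "\<bar>y - x\<bar> < \<eta> / 4"
    then have d: "d x \<ge> 2 * \<eta>" by (simp add: mem)
    obtain z where z: "y < z" "z < y + w" "\<psi> y = f z" using mvt by blast
    have "\<bar>z - x\<bar> < \<eta> / 2" using z \<open>\<bar>y - x\<bar> < \<eta> / 4\<close> unfolding w_def by linarith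
    then have "d z \<ge> 3 / 2 * \<eta>" using dlip[of z x] d by linarith
    then have "4 * d z / \<eta> \<ge> 6" using \<eta> by (simp add: field_simps)
    then show "\<psi> y = 0" using z(3) by (simp add: f_def)
  qed
qed

text \<open>Halving makes \<open>2 * c k\<close> dominate the tail from \<open>k\<close> on. The
  partial sums are bounded by the difference \<open>2 * c k - 2 * c (k + j)\<close>, the form in
  which the induction closes.\<close>

lemma geometric_limit:
  fixes f :: "nat \<Rightarrow> 'a::real_vector" and c :: "nat \<Rightarrow> real"
  assumes V: "normed_on V n" "ncomplete n V" and f: "\<And>k. f k \<in> V" "\<And>k. n (f (Suc k) - f k) \<le> c k"
    and c: "\<And>k. 0 \<le> c k" "\<And>k. c (Suc k) \<le> c k / 2" "c \<longlonglongrightarrow> 0"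
  shows "\<exists>w\<in>V. \<forall>k. n (f k - w) \<le> 2 * c k"
proof -
  have diff: "n (f (k + j) - f k) \<le> 2 * c k - 2 * c (k + j)" for k j
  proof (induction j)
    case 0 then show ?case using normed_zero[OF V(1)] by simp
  next
    case (Suc j)
    have "n (f (k + Suc j) - f k) \<le> n (f (Suc (k + j)) - f (k + j)) + n (f (k + j) - f k)"
      using normed_triangle_mid[OF V(1) f(1)[of "k + Suc j"] f(1)[of "k + j"] f(1)[of k]] by simp
    also have "\<dots> \<le> c (k + j) + (2 * c k - 2 * c (k + j))"
      by (intro add_mono f(2) Suc)
    finally show ?case using c(2)[of "k + j"] by simp
  qed
  have tail: "n (f i - f k) \<le> 2 * c k" if ki: "k \<le> i" for i k
  proof -
    obtain j where "i = k + j" using le_Suc_ex[OF ki] by blast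
    then show ?thesis using diff[of k j] c(1)[of "k + j"] by simp
  qed
  have "\<exists>w\<in>V. (\<lambda>k. n (f k - w)) \<longlonglongrightarrow> 0"
  proof (rule ncompleteD[OF V(2) f(1)])
    fix e :: real assume "e > 0"
    then have "\<forall>\<^sub>F k in sequentially. c k < e / 4"
      using order_tendstoD(2)[OF c(3), of "e / 4"] by simp
    then obtain k0 where k0: "c k0 < e / 4" unfolding eventually_sequentially by blast
    have "n (f i - f j) < e" if "i \<ge> k0" "j \<ge> k0" for i j
    proof -
      have "n (f i - f j) \<le> n (f i - f k0) + n (f k0 - f j)"
        by (rule normed_triangle_mid[OF V(1) f(1) f(1) f(1)])
      also have "n (f k0 - f j) = n (f j - f k0)" by (rule normed_commute[OF V(1) f(1) f(1)])
      finally show ?thesis using tail[OF that(1)] tail[OF that(2)] k0 by argo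
    qed
    then show "\<exists>k0. \<forall>i\<ge>k0. \<forall>j\<ge>k0. n (f i - f j) < e" by blast
  qed
  then obtain w where w: "w \<in> V" "(\<lambda>k. n (f k - w)) \<longlonglongrightarrow> 0" by blast
  have "n (f k - w) \<le> 2 * c k" for k
  proof (rule LIMSEQ_le_const[of "\<lambda>i. 2 * c k + n (f i - w)"])
    show "(\<lambda>i. 2 * c k + n (f i - w)) \<longlonglongrightarrow> 2 * c k"
      using tendsto_add[OF tendsto_const w(2), of "2 * c k"] by simp
    have "n (f k - w) \<le> 2 * c k + n (f i - w)" if "k \<le> i" for i
    proof -
      have "n (f k - w) \<le> n (f k - f i) + n (f i - w)"
        by (rule normed_triangle_mid[OF V(1) f(1) f(1) w(1)])
      also have "n (f k - f i) = n (f i - f k)" by (rule normed_commute[OF V(1) f(1) f(1)])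
      finally show ?thesis using tail[OF that] by argo
    qed
    then show "\<exists>N. \<forall>i\<ge>N. n (f k - w) \<le> 2 * c k + n (f i - w)" by blast
  qed
  with w(1) show ?thesis by blast
qed

text \<open>The curve \<open>u m - u k\<close> is Lipschitz with constant \<open>c m + c k\<close>.
  Letting \<open>m\<close> grow, the increments of \<open>w\<close> and of \<open>u k\<close> differ
  by at most \<open>c k * \<bar>r - l\<bar>\<close>. Hence the remainder of \<open>w\<close> is
  controlled by that of a single \<open>u k\<close>, chosen before \<open>r\<close> approaches
  \<open>l\<close>.\<close>

lemma C1_limit:
  assumes V: "normed_on V n" and J: "is_interval J" and l: "l \<in> J"
    and u: "\<And>k l. l \<in> J \<Longrightarrow> u k l \<in> V \<and> u' k l \<in> V \<and> nderiv n (u k) (u' k l) l J \<and> ncont n (u' k) l J"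
    and w: "\<And>l. l \<in> J \<Longrightarrow> w l \<in> V \<and> w' l \<in> V"
    and close: "\<And>k l. l \<in> J \<Longrightarrow> n (u k l - w l) \<le> c k \<and> n (u' k l - w' l) \<le> c k"
    and c: "c \<longlonglongrightarrow> 0"
  shows "nderiv n w (w' l) l J" "ncont n w' l J"
proof -
  have small: "\<exists>k. c k \<le> e" if "e > 0" for e :: real
  proof -
    have "\<forall>\<^sub>F k in sequentially. c k < e" using order_tendstoD(2)[OF c that] .
    then show ?thesis unfolding eventually_sequentially by (meson less_imp_le order_refl)
  qed
  have c0: "c k \<ge> 0" for k
    using close[OF l, of k] normed_nonneg[OF V normed_diff_mem[OF V], of "u k l" "w l"] u[OF l, of k] w[OF l] by linarith
  have incr: "n ((w r - w l) - (u k r - u k l)) \<le> c k * \<bar>r - l\<bar>" if r: "r \<in> J" for r k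
  proof (rule LIMSEQ_le_const[of "\<lambda>m. 2 * c m + (c m + c k) * \<bar>r - l\<bar>"])
    have "(\<lambda>m. 2 * c m + (c m + c k) * \<bar>r - l\<bar>) \<longlonglongrightarrow> 2 * 0 + (0 + c k) * \<bar>r - l\<bar>"
      by (intro tendsto_intros c)
    then show "(\<lambda>m. 2 * c m + (c m + c k) * \<bar>r - l\<bar>) \<longlonglongrightarrow> c k * \<bar>r - l\<bar>" by simp
    have "n ((w r - w l) - (u k r - u k l)) \<le> 2 * c m + (c m + c k) * \<bar>r - l\<bar>" for m
    proof -
      define g where "g t = u m t + (-1) *\<^sub>R u k t" for t
      define g' where "g' t = u' m t + (-1) *\<^sub>R u' k t" for t
      have gl: "n (g r - g l) \<le> (c m + c k) * \<bar>r - l\<bar>"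
      proof (rule curve_lipschitz[OF V J _ l r])
        show "0 \<le> c m + c k" using c0 by simp
        fix t assume t: "t \<in> J"
        have mem: "u m t \<in> V" "u k t \<in> V" "u' m t \<in> V" "u' k t \<in> V" "w' t \<in> V" using u w t by auto
        have "nderiv n g (g' t) t J"
          unfolding g_def g'_def
          by (intro nderiv_add[OF V] nderiv_cmul[OF V] conjI normed_mem[OF V]) (use u t in auto)
        moreover have "n (g' t) \<le> c m + c k"
        proof -
          have "n (u' m t - u' k t) \<le> n (u' m t - w' t) + n (w' t - u' k t)"
            by (rule normed_triangle_mid[OF V mem(3,5,4)])
          also have "n (w' t - u' k t) = n (u' k t - w' t)" by (rule normed_commute[OF V mem(5,4)])
          finally show ?thesis using close[OF t, of m] close[OF t, of k] by (simp add: g'_def)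
        qed
        moreover have "g t \<in> V" "g' t \<in> V" unfolding g_def g'_def by (intro normed_mem[OF V] mem)+
        ultimately show "g t \<in> V \<and> g' t \<in> V \<and> n (g' t) \<le> c m + c k \<and> nderiv n g (g' t) t J" by blast
      qed
      have mm: "w r \<in> V" "w l \<in> V" "u m r \<in> V" "u m l \<in> V" "u k r \<in> V" "u k l \<in> V" using u w r l by auto
      have eq: "(w r - w l) - (u k r - u k l) = (u m l - w l) - (u m r - w r) + (g r - g l)"
        by (simp add: g_def)
      have "n ((u m l - w l) - (u m r - w r) + (g r - g l)) \<le> n ((u m l - w l) - (u m r - w r)) + n (g r - g l)"
        unfolding g_def by (intro normed_triangle[OF V] normed_mem[OF V] mm)
      moreover have "n ((u m l - w l) - (u m r - w r)) \<le> n (u m l - w l) + n (u m r - w r)"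
        by (intro normed_diff_le[OF V] normed_mem[OF V] mm)
      ultimately show ?thesis using gl close[OF l, of m] close[OF r, of m] unfolding eq by linarith
    qed
    then show "\<exists>N. \<forall>m\<ge>N. n ((w r - w l) - (u k r - u k l)) \<le> 2 * c m + (c m + c k) * \<bar>r - l\<bar>" by blast
  qed
  show "nderiv n w (w' l) l J"
    unfolding nderiv_def
  proof (intro allI impI)
    fix e :: real assume e: "e > 0"
    then obtain k where k: "c k \<le> e / 4" using small[of "e / 4"] by auto
    have e2: "e / 2 > 0" using e by simp
    have "nderiv n (u k) (u' k l) l J" using u[OF l] by blast
    from nderivD[OF this e2] eventually_in_within
    show "\<forall>\<^sub>F r in at l within J. n (w r - w l - (r - l) *\<^sub>R w' l) \<le> e * \<bar>r - l\<bar>"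
    proof eventually_elim
      case (elim r)
      have mm: "w r \<in> V" "w l \<in> V" "u k r \<in> V" "u k l \<in> V" "u' k l \<in> V" "w' l \<in> V" using u w elim l by auto
      let ?a = "(w r - w l) - (u k r - u k l)" and ?b = "u k r - u k l - (r - l) *\<^sub>R u' k l" and ?c = "(r - l) *\<^sub>R (u' k l - w' l)"
      have eq: "w r - w l - (r - l) *\<^sub>R w' l = ?a + ?b + ?c" by (simp add: algebra_simps)
      have "n (?a + ?b + ?c) \<le> n (?a + ?b) + n ?c" "n (?a + ?b) \<le> n ?a + n ?b"
        by (intro normed_triangle[OF V] normed_mem[OF V] mm)+
      moreover have "n ?c \<le> e / 4 * \<bar>r - l\<bar>"
        using normed_scale[OF V normed_diff_mem[OF V mm(5,6)], of "r - l"] close[OF l, of k] k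
          mult_right_mono[of "n (u' k l - w' l)" "e / 4" "\<bar>r - l\<bar>"] by (simp add: mult.commute)
      moreover have "n ?a \<le> e / 4 * \<bar>r - l\<bar>"
        using incr[of r k] elim(2) mult_right_mono[OF k, of "\<bar>r - l\<bar>"] by linarith
      ultimately show ?case using elim(1) unfolding eq by (simp add: field_simps)
    qed
  qed
  show "ncont n w' l J"
    unfolding ncont_def
  proof (intro allI impI)
    fix e :: real assume e: "e > 0"
    then obtain k where k: "c k \<le> e / 4" using small[of "e / 4"] by auto
    have e2: "e / 2 > 0" using e by simp
    have "ncont n (u' k) l J" using u[OF l] by blast
    from ncontD[OF this e2] eventually_in_within
    show "\<forall>\<^sub>F r in at l within J. n (w' r - w' l) \<le> e"
    proof eventually_elim
      case (elim r)
      have mm: "w' r \<in> V" "w' l \<in> V" "u' k r \<in> V" "u' k l \<in> V" using u w elim l by auto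
      have "n (w' r - w' l) \<le> n (w' r - u' k r) + n (u' k r - w' l)" by (rule normed_triangle_mid[OF V mm(1,3,2)])
      moreover have "n (u' k r - w' l) \<le> n (u' k r - u' k l) + n (u' k l - w' l)" by (rule normed_triangle_mid[OF V mm(3,4,2)])
      moreover have "n (w' r - u' k r) = n (u' k r - w' r)" by (rule normed_commute[OF V mm(1,3)])
      ultimately show ?case using elim close[OF l, of k] close[OF elim(2), of k] k by linarith
    qed
  qed
qed

section \<open>Tame estimates\<close>

lemma (in banach_scale) normed_X: "0 \<le> s \<Longrightarrow> normed_on (X s) (nrm s)"
  using banach by (simp add: banach_on_def)

lemma (in banach_scale) X_mono: "u \<in> X s' \<Longrightarrow> 0 \<le> s \<Longrightarrow> s \<le> s' \<Longrightarrow> u \<in> X s"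
  using X_antimono by blast

context tame_family
begin

definition VV :: "(real \<times> 'a) set" where
  "VV = UNIV \<times> X (s0 + \<nu>)"

definition pn :: "real \<times> 'a \<Rightarrow> real" where
  "pn = (\<lambda>(l, u). \<bar>l\<bar> + nrm (s0 + \<nu>) u)"

definition FF :: "real \<Rightarrow> real \<times> 'a \<Rightarrow> 'a" where
  "FF \<epsilon> = (\<lambda>(l, u). F \<epsilon> l u)"

definition DD :: "(real \<times> 'a) set" where
  "DD = J \<times> X (s0 + \<nu>)"

lemma s0\<nu>: "0 \<le> s0 + \<nu>"
  using s0_nonneg \<nu>_pos by simp

lemma pn_pair [simp]: "pn (l, u) = \<bar>l\<bar> + nrm (s0 + \<nu>) u"
  by (simp add: pn_def)

lemma VV_pair [simp]: "(l, u) \<in> VV \<longleftrightarrow> u \<in> X (s0 + \<nu>)"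
  by (simp add: VV_def)

lemma DD_pair [simp]: "(l, u) \<in> DD \<longleftrightarrow> l \<in> J \<and> u \<in> X (s0 + \<nu>)"
  by (simp add: DD_def)

lemma FF_pair [simp]: "FF \<epsilon> (l, u) = F \<epsilon> l u"
  by (simp add: FF_def)

lemma normed_VV: "normed_on VV pn"
proof -
  note N = normed_X[OF s0\<nu>]
  have "subspace VV"
    unfolding VV_def by (intro subspace_Times subspace_UNIV normed_subspace[OF N])
  moreover have "\<forall>x\<in>VV. 0 \<le> pn x \<and> (pn x = 0 \<longleftrightarrow> x = 0)"
    using normed_nonneg[OF N] normed_eq_0[OF N]
    by (auto simp: zero_prod_def add_nonneg_eq_0_iff)
  moreover have "\<forall>c. \<forall>x\<in>VV. pn (c *\<^sub>R x) = \<bar>c\<bar> * pn x"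
    using normed_scale[OF N] by (auto simp: abs_mult algebra_simps)
  moreover have "\<forall>x\<in>VV. \<forall>y\<in>VV. pn (x + y) \<le> pn x + pn y"
  proof (intro ballI)
    fix x y assume xy: "x \<in> VV" "y \<in> VV"
    then show "pn (x + y) \<le> pn x + pn y"
      using normed_triangle[OF N, of "snd x" "snd y"] abs_triangle_ineq[of "fst x" "fst y"]
      by (cases x; cases y) auto
  qed
  ultimately show ?thesis by (simp add: normed_on_def)
qed

lemma DD_subset: "DD \<subseteq> VV"
  by (auto simp: DD_def VV_def)

text \<open>A nondegenerate interval has no isolated points. So there are points
  \<open>t \<noteq> l\<close> of \<open>J\<close> arbitrarily close to \<open>l\<close> at which a
  derivative can be read off from its remainder estimate.\<close>

lemma islimpt_J:
  assumes "l \<in> J"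
  shows "at l within J \<noteq> bot"
proof -
  have "J \<noteq> {x}" for x using J_nondegenerate by auto
  then show ?thesis
    using connected_imp_perfect[of J l] J_interval assms
    by (simp add: is_interval_connected trivial_limit_within)
qed

context
  fixes \<epsilon> :: real
  assumes \<epsilon>: "0 \<le> \<epsilon>" "\<epsilon> < \<epsilon>s"
begin

lemma C2_FF: "C2_on VV pn (X s0) (nrm s0) DD (FF \<epsilon>) (DF \<epsilon>) (D2F \<epsilon>)"
  using C2[OF \<epsilon>] by (simp add: VV_def pn_def DD_def FF_def)

lemma FF_mem: "p \<in> DD \<Longrightarrow> FF \<epsilon> p \<in> X s0"
  and DF_linear: "p \<in> DD \<Longrightarrow> bounded_linear_on VV pn (X s0) (nrm s0) (DF \<epsilon> p)"
  and D2F_bilinear: "p \<in> DD \<Longrightarrow> bounded_bilinear_on VV pn (X s0) (nrm s0) (D2F \<epsilon> p)"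
  and FF_fderiv: "p \<in> DD \<Longrightarrow> fderiv_on pn (nrm s0) DD (FF \<epsilon>) (DF \<epsilon> p) p"
  using C2_FF unfolding C2_on_def fderiv_on_def by blast+

lemma D2F_linear_right: "p \<in> DD \<Longrightarrow> k \<in> VV \<Longrightarrow> bounded_linear_on VV pn (X s0) (nrm s0) (D2F \<epsilon> p k)"
  and D2F_linear_left: "p \<in> DD \<Longrightarrow> h \<in> VV \<Longrightarrow> bounded_linear_on VV pn (X s0) (nrm s0) (\<lambda>k. D2F \<epsilon> p k h)"
  using D2F_bilinear unfolding bounded_bilinear_on_def by blast+

lemma DF_diff_bound:
  assumes "p \<in> DD" "e > 0"
  shows "\<exists>d>0. \<forall>q\<in>DD. pn (q - p) < d \<longrightarrow>
     (\<forall>h\<in>VV. nrm s0 (DF \<epsilon> q h - DF \<epsilon> p h - D2F \<epsilon> p (q - p) h) \<le> e * pn (q - p) * pn h)"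
  using C2_FF assms unfolding C2_on_def by blast

lemma DF_fderiv:
  assumes p: "p \<in> DD" and h: "h \<in> VV"
  shows "fderiv_on pn (nrm s0) DD (\<lambda>q. DF \<epsilon> q h) (\<lambda>k. D2F \<epsilon> p k h) p"
  unfolding fderiv_on_def
proof (intro allI impI)
  fix e :: real assume e: "e > 0"
  have nh: "pn h \<ge> 0" by (rule normed_nonneg[OF normed_VV h])
  then have "e / (pn h + 1) > 0" using e by simp
  from DF_diff_bound[OF p this] obtain d where d: "d > 0"
    "\<And>q. q \<in> DD \<Longrightarrow> pn (q - p) < d \<Longrightarrow>
      nrm s0 (DF \<epsilon> q h - DF \<epsilon> p h - D2F \<epsilon> p (q - p) h) \<le> e / (pn h + 1) * pn (q - p) * pn h"
    using h by blast
  have "nrm s0 (DF \<epsilon> q h - DF \<epsilon> p h - D2F \<epsilon> p (q - p) h) \<le> e * pn (q - p)"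
    if q: "q \<in> DD" "pn (q - p) < d" for q
  proof -
    have "pn (q - p) \<ge> 0"
      using q p DD_subset by (intro normed_nonneg[OF normed_VV] normed_mem[OF normed_VV]) auto
    then have "e * pn (q - p) * (pn h / (pn h + 1)) \<le> e * pn (q - p) * 1"
      using e nh by (intro mult_left_mono) auto
    then show ?thesis using d(2)[OF q] by (simp add: mult_ac)
  qed
  with d(1) show "\<exists>d>0. \<forall>q\<in>DD. pn (q - p) < d \<longrightarrow>
    nrm s0 (DF \<epsilon> q h - DF \<epsilon> p h - D2F \<epsilon> p (q - p) h) \<le> e * pn (q - p)" by blast
qed

text \<open>The definition of the second derivative, used with error 1, bounds the increment of
  \<open>DF\<close> by a multiple of \<open>pn (q - p)\<close>, uniformly in the direction
  \<open>h\<close>.\<close>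

lemma DF_continuous:
  assumes p: "p \<in> DD" and e: "e > 0"
  shows "\<exists>d>0. \<forall>q\<in>DD. pn (q - p) < d \<longrightarrow> (\<forall>h\<in>VV. nrm s0 (DF \<epsilon> q h - DF \<epsilon> p h) \<le> e * pn h)"
proof -
  obtain K where K: "\<And>x y. x \<in> VV \<Longrightarrow> y \<in> VV \<Longrightarrow> nrm s0 (D2F \<epsilon> p x y) \<le> K * pn x * pn y"
    using D2F_bilinear[OF p] unfolding bounded_bilinear_on_def by blast
  obtain d where d: "d > 0" "\<And>q h. q \<in> DD \<Longrightarrow> pn (q - p) < d \<Longrightarrow> h \<in> VV \<Longrightarrow>
      nrm s0 (DF \<epsilon> q h - DF \<epsilon> p h - D2F \<epsilon> p (q - p) h) \<le> 1 * pn (q - p) * pn h"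
    using DF_diff_bound[OF p zero_less_one] by blast
  define d' where "d' = min d (e / (1 + \<bar>K\<bar>))"
  have d': "d' > 0" using d e by (simp add: d'_def)
  have "nrm s0 (DF \<epsilon> q h - DF \<epsilon> p h) \<le> e * pn h" if q: "q \<in> DD" "pn (q - p) < d'" and h: "h \<in> VV" for q h
  proof -
    note N0 = normed_X[OF s0_nonneg]
    have qp: "q - p \<in> VV" using q p DD_subset by (intro normed_mem[OF normed_VV]) auto
    have nn: "pn h \<ge> 0" "pn (q - p) \<ge> 0" using h qp by (auto intro: normed_nonneg[OF normed_VV])
    have "nrm s0 (DF \<epsilon> q h - DF \<epsilon> p h) \<le> nrm s0 (D2F \<epsilon> p (q - p) h)
        + nrm s0 (DF \<epsilon> q h - DF \<epsilon> p h - D2F \<epsilon> p (q - p) h)"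
      by (intro normed_le_add_diff[OF N0] normed_mem[OF N0] bounded_linear_on_mem[OF DF_linear]
          bounded_linear_on_mem[OF D2F_linear_right] p q h qp)
    also have "\<dots> \<le> K * pn (q - p) * pn h + 1 * pn (q - p) * pn h"
      by (intro add_mono K d h qp q) (use q in \<open>auto simp: d'_def\<close>)
    also have "\<dots> = (1 + K) * pn (q - p) * pn h" by (simp add: algebra_simps)
    also have "\<dots> \<le> (1 + \<bar>K\<bar>) * (e / (1 + \<bar>K\<bar>)) * pn h"
      by (intro mult_right_mono mult_mono) (use nn q in \<open>auto simp: d'_def\<close>)
    also have "\<dots> = e * pn h" by simp
    finally show ?thesis .
  qed
  with d' show ?thesis by blast
qed

section \<open>Increments of \<open>F\<close> and of its derivatives after a smoothing
  operator\<close>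

context
  fixes T :: "'a \<Rightarrow> 'a" and r :: real
  assumes r: "0 \<le> r" and T: "bounded_linear_on (X s0) (nrm s0) (X r) (nrm r) T"
begin

lemma T_FF_mem: "p \<in> DD \<Longrightarrow> T (FF \<epsilon> p) \<in> X r"
  and T_DF_mem: "p \<in> DD \<Longrightarrow> h \<in> VV \<Longrightarrow> T (DF \<epsilon> p h) \<in> X r"
  and T_D2F_mem: "p \<in> DD \<Longrightarrow> k \<in> VV \<Longrightarrow> h \<in> VV \<Longrightarrow> T (D2F \<epsilon> p k h) \<in> X r"
  by (meson FF_mem DF_linear D2F_linear_right bounded_linear_on_mem T)+

lemma nderiv_T_FF:
  assumes c: "nderiv pn c c' t I" and cD: "\<And>\<theta>. \<theta> \<in> insert t I \<Longrightarrow> c \<theta> \<in> DD" and c': "c' \<in> VV"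
  shows "nderiv (nrm r) (\<lambda>\<theta>. T (FF \<epsilon> (c \<theta>))) (T (DF \<epsilon> (c t) c')) t I"
proof (rule nderiv_bounded_linear[OF normed_X[OF s0_nonneg] T])
  have ct: "c t \<in> DD" using cD by simp
  show "nderiv (nrm s0) (\<lambda>\<theta>. FF \<epsilon> (c \<theta>)) (DF \<epsilon> (c t) c') t I"
    by (rule nderiv_chain[OF normed_VV normed_X[OF s0_nonneg] FF_fderiv[OF ct] DF_linear[OF ct] FF_mem c _ c'])
       (use cD DD_subset in auto)
  show "\<theta> \<in> insert t I \<Longrightarrow> FF \<epsilon> (c \<theta>) \<in> X s0" for \<theta> using cD FF_mem by blast
  show "DF \<epsilon> (c t) c' \<in> X s0" by (rule bounded_linear_on_mem[OF DF_linear[OF ct] c'])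
qed

lemma nderiv_T_DF:
  assumes c: "nderiv pn c c' t I" and cD: "\<And>\<theta>. \<theta> \<in> insert t I \<Longrightarrow> c \<theta> \<in> DD" and c': "c' \<in> VV" and h: "h \<in> VV"
  shows "nderiv (nrm r) (\<lambda>\<theta>. T (DF \<epsilon> (c \<theta>) h)) (T (D2F \<epsilon> (c t) c' h)) t I"
proof (rule nderiv_bounded_linear[OF normed_X[OF s0_nonneg] T])
  have ct: "c t \<in> DD" using cD by simp
  have mem: "q \<in> DD \<Longrightarrow> DF \<epsilon> q h \<in> X s0" for q by (rule bounded_linear_on_mem[OF DF_linear h])
  show "nderiv (nrm s0) (\<lambda>\<theta>. DF \<epsilon> (c \<theta>) h) (D2F \<epsilon> (c t) c' h) t I"
    by (rule nderiv_chain[OF normed_VV normed_X[OF s0_nonneg] DF_fderiv[OF ct h]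
          D2F_linear_left[OF ct h] mem c _ c'])
       (use cD DD_subset in auto)
  show "\<theta> \<in> insert t I \<Longrightarrow> DF \<epsilon> (c \<theta>) h \<in> X s0" for \<theta> using cD mem by blast
  show "D2F \<epsilon> (c t) c' h \<in> X s0" by (rule bounded_linear_on_mem[OF D2F_linear_left[OF ct h] c'])
qed

text \<open>Mean value theorem along the segment from \<open>u\<close> to \<open>u + h\<close>. The
  vector \<open>z\<close> is subtracted so that the lemma serves both for plain increments, with
  \<open>z = 0\<close>, and for the error of a linear approximation, with \<open>z\<close> the image
  of \<open>h\<close> under a frozen operator.\<close>

lemma T_F_diff:
  assumes l: "l \<in> J" and u: "u \<in> X (s0 + \<nu>)" and h: "h \<in> X (s0 + \<nu>)" and z: "z \<in> X r" and B: "B \<ge> 0"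
    and bound: "\<And>t. t \<in> {0..1} \<Longrightarrow> nrm r (T (DF \<epsilon> (l, u + t *\<^sub>R h) (0, h)) - z) \<le> B"
  shows "nrm r (T (F \<epsilon> l (u + h)) - T (F \<epsilon> l u) - z) \<le> B"
proof -
  note Nr = normed_X[OF r] and N = normed_X[OF s0\<nu>]
  define c where "c t = (l, u) + t *\<^sub>R (0 :: real, h)" for t
  have c_eq: "c t = (l, u + t *\<^sub>R h)" for t by (simp add: c_def)
  have cD: "c t \<in> DD" for t by (simp add: c_eq l normed_mem[OF N] u h)
  have h': "(0, h) \<in> VV" using h by simp
  define g where "g t = T (FF \<epsilon> (c t)) + (0 + t *\<^sub>R (- z))" for t
  define g' where "g' t = T (DF \<epsilon> (c t) (0, h)) + (- z)" for t
  have "nrm r (g 1 - g 0) \<le> B * (1 - 0)"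
  proof (rule mean_value_normed[OF Nr _ B, of 0 1 g g'])
    fix t :: real assume t: "t \<in> {0..1}"
    have "nderiv (nrm r) g (g' t) t {0..1}"
      unfolding g_def g'_def
    proof (rule nderiv_add[OF Nr])
      show "nderiv (nrm r) (\<lambda>r. T (FF \<epsilon> (c r))) (T (DF \<epsilon> (c t) (0, h))) t {0..1}"
        by (rule nderiv_T_FF[OF _ cD h']) (unfold c_def, rule nderiv_affine[OF normed_VV])
      show "nderiv (nrm r) (\<lambda>r. 0 + r *\<^sub>R - z) (- z) t {0..1}" by (rule nderiv_affine[OF Nr])
    qed (use z T_FF_mem[OF cD] T_DF_mem[OF cD h'] in \<open>auto intro!: normed_mem[OF Nr]\<close>)
    moreover have "g t \<in> X r" "g' t \<in> X r"
      unfolding g_def g'_def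
      by (intro normed_mem[OF Nr] T_FF_mem[OF cD] T_DF_mem[OF cD h'] z)+
    moreover have "nrm r (g' t) \<le> B" using bound[OF t] by (simp add: g'_def c_eq)
    ultimately show "g t \<in> X r \<and> g' t \<in> X r \<and> nrm r (g' t) \<le> B \<and> nderiv (nrm r) g (g' t) t {0..1}"
      by blast
  qed simp
  moreover have "g 1 - g 0 = T (F \<epsilon> l (u + h)) - T (F \<epsilon> l u) - z" by (simp add: g_def c_eq)
  ultimately show ?thesis by simp
qed

lemma T_DF_diff:
  assumes l: "l \<in> J" and u: "u \<in> X (s0 + \<nu>)" and h: "h \<in> X (s0 + \<nu>)" and v: "v \<in> X (s0 + \<nu>)" and B: "B \<ge> 0"
    and bound: "\<And>t. t \<in> {0..1} \<Longrightarrow> nrm r (T (D2F \<epsilon> (l, u + t *\<^sub>R h) (0, h) (0, v))) \<le> B"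
  shows "nrm r (T (DF \<epsilon> (l, u + h) (0, v)) - T (DF \<epsilon> (l, u) (0, v))) \<le> B"
proof -
  note Nr = normed_X[OF r] and N = normed_X[OF s0\<nu>]
  define c where "c t = (l, u) + t *\<^sub>R (0 :: real, h)" for t
  have c_eq: "c t = (l, u + t *\<^sub>R h)" for t by (simp add: c_def)
  have cD: "c t \<in> DD" for t by (simp add: c_eq l normed_mem[OF N] u h)
  have h': "(0, h) \<in> VV" and v': "(0, v) \<in> VV" using h v by simp_all
  define g where "g t = T (DF \<epsilon> (c t) (0, v))" for t
  define g' where "g' t = T (D2F \<epsilon> (c t) (0, h) (0, v))" for t
  have "nrm r (g 1 - g 0) \<le> B * (1 - 0)"
  proof (rule mean_value_normed[OF Nr _ B, of 0 1 g g'])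
    fix t :: real assume t: "t \<in> {0..1}"
    have "nderiv (nrm r) g (g' t) t {0..1}"
      unfolding g_def g'_def
      by (rule nderiv_T_DF[OF _ cD h' v']) (unfold c_def, rule nderiv_affine[OF normed_VV])
    moreover have "g t \<in> X r" "g' t \<in> X r"
      unfolding g_def g'_def by (intro T_DF_mem[OF cD v'] T_D2F_mem[OF cD h' v'])+
    moreover have "nrm r (g' t) \<le> B" using bound[OF t] by (simp add: g'_def c_eq)
    ultimately show "g t \<in> X r \<and> g' t \<in> X r \<and> nrm r (g' t) \<le> B \<and> nderiv (nrm r) g (g' t) t {0..1}"
      by blast
  qed simp
  then show ?thesis by (simp add: g_def c_eq)
qed

lemma T_DF_diff_param:
  assumes l: "l \<in> J" and l': "l' \<in> J" and u: "u \<in> X (s0 + \<nu>)" and v: "v \<in> X (s0 + \<nu>)" and B: "B \<ge> 0"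
    and bound: "\<And>t. t \<in> J \<Longrightarrow> nrm r (T (D2F \<epsilon> (t, u) (1, 0) (0, v))) \<le> B"
  shows "nrm r (T (DF \<epsilon> (l', u) (0, v)) - T (DF \<epsilon> (l, u) (0, v))) \<le> B * \<bar>l' - l\<bar>"
proof -
  note Nr = normed_X[OF r] and N = normed_X[OF s0\<nu>]
  have e1: "(1, 0) \<in> VV" and v': "(0, v) \<in> VV" using v normed_mem[OF N] by simp_all
  show ?thesis
  proof (rule curve_lipschitz[OF Nr J_interval B l l'])
    fix t assume t: "t \<in> J"
    define c where "c t = (0, u) + t *\<^sub>R (1 :: real, 0 :: 'a)" for t
    have c_eq: "c t = (t, u)" for t by (simp add: c_def)
    have cD: "s \<in> insert t J \<Longrightarrow> c s \<in> DD" for s using t by (auto simp: c_eq u)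
    have "nderiv (nrm r) (\<lambda>\<theta>. T (DF \<epsilon> (c \<theta>) (0, v))) (T (D2F \<epsilon> (c t) (1, 0) (0, v))) t J"
      by (rule nderiv_T_DF[OF _ cD e1 v']) (unfold c_def, rule nderiv_affine[OF normed_VV])
    then have "nderiv (nrm r) (\<lambda>t. T (DF \<epsilon> (t, u) (0, v))) (T (D2F \<epsilon> (t, u) (1, 0) (0, v))) t J"
      by (simp add: c_eq)
    moreover have "(t, u) \<in> DD" using t u by simp
    ultimately show "T (DF \<epsilon> (t, u) (0, v)) \<in> X r \<and> T (D2F \<epsilon> (t, u) (1, 0) (0, v)) \<in> X r \<and>
      nrm r (T (D2F \<epsilon> (t, u) (1, 0) (0, v))) \<le> B \<and>
      nderiv (nrm r) (\<lambda>t. T (DF \<epsilon> (t, u) (0, v))) (T (D2F \<epsilon> (t, u) (1, 0) (0, v))) t J"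
      using bound[OF t] T_DF_mem[OF _ v'] T_D2F_mem[OF _ e1 v'] by blast
  qed
qed

text \<open>
  Only the mixed derivative in the order \<open>\<partial>\<^sub>\<lambda> D\<^sub>u F\<close> is controlled, so the increment of \<open>\<partial>\<^sub>\<lambda> F\<close> in
  \<open>u\<close> is estimated as the \<open>\<lambda>\<close>-derivative of an increment of \<open>F\<close> in \<open>u\<close>; no symmetry of the second
  derivative is needed.
\<close>

lemma T_DF_param_diff:
  assumes l: "l \<in> J" and u: "u \<in> X (s0 + \<nu>)" and h: "h \<in> X (s0 + \<nu>)" and B: "B \<ge> 0"
    and bound: "\<And>t \<theta>. t \<in> J \<Longrightarrow> \<theta> \<in> {0..1} \<Longrightarrow> nrm r (T (D2F \<epsilon> (t, u + \<theta> *\<^sub>R h) (1, 0) (0, h))) \<le> B"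
  shows "nrm r (T (DF \<epsilon> (l, u + h) (1, 0)) - T (DF \<epsilon> (l, u) (1, 0))) \<le> B"
proof -
  note Nr = normed_X[OF r] and N = normed_X[OF s0\<nu>]
  have e1: "(1, 0) \<in> VV" and h': "(0, h) \<in> VV" using h normed_mem[OF N] by simp_all
  define g where "g t = T (F \<epsilon> t (u + h)) + (-1) *\<^sub>R T (F \<epsilon> t u)" for t
  define g' where "g' = T (DF \<epsilon> (l, u + h) (1, 0)) + (-1) *\<^sub>R T (DF \<epsilon> (l, u) (1, 0))"
  have FT: "T (F \<epsilon> t w) \<in> X r" if "t \<in> J" "w \<in> X (s0 + \<nu>)" for t w
    using T_FF_mem[of "(t, w)"] that by simp
  have DT: "T (DF \<epsilon> (t, w) k) \<in> X r" if "t \<in> J" "w \<in> X (s0 + \<nu>)" "k \<in> VV" for t w k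
    using T_DF_mem[of "(t, w)" k] that by simp
  have uh: "u + \<theta> *\<^sub>R h \<in> X (s0 + \<nu>)" for \<theta> by (intro normed_mem[OF N] u h)
  have uh1: "u + h \<in> X (s0 + \<nu>)" by (intro normed_mem[OF N] u h)
  have der: "nderiv (nrm r) (\<lambda>t. T (F \<epsilon> t w)) (T (DF \<epsilon> (l, w) (1, 0))) l J" if w: "w \<in> X (s0 + \<nu>)" for w
  proof -
    define c where "c t = (0, w) + t *\<^sub>R (1 :: real, 0 :: 'a)" for t
    have c_eq: "c t = (t, w)" for t by (simp add: c_def)
    have cD: "s \<in> insert l J \<Longrightarrow> c s \<in> DD" for s using l w by (auto simp: c_eq)
    have "nderiv (nrm r) (\<lambda>\<theta>. T (FF \<epsilon> (c \<theta>))) (T (DF \<epsilon> (c l) (1, 0))) l J"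
      by (rule nderiv_T_FF[OF _ cD e1]) (unfold c_def, rule nderiv_affine[OF normed_VV])
    then show ?thesis by (simp add: c_eq)
  qed
  have gd: "nderiv (nrm r) g g' l J"
    unfolding g_def g'_def
    by (intro nderiv_add[OF Nr] nderiv_cmul[OF Nr] der uh1 u normed_mem[OF Nr] conjI)
       (use l FT DT uh1 u e1 in \<open>auto intro!: normed_mem[OF Nr]\<close>)
  have gmem: "g t \<in> X r" if "t \<in> J" for t
    unfolding g_def by (intro normed_mem[OF Nr] FT that uh1 u)
  have g'mem: "g' \<in> X r" unfolding g'_def by (intro normed_mem[OF Nr] DT l uh1 u e1)
  \<comment> \<open>An increment of \<open>g\<close> in \<open>t\<close> is also an increment in
    \<open>\<theta>\<close>, along the segment, of the difference of \<open>F\<close> at the two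
    parameters. Its derivative in \<open>\<theta>\<close> is an increment of the differential in the
    parameter, which \<open>T_DF_diff_param\<close> bounds.\<close>
  have lip: "nrm r (g t - g l) \<le> B * \<bar>t - l\<bar>" if t: "t \<in> J" for t
  proof -
    define \<phi> where "\<phi> \<theta> = T (F \<epsilon> t (u + \<theta> *\<^sub>R h)) + (-1) *\<^sub>R T (F \<epsilon> l (u + \<theta> *\<^sub>R h))" for \<theta>
    define \<phi>' where "\<phi>' \<theta> = T (DF \<epsilon> (t, u + \<theta> *\<^sub>R h) (0, h)) + (-1) *\<^sub>R T (DF \<epsilon> (l, u + \<theta> *\<^sub>R h) (0, h))" for \<theta>
    have der2: "nderiv (nrm r) (\<lambda>\<theta>. T (F \<epsilon> s (u + \<theta> *\<^sub>R h))) (T (DF \<epsilon> (s, u + \<theta> *\<^sub>R h) (0, h))) \<theta> {0..1}"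
      if s: "s \<in> J" for s \<theta>
    proof -
      define c where "c t = (s, u) + t *\<^sub>R (0 :: real, h)" for t
      have c_eq: "c t = (s, u + t *\<^sub>R h)" for t by (simp add: c_def)
      have cD: "c t \<in> DD" for t using s uh by (simp add: c_eq)
      have "nderiv (nrm r) (\<lambda>\<theta>. T (FF \<epsilon> (c \<theta>))) (T (DF \<epsilon> (c \<theta>) (0, h))) \<theta> {0..1}"
        by (rule nderiv_T_FF[OF _ cD h']) (unfold c_def, rule nderiv_affine[OF normed_VV])
      then show ?thesis by (simp add: c_eq)
    qed
    have "nrm r (\<phi> 1 - \<phi> 0) \<le> (B * \<bar>t - l\<bar>) * (1 - 0)"
    proof (rule mean_value_normed[OF Nr, of 0 1 _ \<phi> \<phi>'])
      fix \<theta> :: real assume \<theta>: "\<theta> \<in> {0..1}"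
      have "nderiv (nrm r) \<phi> (\<phi>' \<theta>) \<theta> {0..1}"
        unfolding \<phi>_def \<phi>'_def
        by (intro nderiv_add[OF Nr] nderiv_cmul[OF Nr] der2 t l conjI normed_mem[OF Nr])
           (use l t FT DT uh h' in \<open>auto intro!: normed_mem[OF Nr]\<close>)
      moreover have "\<phi> \<theta> \<in> X r" "\<phi>' \<theta> \<in> X r"
        unfolding \<phi>_def \<phi>'_def by (intro normed_mem[OF Nr] FT DT uh t l h')+
      moreover have "nrm r (\<phi>' \<theta>) \<le> B * \<bar>t - l\<bar>"
        using T_DF_diff_param[OF l t uh h B bound[OF _ \<theta>]] by (simp add: \<phi>'_def)
      ultimately show "\<phi> \<theta> \<in> X r \<and> \<phi>' \<theta> \<in> X r \<and> nrm r (\<phi>' \<theta>) \<le> B * \<bar>t - l\<bar> \<and>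
          nderiv (nrm r) \<phi> (\<phi>' \<theta>) \<theta> {0..1}" by blast
    qed (use B in auto)
    moreover have "\<phi> 1 - \<phi> 0 = g t - g l" by (simp add: \<phi>_def g_def)
    ultimately show ?thesis by simp
  qed
  have "nrm r g' \<le> B"
  proof (rule field_le_epsilon)
    fix e :: real assume e: "e > 0"
    have ev: "\<forall>\<^sub>F t in at l within J. t \<in> J \<and> t \<noteq> l" by (simp add: eventually_at_filter)
    from eventually_happens[OF eventually_conj[OF nderivD[OF gd e] ev]] islimpt_J[OF l]
    obtain t where t: "nrm r (g t - g l - (t - l) *\<^sub>R g') \<le> e * \<bar>t - l\<bar>" "t \<in> J" "t \<noteq> l" by blast
    have m: "g t \<in> X r" "g l \<in> X r" using gmem t l by auto
    have "\<bar>t - l\<bar> * nrm r g' = nrm r ((t - l) *\<^sub>R g')" by (rule normed_scale[OF Nr g'mem, symmetric])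
    also have "\<dots> \<le> nrm r (g t - g l) + nrm r ((t - l) *\<^sub>R g' - (g t - g l))"
      by (intro normed_le_add_diff[OF Nr] normed_mem[OF Nr] m g'mem)
    also have "nrm r ((t - l) *\<^sub>R g' - (g t - g l)) = nrm r (g t - g l - (t - l) *\<^sub>R g')"
      by (intro normed_commute[OF Nr] normed_mem[OF Nr] m g'mem)
    finally have "\<bar>t - l\<bar> * nrm r g' \<le> \<bar>t - l\<bar> * (B + e)"
      using t(1) lip[OF t(2)] by (simp add: algebra_simps)
    then show "nrm r g' \<le> B + e" using t(3) by simp
  qed
  then show ?thesis by (simp add: g'_def)
qed

end

end

section \<open>Tame bounds at one level of the scale\<close>

definition tame_at :: "real \<Rightarrow> real \<Rightarrow> bool" where
  "tame_at s K \<longleftrightarrow> s0 \<le> s \<and> 0 \<le> K \<and> (\<forall>\<epsilon>\<in>{0..<\<epsilon>s}. \<forall>l\<in>J.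
     (F \<epsilon> l 0 \<in> X s \<and> nrm s (F \<epsilon> l 0) \<le> K * \<epsilon>) \<and>
     (\<forall>h\<in>X (s + \<nu>). DF \<epsilon> (l, 0) (0, h) \<in> X s \<and> nrm s (DF \<epsilon> (l, 0) (0, h)) \<le> K * nrm (s + \<nu>) h) \<and>
     (\<forall>u\<in>X (s + \<nu>). nrm s0 u \<le> 1 \<longrightarrow>
       (DF \<epsilon> (l, u) (1, 0) \<in> X s \<and> nrm s (DF \<epsilon> (l, u) (1, 0)) \<le> K * (1 + nrm (s + \<nu>) u)) \<and>
       (\<forall>h\<in>X (s + \<nu>). \<forall>v\<in>X (s + \<nu>). D2F \<epsilon> (l, u) (0, h) (0, v) \<in> X s \<and>
          nrm s (D2F \<epsilon> (l, u) (0, h) (0, v)) \<le>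
            K * (nrm (s + \<nu>) u * nrm s0 h * nrm s0 v + nrm (s + \<nu>) h * nrm s0 v + nrm s0 h * nrm (s + \<nu>) v)) \<and>
       (\<forall>h\<in>X (s + \<nu>). D2F \<epsilon> (l, u) (1, 0) (0, h) \<in> X s \<and>
          nrm s (D2F \<epsilon> (l, u) (1, 0) (0, h)) \<le> K * (nrm (s + \<nu>) h + nrm (s + \<nu>) u * nrm s0 h))))"

text \<open>The bounds are monotone in the constant. Stating them for all large \<open>K\<close>
  allows one constant to be shared by the levels \<open>s1\<close> and \<open>S\<close>.\<close>

lemma tame_at_exists:
  assumes small: "small_at_zero X nrm s0 \<epsilon>s S' J F" and s: "s0 \<le> s" "s < S'"
  shows "\<exists>K0. \<forall>K\<ge>K0. tame_at s K"
proof -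
  have sn: "0 \<le> s + \<nu>" "0 \<le> s0" "s0 \<le> s + \<nu>" using s s0_nonneg \<nu>_pos by auto
  note nn = normed_nonneg[OF normed_X[OF sn(1)]] normed_nonneg[OF normed_X[OF sn(2)]]
  have x0: "u \<in> X (s + \<nu>) \<Longrightarrow> u \<in> X s0" for u using X_mono sn by blast
  obtain C0 where C0: "\<And>\<epsilon> l. \<epsilon> \<in> {0..<\<epsilon>s} \<Longrightarrow> l \<in> J \<Longrightarrow> F \<epsilon> l 0 \<in> X s \<and> nrm s (F \<epsilon> l 0) \<le> C0 * \<epsilon>"
    using small s unfolding small_at_zero_def by (metis atLeastLessThan_iff)
  obtain C1 where C1: "\<And>\<epsilon> l u. \<epsilon> \<in> {0..<\<epsilon>s} \<Longrightarrow> l \<in> J \<Longrightarrow> u \<in> X (s + \<nu>) \<Longrightarrow> nrm s0 u \<le> 1 \<Longrightarrow>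
      DF \<epsilon> (l, u) (1, 0) \<in> X s \<and> nrm s (DF \<epsilon> (l, u) (1, 0)) \<le> C1 * (1 + nrm (s + \<nu>) u)"
    using F1[OF s] by meson
  obtain C2 where C2: "\<And>\<epsilon> l h. \<epsilon> \<in> {0..<\<epsilon>s} \<Longrightarrow> l \<in> J \<Longrightarrow> h \<in> X (s + \<nu>) \<Longrightarrow>
      DF \<epsilon> (l, 0) (0, h) \<in> X s \<and> nrm s (DF \<epsilon> (l, 0) (0, h)) \<le> C2 * nrm (s + \<nu>) h"
    using F2[OF s] by meson
  obtain C3 where C3: "\<And>\<epsilon> l u h v. \<epsilon> \<in> {0..<\<epsilon>s} \<Longrightarrow> l \<in> J \<Longrightarrow> u \<in> X (s + \<nu>) \<Longrightarrow> nrm s0 u \<le> 1 \<Longrightarrow>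
      h \<in> X (s + \<nu>) \<Longrightarrow> v \<in> X (s + \<nu>) \<Longrightarrow> D2F \<epsilon> (l, u) (0, h) (0, v) \<in> X s \<and>
          nrm s (D2F \<epsilon> (l, u) (0, h) (0, v)) \<le>
            C3 * (nrm (s + \<nu>) u * nrm s0 h * nrm s0 v + nrm (s + \<nu>) h * nrm s0 v + nrm s0 h * nrm (s + \<nu>) v)"
    using F3[OF s] by meson
  obtain C4 where C4: "\<And>\<epsilon> l u h. \<epsilon> \<in> {0..<\<epsilon>s} \<Longrightarrow> l \<in> J \<Longrightarrow> u \<in> X (s + \<nu>) \<Longrightarrow> nrm s0 u \<le> 1 \<Longrightarrow>
      h \<in> X (s + \<nu>) \<Longrightarrow> D2F \<epsilon> (l, u) (1, 0) (0, h) \<in> X s \<and>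
          nrm s (D2F \<epsilon> (l, u) (1, 0) (0, h)) \<le> C4 * (nrm (s + \<nu>) h + nrm (s + \<nu>) u * nrm s0 h)"
    using F4[OF s] by meson
  have "tame_at s K" if "\<bar>C0\<bar> + \<bar>C1\<bar> + \<bar>C2\<bar> + \<bar>C3\<bar> + \<bar>C4\<bar> \<le> K" for K
  proof -
  have K: "C0 \<le> K" "C1 \<le> K" "C2 \<le> K" "C3 \<le> K" "C4 \<le> K" "0 \<le> K" using that by auto
  have up: "y \<in> X s \<and> nrm s y \<le> C * x \<Longrightarrow> C \<le> K \<Longrightarrow> 0 \<le> x \<Longrightarrow> y \<in> X s \<and> nrm s y \<le> K * x" for y C x
    by (meson mult_right_mono order_trans)
  show "tame_at s K"
    unfolding tame_at_def
  proof (intro conjI ballI impI)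
    fix \<epsilon> l assume el: "\<epsilon> \<in> {0..<\<epsilon>s}" "l \<in> J"
    have a: "F \<epsilon> l 0 \<in> X s \<and> nrm s (F \<epsilon> l 0) \<le> K * \<epsilon>"
      by (rule up[OF C0[OF el] K(1)]) (use el in auto)
    then show "F \<epsilon> l 0 \<in> X s" "nrm s (F \<epsilon> l 0) \<le> K * \<epsilon>" by auto
    fix h assume h: "h \<in> X (s + \<nu>)"
    have c: "DF \<epsilon> (l, 0) (0, h) \<in> X s \<and> nrm s (DF \<epsilon> (l, 0) (0, h)) \<le> K * nrm (s + \<nu>) h"
      by (rule up[OF C2[OF el h] K(3)]) (rule nn(1)[OF h])
    then show "DF \<epsilon> (l, 0) (0, h) \<in> X s" "nrm s (DF \<epsilon> (l, 0) (0, h)) \<le> K * nrm (s + \<nu>) h" by auto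
  next
    fix \<epsilon> l u assume elu: "\<epsilon> \<in> {0..<\<epsilon>s}" "l \<in> J" "u \<in> X (s + \<nu>)" "nrm s0 u \<le> 1"
    have c: "DF \<epsilon> (l, u) (1, 0) \<in> X s \<and> nrm s (DF \<epsilon> (l, u) (1, 0)) \<le> K * (1 + nrm (s + \<nu>) u)"
      by (rule up[OF C1[OF elu] K(2)]) (use nn(1)[OF elu(3)] in simp)
    then show "DF \<epsilon> (l, u) (1, 0) \<in> X s" "nrm s (DF \<epsilon> (l, u) (1, 0)) \<le> K * (1 + nrm (s + \<nu>) u)" by auto
    fix h assume h: "h \<in> X (s + \<nu>)"
    note pos = nn(1)[OF h] nn(2)[OF x0[OF h]] nn(1)[OF elu(3)]
    have d: "D2F \<epsilon> (l, u) (1, 0) (0, h) \<in> X s \<and>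
          nrm s (D2F \<epsilon> (l, u) (1, 0) (0, h)) \<le> K * (nrm (s + \<nu>) h + nrm (s + \<nu>) u * nrm s0 h)"
      by (rule up[OF C4[OF elu h] K(5)]) (intro add_nonneg_nonneg mult_nonneg_nonneg pos)
    then show "D2F \<epsilon> (l, u) (1, 0) (0, h) \<in> X s"
      "nrm s (D2F \<epsilon> (l, u) (1, 0) (0, h)) \<le> K * (nrm (s + \<nu>) h + nrm (s + \<nu>) u * nrm s0 h)" by auto
    fix v assume v: "v \<in> X (s + \<nu>)"
    have d: "D2F \<epsilon> (l, u) (0, h) (0, v) \<in> X s \<and> nrm s (D2F \<epsilon> (l, u) (0, h) (0, v)) \<le>
       K * (nrm (s + \<nu>) u * nrm s0 h * nrm s0 v + nrm (s + \<nu>) h * nrm s0 v + nrm s0 h * nrm (s + \<nu>) v)"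
      by (rule up[OF C3[OF elu h v] K(4)])
         (intro add_nonneg_nonneg mult_nonneg_nonneg pos nn(1)[OF v] nn(2)[OF x0[OF v]])
    then show "D2F \<epsilon> (l, u) (0, h) (0, v) \<in> X s" "nrm s (D2F \<epsilon> (l, u) (0, h) (0, v)) \<le>
       K * (nrm (s + \<nu>) u * nrm s0 h * nrm s0 v + nrm (s + \<nu>) h * nrm s0 v + nrm s0 h * nrm (s + \<nu>) v)"
      by auto
  qed (use K s in auto)
  qed
  then show ?thesis by blast
qed

lemma
  assumes tame: "tame_at s K" and \<epsilon>: "0 \<le> \<epsilon>" "\<epsilon> < \<epsilon>s" and l: "l \<in> J"
  shows tame_at_F: "F \<epsilon> l 0 \<in> X s \<and> nrm s (F \<epsilon> l 0) \<le> K * \<epsilon>"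
    and tame_at_DF: "h \<in> X (s + \<nu>) \<Longrightarrow>
      DF \<epsilon> (l, 0) (0, h) \<in> X s \<and> nrm s (DF \<epsilon> (l, 0) (0, h)) \<le> K * nrm (s + \<nu>) h"
    and tame_at_param: "u \<in> X (s + \<nu>) \<Longrightarrow> nrm s0 u \<le> 1 \<Longrightarrow>
      DF \<epsilon> (l, u) (1, 0) \<in> X s \<and> nrm s (DF \<epsilon> (l, u) (1, 0)) \<le> K * (1 + nrm (s + \<nu>) u)"
    and tame_at_D2F: "u \<in> X (s + \<nu>) \<Longrightarrow> nrm s0 u \<le> 1 \<Longrightarrow> h \<in> X (s + \<nu>) \<Longrightarrow> v \<in> X (s + \<nu>) \<Longrightarrow>
      D2F \<epsilon> (l, u) (0, h) (0, v) \<in> X s \<and> nrm s (D2F \<epsilon> (l, u) (0, h) (0, v)) \<le>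
        K * (nrm (s + \<nu>) u * nrm s0 h * nrm s0 v + nrm (s + \<nu>) h * nrm s0 v + nrm s0 h * nrm (s + \<nu>) v)"
    and tame_at_D2F_param: "u \<in> X (s + \<nu>) \<Longrightarrow> nrm s0 u \<le> 1 \<Longrightarrow> h \<in> X (s + \<nu>) \<Longrightarrow>
      D2F \<epsilon> (l, u) (1, 0) (0, h) \<in> X s \<and>
      nrm s (D2F \<epsilon> (l, u) (1, 0) (0, h)) \<le> K * (nrm (s + \<nu>) h + nrm (s + \<nu>) u * nrm s0 h)"
proof -
  have "\<epsilon> \<in> {0..<\<epsilon>s}" using \<epsilon> by simp
  note all = tame[unfolded tame_at_def, THEN conjunct2, THEN conjunct2, THEN bspec, OF this, THEN bspec, OF l]
  from all show "F \<epsilon> l 0 \<in> X s \<and> nrm s (F \<epsilon> l 0) \<le> K * \<epsilon>" by (rule conjunct1)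
  from all show "h \<in> X (s + \<nu>) \<Longrightarrow>
      DF \<epsilon> (l, 0) (0, h) \<in> X s \<and> nrm s (DF \<epsilon> (l, 0) (0, h)) \<le> K * nrm (s + \<nu>) h" by blast
  assume u: "u \<in> X (s + \<nu>)" "nrm s0 u \<le> 1"
  note all_u = all[THEN conjunct2, THEN conjunct2, THEN bspec, OF u(1), THEN mp, OF u(2)]
  from all_u show "DF \<epsilon> (l, u) (1, 0) \<in> X s \<and> nrm s (DF \<epsilon> (l, u) (1, 0)) \<le> K * (1 + nrm (s + \<nu>) u)"
    by (rule conjunct1)
  assume h: "h \<in> X (s + \<nu>)"
  show "D2F \<epsilon> (l, u) (1, 0) (0, h) \<in> X s \<and>
      nrm s (D2F \<epsilon> (l, u) (1, 0) (0, h)) \<le> K * (nrm (s + \<nu>) h + nrm (s + \<nu>) u * nrm s0 h)"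
    by (rule all_u[THEN conjunct2, THEN conjunct2, THEN bspec, OF h])
  assume v: "v \<in> X (s + \<nu>)"
  show "D2F \<epsilon> (l, u) (0, h) (0, v) \<in> X s \<and> nrm s (D2F \<epsilon> (l, u) (0, h) (0, v)) \<le>
        K * (nrm (s + \<nu>) u * nrm s0 h * nrm s0 v + nrm (s + \<nu>) h * nrm s0 v + nrm s0 h * nrm (s + \<nu>) v)"
    by (rule all_u[THEN conjunct2, THEN conjunct1, THEN bspec, OF h, THEN bspec, OF v])
qed

context
  fixes \<epsilon> :: real and T :: "'a \<Rightarrow> 'a" and r s b K :: real
  assumes \<epsilon>: "0 \<le> \<epsilon>" "\<epsilon> < \<epsilon>s"
    and r: "0 \<le> r" and T: "bounded_linear_on (X s0) (nrm s0) (X r) (nrm r) T"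
    and tame: "tame_at s K" and b: "0 \<le> b" "\<And>y. y \<in> X s \<Longrightarrow> nrm r (T y) \<le> b * nrm s y"
begin

lemma tame_arith: "s0 \<le> s" "0 \<le> K" "0 \<le> s" "0 \<le> s + \<nu>" "s0 + \<nu> \<le> s + \<nu>" "s0 \<le> s0 + \<nu>" "s0 \<le> s + \<nu>" "0 \<le> b * K"
  using tame b s0_nonneg \<nu>_pos by (auto simp: tame_at_def)

lemma tame_X: "u \<in> X (s + \<nu>) \<Longrightarrow> u \<in> X (s0 + \<nu>)" "u \<in> X (s + \<nu>) \<Longrightarrow> u \<in> X s0"
  using X_mono s0\<nu> s0_nonneg tame_arith by blast+

text \<open>\<open>T\<close> has two bounds with different roles. Boundedness from
  \<open>X s0\<close> makes the composed maps differentiable, and its constant never shows in an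
  estimate. The factor \<open>b\<close>, the size of \<open>T\<close> as a map from
  \<open>X s\<close>, is the one that counts; for a high-frequency remainder it is a negative power
  of the scale.\<close>

lemma T_le: "y \<in> X s \<and> nrm s y \<le> K * c \<Longrightarrow> nrm r (T y) \<le> b * K * c"
  using b(2)[of y] mult_left_mono[OF _ b(1), of "nrm s y" "K * c"] by (simp add: mult.assoc)

lemma tame_mem [intro]: "u \<in> X (s + \<nu>) \<Longrightarrow> k \<in> X (s + \<nu>) \<Longrightarrow> u + \<theta> *\<^sub>R k \<in> X (s + \<nu>)"
  by (intro normed_mem[OF normed_X[OF tame_arith(4)]])

text \<open>The unit ball at \<open>s0\<close> is convex, so the smallness required in
  \<open>F3\<close> and \<open>F4\<close> persists along the segment. Its increment \<open>k\<close>
  has norm at most 2 there, which later reduces quadratic terms in \<open>k\<close> to linear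
  ones.\<close>

lemma tame_segment:
  assumes u: "u \<in> X (s + \<nu>)" "k \<in> X (s + \<nu>)" "nrm s0 u \<le> 1" "nrm s0 (u + k) \<le> 1" and \<theta>: "\<theta> \<in> {0..1}"
  shows "nrm s0 (u + \<theta> *\<^sub>R k) \<le> 1" "nrm (s + \<nu>) (u + \<theta> *\<^sub>R k) \<le> nrm (s + \<nu>) u + nrm (s + \<nu>) k"
    "nrm s0 k \<le> 2"
proof -
  note N0 = normed_X[OF s0_nonneg] and N = normed_X[OF tame_arith(4)]
  have m: "u \<in> X s0" "k \<in> X s0" using tame_X u by auto
  have "u + \<theta> *\<^sub>R k = (1 - \<theta>) *\<^sub>R u + \<theta> *\<^sub>R (u + k)" by (simp add: algebra_simps)
  also have "nrm s0 \<dots> \<le> nrm s0 ((1 - \<theta>) *\<^sub>R u) + nrm s0 (\<theta> *\<^sub>R (u + k))"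
    by (intro normed_triangle[OF N0] normed_mem[OF N0] m)
  also have "\<dots> = (1 - \<theta>) * nrm s0 u + \<theta> * nrm s0 (u + k)"
    using normed_scale[OF N0] m normed_mem[OF N0] \<theta> by simp
  also have "\<dots> \<le> (1 - \<theta>) * 1 + \<theta> * 1" using u \<theta> by (intro add_mono mult_left_mono) auto
  finally show "nrm s0 (u + \<theta> *\<^sub>R k) \<le> 1" by simp
  have "nrm (s + \<nu>) (u + \<theta> *\<^sub>R k) \<le> nrm (s + \<nu>) u + \<bar>\<theta>\<bar> * nrm (s + \<nu>) k"
    using normed_triangle[OF N u(1), of "\<theta> *\<^sub>R k"] normed_scale[OF N u(2)] normed_mem[OF N] u by simp
  moreover have "\<bar>\<theta>\<bar> * nrm (s + \<nu>) k \<le> 1 * nrm (s + \<nu>) k"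
    using \<theta> normed_nonneg[OF N u(2)] by (intro mult_right_mono) auto
  ultimately show "nrm (s + \<nu>) (u + \<theta> *\<^sub>R k) \<le> nrm (s + \<nu>) u + nrm (s + \<nu>) k" by simp
  show "nrm s0 k \<le> 2"
    using normed_diff_le[OF N0 normed_add_mem[OF N0 m] m(1)] u by simp
qed

text \<open>The second derivative is bounded along the segment. The high norm of
  \<open>u + \<theta> *\<^sub>R k\<close> produces a term quadratic in \<open>k\<close>, and
  \<open>nrm s0 k \<le> 2\<close> merges it into the linear one, whence the factor 3.\<close>

lemma tame_DF_diff:
  assumes l: "l \<in> J" and u: "u \<in> X (s + \<nu>)" "k \<in> X (s + \<nu>)" "nrm s0 u \<le> 1" "nrm s0 (u + k) \<le> 1"
    and h: "h \<in> X (s + \<nu>)"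
  shows "nrm r (T (DF \<epsilon> (l, u + k) (0, h)) - T (DF \<epsilon> (l, u) (0, h))) \<le>
    b * K * (nrm (s + \<nu>) u * nrm s0 k * nrm s0 h + 3 * nrm (s + \<nu>) k * nrm s0 h + nrm s0 k * nrm (s + \<nu>) h)"
proof -
  note nn = normed_nonneg[OF normed_X[OF s0_nonneg]] normed_nonneg[OF normed_X[OF tame_arith(4)]]
  have pos: "0 \<le> nrm s0 k" "0 \<le> nrm s0 h" "0 \<le> nrm (s + \<nu>) u" "0 \<le> nrm (s + \<nu>) k" "0 \<le> nrm (s + \<nu>) h"
    using nn tame_X u h by auto
  show ?thesis
  proof (rule T_DF_diff[OF \<epsilon> r T l])
    show "u \<in> X (s0 + \<nu>)" "k \<in> X (s0 + \<nu>)" "h \<in> X (s0 + \<nu>)" using u h tame_X by auto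
    show "0 \<le> b * K * (nrm (s + \<nu>) u * nrm s0 k * nrm s0 h + 3 * nrm (s + \<nu>) k * nrm s0 h + nrm s0 k * nrm (s + \<nu>) h)"
      using pos tame_arith(8) by (intro mult_nonneg_nonneg[OF tame_arith(8)] add_nonneg_nonneg mult_nonneg_nonneg) auto
    fix \<theta> :: real assume \<theta>: "\<theta> \<in> {0..1}"
    note seg = tame_segment[OF u \<theta>]
    let ?w = "u + \<theta> *\<^sub>R k"
    have "nrm r (T (D2F \<epsilon> (l, ?w) (0, k) (0, h))) \<le> b * K *
      (nrm (s + \<nu>) ?w * nrm s0 k * nrm s0 h + nrm (s + \<nu>) k * nrm s0 h + nrm s0 k * nrm (s + \<nu>) h)"
      by (rule T_le, rule tame_at_D2F[OF tame \<epsilon> l tame_mem[OF u(1,2)] seg(1) u(2) h])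
    also have "\<dots> \<le> b * K * (nrm (s + \<nu>) u * nrm s0 k * nrm s0 h + 3 * nrm (s + \<nu>) k * nrm s0 h + nrm s0 k * nrm (s + \<nu>) h)"
    proof (rule mult_left_mono[OF _ tame_arith(8)])
      have "nrm (s + \<nu>) ?w * (nrm s0 k * nrm s0 h) \<le> (nrm (s + \<nu>) u + nrm (s + \<nu>) k) * (nrm s0 k * nrm s0 h)"
        using seg pos by (intro mult_right_mono) auto
      moreover have "nrm s0 k * (nrm (s + \<nu>) k * nrm s0 h) \<le> 2 * (nrm (s + \<nu>) k * nrm s0 h)"
        using seg pos by (intro mult_right_mono) auto
      ultimately show "nrm (s + \<nu>) ?w * nrm s0 k * nrm s0 h + nrm (s + \<nu>) k * nrm s0 h + nrm s0 k * nrm (s + \<nu>) h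
        \<le> nrm (s + \<nu>) u * nrm s0 k * nrm s0 h + 3 * nrm (s + \<nu>) k * nrm s0 h + nrm s0 k * nrm (s + \<nu>) h"
        by (simp add: algebra_simps)
    qed
    finally show "nrm r (T (D2F \<epsilon> (l, ?w) (0, k) (0, h))) \<le> \<dots>" .
  qed
qed

text \<open>\<open>F2\<close> bounds the differential at 0 only; the value at \<open>u\<close>
  follows by adding the increment from 0 to \<open>u\<close>.\<close>

lemma tame_DF:
  assumes l: "l \<in> J" and u: "u \<in> X (s + \<nu>)" "nrm s0 u \<le> 1" and h: "h \<in> X (s + \<nu>)"
  shows "nrm r (T (DF \<epsilon> (l, u) (0, h))) \<le> 3 * b * K * (nrm (s + \<nu>) h + nrm (s + \<nu>) u * nrm s0 h)"
proof -
  note Nr = normed_X[OF r] and N0 = normed_X[OF s0_nonneg] and N = normed_X[OF tame_arith(4)]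
  have pos: "0 \<le> nrm s0 u" "0 \<le> nrm s0 h" "0 \<le> nrm (s + \<nu>) u" "0 \<le> nrm (s + \<nu>) h"
    using normed_nonneg[OF N0] normed_nonneg[OF N] tame_X u h by auto
  have z: "0 \<in> X (s + \<nu>)" "nrm s0 0 \<le> 1" using normed_zero_mem[OF N] normed_zero[OF N0] by auto
  have mem: "T (DF \<epsilon> (l, w) (0, h)) \<in> X r" if "w \<in> X (s + \<nu>)" for w
    using T_DF_mem[OF \<epsilon> r T, of "(l, w)" "(0, h)"] l h that tame_X by simp
  have "nrm r (T (DF \<epsilon> (l, u) (0, h))) \<le>
      nrm r (T (DF \<epsilon> (l, 0) (0, h))) + nrm r (T (DF \<epsilon> (l, u) (0, h)) - T (DF \<epsilon> (l, 0) (0, h)))"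
    by (intro normed_le_add_diff[OF Nr] mem u z)
  also have "nrm r (T (DF \<epsilon> (l, 0) (0, h))) \<le> b * K * nrm (s + \<nu>) h"
    by (rule T_le, rule tame_at_DF[OF tame \<epsilon> l h])
  also have "nrm r (T (DF \<epsilon> (l, u) (0, h)) - T (DF \<epsilon> (l, 0) (0, h))) \<le>
      b * K * (3 * nrm (s + \<nu>) u * nrm s0 h + nrm s0 u * nrm (s + \<nu>) h)"
    using tame_DF_diff[OF l z(1) u(1) z(2) _ h] u normed_zero[OF N] by simp
  also have "\<dots> \<le> b * K * (3 * nrm (s + \<nu>) u * nrm s0 h + 1 * nrm (s + \<nu>) h)"
    using u pos by (intro mult_left_mono[OF _ tame_arith(8)] add_left_mono mult_right_mono) auto
  also have "b * K * nrm (s + \<nu>) h + \<dots> \<le> 3 * b * K * (nrm (s + \<nu>) h + nrm (s + \<nu>) u * nrm s0 h)"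
    using mult_nonneg_nonneg[OF tame_arith(8) pos(4)] by (simp add: algebra_simps)
  finally show ?thesis by simp
qed

text \<open>The value at 0 is of order \<open>\<epsilon>\<close>, and the increment from 0 to
  \<open>u\<close> is controlled by \<open>tame_DF\<close> along the ray. The bound
  \<open>nrm s0 u \<le> 1\<close> keeps the result linear in the high norm.\<close>

lemma tame_F:
  assumes l: "l \<in> J" and u: "u \<in> X (s + \<nu>)" "nrm s0 u \<le> 1"
  shows "nrm r (T (F \<epsilon> l u)) \<le> 6 * b * K * (\<epsilon> + nrm (s + \<nu>) u)"
proof -
  note Nr = normed_X[OF r] and N0 = normed_X[OF s0_nonneg] and N = normed_X[OF tame_arith(4)]
  have pos: "0 \<le> nrm s0 u" "0 \<le> nrm (s + \<nu>) u"
    using normed_nonneg[OF N0] normed_nonneg[OF N] tame_X u by auto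
  have z: "0 \<in> X (s + \<nu>)" "nrm s0 0 \<le> 1" using normed_zero_mem[OF N] normed_zero[OF N0] by auto
  have mem: "T (F \<epsilon> l w) \<in> X r" if "w \<in> X (s + \<nu>)" for w
    using T_FF_mem[OF \<epsilon> r T, of "(l, w)"] l that tame_X by simp
  have "nrm r (T (F \<epsilon> l (0 + u)) - T (F \<epsilon> l 0) - 0) \<le> 6 * b * K * nrm (s + \<nu>) u"
  proof (rule T_F_diff[OF \<epsilon> r T l])
    show "0 \<in> X (s0 + \<nu>)" "u \<in> X (s0 + \<nu>)" using u z tame_X by auto
    show "0 \<in> X r" by (rule normed_zero_mem[OF Nr])
    show "0 \<le> 6 * b * K * nrm (s + \<nu>) u"
      using mult_nonneg_nonneg[OF tame_arith(8) pos(2)] by (simp add: mult.assoc)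
    fix \<theta> :: real assume \<theta>: "\<theta> \<in> {0..1}"
    have seg: "nrm s0 (0 + \<theta> *\<^sub>R u) \<le> 1" "nrm (s + \<nu>) (0 + \<theta> *\<^sub>R u) \<le> nrm (s + \<nu>) u"
      using tame_segment[OF z(1) u(1) z(2) _ \<theta>] u normed_zero[OF N] by auto
    have "nrm r (T (DF \<epsilon> (l, 0 + \<theta> *\<^sub>R u) (0, u))) \<le>
       3 * b * K * (nrm (s + \<nu>) u + nrm (s + \<nu>) (0 + \<theta> *\<^sub>R u) * nrm s0 u)"
      by (intro tame_DF l tame_mem u z seg)
    also have "\<dots> \<le> 3 * b * K * (nrm (s + \<nu>) u + nrm (s + \<nu>) u * 1)"
      using seg u pos b(1) tame_arith(2) by (intro mult_left_mono add_left_mono mult_mono) auto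
    finally show "nrm r (T (DF \<epsilon> (l, 0 + \<theta> *\<^sub>R u) (0, u)) - 0) \<le> 6 * b * K * nrm (s + \<nu>) u" by simp
  qed
  then have "nrm r (T (F \<epsilon> l u) - T (F \<epsilon> l 0)) \<le> 6 * b * K * nrm (s + \<nu>) u" by simp
  moreover have "nrm r (T (F \<epsilon> l 0)) \<le> b * K * \<epsilon>"
    by (rule T_le, rule tame_at_F[OF tame \<epsilon> l])
  moreover have "nrm r (T (F \<epsilon> l u)) \<le> nrm r (T (F \<epsilon> l 0)) + nrm r (T (F \<epsilon> l u) - T (F \<epsilon> l 0))"
    by (intro normed_le_add_diff[OF Nr] mem u z)
  moreover have "0 \<le> b * K * \<epsilon>" using tame_arith(8) \<epsilon> by simp
  ultimately show ?thesis by (simp add: algebra_simps)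
qed

lemma tame_DF_param:
  assumes l: "l \<in> J" "l' \<in> J" and u: "u \<in> X (s + \<nu>)" "nrm s0 u \<le> 1" and h: "h \<in> X (s + \<nu>)"
  shows "nrm r (T (DF \<epsilon> (l', u) (0, h)) - T (DF \<epsilon> (l, u) (0, h))) \<le>
    b * K * (nrm (s + \<nu>) h + nrm (s + \<nu>) u * nrm s0 h) * \<bar>l' - l\<bar>"
proof (rule T_DF_diff_param[OF \<epsilon> r T l])
  show "u \<in> X (s0 + \<nu>)" "h \<in> X (s0 + \<nu>)" using u h tame_X by auto
  show "0 \<le> b * K * (nrm (s + \<nu>) h + nrm (s + \<nu>) u * nrm s0 h)"
    using normed_nonneg[OF normed_X[OF s0_nonneg]] normed_nonneg[OF normed_X[OF tame_arith(4)]] tame_X u h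
    by (intro mult_nonneg_nonneg[OF tame_arith(8)] add_nonneg_nonneg mult_nonneg_nonneg) auto
  show "nrm r (T (D2F \<epsilon> (t, u) (1, 0) (0, h))) \<le> b * K * (nrm (s + \<nu>) h + nrm (s + \<nu>) u * nrm s0 h)"
    if "t \<in> J" for t
    by (rule T_le, rule tame_at_D2F_param[OF tame \<epsilon> that u h])
qed

lemma tame_param_diff:
  assumes l: "l \<in> J" and u: "u \<in> X (s + \<nu>)" "h \<in> X (s + \<nu>)" "nrm s0 u \<le> 1" "nrm s0 (u + h) \<le> 1"
  shows "nrm r (T (DF \<epsilon> (l, u + h) (1, 0)) - T (DF \<epsilon> (l, u) (1, 0))) \<le>
    b * K * (3 * nrm (s + \<nu>) h + nrm (s + \<nu>) u * nrm s0 h)"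
proof (rule T_DF_param_diff[OF \<epsilon> r T l])
  have pos: "0 \<le> nrm s0 h" "0 \<le> nrm (s + \<nu>) u" "0 \<le> nrm (s + \<nu>) h"
    using normed_nonneg[OF normed_X[OF s0_nonneg]] normed_nonneg[OF normed_X[OF tame_arith(4)]] tame_X u by auto
  show "u \<in> X (s0 + \<nu>)" "h \<in> X (s0 + \<nu>)" using u tame_X by auto
  show "0 \<le> b * K * (3 * nrm (s + \<nu>) h + nrm (s + \<nu>) u * nrm s0 h)"
    using pos by (intro mult_nonneg_nonneg[OF tame_arith(8)] add_nonneg_nonneg mult_nonneg_nonneg) auto
  fix t \<theta> :: real assume t: "t \<in> J" and \<theta>: "\<theta> \<in> {0..1}"
  note seg = tame_segment[OF u \<theta>]
  have "nrm r (T (D2F \<epsilon> (t, u + \<theta> *\<^sub>R h) (1, 0) (0, h))) \<le>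
      b * K * (nrm (s + \<nu>) h + nrm (s + \<nu>) (u + \<theta> *\<^sub>R h) * nrm s0 h)"
    by (rule T_le, rule tame_at_D2F_param[OF tame \<epsilon> t tame_mem[OF u(1,2)] seg(1) u(2)])
  also have "\<dots> \<le> b * K * (3 * nrm (s + \<nu>) h + nrm (s + \<nu>) u * nrm s0 h)"
  proof (rule mult_left_mono[OF _ tame_arith(8)])
    have "nrm (s + \<nu>) (u + \<theta> *\<^sub>R h) * nrm s0 h \<le> (nrm (s + \<nu>) u + nrm (s + \<nu>) h) * nrm s0 h"
      using seg pos by (intro mult_right_mono) auto
    moreover have "nrm s0 h * nrm (s + \<nu>) h \<le> 2 * nrm (s + \<nu>) h"
      using seg pos by (intro mult_right_mono) auto
    ultimately show "nrm (s + \<nu>) h + nrm (s + \<nu>) (u + \<theta> *\<^sub>R h) * nrm s0 h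
        \<le> 3 * nrm (s + \<nu>) h + nrm (s + \<nu>) u * nrm s0 h"
      by (simp add: algebra_simps)
  qed
  finally show "nrm r (T (D2F \<epsilon> (t, u + \<theta> *\<^sub>R h) (1, 0) (0, h))) \<le> \<dots>" .
qed

lemma tame_param:
  assumes l: "l \<in> J" and u: "u \<in> X (s + \<nu>)" "nrm s0 u \<le> 1"
  shows "nrm r (T (DF \<epsilon> (l, u) (1, 0))) \<le> b * K * (1 + nrm (s + \<nu>) u)"
  by (rule T_le, rule tame_at_param[OF tame \<epsilon> l u])

end

end

section \<open>Galerkin spaces: equivalence of norms and completeness\<close>

context smoothing_scale
begin

lemma E_X: "1 \<le> N \<Longrightarrow> 0 \<le> s \<Longrightarrow> u \<in> E N \<Longrightarrow> u \<in> X s"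
  using E_subset[of N s] by auto

lemma P_mem: "1 \<le> N \<Longrightarrow> 0 \<le> s \<Longrightarrow> y \<in> X s \<Longrightarrow> P N y \<in> E N"
  using P_range[of N y] X_mono[of y s 0] by auto

lemma P_diff: "1 \<le> N \<Longrightarrow> 0 \<le> s \<Longrightarrow> x \<in> X s \<Longrightarrow> y \<in> X s \<Longrightarrow> P N (x - y) = P N x - P N y"
proof -
  assume *: "1 \<le> N" "0 \<le> s" "x \<in> X s" "y \<in> X s"
  then have m: "x \<in> X 0" "y \<in> X 0" using X_mono by auto
  have "(-1) *\<^sub>R y \<in> X 0" by (rule normed_scale_mem[OF normed_X]) (use m in auto)
  then have "P N (x + (-1) *\<^sub>R y) = P N x + (-1) *\<^sub>R P N y"
    using P_add[of N x "(-1) *\<^sub>R y"] P_scale[of N y "-1"] m * by simp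
  then show ?thesis by simp
qed

lemma E_subspace': "1 \<le> N \<Longrightarrow> subspace (E N)"
  using E_subspace by simp

text \<open>\<open>P N\<close> reproduces the elements of \<open>E N\<close> and, by
  \<open>P1\<close>, gains any number of derivatives over \<open>X 0\<close>. The constant depends
  on \<open>N\<close>, so the lemma is used for qualitative facts such as differentiability and
  completeness; quantitative bounds go through \<open>E_gain\<close>.\<close>

lemma E_norm_equiv:
  assumes N: "1 \<le> N" and s: "0 \<le> s" "0 \<le> s'"
  obtains C where "0 \<le> C" "\<And>u. u \<in> E N \<Longrightarrow> nrm s u \<le> C * nrm s' u"
proof -
  obtain C where C: "C > 0" "\<And>N u. N \<ge> 1 \<Longrightarrow> u \<in> X 0 \<Longrightarrow> nrm s (P N u) \<le> C * N powr s * nrm 0 u"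
    using P1[of 0 s] s by auto
  have "nrm s u \<le> C * N powr s * nrm s' u" if u: "u \<in> E N" for u
  proof -
    have "nrm s u \<le> C * N powr s * nrm 0 u" using C(2)[of N u] N u E_X[of N 0 u] P_id[of N u] by simp
    also have "\<dots> \<le> C * N powr s * nrm s' u"
      using nrm_mono[of 0 s' u] E_X[OF N _ u] s C by (intro mult_left_mono) auto
    finally show ?thesis .
  qed
  then show ?thesis using that[of "C * N powr s"] C by simp
qed

lemma P_bounded_linear:
  assumes N: "1 \<le> N" and s: "0 \<le> s" "0 \<le> s'"
  shows "bounded_linear_on (X s) (nrm s) (X s') (nrm s') (P N)"
proof -
  obtain C where C: "C > 0" "\<And>u. u \<in> X s \<Longrightarrow> nrm s (P N u) \<le> C * nrm s u"
    using P1[of s 0] s N by auto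
  obtain C' where C': "0 \<le> C'" "\<And>u. u \<in> E N \<Longrightarrow> nrm s' u \<le> C' * nrm s u"
    by (rule E_norm_equiv[OF N s(2,1)]) blast
  have m: "x \<in> X s \<Longrightarrow> x \<in> X 0" for x using X_mono s by blast
  have Pm: "x \<in> X s \<Longrightarrow> P N x \<in> E N" for x by (rule P_mem[OF N s(1)])
  have "nrm s' (P N x) \<le> (C' * C) * nrm s x" if x: "x \<in> X s" for x
  proof -
    have "nrm s' (P N x) \<le> C' * nrm s (P N x)" by (rule C'(2)[OF Pm[OF x]])
    also have "\<dots> \<le> C' * (C * nrm s x)" by (rule mult_left_mono[OF C(2)[OF x] C'(1)])
    finally show ?thesis by simp
  qed
  then show ?thesis
    unfolding bounded_linear_on_def using Pm E_X[OF N s(2)] P_add P_scale m N by auto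
qed

text \<open>\<open>P N\<close> is continuous on \<open>X s\<close> and fixes the sequence, hence
  fixes its limit in \<open>X s\<close>, which therefore lies in the range of
  \<open>P N\<close>.\<close>

lemma E_complete:
  assumes N: "1 \<le> N" and s: "0 \<le> s"
  shows "ncomplete (nrm s) (E N)"
  unfolding ncomplete_def
proof (intro allI impI)
  fix x :: "nat \<Rightarrow> 'a"
  assume x: "(\<forall>k. x k \<in> E N) \<and> (\<forall>e>0. \<exists>k0. \<forall>i\<ge>k0. \<forall>j\<ge>k0. nrm s (x i - x j) < e)"
  note Ns = normed_X[OF s]
  have xX: "x k \<in> X s" for k using x E_X[OF N s] by auto
  have "ncomplete (nrm s) (X s)" by (rule banach_ncomplete[OF banach[OF s]])
  then obtain l where l: "l \<in> X s" "(\<lambda>k. nrm s (x k - l)) \<longlonglongrightarrow> 0"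
    using ncompleteD[of "nrm s" "X s" x] x xX by blast
  note Pbl = P_bounded_linear[OF N s s]
  obtain C where C: "C \<ge> 0" "\<And>y. y \<in> X s \<Longrightarrow> nrm s (P N y) \<le> C * nrm s y"
    using bounded_linear_on_bound[OF Pbl Ns] by blast
  have Pl: "P N l \<in> X s" by (rule bounded_linear_on_mem[OF Pbl l(1)])
  have "nrm s (P N l - l) \<le> (C + 1) * nrm s (x k - l)" for k
  proof -
    have "nrm s (P N l - l) \<le> nrm s (P N l - x k) + nrm s (x k - l)"
      by (rule normed_triangle_mid[OF Ns Pl xX l(1)])
    also have "nrm s (P N l - x k) = nrm s (P N (x k - l))"
    proof -
      have "P N (x k) = x k" using P_id[of N "x k"] x N by simp
      then have "P N (x k - l) = x k - P N l" using P_diff[OF N s xX l(1)] by simp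
      then show ?thesis using normed_commute[OF Ns Pl xX] by simp
    qed
    also have "\<dots> \<le> C * nrm s (x k - l)" by (intro C normed_mem[OF Ns] xX l)
    finally show ?thesis by (simp add: algebra_simps)
  qed
  moreover have "(\<lambda>k. (C + 1) * nrm s (x k - l)) \<longlonglongrightarrow> (C + 1) * 0" by (intro tendsto_intros l(2))
  ultimately have "nrm s (P N l - l) \<le> 0" by (intro LIMSEQ_le_const[of _ 0]) auto
  then have "P N l = l"
    using normed_nonneg[OF Ns normed_diff_mem[OF Ns Pl l(1)]]
      normed_eq_0[OF Ns normed_diff_mem[OF Ns Pl l(1)]] by simp
  then have "l \<in> E N" using P_mem[OF N s l(1)] by simp
  with l(2) show "\<exists>l\<in>E N. (\<lambda>k. nrm s (x k - l)) \<longlonglongrightarrow> 0" by blast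
qed

end

text \<open>Two levels drive the iteration: \<open>s1\<close>, where corrections are small, and
  \<open>S\<close>, where growth is permitted. A single \<open>K\<close> bounds the projectors and
  the map at both.\<close>

locale nash_moser = smoothing_scale + tame_family +
  fixes s1 S K :: real
  assumes s1: "s0 < s1" and s1S: "s1 < S" and K: "1 \<le> K"
    and tame_S: "s \<in> {s1, S} \<Longrightarrow> tame_at s K"
    and P_le: "s \<in> {s1, S} \<Longrightarrow> 1 \<le> N \<Longrightarrow> y \<in> X s \<Longrightarrow> nrm s (P N y) \<le> K * nrm s y"
    and P_gain: "s \<in> {s1, S} \<Longrightarrow> 1 \<le> N \<Longrightarrow> y \<in> X s \<Longrightarrow> nrm (s + \<nu>) (P N y) \<le> K * N powr \<nu> * nrm s y"
    and P_rem: "1 \<le> N \<Longrightarrow> y \<in> X S \<Longrightarrow> nrm s1 (y - P N y) \<le> K * N powr (- (S - s1)) * nrm S y"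
begin

lemma s_nonneg: "0 \<le> s1" "0 \<le> S" "0 \<le> s1 + \<nu>" "0 \<le> S + \<nu>" "s0 \<le> s1" "s0 \<le> S" "0 \<le> K" "s0 + \<nu> \<le> s1 + \<nu>"
  using s1 s1S K s0_nonneg \<nu>_pos by auto

lemma sel_nonneg: "s \<in> {s1, S} \<Longrightarrow> 0 \<le> s \<and> 0 \<le> s + \<nu> \<and> s0 \<le> s"
  using s_nonneg by auto

lemma E_gain: "s \<in> {s1, S} \<Longrightarrow> 1 \<le> N \<Longrightarrow> y \<in> E N \<Longrightarrow> nrm (s + \<nu>) y \<le> K * N powr \<nu> * nrm s y"
  using P_gain[of s N y] P_id[of N y] E_X[of N s y] sel_nonneg by auto

lemma E_n0: "1 \<le> N \<Longrightarrow> y \<in> E N \<Longrightarrow> nrm s0 y \<le> nrm s1 y"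
  using nrm_mono[of s0 s1 y] E_X[of N s1 y] s_nonneg s0_nonneg by auto

lemma E_nrm_nonneg: "1 \<le> N \<Longrightarrow> y \<in> E N \<Longrightarrow> 0 \<le> s \<Longrightarrow> 0 \<le> nrm s y"
  using normed_nonneg[OF normed_X] E_X by blast

lemma E_diff: "1 \<le> N \<Longrightarrow> x \<in> E N \<Longrightarrow> y \<in> E N \<Longrightarrow> x - y \<in> E N"
  and E_add: "1 \<le> N \<Longrightarrow> x \<in> E N \<Longrightarrow> y \<in> E N \<Longrightarrow> x + y \<in> E N"
  and E_scale: "1 \<le> N \<Longrightarrow> x \<in> E N \<Longrightarrow> c *\<^sub>R x \<in> E N"
  and E_minus: "1 \<le> N \<Longrightarrow> x \<in> E N \<Longrightarrow> - x \<in> E N"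
  and E_zero: "1 \<le> N \<Longrightarrow> 0 \<in> E N"
  using E_subspace'[of N]
  by (auto intro: subspace_diff subspace_add subspace_scale subspace_neg subspace_0)

lemma P_tame:
  assumes "s \<in> {s1, S}" "1 \<le> N"
  shows "0 \<le> s" "bounded_linear_on (X s0) (nrm s0) (X s) (nrm s) (P N)" "tame_at s K" "0 \<le> K"
    "\<And>y. y \<in> X s \<Longrightarrow> nrm s (P N y) \<le> K * nrm s y"
  using assms P_bounded_linear[OF assms(2) s0_nonneg, of s] tame_S P_le sel_nonneg s_nonneg by auto

end

section \<open>One Galerkin step\<close>

locale power_bounds =
  fixes M t :: real
  assumes base: "1 \<le> M" "10 \<le> M powr t"
begin

lemma pw_le: "x \<le> M powr a \<Longrightarrow> a \<le> b \<Longrightarrow> x \<le> M powr b"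
  using powr_mono[of a b M] base by linarith

lemma pw_mult:
  assumes "0 \<le> x" "0 \<le> y" "x \<le> M powr a" "y \<le> M powr b" "a + b \<le> c"
  shows "x * y \<le> M powr c"
proof -
  have "x * y \<le> M powr a * M powr b" using assms by (intro mult_mono) auto
  then have "x * y \<le> M powr (a + b)" by (simp add: powr_add)
  then show ?thesis using assms(5) by (rule pw_le)
qed

text \<open>A sum costs a factor 2, which is below \<open>M powr t\<close>; each addition thus loses
  one \<open>t\<close> in the exponent.\<close>

lemma pw_add:
  assumes "x \<le> M powr a" "y \<le> M powr b" "a + t \<le> c" "b + t \<le> c"
  shows "x + y \<le> M powr c"
proof -
  have "x \<le> M powr (c - t)" "y \<le> M powr (c - t)" using assms by (auto elim: pw_le)
  moreover have "2 * M powr (c - t) \<le> M powr t * M powr (c - t)" using base by (intro mult_right_mono) auto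
  ultimately show ?thesis by (simp flip: powr_add)
qed

lemma pw_num: "c \<le> 10 \<Longrightarrow> c \<le> M powr t"
  using base by linarith

lemma pw_half: "a \<le> - t \<Longrightarrow> M powr a \<le> 1 / 2"
proof -
  assume a: "a \<le> - t"
  have "M powr a \<le> M powr (- t)" using a base by (intro powr_mono) auto
  also have "\<dots> = 1 / M powr t" by (simp add: powr_minus_divide)
  also have "\<dots> \<le> 1 / 2" using base by (intro divide_left_mono) auto
  finally show ?thesis .
qed

end

text \<open>
  All bounds are recorded as powers of \<open>M\<close>; the small exponent \<open>t\<close> absorbs the constants, through
  \<open>K \<le> M powr t\<close>. The first step of the iteration is the instance \<open>u = 0\<close>, \<open>M = N0\<close>.
\<close>

locale galerkin_step = nash_moser +
  fixes \<epsilon> \<epsilon>0 \<tau> \<delta> \<sigma> \<mu> p q M t Y :: real and CJ :: "real \<Rightarrow> real"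
    and u u' :: "real \<Rightarrow> 'a" and A :: "real set"
  assumes \<epsilon>: "0 \<le> \<epsilon>" "\<epsilon> < \<epsilon>0" "\<epsilon>0 \<le> \<epsilon>s"
    and \<mu>: "\<mu> = \<tau> + \<delta> * s1" "0 < \<mu>" and p: "p = \<mu> + \<nu> / 2 + 1" and q: "q = 2 * \<mu> + \<nu> + 2 + \<sigma> / 2"
    and \<sigma>: "2 * \<mu> + 3 * \<nu> + 2 \<le> \<sigma>" "4 * (\<mu> + \<nu>) \<le> \<sigma>" and \<delta>S: "\<delta> * (S - s1) \<le> \<sigma> + 1"
    and t: "0 < t" "1000 * t \<le> \<nu>" "1000 * t \<le> 1" "1000 * t \<le> \<mu>"
    and M: "1 \<le> M" "10 \<le> M powr t" "K \<le> M powr t" and CJ: "CJ s1 \<le> K" "CJ S \<le> K"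
    and A: "\<And>a. a \<in> A \<Longrightarrow> (a, u a) \<in> good_pairs nrm E P J DF CJ s1 S \<epsilon>0 \<tau> \<delta> M"
    and uE: "\<And>l. l \<in> J \<Longrightarrow> u l \<in> E M" "\<And>l. l \<in> J \<Longrightarrow> u' l \<in> E M"
    and uC1: "\<And>l. l \<in> J \<Longrightarrow> nderiv (nrm s1) u (u' l) l J" "\<And>l. l \<in> J \<Longrightarrow> ncont (nrm s1) u' l J"
    and u_s1: "\<And>l. l \<in> J \<Longrightarrow> nrm s1 (u l) + M powr (- \<sigma> - 1) \<le> 1"
    and u'_s1: "\<And>l. l \<in> J \<Longrightarrow> 1 + nrm s1 (u' l) \<le> M powr (\<sigma> / 4 - \<nu> / 4)"
    and u_S: "\<And>l. l \<in> J \<Longrightarrow> nrm S (u l) \<le> M powr (p + t)"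
    and u_S\<nu>: "\<And>l. l \<in> J \<Longrightarrow> nrm (S + \<nu>) (u l) \<le> M powr (\<nu> / 2 + p + 5 * t)"
    and u'_S\<nu>: "\<And>l. l \<in> J \<Longrightarrow> nrm (S + \<nu>) (u' l) \<le> M powr (\<nu> / 2 + q + 5 * t)"
    and res_s1: "\<And>l. l \<in> open_nbhd A (2 * M powr (- \<sigma> / 2)) \<inter> J \<Longrightarrow>
      nrm s1 (P M (F \<epsilon> l (u l))) \<le> M powr (- 2 - \<sigma> - \<mu> + 10 * t)"
    and res_S: "\<And>l. l \<in> open_nbhd A (2 * M powr (- \<sigma> / 2)) \<inter> J \<Longrightarrow>
      nrm S (P M (F \<epsilon> l (u l))) \<le> M powr (\<nu> / 2 + p + 10 * t)"
    and res': "\<And>l. l \<in> open_nbhd A (2 * M powr (- \<sigma> / 2)) \<inter> J \<Longrightarrow>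
      nrm s1 (P M (DF \<epsilon> (l, u l) (1, u' l))) \<le> Y"
    and Y: "0 \<le> Y" "Y \<le> M powr (10 * t)"
begin

sublocale power_bounds M t
  using M by unfold_locales

abbreviation "L \<equiv> galerkin_lin P DF M \<epsilon>"
abbreviation "g \<equiv> \<lambda>l z. P M (F \<epsilon> l z)"
text \<open>The radius of the quasi-Newton ball is the rate that (S2) allows for the correction. The
  width \<open>\<eta>\<close> below is twice that of (S3): the correction is constructed on the
  wider neighbourhood and cut off between the two.\<close>

abbreviation "\<rho> \<equiv> M powr (- \<sigma> - 1)"
abbreviation "\<eta> \<equiv> 2 * M powr (- \<sigma> / 2)"

lemma \<epsilon>': "0 \<le> \<epsilon>" "\<epsilon> < \<epsilon>s"
  using \<epsilon> by auto

lemma L_def': "L l w h = P M (DF \<epsilon> (l, w) (0, h))"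
  by (simp add: galerkin_lin_def)

lemma pw_K2: "K * K \<le> M powr (2 * t)"
  by (rule pw_mult[OF _ _ M(3) M(3)]) (use s_nonneg in auto)

lemma pw_K3: "K * K * K \<le> M powr (3 * t)"
  by (rule pw_mult[OF _ _ pw_K2 M(3)]) (use s_nonneg in auto)

lemma EX: "x \<in> E M \<Longrightarrow> 0 \<le> s \<Longrightarrow> x \<in> X s"
  by (rule E_X[OF M(1)])

lemma F_mem: "l \<in> J \<Longrightarrow> w \<in> E M \<Longrightarrow> F \<epsilon> l w \<in> X s0"
  using FF_mem[OF \<epsilon>', of "(l, w)"] EX s0\<nu> by simp

lemma DF_mem: "l \<in> J \<Longrightarrow> w \<in> E M \<Longrightarrow> h \<in> E M \<Longrightarrow> DF \<epsilon> (l, w) (c, h) \<in> X s0"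
  using bounded_linear_on_mem[OF DF_linear[OF \<epsilon>', of "(l, w)"], of "(c, h)"] EX s0\<nu> by simp

lemma g_mem: "l \<in> J \<Longrightarrow> w \<in> E M \<Longrightarrow> g l w \<in> E M"
  by (rule P_mem[OF M(1) s0_nonneg F_mem])

lemma PD_mem: "l \<in> J \<Longrightarrow> w \<in> E M \<Longrightarrow> h \<in> E M \<Longrightarrow> P M (DF \<epsilon> (l, w) (c, h)) \<in> E M"
  by (rule P_mem[OF M(1) s0_nonneg DF_mem])

lemma L_mem: "l \<in> J \<Longrightarrow> w \<in> E M \<Longrightarrow> h \<in> E M \<Longrightarrow> L l w h \<in> E M"
  unfolding L_def' by (rule PD_mem)

lemma PDF_linear:
  assumes "l \<in> J" "w \<in> E M"
  shows "h \<in> E M \<Longrightarrow> k \<in> E M \<Longrightarrow> P M (DF \<epsilon> (l, w) ((c, h) + (d, k))) = P M (DF \<epsilon> (l, w) (c, h)) + P M (DF \<epsilon> (l, w) (d, k))"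
    and "h \<in> E M \<Longrightarrow> P M (DF \<epsilon> (l, w) (a *\<^sub>R (c, h))) = a *\<^sub>R P M (DF \<epsilon> (l, w) (c, h))"
proof -
  have bl: "bounded_linear_on VV pn (X s0) (nrm s0) (DF \<epsilon> (l, w))"
    by (rule DF_linear[OF \<epsilon>']) (use assms EX s0\<nu> in auto)
  have V: "x \<in> E M \<Longrightarrow> (c, x) \<in> VV" for c x using EX s0\<nu> by simp
  note Pl = P_bounded_linear[OF M(1) s0_nonneg s0_nonneg]
  show "P M (DF \<epsilon> (l, w) ((c, h) + (d, k))) = P M (DF \<epsilon> (l, w) (c, h)) + P M (DF \<epsilon> (l, w) (d, k))"
    if "h \<in> E M" "k \<in> E M"
    unfolding bounded_linear_on_add[OF bl V[OF that(1)] V[OF that(2)]]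
    by (rule bounded_linear_on_add[OF Pl]) (use DF_mem assms that in auto)
  show "P M (DF \<epsilon> (l, w) (a *\<^sub>R (c, h))) = a *\<^sub>R P M (DF \<epsilon> (l, w) (c, h))" if "h \<in> E M"
    unfolding bounded_linear_on_scale[OF bl V[OF that]]
    by (rule bounded_linear_on_scale[OF Pl]) (use DF_mem assms that in auto)
qed

lemma L_add: "l \<in> J \<Longrightarrow> w \<in> E M \<Longrightarrow> h \<in> E M \<Longrightarrow> k \<in> E M \<Longrightarrow> L l w (h + k) = L l w h + L l w k"
  using PDF_linear(1)[of l w h k 0 0] by (simp add: L_def')

lemma L_scale: "l \<in> J \<Longrightarrow> w \<in> E M \<Longrightarrow> h \<in> E M \<Longrightarrow> L l w (c *\<^sub>R h) = c *\<^sub>R L l w h"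
  using PDF_linear(2)[of l w h c 0] by (simp add: L_def')

lemma L_diff: "l \<in> J \<Longrightarrow> w \<in> E M \<Longrightarrow> h \<in> E M \<Longrightarrow> k \<in> E M \<Longrightarrow> L l w (h - k) = L l w h - L l w k"
  using L_add[of l w h "(-1) *\<^sub>R k"] L_scale[of l w k "-1"] E_scale[OF M(1), of k "-1"] by simp

lemma norms: "normed_on (X s1) (nrm s1)" "normed_on (X S) (nrm S)" "normed_on (X (S + \<nu>)) (nrm (S + \<nu>))"
    "normed_on (X (s1 + \<nu>)) (nrm (s1 + \<nu>))"
  by (intro normed_X s_nonneg)+

lemma A_sub: "a \<in> A \<Longrightarrow> a \<in> J"
  using A by (auto simp: good_pairs_def)

lemma nderiv_E:
  assumes "0 \<le> s" "nderiv (nrm s1) f f' l I" "\<And>r. r \<in> insert l I \<Longrightarrow> f r \<in> E M" "f' \<in> E M"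
  shows "nderiv (nrm s) f f' l I"
proof -
  obtain C where C: "0 \<le> C" "\<And>u. u \<in> E M \<Longrightarrow> nrm s u \<le> C * nrm s1 u"
    using E_norm_equiv[OF M(1) assms(1) s_nonneg(1)] by blast
  show ?thesis
    by (rule nderiv_mono_norm[OF assms(2) C(1)])
       (intro C(2) E_diff E_scale M(1) assms(3,4), use assms in auto)
qed

lemma nderiv_u: "0 \<le> s \<Longrightarrow> l \<in> J \<Longrightarrow> nderiv (nrm s) u (u' l) l J"
  by (rule nderiv_E[OF _ uC1(1)]) (use uE in auto)

lemma u_lipschitz:
  assumes s: "0 \<le> s" and B: "0 \<le> B" "\<And>l. l \<in> J \<Longrightarrow> nrm s (u' l) \<le> B" and l: "l \<in> J" "l' \<in> J"
  shows "nrm s (u l' - u l) \<le> B * \<bar>l' - l\<bar>"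
proof (rule curve_lipschitz[OF normed_X[OF s] J_interval B(1) l])
  fix t assume t: "t \<in> J"
  then show "u t \<in> X s \<and> u' t \<in> X s \<and> nrm s (u' t) \<le> B \<and> nderiv (nrm s) u (u' t) t J"
    using B(2)[OF t] EX uE s nderiv_u[OF s t] by auto
qed

lemma ball_s1: "l \<in> J \<Longrightarrow> z \<in> E M \<Longrightarrow> nrm s1 (z - u l) \<le> \<rho> \<Longrightarrow> nrm s1 z \<le> 1"
  using normed_le_add_diff[OF norms(1), of z "u l"] u_s1[of l] EX uE s_nonneg by fastforce

lemma u_le1: "l \<in> J \<Longrightarrow> nrm s1 (u l) \<le> 1"
  using u_s1[of l] powr_ge_zero[of M "- \<sigma> - 1"] by linarith

section \<open>The linearized operator near a good parameter\<close>

context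
  fixes a l :: real
  assumes a: "a \<in> A" and l: "l \<in> J" and la: "\<bar>l - a\<bar> < \<eta>"
begin

abbreviation "L0 \<equiv> L a (u a)"
abbreviation "T0 \<equiv> inv_into (E M) L0"

lemma aJ: "a \<in> J" and uaE: "u a \<in> E M" and ulE: "u l \<in> E M"
  using A_sub a uE l by auto

lemma L0_bij: "bij_betw L0 (E M) (E M)"
  using A[OF a] \<epsilon> by (auto simp: good_pairs_def)

lemma T0_bound:
  assumes s: "s \<in> {s1..S}" and h: "h \<in> E M"
  shows "nrm s (T0 h) \<le> CJ s * M powr \<mu> * (nrm s h + M powr (\<delta> * (s - s1)) * nrm s (u a) * nrm s1 h)"
proof -
  have "\<epsilon> \<in> {0..<\<epsilon>0}" using \<epsilon> by simp
  then show ?thesis using A[OF a] s h unfolding good_pairs_def \<mu> by blast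
qed

lemma L0_mem: "x \<in> E M \<Longrightarrow> L0 x \<in> E M"
  by (rule L_mem[OF aJ uaE])

lemma T0_mem: "y \<in> E M \<Longrightarrow> T0 y \<in> E M"
  using L0_bij inv_into_into[of y L0 "E M"] by (simp add: bij_betw_def)

lemma L0_T0: "y \<in> E M \<Longrightarrow> L0 (T0 y) = y"
  using L0_bij by (simp add: bij_betw_def f_inv_into_f)

lemma T0_L0: "x \<in> E M \<Longrightarrow> T0 (L0 x) = x"
  using L0_bij by (simp add: bij_betw_def inv_into_f_f)

lemma T0_diff: "y \<in> E M \<Longrightarrow> y' \<in> E M \<Longrightarrow> T0 (y - y') = T0 y - T0 y'"
proof -
  assume y: "y \<in> E M" "y' \<in> E M"
  have "L0 (T0 y - T0 y') = y - y'"
    using L_diff[OF aJ uaE T0_mem T0_mem, OF y] L0_T0 y by simp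
  then show ?thesis using T0_L0[of "T0 y - T0 y'"] T0_mem y E_diff[OF M(1)] by simp
qed

lemma T0_s1: "y \<in> E M \<Longrightarrow> nrm s1 (T0 y) \<le> M powr (\<mu> + 2 * t) * nrm s1 y"
proof -
  assume y: "y \<in> E M"
  have ny: "0 \<le> nrm s1 y" by (rule E_nrm_nonneg[OF M(1) y s_nonneg(1)])
  have nu: "0 \<le> nrm s1 (u a)" by (rule E_nrm_nonneg[OF M(1) uaE s_nonneg(1)])
  have "nrm s1 (T0 y) \<le> CJ s1 * M powr \<mu> * (nrm s1 y + nrm s1 (u a) * nrm s1 y)"
    using T0_bound[of s1 y] y s1S M by simp
  also have "\<dots> \<le> K * M powr \<mu> * (nrm s1 y + 1 * nrm s1 y)"
    using CJ u_le1[OF aJ] ny nu K by (intro mult_mono add_left_mono mult_right_mono) auto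
  also have "\<dots> = (K * M powr \<mu> * 2) * nrm s1 y" by simp
  also have "\<dots> \<le> M powr (\<mu> + 2 * t) * nrm s1 y"
  proof (rule mult_right_mono[OF _ ny])
    have "K * M powr \<mu> \<le> M powr (\<mu> + t)" by (rule pw_mult[OF _ _ M(3) order_refl]) (use K in auto)
    from pw_mult[OF _ _ this pw_num[of 2]] show "K * M powr \<mu> * 2 \<le> M powr (\<mu> + 2 * t)"
      using K by simp
  qed
  finally show ?thesis .
qed

text \<open>In the inverse estimate the factor \<open>M powr (\<delta> * (S - s1))\<close>, at most
  \<open>M powr (\<sigma> + 1)\<close>, and the growth of \<open>u a\<close> at \<open>S\<close>
  multiply only the low norm of the data. The smallness of the residual at \<open>s1\<close> makes
  up for this loss.\<close>

lemma T0_S: "y \<in> E M \<Longrightarrow>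
  nrm S (T0 y) \<le> M powr (\<mu> + t) * nrm S y + M powr (\<mu> + \<sigma> + 1 + p + 2 * t) * nrm s1 y"
proof -
  assume y: "y \<in> E M"
  have ny: "0 \<le> nrm s1 y" "0 \<le> nrm S y" by (intro E_nrm_nonneg[OF M(1) y] s_nonneg)+
  have nu: "0 \<le> nrm S (u a)" by (rule E_nrm_nonneg[OF M(1) uaE s_nonneg(2)])
  have KM: "K * M powr \<mu> \<le> M powr (\<mu> + t)" by (rule pw_mult[OF _ _ M(3) order_refl]) (use K in auto)
  have "M powr (\<delta> * (S - s1)) * nrm S (u a) \<le> M powr (\<sigma> + 1 + p + t)"
    by (rule pw_mult[OF _ nu order_refl u_S[OF aJ]]) (use \<delta>S in auto)
  then have *: "M powr (\<delta> * (S - s1)) * nrm S (u a) * nrm s1 y \<le> M powr (\<sigma> + 1 + p + t) * nrm s1 y"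
    using ny(1) by (rule mult_right_mono)
  have "nrm S (T0 y) \<le> CJ S * M powr \<mu> * (nrm S y + M powr (\<delta> * (S - s1)) * nrm S (u a) * nrm s1 y)"
    using T0_bound[of S y] y s1S by simp
  also have "\<dots> \<le> K * M powr \<mu> * (nrm S y + M powr (\<sigma> + 1 + p + t) * nrm s1 y)"
    by (rule mult_mono[OF mult_right_mono[OF CJ(2)] add_left_mono[OF *]]) (use K ny nu in auto)
  also have "\<dots> \<le> M powr (\<mu> + t) * (nrm S y + M powr (\<sigma> + 1 + p + t) * nrm s1 y)"
    by (rule mult_right_mono[OF KM]) (use ny in auto)
  also have "\<dots> = M powr (\<mu> + t) * nrm S y + M powr (\<mu> + \<sigma> + 1 + p + 2 * t) * nrm s1 y"
  proof -
    have "M powr (\<mu> + t) * M powr (\<sigma> + 1 + p + t) = M powr (\<mu> + \<sigma> + 1 + p + 2 * t)"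
      unfolding powr_add[symmetric] by (rule arg_cong[where f = "(powr) M"]) simp
    then show ?thesis by (simp add: distrib_left flip: mult.assoc)
  qed
  finally show ?thesis .
qed

lemma arith: "\<nu> > 0" "\<mu> > 0" "\<sigma> > 0"
  using \<nu>_pos \<mu> \<sigma> by auto

text \<open>The curve moves by its speed times \<open>\<eta>\<close>, which dominates the radius
  \<open>\<rho>\<close>. In the second estimate the summand \<open>\<sigma> / 2\<close> of
  \<open>q\<close> cancels against the width \<open>\<eta>\<close>.\<close>

lemma drift:
  assumes z: "z \<in> E M" "nrm s1 (z - u l) \<le> \<rho>"
  shows "nrm s1 (z - u a) + \<eta> \<le> M powr (- \<sigma> / 4 - \<nu> / 4 + t)"
    and "nrm (S + \<nu>) (z - u a) \<le> M powr (\<nu> + t) * nrm S (z - u l) + M powr (3 / 2 * \<nu> + 2 * \<mu> + 2 + 6 * t)"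
proof -
  \<comment> \<open>By \<open>u'_s1\<close> the speed is at most \<open>d - 1\<close>; the unit left
    over pays for the summand \<open>\<eta>\<close> on the left of the claim.\<close>
  define d where "d = M powr (\<sigma> / 4 - \<nu> / 4)"
  have d1: "1 \<le> d" using u'_s1[OF l] E_nrm_nonneg[OF M(1) uE(2)[OF l] s_nonneg(1)] by (simp add: d_def)
  have mem: "z \<in> X s" "u l \<in> X s" "u a \<in> X s" if "0 \<le> s" for s using that EX z ulE uaE by auto
  have "nrm s1 (u l - u a) \<le> (d - 1) * \<bar>l - a\<bar>"
    by (rule u_lipschitz[OF s_nonneg(1) _ _ aJ l]) (use d1 u'_s1 in \<open>auto simp: d_def algebra_simps\<close>)
  also have "\<dots> \<le> (d - 1) * \<eta>" using la d1 by (intro mult_left_mono) auto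
  finally have "nrm s1 (z - u a) + \<eta> \<le> \<rho> + \<eta> * d"
    using normed_triangle_mid[OF norms(1), of z "u l" "u a"] mem s_nonneg z by (simp add: algebra_simps)
  also have "\<eta> * d = 2 * M powr (- \<sigma> / 4 - \<nu> / 4)"
    by (simp add: d_def flip: powr_add)
  also have "\<rho> \<le> M powr (- \<sigma> / 4 - \<nu> / 4)"
    using M \<sigma> arith by (intro powr_mono) auto
  finally have "nrm s1 (z - u a) + \<eta> \<le> 3 * M powr (- \<sigma> / 4 - \<nu> / 4)" by simp
  also have "\<dots> \<le> M powr (- \<sigma> / 4 - \<nu> / 4 + t)"
    by (rule pw_mult[OF _ _ pw_num[of 3] order_refl]) auto
  finally show "nrm s1 (z - u a) + \<eta> \<le> M powr (- \<sigma> / 4 - \<nu> / 4 + t)" .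
  have "nrm (S + \<nu>) (u l - u a) \<le> M powr (\<nu> / 2 + q + 5 * t) * \<bar>l - a\<bar>"
    by (rule u_lipschitz[OF s_nonneg(4) _ u'_S\<nu> aJ l]) auto
  also have "\<dots> \<le> M powr (\<nu> / 2 + q + 5 * t) * (2 * M powr (- \<sigma> / 2))"
    using la by (intro mult_left_mono) auto
  also have "\<dots> \<le> M powr (3 / 2 * \<nu> + 2 * \<mu> + 2 + 6 * t)"
  proof (rule pw_mult[OF _ _ order_refl])
    show "2 * M powr (- \<sigma> / 2) \<le> M powr (t - \<sigma> / 2)"
      by (rule pw_mult[OF _ _ pw_num[of 2] order_refl]) auto
  qed (auto simp: q field_simps)
  finally have 1: "nrm (S + \<nu>) (u l - u a) \<le> M powr (3 / 2 * \<nu> + 2 * \<mu> + 2 + 6 * t)" .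
  have zu: "z - u l \<in> E M" by (intro E_diff M(1) z ulE)
  have "nrm (S + \<nu>) (z - u l) \<le> K * M powr \<nu> * nrm S (z - u l)"
    by (rule E_gain[OF _ M(1) zu]) simp
  also have "\<dots> \<le> M powr (\<nu> + t) * nrm S (z - u l)"
    by (intro mult_right_mono pw_mult[OF _ _ M(3) order_refl] E_nrm_nonneg[OF M(1) zu]) (use K s_nonneg in auto)
  finally have 2: "nrm (S + \<nu>) (z - u l) \<le> M powr (\<nu> + t) * nrm S (z - u l)" .
  show "nrm (S + \<nu>) (z - u a) \<le> M powr (\<nu> + t) * nrm S (z - u l) + M powr (3 / 2 * \<nu> + 2 * \<mu> + 2 + 6 * t)"
    using normed_triangle_mid[OF norms(3), of z "u l" "u a"] mem s_nonneg 1 2 by simp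
qed

text \<open>Two moves: from \<open>z\<close> to \<open>u a\<close> at the fixed parameter
  \<open>l\<close>, then from \<open>l\<close> to \<open>a\<close> at the fixed point
  \<open>u a\<close>. The second contributes \<open>\<bar>l - a\<bar> < \<eta>\<close>, which joins
  \<open>nrm s1 (z - u a)\<close> in a common small factor.\<close>

lemma L_perturb:
  assumes z: "z \<in> E M" "nrm s1 (z - u l) \<le> \<rho>" and x: "x \<in> E M" and s: "s \<in> {s1, S}"
  shows "nrm s (L l z x - L0 x) \<le> K * K * (nrm (s + \<nu>) (u a) * (nrm s1 (z - u a) + \<eta>) * nrm s1 x
     + 3 * nrm (s + \<nu>) (z - u a) * nrm s1 x + (nrm s1 (z - u a) + \<eta>) * nrm (s + \<nu>) x)"
proof -
  note Pt = P_tame[OF s M(1)]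
  have sn: "0 \<le> s" "0 \<le> s + \<nu>" using sel_nonneg[OF s] by auto
  let ?k = "z - u a"
  have kE: "?k \<in> E M" by (intro E_diff M(1) z uaE)
  have mem: "u a \<in> X (s + \<nu>)" "?k \<in> X (s + \<nu>)" "x \<in> X (s + \<nu>)" using EX uaE kE x sn by auto
  have n0: "nrm s0 (u a) \<le> 1" "nrm s0 (u a + ?k) \<le> 1" "nrm s0 ?k \<le> nrm s1 ?k" "nrm s0 x \<le> nrm s1 x"
    using E_n0[OF M(1)] uaE z kE x u_le1[OF aJ] ball_s1[OF l z] by fastforce+
  have pos: "0 \<le> nrm s1 ?k" "0 \<le> nrm s0 ?k" "0 \<le> nrm s1 x" "0 \<le> nrm s0 x" "0 \<le> nrm (s + \<nu>) (u a)"
    "0 \<le> nrm (s + \<nu>) ?k" "0 \<le> nrm (s + \<nu>) x"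
    using E_nrm_nonneg[OF M(1)] kE x uaE sn s_nonneg s0_nonneg by auto
  have "nrm s (L l z x - L l (u a) x) \<le> K * K * (nrm (s + \<nu>) (u a) * nrm s0 ?k * nrm s0 x
      + 3 * nrm (s + \<nu>) ?k * nrm s0 x + nrm s0 ?k * nrm (s + \<nu>) x)"
    using tame_DF_diff[OF \<epsilon>' Pt l mem(1,2) n0(1,2) mem(3)] by (simp add: L_def')
  also have "\<dots> \<le> K * K * (nrm (s + \<nu>) (u a) * nrm s1 ?k * nrm s1 x
      + 3 * nrm (s + \<nu>) ?k * nrm s1 x + nrm s1 ?k * nrm (s + \<nu>) x)"
    using pos n0 K by (intro mult_left_mono add_mono mult_mono) auto
  finally have 1: "nrm s (L l z x - L l (u a) x) \<le> \<dots>" .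
  have "nrm s (L l (u a) x - L0 x) \<le> K * K * (nrm (s + \<nu>) x + nrm (s + \<nu>) (u a) * nrm s0 x) * \<bar>l - a\<bar>"
    using tame_DF_param[OF \<epsilon>' Pt aJ l mem(1) n0(1) mem(3)] by (simp add: L_def')
  also have "\<dots> \<le> K * K * (nrm (s + \<nu>) x + nrm (s + \<nu>) (u a) * nrm s1 x) * \<eta>"
    using pos n0 K la by (intro mult_left_mono add_mono mult_mono) auto
  finally have 2: "nrm s (L l (u a) x - L0 x) \<le> \<dots>" .
  have "nrm s (L l z x - L0 x) \<le> nrm s (L l z x - L l (u a) x) + nrm s (L l (u a) x - L0 x)"
    by (intro normed_triangle_mid[OF normed_X[OF sn(1)]] EX[OF L_mem] sn l z x uaE aJ)
  also have "\<dots> \<le> K * K * (nrm (s + \<nu>) (u a) * (nrm s1 (z - u a) + \<eta>) * nrm s1 x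
     + 3 * nrm (s + \<nu>) (z - u a) * nrm s1 x + (nrm s1 (z - u a) + \<eta>) * nrm (s + \<nu>) x)"
    using 1 2 by (simp add: algebra_simps)
  finally show ?thesis .
qed

text \<open>Passing from \<open>s1 + \<nu>\<close> to \<open>s1\<close> costs
  \<open>M powr \<nu>\<close>, and the drift contributes the exponent
  \<open>- \<sigma> / 4 - \<nu> / 4\<close>. By \<open>4 * (\<mu> + \<nu>) \<le> \<sigma>\<close>
  the sum is at most \<open>- \<mu> - \<nu> / 4\<close>, and the term \<open>\<nu> / 4\<close>
  outweighs the accumulated multiples of \<open>t\<close>. The result beats the size of
  \<open>T0\<close>.\<close>

lemma L_perturb_s1:
  assumes z: "z \<in> E M" "nrm s1 (z - u l) \<le> \<rho>" and x: "x \<in> E M"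
  shows "nrm s1 (L l z x - L0 x) \<le> M powr (- \<mu> - 4 * t) * nrm s1 x"
proof -
  let ?k = "z - u a" and ?\<kappa> = "nrm s1 (z - u a) + \<eta>"
  have kE: "?k \<in> E M" by (intro E_diff M(1) z uaE)
  have nx: "0 \<le> nrm s1 x" "0 \<le> nrm s1 ?k" using E_nrm_nonneg[OF M(1)] x kE s_nonneg by auto
  have \<kappa>: "0 \<le> ?\<kappa>" "nrm s1 ?k \<le> ?\<kappa>" using nx by auto
  have G: "nrm (s1 + \<nu>) y \<le> K * M powr \<nu> * nrm s1 y" if "y \<in> E M" for y
    by (rule E_gain[OF _ M(1) that]) simp
  have KM: "0 \<le> K * M powr \<nu>" using K by simp
  have "nrm (s1 + \<nu>) (u a) \<le> K * M powr \<nu> * 1"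
    using G[OF uaE] mult_left_mono[OF u_le1[OF aJ] KM] by linarith
  moreover have "nrm (s1 + \<nu>) ?k \<le> K * M powr \<nu> * ?\<kappa>"
    using G[OF kE] mult_left_mono[OF \<kappa>(2) KM] by linarith
  moreover note G[OF x]
  ultimately have "nrm s1 (L l z x - L0 x) \<le> K * K * (K * M powr \<nu> * 1 * ?\<kappa> * nrm s1 x
     + 3 * (K * M powr \<nu> * ?\<kappa>) * nrm s1 x + ?\<kappa> * (K * M powr \<nu> * nrm s1 x))"
    using \<kappa> nx K
    by (intro order_trans[OF L_perturb[OF z x, of s1]] mult_left_mono add_mono mult_right_mono) auto
  also have "\<dots> = (K * K * K * 5) * (M powr \<nu> * ?\<kappa>) * nrm s1 x" by (simp add: algebra_simps)
  also have "\<dots> \<le> M powr (- \<mu> - 4 * t) * nrm s1 x"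
  proof (rule mult_right_mono[OF _ nx(1)])
    have 1: "K * K * K * 5 \<le> M powr (4 * t)" by (rule pw_mult[OF _ _ pw_K3 pw_num]) (use K in auto)
    have 2: "M powr \<nu> * ?\<kappa> \<le> M powr (\<nu> + (- \<sigma> / 4 - \<nu> / 4 + t))"
      by (rule pw_mult[OF _ \<kappa>(1) order_refl drift(1)[OF z]]) auto
    show "(K * K * K * 5) * (M powr \<nu> * ?\<kappa>) \<le> M powr (- \<mu> - 4 * t)"
      by (rule pw_mult[OF _ _ 1 2]) (use K \<kappa> \<sigma> t in auto)
  qed
  finally show ?thesis .
qed

text \<open>The high norm of \<open>x\<close> carries the same small factor as at \<open>s1\<close>,
  so that it can be absorbed later; everything large falls on the low norm. The quantity
  \<open>nrm S (z - u l)\<close> stays explicit, since in \<open>solution_S\<close> it is the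
  unknown to be bounded.\<close>

lemma L_perturb_S:
  assumes z: "z \<in> E M" "nrm s1 (z - u l) \<le> \<rho>" and x: "x \<in> E M"
  shows "nrm S (L l z x - L0 x) \<le> M powr (- \<mu> - 4 * t) * nrm S x
    + (M powr (2 * \<mu> + 3 / 2 * \<nu> + 2 + 20 * t) + M powr (\<nu> + 20 * t) * nrm S (z - u l)) * nrm s1 x"
proof -
  let ?k = "z - u a" and ?\<kappa> = "nrm s1 (z - u a) + \<eta>" and ?h = "nrm S (z - u l)"
  have kE: "?k \<in> E M" "z - u l \<in> E M" by (intro E_diff M(1) z uaE ulE)+
  have pos: "0 \<le> nrm s1 x" "0 \<le> nrm S x" "0 \<le> nrm s1 ?k" "0 \<le> ?h"
    using E_nrm_nonneg[OF M(1)] x kE s_nonneg by auto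
  have \<kappa>: "0 \<le> ?\<kappa>" using pos by auto
  have Gx: "nrm (S + \<nu>) x \<le> K * M powr \<nu> * nrm S x"
    by (rule E_gain[OF _ M(1) x]) simp
  have "nrm S (L l z x - L0 x) \<le> K * K * (M powr (\<nu> / 2 + p + 5 * t) * ?\<kappa> * nrm s1 x
     + 3 * (M powr (\<nu> + t) * ?h + M powr (3 / 2 * \<nu> + 2 * \<mu> + 2 + 6 * t)) * nrm s1 x
     + ?\<kappa> * (K * M powr \<nu> * nrm S x))"
    using \<kappa> pos K Gx u_S\<nu>[OF aJ] drift(2)[OF z]
    by (intro order_trans[OF L_perturb[OF z x, of S]] mult_left_mono add_mono mult_right_mono) auto
  also have "\<dots> = (K * K * K) * (M powr \<nu> * ?\<kappa>) * nrm S x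
     + (K * K * (M powr (\<nu> / 2 + p + 5 * t) * ?\<kappa>) + (K * K * 3) * M powr (3 / 2 * \<nu> + 2 * \<mu> + 2 + 6 * t)
       + (K * K * 3) * M powr (\<nu> + t) * ?h) * nrm s1 x"
    by (simp add: algebra_simps)
  also have "\<dots> \<le> M powr (- \<mu> - 4 * t) * nrm S x
    + (M powr (2 * \<mu> + 3 / 2 * \<nu> + 2 + 20 * t) + M powr (\<nu> + 20 * t) * ?h) * nrm s1 x"
  proof (intro add_mono mult_right_mono pos)
    have 2: "M powr \<nu> * ?\<kappa> \<le> M powr (\<nu> + (- \<sigma> / 4 - \<nu> / 4 + t))"
      by (rule pw_mult[OF _ \<kappa>(1) order_refl drift(1)[OF z]]) auto
    show "(K * K * K) * (M powr \<nu> * ?\<kappa>) \<le> M powr (- \<mu> - 4 * t)"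
      by (rule pw_mult[OF _ _ pw_K3 2]) (use K \<kappa> \<sigma> t in auto)
    have K3: "K * K * 3 \<le> M powr (3 * t)" by (rule pw_mult[OF _ _ pw_K2 pw_num]) (use K in auto)
    have "M powr (\<nu> / 2 + p + 5 * t) * ?\<kappa> \<le> M powr (\<nu> / 2 + p + 5 * t + (- \<sigma> / 4 - \<nu> / 4 + t))"
      by (rule pw_mult[OF _ \<kappa>(1) order_refl drift(1)[OF z]]) auto
    from pw_mult[OF _ _ pw_K2 this order_refl]
    have A1: "K * K * (M powr (\<nu> / 2 + p + 5 * t) * ?\<kappa>) \<le> M powr (2 * t + (\<nu> / 2 + p + 5 * t + (- \<sigma> / 4 - \<nu> / 4 + t)))"
      using K \<kappa> by simp
    have A2: "(K * K * 3) * M powr (3 / 2 * \<nu> + 2 * \<mu> + 2 + 6 * t) \<le> M powr (3 * t + (3 / 2 * \<nu> + 2 * \<mu> + 2 + 6 * t))"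
      by (rule pw_mult[OF _ _ K3 order_refl]) (use K in auto)
    show "K * K * (M powr (\<nu> / 2 + p + 5 * t) * ?\<kappa>) + (K * K * 3) * M powr (3 / 2 * \<nu> + 2 * \<mu> + 2 + 6 * t)
        \<le> M powr (2 * \<mu> + 3 / 2 * \<nu> + 2 + 20 * t)"
      by (rule pw_add[OF A1 A2]) (use arith t p \<sigma> in auto)
    show "(K * K * 3) * M powr (\<nu> + t) \<le> M powr (\<nu> + 20 * t)"
      by (rule pw_mult[OF _ _ K3 order_refl]) (use K t in auto)
  qed
  finally show ?thesis .
qed

end

lemma ball_convex:
  assumes "l \<in> J" "z \<in> E M" "z' \<in> E M" "nrm s1 (z - u l) \<le> r" "nrm s1 (z' - u l) \<le> r" "\<theta> \<in> {0..1}"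
  shows "z' + \<theta> *\<^sub>R (z - z') \<in> E M" "nrm s1 (z' + \<theta> *\<^sub>R (z - z') - u l) \<le> r"
proof -
  show "z' + \<theta> *\<^sub>R (z - z') \<in> E M" using assms by (intro E_add E_scale E_diff M(1))
  have m: "z \<in> X s1" "z' \<in> X s1" "u l \<in> X s1" using assms EX uE s_nonneg by auto
  have "z' + \<theta> *\<^sub>R (z - z') - u l = (1 - \<theta>) *\<^sub>R (z' - u l) + \<theta> *\<^sub>R (z - u l)"
    by (simp add: algebra_simps)
  also have "nrm s1 \<dots> \<le> nrm s1 ((1 - \<theta>) *\<^sub>R (z' - u l)) + nrm s1 (\<theta> *\<^sub>R (z - u l))"
    by (intro normed_triangle[OF norms(1)] normed_mem[OF norms(1)] m)
  also have "\<dots> = (1 - \<theta>) * nrm s1 (z' - u l) + \<theta> * nrm s1 (z - u l)"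
    using assms(6) m by (simp add: normed_scale[OF norms(1)] normed_diff_mem[OF norms(1)])
  also have "\<dots> \<le> (1 - \<theta>) * r + \<theta> * r" using assms by (intro add_mono mult_left_mono) auto
  finally show "nrm s1 (z' + \<theta> *\<^sub>R (z - z') - u l) \<le> r" by (simp add: algebra_simps)
qed

section \<open>The correction at a single parameter\<close>

context
  fixes a l :: real
  assumes a: "a \<in> A" and l: "l \<in> J" and la: "\<bar>l - a\<bar> < \<eta>"
begin

abbreviation (input) "La \<equiv> L a (u a)"
abbreviation (input) "Ta \<equiv> inv_into (E M) (L a (u a))"

lemmas near = a l la

lemma g_linearize:
  assumes z: "z \<in> E M" "nrm s1 (z - u l) \<le> \<rho>" and z': "z' \<in> E M" "nrm s1 (z' - u l) \<le> \<rho>"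
    and s: "s \<in> {s1, S}" and B: "0 \<le> B"
    and bound: "\<And>\<theta>. \<theta> \<in> {0..1} \<Longrightarrow> nrm s (L l (z' + \<theta> *\<^sub>R (z - z')) (z - z') - La (z - z')) \<le> B"
  shows "nrm s (g l z - g l z' - La (z - z')) \<le> B"
proof -
  have sn: "0 \<le> s" using sel_nonneg[OF s] by auto
  have zz: "z - z' \<in> E M" by (intro E_diff M(1) z z')
  have "nrm s (P M (F \<epsilon> l (z' + (z - z'))) - P M (F \<epsilon> l z') - La (z - z')) \<le> B"
  proof (rule T_F_diff[OF \<epsilon>' sn P_bounded_linear[OF M(1) s0_nonneg sn] l _ _ _ B])
    show "z' \<in> X (s0 + \<nu>)" "z - z' \<in> X (s0 + \<nu>)" using EX z' zz s0\<nu> by auto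
    show "La (z - z') \<in> X s" by (intro EX L_mem aJ[OF near] uaE[OF near] zz sn)
    show "nrm s (P M (DF \<epsilon> (l, z' + \<theta> *\<^sub>R (z - z')) (0, z - z')) - La (z - z')) \<le> B"
      if "\<theta> \<in> {0..1}" for \<theta>
      using bound[OF that] by (simp add: L_def')
  qed
  then show ?thesis by simp
qed

lemma g_linearize_s1:
  assumes z: "z \<in> E M" "nrm s1 (z - u l) \<le> \<rho>" and z': "z' \<in> E M" "nrm s1 (z' - u l) \<le> \<rho>"
  shows "nrm s1 (g l z - g l z' - La (z - z')) \<le> M powr (- \<mu> - 4 * t) * nrm s1 (z - z')"
proof (rule g_linearize[OF z z'])
  show "0 \<le> M powr (- \<mu> - 4 * t) * nrm s1 (z - z')"
    using E_nrm_nonneg[OF M(1) E_diff[OF M(1) z(1) z'(1)]] s_nonneg by simp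
  show "nrm s1 (L l (z' + \<theta> *\<^sub>R (z - z')) (z - z') - La (z - z')) \<le> M powr (- \<mu> - 4 * t) * nrm s1 (z - z')"
    if "\<theta> \<in> {0..1}" for \<theta>
    using ball_convex[OF l z(1) z'(1) z(2) z'(2) that]
    by (intro L_perturb_s1 near E_diff M(1) z z')
qed simp

lemma T0_small:
  assumes "d \<in> E M" "nrm s1 d \<le> M powr (- \<mu> - 4 * t) * c" "0 \<le> c"
  shows "nrm s1 (Ta d) \<le> 1/2 * c"
proof -
  have "nrm s1 (Ta d) \<le> M powr (\<mu> + 2 * t) * nrm s1 d" by (rule T0_s1[OF near assms(1)])
  also have "\<dots> \<le> M powr (\<mu> + 2 * t) * (M powr (- \<mu> - 4 * t) * c)"
    by (rule mult_left_mono[OF assms(2)]) simp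
  also have "\<dots> = M powr (- 2 * t) * c" by (simp flip: powr_add mult.assoc)
  also have "\<dots> \<le> 1/2 * c" by (intro mult_right_mono pw_half assms) (use t in auto)
  finally show ?thesis .
qed

text \<open>The vector on the left is, up to sign, \<open>Ta\<close> applied to the linearization
  error; the factor \<open>M powr (- \<mu> - 4 * t)\<close> of the latter beats the norm
  \<open>M powr (\<mu> + 2 * t)\<close> of \<open>Ta\<close>.\<close>

lemma newton_contraction:
  assumes z: "z \<in> E M" "nrm s1 (z - u l) \<le> \<rho>" and z': "z' \<in> E M" "nrm s1 (z' - u l) \<le> \<rho>"
  shows "nrm s1 (z - z' - Ta (g l z - g l z')) \<le> 1/2 * nrm s1 (z - z')"
proof -
  have zz: "z - z' \<in> E M" by (intro E_diff M(1) z z')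
  have gE: "g l z - g l z' \<in> E M" by (intro E_diff M(1) g_mem l z z')
  have LE: "La (z - z') \<in> E M" by (rule L0_mem[OF near zz])
  have dE: "g l z - g l z' - La (z - z') \<in> E M" by (intro E_diff M(1) gE LE)
  have "Ta (g l z - g l z' - La (z - z')) = - (z - z' - Ta (g l z - g l z'))"
    using T0_diff[OF near gE LE] T0_L0[OF near zz] by simp
  then have "nrm s1 (z - z' - Ta (g l z - g l z')) = nrm s1 (Ta (g l z - g l z' - La (z - z')))"
    using normed_minus[OF norms(1), of "z - z' - Ta (g l z - g l z')"]
      EX[OF E_diff[OF M(1) zz T0_mem[OF near gE]] s_nonneg(1)] by simp
  also have "\<dots> \<le> 1/2 * nrm s1 (z - z')"
    by (rule T0_small[OF dE g_linearize_s1[OF z z'] E_nrm_nonneg[OF M(1) zz s_nonneg(1)]])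
  finally show ?thesis .
qed

text \<open>\<open>Ta (g l z - g l z')\<close> differs from \<open>z - z'\<close> by at most half of
  its norm, so \<open>g l\<close> is injective on the ball with a quantitative inverse. Uniqueness,
  Lipschitz dependence on the parameter, and the sharper size of the correction are drawn from
  this.\<close>

lemma newton_stable:
  assumes z: "z \<in> E M" "nrm s1 (z - u l) \<le> \<rho>" and z': "z' \<in> E M" "nrm s1 (z' - u l) \<le> \<rho>"
  shows "nrm s1 (z - z') \<le> M powr (\<mu> + 3 * t) * nrm s1 (g l z - g l z')"
proof -
  have zz: "z - z' \<in> E M" by (intro E_diff M(1) z z')
  have gE: "g l z - g l z' \<in> E M" by (intro E_diff M(1) g_mem l z z')
  note X1 = EX[OF _ s_nonneg(1)]
  have "nrm s1 (z - z') \<le> nrm s1 (Ta (g l z - g l z')) + nrm s1 (z - z' - Ta (g l z - g l z'))"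
    by (intro normed_le_add_diff[OF norms(1)] X1 zz T0_mem[OF near] gE)
  also note newton_contraction[OF z z']
  finally have "nrm s1 (z - z') \<le> 2 * nrm s1 (Ta (g l z - g l z'))" by simp
  also have "\<dots> \<le> 2 * (M powr (\<mu> + 2 * t) * nrm s1 (g l z - g l z'))"
    using T0_s1[OF near gE] by simp
  also have "\<dots> = (2 * M powr (\<mu> + 2 * t)) * nrm s1 (g l z - g l z')" by simp
  also have "\<dots> \<le> M powr (\<mu> + 3 * t) * nrm s1 (g l z - g l z')"
    by (intro mult_right_mono pw_mult[OF _ _ pw_num order_refl] E_nrm_nonneg[OF M(1) gE s_nonneg(1)]) auto
  finally show ?thesis .
qed

lemma l_nbhd: "l \<in> open_nbhd A \<eta> \<inter> J"
  using a l la by (auto simp: open_nbhd_def dist_real_def intro!: bexI[of _ a])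

text \<open>The iteration never leaves a complete subspace \<open>C\<close> that contains
  \<open>u l\<close> and is preserved by \<open>g l\<close> and \<open>Ta\<close>. With
  \<open>C = E M\<close> this is existence; with an invariant subspace it places the same solution
  in that subspace.\<close>

lemma solution_exists:
  assumes C: "subspace C" "C \<subseteq> E M" "ncomplete (nrm s1) C" "u l \<in> C"
    and TC: "\<And>y. y \<in> C \<Longrightarrow> Ta y \<in> C" and gC: "\<And>z. z \<in> C \<Longrightarrow> g l z \<in> C"
  shows "\<exists>z\<in>C. nrm s1 (z - u l) \<le> \<rho> \<and> g l z = 0"
proof (rule quasi_newton_zero[OF norms(1) C(1) _ C(3,4) TC])
  show "C \<subseteq> X s1" using C EX s_nonneg by blast
  show "y \<in> C \<Longrightarrow> y' \<in> C \<Longrightarrow> Ta (y - y') = Ta y - Ta y'" for y y'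
    using T0_diff[OF near] C by blast
  show "y \<in> C \<Longrightarrow> Ta y = 0 \<Longrightarrow> y = 0" for y
    using L0_T0[OF near, of y] C L_diff[OF aJ[OF near] uaE[OF near], of 0 0] E_zero[OF M(1)] by auto
  show "nrm s1 (z - z' - Ta (g l z - g l z')) \<le> 1 / 2 * nrm s1 (z - z')"
    if "z \<in> C" "nrm s1 (z - u l) \<le> \<rho>" "z' \<in> C" "nrm s1 (z' - u l) \<le> \<rho>" for z z'
    using newton_contraction that C by blast
  have gE: "g l (u l) \<in> E M" by (intro g_mem uE l)
  have "nrm s1 (Ta (g l (u l))) \<le> M powr (\<mu> + 2 * t) * nrm s1 (g l (u l))" by (rule T0_s1[OF near gE])
  also have "\<dots> \<le> M powr (\<mu> + 2 * t) * M powr (- 2 - \<sigma> - \<mu> + 10 * t)"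
    by (rule mult_left_mono[OF res_s1[OF l_nbhd]]) simp
  also have "\<dots> = M powr (- 1 + 12 * t) * \<rho>"
    unfolding powr_add[symmetric] by (rule arg_cong[where f = "(powr) M"]) simp
  also have "\<dots> \<le> 1/2 * \<rho>" using t by (intro mult_right_mono pw_half) auto
  finally show "nrm s1 (Ta (g l (u l))) \<le> \<rho> / 2" by simp
qed (use gC in auto)

text \<open>Comparing the solution with \<open>u l\<close> improves the radius \<open>\<rho>\<close>
  by nearly a factor \<open>M\<close>. The gain keeps the solution in the inner half of the ball and
  makes the increments summable.\<close>

lemma solution_s1:
  assumes z: "z \<in> E M" "nrm s1 (z - u l) \<le> \<rho>" "g l z = 0"
  shows "nrm s1 (z - u l) \<le> M powr (- 2 - \<sigma> + 13 * t)"
proof -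
  have "nrm s1 (u l - u l) \<le> \<rho>" using normed_zero[OF norms(1)] by simp
  from newton_stable[OF z(1,2) uE(1)[OF l] this]
  have "nrm s1 (z - u l) \<le> M powr (\<mu> + 3 * t) * nrm s1 (- g l (u l))" using z(3) by simp
  also have "nrm s1 (- g l (u l)) = nrm s1 (g l (u l))"
    by (rule normed_minus[OF norms(1)]) (intro EX g_mem l uE s_nonneg)
  also have "M powr (\<mu> + 3 * t) * nrm s1 (g l (u l)) \<le> M powr (- 2 - \<sigma> + 13 * t)"
    by (rule pw_mult[OF _ _ order_refl res_s1[OF l_nbhd]])
       (auto intro!: E_nrm_nonneg[OF M(1)] g_mem l uE s_nonneg)
  finally show ?thesis .
qed

lemma T0_sum:
  assumes x: "x \<in> E M" "y \<in> E M" "d \<in> E M" "La x = y + d"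
  shows "nrm S x \<le> M powr (\<mu> + t) * (nrm S y + nrm S d)
      + M powr (2 * \<mu> + \<sigma> + 2 + \<nu> / 2 + 2 * t) * (nrm s1 y + nrm s1 d)"
proof -
  have yd: "y + d \<in> E M" by (intro E_add M(1) x)
  have "x = Ta (y + d)" using T0_L0[OF near x(1)] x(4) by simp
  then have "nrm S x \<le> M powr (\<mu> + t) * nrm S (y + d) + M powr (\<mu> + \<sigma> + 1 + p + 2 * t) * nrm s1 (y + d)"
    using T0_S[OF near yd] by simp
  also have "\<dots> \<le> M powr (\<mu> + t) * (nrm S y + nrm S d) + M powr (\<mu> + \<sigma> + 1 + p + 2 * t) * (nrm s1 y + nrm s1 d)"
    by (intro add_mono mult_left_mono normed_triangle[OF norms(1)] normed_triangle[OF norms(2)] EX x s_nonneg) auto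
  also have "\<mu> + \<sigma> + 1 + p + 2 * t = 2 * \<mu> + \<sigma> + 2 + \<nu> / 2 + 2 * t" by (simp add: p)
  finally show ?thesis .
qed

text \<open>The linearization error at \<open>S\<close> contains the unknown
  \<open>nrm S (z - u l)\<close> twice with a small factor: once through the perturbed operator, and
  once through a quadratic term made small by the bound at \<open>s1\<close>. After applying
  \<open>Ta\<close> both are absorbed on the left. The leading exponent
  \<open>2 * \<mu> + \<nu> + 1\<close> is the inverse acting on the residual at
  \<open>S\<close>.\<close>

lemma solution_S:
  assumes z: "z \<in> E M" "nrm s1 (z - u l) \<le> \<rho>" "g l z = 0"
  shows "nrm S (z - u l) \<le> M powr (2 * \<mu> + \<nu> + 1 + 16 * t)"
proof -
  let ?h = "z - u l"
  let ?w = "M powr (2 * \<mu> + 3 / 2 * \<nu> - \<sigma> + 33 * t)"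
  have h: "?h \<in> E M" by (intro E_diff M(1) z uE l)
  have ball: "nrm s1 (u l - u l) \<le> \<rho>" using normed_zero[OF norms(1)] by simp
  have pos: "0 \<le> nrm s1 ?h" "0 \<le> nrm S ?h" using E_nrm_nonneg[OF M(1) h] s_nonneg by auto
  have hs1: "nrm s1 ?h \<le> M powr (- 2 - \<sigma> + 13 * t)" by (rule solution_s1[OF z])
  have ul: "u l \<in> E M" by (rule uE(1)[OF l])
  have gE: "g l (u l) \<in> E M" "- g l (u l) \<in> E M" by (intro E_minus g_mem M(1) l ul)+
  define e where "e = - (g l z - g l (u l) - La ?h)"
  have e: "e \<in> E M" unfolding e_def by (intro E_minus E_diff g_mem L_mem aJ[OF near] uaE[OF near] M(1) l ul z h)
  have nme: "nrm s e = nrm s (g l z - g l (u l) - La ?h)" if "0 \<le> s" for s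
    unfolding e_def
    by (rule normed_minus[OF normed_X[OF that]]) (intro EX E_diff g_mem L_mem aJ[OF near] uaE[OF near] M(1) l ul z h that)
  have eq: "La ?h = - g l (u l) + e" by (simp add: e_def z(3))
  have e1: "nrm s1 e \<le> M powr (- \<mu> - 4 * t) * nrm s1 ?h"
    unfolding nme[OF s_nonneg(1)] by (rule g_linearize_s1[OF z(1,2) ul ball])
  also have "\<dots> \<le> M powr (- 2 - \<sigma> - \<mu> + 9 * t)"
    by (rule pw_mult[OF _ _ order_refl hs1]) (use pos in auto)
  finally have e1': "nrm s1 e \<le> M powr (- 2 - \<sigma> - \<mu> + 9 * t)" .
  have eS: "nrm S e \<le> 2 * (M powr (- \<mu> - 4 * t) * nrm S ?h) + ?w"
    unfolding nme[OF s_nonneg(2)]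
  proof (rule g_linearize[OF z(1,2) ul ball])
    show "0 \<le> 2 * (M powr (- \<mu> - 4 * t) * nrm S ?h) + ?w" using pos by simp
    fix \<theta> :: real assume \<theta>: "\<theta> \<in> {0..1}"
    let ?v = "u l + \<theta> *\<^sub>R ?h"
    have v: "?v \<in> E M" "nrm s1 (?v - u l) \<le> \<rho>" by (rule ball_convex[OF l z(1) ul z(2) ball \<theta>])+
    have "nrm S (?v - u l) = \<theta> * nrm S ?h"
      using \<theta> normed_scale[OF norms(2) EX[OF h s_nonneg(2)], of \<theta>] by simp
    then have vS: "nrm S (?v - u l) \<le> nrm S ?h" using \<theta> pos mult_right_mono[of \<theta> 1 "nrm S ?h"] by simp
    have c1: "M powr (2 * \<mu> + 3 / 2 * \<nu> + 2 + 20 * t) * nrm s1 ?h \<le> ?w"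
      by (rule pw_mult[OF _ pos(1) order_refl hs1]) auto
    have c2: "M powr (\<nu> + 20 * t) * nrm s1 ?h \<le> M powr (- \<mu> - 4 * t)"
      by (rule pw_mult[OF _ pos(1) order_refl hs1]) (use t \<sigma> arith[OF near] in auto)
    have "nrm S (L l ?v ?h - La ?h) \<le> M powr (- \<mu> - 4 * t) * nrm S ?h
      + (M powr (2 * \<mu> + 3 / 2 * \<nu> + 2 + 20 * t) + M powr (\<nu> + 20 * t) * nrm S (?v - u l)) * nrm s1 ?h"
      by (rule L_perturb_S[OF near v h])
    also have "\<dots> \<le> M powr (- \<mu> - 4 * t) * nrm S ?h
      + (M powr (2 * \<mu> + 3 / 2 * \<nu> + 2 + 20 * t) + M powr (\<nu> + 20 * t) * nrm S ?h) * nrm s1 ?h"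
      using vS pos by (intro add_left_mono mult_right_mono mult_left_mono) auto
    also have "\<dots> = M powr (- \<mu> - 4 * t) * nrm S ?h + (M powr (2 * \<mu> + 3 / 2 * \<nu> + 2 + 20 * t) * nrm s1 ?h
       + (M powr (\<nu> + 20 * t) * nrm s1 ?h) * nrm S ?h)" by (simp add: algebra_simps)
    also have "\<dots> \<le> M powr (- \<mu> - 4 * t) * nrm S ?h + (?w + M powr (- \<mu> - 4 * t) * nrm S ?h)"
      by (intro add_left_mono add_mono c1 mult_right_mono c2 pos)
    finally show "nrm S (L l ?v ?h - La ?h) \<le> 2 * (M powr (- \<mu> - 4 * t) * nrm S ?h) + ?w" by linarith
  qed simp
  have r: "nrm s1 (- g l (u l)) \<le> M powr (- 2 - \<sigma> - \<mu> + 10 * t)" "nrm S (- g l (u l)) \<le> M powr (\<nu> / 2 + p + 10 * t)"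
    using res_s1[OF l_nbhd] res_S[OF l_nbhd] normed_minus[OF norms(1)] normed_minus[OF norms(2)] EX[OF gE(1)] s_nonneg
    by auto
  have "nrm S ?h \<le> M powr (\<mu> + t) * (nrm S (- g l (u l)) + nrm S e)
      + M powr (2 * \<mu> + \<sigma> + 2 + \<nu> / 2 + 2 * t) * (nrm s1 (- g l (u l)) + nrm s1 e)"
    by (rule T0_sum[OF h gE(2) e eq])
  also have "\<dots> \<le> M powr (\<mu> + t) * (M powr (\<nu> / 2 + p + 10 * t) + (2 * (M powr (- \<mu> - 4 * t) * nrm S ?h) + ?w))
      + M powr (2 * \<mu> + \<sigma> + 2 + \<nu> / 2 + 2 * t) * (M powr (- 2 - \<sigma> - \<mu> + 10 * t) + M powr (- 2 - \<sigma> - \<mu> + 9 * t))"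
    by (intro add_mono mult_left_mono r eS e1') auto
  also have "\<dots> = (M powr (\<mu> + t) * M powr (\<nu> / 2 + p + 10 * t) + M powr (\<mu> + t) * ?w
      + M powr (2 * \<mu> + \<sigma> + 2 + \<nu> / 2 + 2 * t) * (M powr (- 2 - \<sigma> - \<mu> + 10 * t) + M powr (- 2 - \<sigma> - \<mu> + 9 * t)))
      + (2 * (M powr (\<mu> + t) * M powr (- \<mu> - 4 * t))) * nrm S ?h" by (simp add: algebra_simps)
  also have "\<dots> \<le> M powr (2 * \<mu> + \<nu> + 1 + 15 * t) + 1/2 * nrm S ?h"
  proof (intro add_mono mult_right_mono pos)
    have "M powr (\<mu> + t) * M powr (- \<mu> - 4 * t) = M powr (- 2 * t) * M powr (- t)" by (simp flip: powr_add)
    also have "\<dots> \<le> 1/2 * (1/2)" using t by (intro mult_mono pw_half) auto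
    finally show "2 * (M powr (\<mu> + t) * M powr (- \<mu> - 4 * t)) \<le> 1/2" by simp
    have b1: "M powr (\<mu> + t) * M powr (\<nu> / 2 + p + 10 * t) \<le> M powr (2 * \<mu> + \<nu> + 1 + 11 * t)"
      by (rule pw_mult[OF _ _ order_refl order_refl]) (auto simp: p)
    have b2: "M powr (\<mu> + t) * ?w \<le> M powr (2 * \<mu> + \<nu> + 1 + 11 * t)"
      by (rule pw_mult[OF _ _ order_refl order_refl]) (use \<sigma> t arith[OF near] in auto)
    have b3: "M powr (2 * \<mu> + \<sigma> + 2 + \<nu> / 2 + 2 * t) * (M powr (- 2 - \<sigma> - \<mu> + 10 * t) + M powr (- 2 - \<sigma> - \<mu> + 9 * t))
       \<le> M powr (2 * \<mu> + \<nu> + 1 + 13 * t)"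
      by (rule pw_mult[OF _ _ order_refl pw_add[OF order_refl order_refl order_refl]])
         (use t arith[OF near] in auto)
    show "M powr (\<mu> + t) * M powr (\<nu> / 2 + p + 10 * t) + M powr (\<mu> + t) * ?w
      + M powr (2 * \<mu> + \<sigma> + 2 + \<nu> / 2 + 2 * t) * (M powr (- 2 - \<sigma> - \<mu> + 10 * t) + M powr (- 2 - \<sigma> - \<mu> + 9 * t))
      \<le> M powr (2 * \<mu> + \<nu> + 1 + 15 * t)"
      by (rule pw_add[OF pw_add[OF b1 b2 order_refl] b3]) (use t in auto)
  qed
  finally have "nrm S ?h \<le> 2 * M powr (2 * \<mu> + \<nu> + 1 + 15 * t)" by simp
  also have "\<dots> \<le> M powr (2 * \<mu> + \<nu> + 1 + 16 * t)"
    by (rule pw_mult[OF _ _ pw_num order_refl]) auto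
  finally show ?thesis .
qed

lemma L_inverse_s1:
  assumes z: "z \<in> E M" "nrm s1 (z - u l) \<le> \<rho>" and x: "x \<in> E M"
  shows "nrm s1 x \<le> M powr (\<mu> + 3 * t) * nrm s1 (L l z x)"
proof -
  have m: "L l z x \<in> E M" "La x \<in> E M" "L l z x - La x \<in> E M"
    by (intro E_diff L_mem L_mem aJ[OF near] uaE[OF near] M(1) l z x)+
  have nx: "0 \<le> nrm s1 x" by (rule E_nrm_nonneg[OF M(1) x s_nonneg(1)])
  have "x = Ta (L l z x) - Ta (L l z x - La x)"
    using T0_diff[OF near m(1,2)] T0_L0[OF near x] by simp
  then have "nrm s1 x \<le> nrm s1 (Ta (L l z x)) + nrm s1 (Ta (L l z x - La x))"
    using normed_diff_le[OF norms(1) EX EX, OF T0_mem[OF near m(1)] s_nonneg(1) T0_mem[OF near m(3)] s_nonneg(1)] by simp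
  also have "nrm s1 (Ta (L l z x - La x)) \<le> 1/2 * nrm s1 x"
    by (rule T0_small[OF m(3) L_perturb_s1[OF near z x] nx])
  finally have "nrm s1 x \<le> 2 * nrm s1 (Ta (L l z x))" by simp
  also have "\<dots> \<le> 2 * (M powr (\<mu> + 2 * t) * nrm s1 (L l z x))"
    using T0_s1[OF near m(1)] by simp
  also have "\<dots> = (2 * M powr (\<mu> + 2 * t)) * nrm s1 (L l z x)" by simp
  also have "\<dots> \<le> M powr (\<mu> + 3 * t) * nrm s1 (L l z x)"
    by (intro mult_right_mono pw_mult[OF _ _ pw_num order_refl] E_nrm_nonneg[OF M(1) m(1) s_nonneg(1)]) auto
  finally show ?thesis .
qed

text \<open>\<open>E M\<close> may be infinite-dimensional, so injectivity does not give
  surjectivity. Instead \<open>quasi_newton_zero\<close> is applied to the affine map with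
  \<open>L l z x - y\<close> as value at \<open>x\<close>, for which the contraction holds globally;
  the radius is chosen to fit the first step from 0.\<close>

lemma L_surjective:
  assumes z: "z \<in> E M" "nrm s1 (z - u l) \<le> \<rho>" and y: "y \<in> E M"
  shows "\<exists>x\<in>E M. L l z x = y"
proof -
  have "\<exists>x\<in>E M. nrm s1 (x - 0) \<le> 2 * nrm s1 (Ta (L l z 0 - y)) \<and> L l z x - y = 0"
  proof (rule quasi_newton_zero[OF norms(1) E_subspace'[OF M(1)]])
    show "E M \<subseteq> X s1" using EX s_nonneg by blast
    show "ncomplete (nrm s1) (E M)" by (rule E_complete[OF M(1) s_nonneg(1)])
    show "0 \<in> E M" by (rule E_zero[OF M(1)])
    show "y \<in> E M \<Longrightarrow> Ta y \<in> E M" for y by (rule T0_mem[OF near])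
    show "y \<in> E M \<Longrightarrow> y' \<in> E M \<Longrightarrow> Ta (y - y') = Ta y - Ta y'" for y y' by (rule T0_diff[OF near])
    show "y \<in> E M \<Longrightarrow> Ta y = 0 \<Longrightarrow> y = 0" for y
      using L0_T0[OF near, of y] L_diff[OF aJ[OF near] uaE[OF near], of 0 0] E_zero[OF M(1)] by auto
    show "x \<in> E M \<Longrightarrow> L l z x - y \<in> E M" for x by (intro E_diff L_mem M(1) l z y)
    show "0 \<le> 2 * nrm s1 (Ta (L l z 0 - y))"
      using E_nrm_nonneg[OF M(1) T0_mem[OF near] s_nonneg(1)] E_diff[OF M(1) L_mem[OF l z(1)] y] E_zero[OF M(1)] by simp
    fix x x' assume x: "x \<in> E M" "x' \<in> E M"
    have xx: "x - x' \<in> E M" by (intro E_diff M(1) x)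
    have m: "L l z (x - x') \<in> E M" "La (x - x') \<in> E M" by (intro L_mem L_mem aJ[OF near] uaE[OF near] l z xx)+
    have "x - x' - Ta (L l z (x - x')) = - Ta (L l z (x - x') - La (x - x'))"
      using T0_diff[OF near m] T0_L0[OF near xx] by simp
    then have "nrm s1 (x - x' - Ta (L l z (x - x'))) = nrm s1 (Ta (L l z (x - x') - La (x - x')))"
      using normed_minus[OF norms(1) EX, OF T0_mem[OF near] s_nonneg(1)] E_diff[OF M(1) m] by simp
    also have "\<dots> \<le> 1/2 * nrm s1 (x - x')"
      by (rule T0_small[OF E_diff[OF M(1) m] L_perturb_s1[OF near z xx] E_nrm_nonneg[OF M(1) xx s_nonneg(1)]])
    finally show "nrm s1 (x - x' - Ta (L l z x - y - (L l z x' - y))) \<le> 1 / 2 * nrm s1 (x - x')"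
      by (simp add: L_diff[OF l z(1) x])
  qed simp
  then show ?thesis by auto
qed

lemma L_inverse_S:
  assumes z: "z \<in> E M" "nrm s1 (z - u l) \<le> \<rho>" and x: "x \<in> E M"
    and zS: "nrm S (z - u l) \<le> M powr (2 * \<mu> + \<nu> + 1 + 16 * t)"
  shows "nrm S x \<le> M powr (\<mu> + 2 * t) * nrm S (L l z x) + M powr (2 * \<mu> + \<sigma> + 2 + \<nu> / 2 + 6 * t) * nrm s1 (L l z x)"
proof -
  let ?y = "L l z x" and ?d = "- (L l z x - La x)"
  let ?e = "2 * \<mu> + \<sigma> + 2 + \<nu> / 2 + 2 * t"
  have m: "?y \<in> E M" "?d \<in> E M" "L l z x - La x \<in> E M"
    by (intro E_minus E_diff L_mem L_mem aJ[OF near] uaE[OF near] M(1) l z x)+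
  have pos: "0 \<le> nrm S x" "0 \<le> nrm s1 x" "0 \<le> nrm s1 ?y" "0 \<le> nrm S ?y" "0 \<le> nrm S (z - u l)"
    using E_nrm_nonneg[OF M(1)] x m s_nonneg E_diff[OF M(1) z(1) uE(1)[OF l]] by auto
  have nd: "nrm s ?d = nrm s (L l z x - La x)" if "0 \<le> s" for s
    by (rule normed_minus[OF normed_X[OF that] EX[OF m(3) that]])
  have x1: "nrm s1 x \<le> M powr (\<mu> + 3 * t) * nrm s1 ?y" by (rule L_inverse_s1[OF z x])
  have d1: "nrm s1 ?d \<le> 1 * nrm s1 ?y"
  proof -
    have "nrm s1 ?d \<le> M powr (- \<mu> - 4 * t) * nrm s1 x"
      using L_perturb_s1[OF near z x] nd[OF s_nonneg(1)] by simp
    also have "\<dots> \<le> M powr (- \<mu> - 4 * t) * (M powr (\<mu> + 3 * t) * nrm s1 ?y)"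
      using x1 by (intro mult_left_mono) auto
    also have "\<dots> = M powr (- t) * nrm s1 ?y" by (simp flip: powr_add mult.assoc)
    also have "\<dots> \<le> 1 * nrm s1 ?y" using pw_half[of "- t"] pos by (intro mult_right_mono) auto
    finally show ?thesis .
  qed
  let ?Q = "M powr (2 * \<mu> + 3 / 2 * \<nu> + 2 + 20 * t) + M powr (\<nu> + 20 * t) * nrm S (z - u l)"
  have Q: "?Q \<le> M powr (2 * \<mu> + 2 * \<nu> + 2 + 37 * t)"
  proof (rule pw_add[OF order_refl])
    show "M powr (\<nu> + 20 * t) * nrm S (z - u l) \<le> M powr (2 * \<mu> + 2 * \<nu> + 1 + 36 * t)"
      by (rule pw_mult[OF _ pos(5) order_refl zS]) auto
  qed (use t arith[OF near] in auto)
  have dS: "nrm S ?d \<le> M powr (- \<mu> - 4 * t) * nrm S x + M powr (2 * \<mu> + 2 * \<nu> + 2 + 37 * t) * (M powr (\<mu> + 3 * t) * nrm s1 ?y)"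
  proof -
    have "nrm S ?d \<le> M powr (- \<mu> - 4 * t) * nrm S x + ?Q * nrm s1 x"
      using L_perturb_S[OF near z x] nd[OF s_nonneg(2)] by simp
    also have "\<dots> \<le> M powr (- \<mu> - 4 * t) * nrm S x + M powr (2 * \<mu> + 2 * \<nu> + 2 + 37 * t) * (M powr (\<mu> + 3 * t) * nrm s1 ?y)"
      using Q x1 pos by (intro add_left_mono mult_mono) auto
    finally show ?thesis .
  qed
  have "nrm S x \<le> M powr (\<mu> + t) * (nrm S ?y + nrm S ?d) + M powr ?e * (nrm s1 ?y + nrm s1 ?d)"
    by (rule T0_sum[OF x m(1,2)]) simp
  also have "\<dots> \<le> M powr (\<mu> + t) * (nrm S ?y + (M powr (- \<mu> - 4 * t) * nrm S x + M powr (2 * \<mu> + 2 * \<nu> + 2 + 37 * t) * (M powr (\<mu> + 3 * t) * nrm s1 ?y)))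
      + M powr ?e * (nrm s1 ?y + 1 * nrm s1 ?y)"
    by (intro add_mono mult_left_mono dS d1 add_left_mono) auto
  also have "\<dots> = M powr (\<mu> + t) * nrm S ?y + (M powr (\<mu> + t) * M powr (- \<mu> - 4 * t)) * nrm S x
     + (M powr (\<mu> + t) * M powr (2 * \<mu> + 2 * \<nu> + 2 + 37 * t) * M powr (\<mu> + 3 * t) + 2 * M powr ?e) * nrm s1 ?y"
    by (simp add: algebra_simps)
  also have "\<dots> \<le> M powr (\<mu> + t) * nrm S ?y + 1/2 * nrm S x + M powr (2 * \<mu> + \<sigma> + 2 + \<nu> / 2 + 5 * t) * nrm s1 ?y"
  proof (intro add_mono mult_right_mono pos order_refl)
    have "M powr (\<mu> + t) * M powr (- \<mu> - 4 * t) = M powr (- 3 * t)" by (simp flip: powr_add)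
    also have "\<dots> \<le> 1/2" using t by (intro pw_half) auto
    finally show "M powr (\<mu> + t) * M powr (- \<mu> - 4 * t) \<le> 1/2" .
    have b1: "M powr (\<mu> + t) * M powr (2 * \<mu> + 2 * \<nu> + 2 + 37 * t) * M powr (\<mu> + 3 * t) \<le> M powr (4 * \<mu> + 2 * \<nu> + 2 + 41 * t)"
      by (rule pw_mult[OF _ _ pw_mult[OF _ _ order_refl order_refl order_refl] order_refl]) auto
    have b2: "2 * M powr ?e \<le> M powr (2 * \<mu> + \<sigma> + 2 + \<nu> / 2 + 3 * t)"
      by (rule pw_mult[OF _ _ pw_num order_refl]) auto
    show "M powr (\<mu> + t) * M powr (2 * \<mu> + 2 * \<nu> + 2 + 37 * t) * M powr (\<mu> + 3 * t) + 2 * M powr ?e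
       \<le> M powr (2 * \<mu> + \<sigma> + 2 + \<nu> / 2 + 5 * t)"
      by (rule pw_add[OF b1 b2]) (use t arith[OF near] \<sigma> in auto)
  qed
  finally have "nrm S x \<le> 2 * M powr (\<mu> + t) * nrm S ?y + 2 * M powr (2 * \<mu> + \<sigma> + 2 + \<nu> / 2 + 5 * t) * nrm s1 ?y"
    by (simp add: algebra_simps)
  also have "\<dots> \<le> M powr (\<mu> + 2 * t) * nrm S ?y + M powr (2 * \<mu> + \<sigma> + 2 + \<nu> / 2 + 6 * t) * nrm s1 ?y"
    by (rule add_mono[OF mult_right_mono[OF pw_mult[OF _ _ pw_num order_refl]] mult_right_mono[OF pw_mult[OF _ _ pw_num order_refl]]])
       (use pos in auto)
  finally show ?thesis .
qed

end

section \<open>The branch of solutions over the neighbourhood and its derivative\<close>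

abbreviation "U \<equiv> open_nbhd A \<eta> \<inter> J"

lemma U_near: "l \<in> U \<Longrightarrow> \<exists>a\<in>A. l \<in> J \<and> \<bar>l - a\<bar> < \<eta>"
  by (auto simp: open_nbhd_def dist_real_def abs_minus_commute)

text \<open>Off \<open>U\<close> the value is \<open>u l\<close>, so that the correction vanishes
  there. On \<open>U\<close> the choice is unambiguous by \<open>newton_stable\<close>.\<close>

definition sol :: "real \<Rightarrow> 'a" where
  "sol l = (if l \<in> U then SOME z. z \<in> E M \<and> nrm s1 (z - u l) \<le> \<rho> \<and> g l z = 0 else u l)"

lemma sol_unique:
  assumes l: "l \<in> U" and z: "z \<in> E M" "nrm s1 (z - u l) \<le> \<rho>" "g l z = 0"
    and z': "z' \<in> E M" "nrm s1 (z' - u l) \<le> \<rho>" "g l z' = 0"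
  shows "z = z'"
proof -
  obtain a where a: "a \<in> A" "l \<in> J" "\<bar>l - a\<bar> < \<eta>" using U_near[OF l] by blast
  have "nrm s1 (z - z') \<le> M powr (\<mu> + 3 * t) * nrm s1 (g l z - g l z')"
    by (rule newton_stable[OF a z(1,2) z'(1,2)])
  also have "\<dots> = 0" using z z' normed_zero[OF norms(1)] by simp
  finally have "nrm s1 (z - z') \<le> 0" .
  moreover have m: "z - z' \<in> E M" by (intro E_diff M(1) z z')
  ultimately have "nrm s1 (z - z') = 0" using E_nrm_nonneg[OF M(1) m s_nonneg(1)] by simp
  then show ?thesis using normed_eq_0[OF norms(1) EX[OF m s_nonneg(1)]] by simp
qed

lemma sol:
  assumes l: "l \<in> U"
  shows "sol l \<in> E M" "nrm s1 (sol l - u l) \<le> \<rho>" "g l (sol l) = 0"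
proof -
  obtain a where a: "a \<in> A" "l \<in> J" "\<bar>l - a\<bar> < \<eta>" using U_near[OF l] by blast
  have "\<exists>z\<in>E M. nrm s1 (z - u l) \<le> \<rho> \<and> g l z = 0"
    by (rule solution_exists[OF a E_subspace'[OF M(1)] order_refl E_complete[OF M(1) s_nonneg(1)] uE(1)[OF a(2)]
          T0_mem[OF a] g_mem[OF a(2)]])
  then have "\<exists>z. z \<in> E M \<and> nrm s1 (z - u l) \<le> \<rho> \<and> g l z = 0" by blast
  from someI_ex[OF this] show "sol l \<in> E M" "nrm s1 (sol l - u l) \<le> \<rho>" "g l (sol l) = 0"
    using l by (simp_all add: sol_def)
qed

lemma sol_eq: "l \<in> U \<Longrightarrow> z \<in> E M \<Longrightarrow> nrm s1 (z - u l) \<le> \<rho> \<Longrightarrow> g l z = 0 \<Longrightarrow> sol l = z"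
  using sol_unique sol by blast

lemma sol_mem: "l \<in> J \<Longrightarrow> sol l \<in> E M"
  using sol uE by (cases "l \<in> U") (auto simp: sol_def)

lemma sol_s1: "l \<in> U \<Longrightarrow> nrm s1 (sol l - u l) \<le> M powr (- 2 - \<sigma> + 13 * t)"
  using U_near sol solution_s1 by blast

lemma sol_S: "l \<in> U \<Longrightarrow> nrm S (sol l - u l) \<le> M powr (2 * \<mu> + \<nu> + 1 + 16 * t)"
  using U_near sol solution_S by blast

text \<open>The value forced by differentiating \<open>g l (sol l) = 0\<close>. It is obtained by
  solving the linearized equation first and is identified as the derivative afterwards.\<close>

definition sol' :: "real \<Rightarrow> 'a" where
  "sol' l = (if l \<in> U then SOME x. x \<in> E M \<and> L l (sol l) x = - P M (DF \<epsilon> (l, sol l) (1, 0)) else u' l)"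

lemma sol':
  assumes l: "l \<in> U"
  shows "sol' l \<in> E M" "L l (sol l) (sol' l) = - P M (DF \<epsilon> (l, sol l) (1, 0))"
proof -
  obtain a where a: "a \<in> A" "l \<in> J" "\<bar>l - a\<bar> < \<eta>" using U_near[OF l] by blast
  have "- P M (DF \<epsilon> (l, sol l) (1, 0)) \<in> E M"
    by (intro E_minus PD_mem M(1) a sol[OF l] E_zero)
  then have "\<exists>x\<in>E M. L l (sol l) x = - P M (DF \<epsilon> (l, sol l) (1, 0))"
    by (rule L_surjective[OF a sol(1,2)[OF l]])
  then have "\<exists>x. x \<in> E M \<and> L l (sol l) x = - P M (DF \<epsilon> (l, sol l) (1, 0))" by blast
  from someI_ex[OF this] show "sol' l \<in> E M" "L l (sol l) (sol' l) = - P M (DF \<epsilon> (l, sol l) (1, 0))"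
    using l by (simp_all add: sol'_def)
qed

lemma sol'_mem: "l \<in> J \<Longrightarrow> sol' l \<in> E M"
  using sol' uE by (cases "l \<in> U") (auto simp: sol'_def)

lemma pn_E:
  obtains C where "0 \<le> C" "\<And>x. x \<in> E M \<Longrightarrow> nrm (s0 + \<nu>) x \<le> C * nrm s1 x"
  using E_norm_equiv[OF M(1) s0\<nu> s_nonneg(1)] by blast

lemma eventually_near:
  assumes l: "l \<in> U"
  shows "\<exists>a\<in>A. \<forall>\<^sub>F r in at l within J. r \<in> U \<and> \<bar>r - a\<bar> < \<eta>"
proof -
  obtain a where a: "a \<in> A" "l \<in> J" "\<bar>l - a\<bar> < \<eta>" using U_near[OF l] by blast
  have "\<forall>\<^sub>F r in at l within J. r \<in> ball a \<eta> \<and> r \<in> J"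
    using a by (intro eventually_conj eventually_in_within topological_tendstoD[OF tendsto_ident_at])
      (auto simp: dist_real_def abs_minus_commute)
  then have "\<forall>\<^sub>F r in at l within J. r \<in> U \<and> \<bar>r - a\<bar> < \<eta>"
    by eventually_elim (use a in \<open>auto simp: open_nbhd_def dist_real_def abs_minus_commute\<close>)
  with a show ?thesis by blast
qed

text \<open>At a nearby parameter \<open>r\<close> the old value \<open>sol l\<close> is compared
  with \<open>sol r\<close> by \<open>newton_stable\<close>. This requires \<open>sol l\<close> to
  lie in the ball around \<open>u r\<close>: it fills only half the radius around
  \<open>u l\<close>, and continuity of \<open>u\<close> supplies the other half. The defect of
  \<open>sol l\<close> at \<open>r\<close> is of first order in \<open>r - l\<close>.\<close>

lemma sol_lipschitz:
  assumes l: "l \<in> U"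
  shows "\<exists>C\<ge>0. \<forall>\<^sub>F r in at l within J. r \<in> U \<and> nrm s1 (sol r - sol l) \<le> C * \<bar>r - l\<bar>"
proof -
  obtain a where a: "a \<in> A" "\<forall>\<^sub>F r in at l within J. r \<in> U \<and> \<bar>r - a\<bar> < \<eta>"
    using eventually_near[OF l] by blast
  note z = sol[OF l]
  have lJ: "l \<in> J" using l by simp
  let ?b = "P M (DF \<epsilon> (l, sol l) (1, 0))"
  have b: "?b \<in> E M" "0 \<le> nrm s1 ?b"
    using PD_mem[OF lJ z(1) E_zero[OF M(1)]] E_nrm_nonneg[OF M(1) _ s_nonneg(1)] by auto
  define c where "c \<theta> = (0, sol l) + \<theta> *\<^sub>R (1 :: real, 0 :: 'a)" for \<theta>
  have c_eq: "c \<theta> = (\<theta>, sol l)" for \<theta> by (simp add: c_def)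
  have "nderiv (nrm s1) (\<lambda>\<theta>. P M (FF \<epsilon> (c \<theta>))) (P M (DF \<epsilon> (c l) (1, 0))) l J"
  proof (rule nderiv_T_FF[OF \<epsilon>' s_nonneg(1) P_bounded_linear[OF M(1) s0_nonneg s_nonneg(1)]])
    show "nderiv pn c (1, 0) l J" unfolding c_def by (rule nderiv_affine[OF normed_VV])
    show "\<theta> \<in> insert l J \<Longrightarrow> c \<theta> \<in> DD" for \<theta> using lJ EX[OF z(1) s0\<nu>] by (auto simp: c_eq)
    show "(1, 0) \<in> VV" using EX[OF E_zero[OF M(1)] s0\<nu>] by simp
  qed
  then have gd: "nderiv (nrm s1) (\<lambda>\<theta>. g \<theta> (sol l)) ?b l J" by (simp add: c_eq)
  have "ncont (nrm s1) u l J"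
    by (rule nderiv_imp_ncont[OF norms(1) nderiv_u[OF s_nonneg(1) lJ]]) (use lJ uE EX s_nonneg in auto)
  moreover have "\<rho> / 2 > 0" using M by simp
  ultimately have uc: "\<forall>\<^sub>F r in at l within J. nrm s1 (u r - u l) \<le> \<rho> / 2" by (rule ncontD)
  have half: "nrm s1 (sol l - u l) \<le> \<rho> / 2"
  proof -
    have "M powr (- 2 - \<sigma> + 13 * t) = M powr (- 1 + 13 * t) * \<rho>"
      unfolding powr_add[symmetric] by (rule arg_cong[where f = "(powr) M"]) simp
    also have "\<dots> \<le> 1/2 * \<rho>" using t by (intro mult_right_mono pw_half) auto
    finally show ?thesis using sol_s1[OF l] by simp
  qed
  define C where "C = M powr (\<mu> + 3 * t) * (nrm s1 ?b + 1)"
  have "\<forall>\<^sub>F r in at l within J. r \<in> U \<and> nrm s1 (sol r - sol l) \<le> C * \<bar>r - l\<bar>"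
    using a(2) uc nderivD[OF gd zero_less_one]
  proof eventually_elim
    case (elim r)
    then have r: "r \<in> U" "r \<in> J" by auto
    have m: "sol l \<in> X s1" "u r \<in> X s1" "u l \<in> X s1" using EX[OF _ s_nonneg(1)] uE r lJ z by auto
    have gm: "g r (sol l) - g l (sol l) \<in> X s1" "(r - l) *\<^sub>R ?b \<in> X s1"
      by (intro EX[OF _ s_nonneg(1)] E_diff E_scale M(1) g_mem r lJ z b)+
    have "nrm s1 (sol l - u r) \<le> nrm s1 (sol l - u l) + nrm s1 (u l - u r)"
      by (rule normed_triangle_mid[OF norms(1) m(1,3,2)])
    also have "\<dots> \<le> \<rho> / 2 + \<rho> / 2"
      using elim half normed_commute[OF norms(1) m(2,3)] by (intro add_mono) auto
    finally have ball: "nrm s1 (sol l - u r) \<le> \<rho>" by simp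
    have "nrm s1 (sol r - sol l) \<le> M powr (\<mu> + 3 * t) * nrm s1 (g r (sol r) - g r (sol l))"
      by (rule newton_stable[OF a(1) r(2) _ sol(1,2)[OF r(1)] z(1) ball]) (use elim in simp)
    also have "nrm s1 (g r (sol r) - g r (sol l)) = nrm s1 (g r (sol l) - g l (sol l))"
      using sol(3)[OF r(1)] z(3) normed_minus[OF norms(1)] EX[OF g_mem[OF r(2) z(1)] s_nonneg(1)] by simp
    also have "M powr (\<mu> + 3 * t) * nrm s1 (g r (sol l) - g l (sol l)) \<le> M powr (\<mu> + 3 * t) * ((nrm s1 ?b + 1) * \<bar>r - l\<bar>)"
    proof (rule mult_left_mono)
      have "nrm s1 (g r (sol l) - g l (sol l)) \<le> nrm s1 ((r - l) *\<^sub>R ?b) + nrm s1 (g r (sol l) - g l (sol l) - (r - l) *\<^sub>R ?b)"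
        by (rule normed_le_add_diff[OF norms(1) gm])
      also have "\<dots> \<le> \<bar>r - l\<bar> * nrm s1 ?b + 1 * \<bar>r - l\<bar>"
        using elim normed_scale[OF norms(1) EX[OF b(1) s_nonneg(1)]] by simp
      finally show "nrm s1 (g r (sol l) - g l (sol l)) \<le> (nrm s1 ?b + 1) * \<bar>r - l\<bar>" by (simp add: algebra_simps)
    qed simp
    finally show ?case using r by (simp add: C_def mult.assoc)
  qed
  moreover have "C \<ge> 0" using b by (simp add: C_def)
  ultimately show ?thesis by blast
qed

lemma sol_pn:
  assumes l: "l \<in> U"
  shows "\<exists>C\<ge>0. \<forall>\<^sub>F r in at l within J. r \<in> U \<and> pn ((r, sol r) - (l, sol l)) \<le> C * \<bar>r - l\<bar>"
proof -
  obtain C where C: "C \<ge> 0" "\<forall>\<^sub>F r in at l within J. r \<in> U \<and> nrm s1 (sol r - sol l) \<le> C * \<bar>r - l\<bar>"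
    using sol_lipschitz[OF l] by blast
  obtain C' where C': "0 \<le> C'" "\<And>x. x \<in> E M \<Longrightarrow> nrm (s0 + \<nu>) x \<le> C' * nrm s1 x"
    using pn_E by blast
  have "\<forall>\<^sub>F r in at l within J. r \<in> U \<and> pn ((r, sol r) - (l, sol l)) \<le> (1 + C' * C) * \<bar>r - l\<bar>"
    using C(2)
  proof eventually_elim
    case (elim r)
    have "nrm (s0 + \<nu>) (sol r - sol l) \<le> C' * nrm s1 (sol r - sol l)"
      by (intro C' E_diff M(1) sol_mem) (use elim l in auto)
    also have "\<dots> \<le> C' * (C * \<bar>r - l\<bar>)" using elim C' by (intro mult_left_mono) auto
    finally show ?case using elim by (simp add: algebra_simps)
  qed
  moreover have "0 \<le> 1 + C' * C" using C C' by simp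
  ultimately show ?thesis by blast
qed

lemma small_mult: "C \<ge> 0 \<Longrightarrow> e > 0 \<Longrightarrow> \<forall>\<^sub>F r in at (l::real) within J. C * \<bar>r - l\<bar> < e"
proof -
  assume "C \<ge> 0" "e > (0::real)"
  have "((\<lambda>r. C * \<bar>r - l\<bar>) \<longlongrightarrow> C * \<bar>l - l\<bar>) (at l within J)" by (intro tendsto_intros)
  then show ?thesis using \<open>e > 0\<close> by (auto dest: order_tendstoD(2))
qed

text \<open>Implicit differentiation. The projected equation vanishes at both parameters, so its
  joint remainder \<open>?R\<close> satisfies \<open>P M ?R = - L l (sol l) x\<close> with
  \<open>x\<close> the remainder of \<open>sol\<close>. The inverse bound transfers smallness from
  \<open>?R\<close> to \<open>x\<close>, and the Lipschitz bound turns it into a multiple of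
  \<open>\<bar>r - l\<bar>\<close>.\<close>

lemma sol_nderiv:
  assumes l: "l \<in> U"
  shows "nderiv (nrm s1) sol (sol' l) l J"
  unfolding nderiv_def
proof (intro allI impI)
  fix e :: real assume e: "e > 0"
  have lJ: "l \<in> J" using l by simp
  obtain a where a: "a \<in> A" "l \<in> J" "\<bar>l - a\<bar> < \<eta>" using U_near[OF l] by blast
  note z = sol[OF l] and z' = sol'[OF l]
  let ?p = "(l, sol l)"
  have pD: "?p \<in> DD" using lJ EX[OF z(1) s0\<nu>] by simp
  note Pb = P_bounded_linear[OF M(1) s0_nonneg s_nonneg(1)]
  obtain C where C: "C \<ge> 0" "\<forall>\<^sub>F r in at l within J. r \<in> U \<and> pn ((r, sol r) - ?p) \<le> C * \<bar>r - l\<bar>"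
    using sol_pn[OF l] by blast
  obtain CP where CP: "CP \<ge> 0" "\<And>y. y \<in> X s0 \<Longrightarrow> nrm s1 (P M y) \<le> CP * nrm s0 y"
    using bounded_linear_on_bound[OF Pb normed_X[OF s0_nonneg]] by blast
  define B where "B = M powr (\<mu> + 3 * t)"
  define e1 where "e1 = e / (B * CP * C + 1)"
  have B: "B \<ge> 0" by (simp add: B_def)
  have den: "B * CP * C + 1 > 0" using B CP C by (simp add: add_nonneg_pos)
  have e1: "e1 > 0" using e den by (simp add: e1_def)
  obtain d where d: "d > 0" "\<And>q. q \<in> DD \<Longrightarrow> pn (q - ?p) < d \<Longrightarrow>
      nrm s0 (FF \<epsilon> q - FF \<epsilon> ?p - DF \<epsilon> ?p (q - ?p)) \<le> e1 * pn (q - ?p)"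
    using FF_fderiv[OF \<epsilon>' pD] e1 unfolding fderiv_on_def by blast
  show "\<forall>\<^sub>F r in at l within J. nrm s1 (sol r - sol l - (r - l) *\<^sub>R sol' l) \<le> e * \<bar>r - l\<bar>"
    using C(2) small_mult[OF C(1) d(1)]
  proof eventually_elim
    case (elim r)
    then have r: "r \<in> U" "r \<in> J" by auto
    note zr = sol[OF r(1)]
    let ?q = "(r, sol r)"
    have qD: "?q \<in> DD" using r EX[OF zr(1) s0\<nu>] by simp
    let ?R = "FF \<epsilon> ?q - FF \<epsilon> ?p - DF \<epsilon> ?p (?q - ?p)"
    have dE: "sol r - sol l \<in> E M" by (intro E_diff M(1) zr z)
    have mF: "F \<epsilon> r (sol r) \<in> X s0" "F \<epsilon> l (sol l) \<in> X s0" "DF \<epsilon> ?p (r - l, sol r - sol l) \<in> X s0"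
      by (intro F_mem DF_mem r lJ zr z dE)+
    note N0 = normed_X[OF s0_nonneg]
    have "P M ?R = - P M (DF \<epsilon> ?p (r - l, sol r - sol l))"
      using bounded_linear_on_diff[OF Pb N0 normed_diff_mem[OF N0 mF(1,2)] mF(3)]
        bounded_linear_on_diff[OF Pb N0 mF(1,2)] zr(3) z(3) by simp
    also have "P M (DF \<epsilon> ?p (r - l, sol r - sol l)) = P M (DF \<epsilon> ?p ((r - l) *\<^sub>R (1, 0) + (0, sol r - sol l)))" by simp
    also have "\<dots> = (r - l) *\<^sub>R P M (DF \<epsilon> ?p (1, 0)) + L l (sol l) (sol r - sol l)"
      using PDF_linear(1)[OF lJ z(1) E_zero[OF M(1)] dE, of "r - l" 0]
        PDF_linear(2)[OF lJ z(1) E_zero[OF M(1)], of "r - l" 1] by (simp add: L_def')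
    also have "P M (DF \<epsilon> ?p (1, 0)) = - L l (sol l) (sol' l)" using z'(2) by simp
    also have "(r - l) *\<^sub>R - L l (sol l) (sol' l) + L l (sol l) (sol r - sol l) = L l (sol l) (sol r - sol l - (r - l) *\<^sub>R sol' l)"
      by (simp add: L_diff[OF lJ z(1) dE E_scale[OF M(1) z'(1)]] L_scale[OF lJ z(1) z'(1)])
    finally have PR: "P M ?R = - L l (sol l) (sol r - sol l - (r - l) *\<^sub>R sol' l)" .
    have xE: "sol r - sol l - (r - l) *\<^sub>R sol' l \<in> E M" by (intro E_diff E_scale M(1) dE z' zr z)
    have RX: "?R \<in> X s0" using mF by (intro normed_mem[OF N0]) auto
    have "nrm s1 (sol r - sol l - (r - l) *\<^sub>R sol' l) \<le> B * nrm s1 (L l (sol l) (sol r - sol l - (r - l) *\<^sub>R sol' l))"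
      unfolding B_def by (rule L_inverse_s1[OF a z(1,2) xE])
    also have "nrm s1 (L l (sol l) (sol r - sol l - (r - l) *\<^sub>R sol' l)) = nrm s1 (P M ?R)"
      unfolding PR by (rule normed_minus[OF norms(1), symmetric]) (intro EX L_mem lJ z xE s_nonneg)
    also have "B * nrm s1 (P M ?R) \<le> B * (CP * (e1 * (C * \<bar>r - l\<bar>)))"
    proof (intro mult_left_mono B)
      have "nrm s1 (P M ?R) \<le> CP * nrm s0 ?R" by (rule CP(2)[OF RX])
      also have "\<dots> \<le> CP * (e1 * pn (?q - ?p))"
        using d(2)[OF qD] elim CP by (intro mult_left_mono) auto
      also have "\<dots> \<le> CP * (e1 * (C * \<bar>r - l\<bar>))"
        using elim CP e1 by (intro mult_left_mono) auto
      finally show "nrm s1 (P M ?R) \<le> CP * (e1 * (C * \<bar>r - l\<bar>))" .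
    qed
    also have "\<dots> = (B * CP * C / (B * CP * C + 1)) * (e * \<bar>r - l\<bar>)" by (simp add: e1_def)
    also have "\<dots> \<le> 1 * (e * \<bar>r - l\<bar>)" using den e by (intro mult_right_mono) auto
    finally show ?case by simp
  qed
qed

text \<open>Subtracting the linearized equations in the fixed direction \<open>(1, sol' l)\<close>
  expresses the operator at \<open>r\<close>, applied to \<open>sol' r - sol' l\<close>, by the
  change of \<open>DF\<close> in that direction. The inverse bound at \<open>r\<close> does not
  depend on \<open>r\<close>.\<close>

lemma sol'_ncont:
  assumes l: "l \<in> U"
  shows "ncont (nrm s1) sol' l J"
  unfolding ncont_def
proof (intro allI impI)
  fix e :: real assume e: "e > 0"
  have lJ: "l \<in> J" using l by simp
  note z = sol[OF l] and z' = sol'[OF l]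
  let ?p = "(l, sol l)" and ?k = "(1, sol' l)"
  have pD: "?p \<in> DD" and kV: "?k \<in> VV" using lJ EX[OF _ s0\<nu>] z z' by auto
  have nk: "0 \<le> pn ?k" by (rule normed_nonneg[OF normed_VV kV])
  note Pb = P_bounded_linear[OF M(1) s0_nonneg s_nonneg(1)] and N0 = normed_X[OF s0_nonneg]
  obtain C where C: "C \<ge> 0" "\<forall>\<^sub>F r in at l within J. r \<in> U \<and> pn ((r, sol r) - ?p) \<le> C * \<bar>r - l\<bar>"
    using sol_pn[OF l] by blast
  obtain CP where CP: "CP \<ge> 0" "\<And>y. y \<in> X s0 \<Longrightarrow> nrm s1 (P M y) \<le> CP * nrm s0 y"
    using bounded_linear_on_bound[OF Pb normed_X[OF s0_nonneg]] by blast
  define B where "B = M powr (\<mu> + 3 * t)"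
  define e1 where "e1 = e / (B * CP * pn ?k + 1)"
  have B: "B \<ge> 0" by (simp add: B_def)
  have den: "B * CP * pn ?k + 1 > 0" using mult_nonneg_nonneg[OF mult_nonneg_nonneg[OF B CP(1)] nk] by linarith
  have e1: "e1 > 0" using e den unfolding e1_def by (rule divide_pos_pos)
  obtain d where d: "d > 0" "\<And>q. q \<in> DD \<Longrightarrow> pn (q - ?p) < d \<Longrightarrow> nrm s0 (DF \<epsilon> q ?k - DF \<epsilon> ?p ?k) \<le> e1 * pn ?k"
    using DF_continuous[OF \<epsilon>' pD e1] kV by blast
  show "\<forall>\<^sub>F r in at l within J. nrm s1 (sol' r - sol' l) \<le> e"
    using C(2) small_mult[OF C(1) d(1)]
  proof eventually_elim
    case (elim r)
    then have r: "r \<in> U" "r \<in> J" by auto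
    obtain a where a: "a \<in> A" "r \<in> J" "\<bar>r - a\<bar> < \<eta>" using U_near[OF r(1)] by blast
    note zr = sol[OF r(1)] and z'r = sol'[OF r(1)]
    let ?q = "(r, sol r)"
    have qD: "?q \<in> DD" using r EX[OF zr(1) s0\<nu>] by simp
    have split: "P M (DF \<epsilon> (\<theta>, w) ?k) = P M (DF \<epsilon> (\<theta>, w) (1, 0)) + L \<theta> w (sol' l)" if "\<theta> \<in> J" "w \<in> E M" for \<theta> w
      using PDF_linear(1)[OF that E_zero[OF M(1)] z'(1), of 1 0] by (simp add: L_def')
    have mk: "DF \<epsilon> ?q ?k \<in> X s0" "DF \<epsilon> ?p ?k \<in> X s0" by (intro DF_mem r lJ zr z z')+
    have "P M (DF \<epsilon> ?q ?k - DF \<epsilon> ?p ?k) = P M (DF \<epsilon> ?q ?k) - P M (DF \<epsilon> ?p ?k)"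
      by (rule bounded_linear_on_diff[OF Pb N0 mk])
    also have "\<dots> = - L r (sol r) (sol' r) + L r (sol r) (sol' l)"
      using split[OF r(2) zr(1)] split[OF lJ z(1)] z'(2) z'r(2) by simp
    also have "\<dots> = - L r (sol r) (sol' r - sol' l)" using L_diff[OF r(2) zr(1) z'r(1) z'(1)] by simp
    finally have eq: "P M (DF \<epsilon> ?q ?k - DF \<epsilon> ?p ?k) = - L r (sol r) (sol' r - sol' l)" .
    have xE: "sol' r - sol' l \<in> E M" by (intro E_diff M(1) z'r z')
    have "nrm s1 (sol' r - sol' l) \<le> B * nrm s1 (L r (sol r) (sol' r - sol' l))"
      unfolding B_def by (rule L_inverse_s1[OF a zr(1,2) xE])
    also have "nrm s1 (L r (sol r) (sol' r - sol' l)) = nrm s1 (P M (DF \<epsilon> ?q ?k - DF \<epsilon> ?p ?k))"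
      unfolding eq by (rule normed_minus[OF norms(1), symmetric]) (intro EX L_mem r zr xE s_nonneg)
    also have "B * nrm s1 (P M (DF \<epsilon> ?q ?k - DF \<epsilon> ?p ?k)) \<le> B * (CP * (e1 * pn ?k))"
    proof (intro mult_left_mono B)
      have "nrm s1 (P M (DF \<epsilon> ?q ?k - DF \<epsilon> ?p ?k)) \<le> CP * nrm s0 (DF \<epsilon> ?q ?k - DF \<epsilon> ?p ?k)"
        by (rule CP(2)[OF normed_diff_mem[OF N0 mk]])
      also have "\<dots> \<le> CP * (e1 * pn ?k)"
        using d(2)[OF qD] elim CP(1) by (intro mult_left_mono) auto
      finally show "nrm s1 (P M (DF \<epsilon> ?q ?k - DF \<epsilon> ?p ?k)) \<le> CP * (e1 * pn ?k)" .
    qed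
    also have "\<dots> = (B * CP * pn ?k / (B * CP * pn ?k + 1)) * e" by (simp add: e1_def)
    also have "\<dots> \<le> 1 * e"
    proof (rule mult_right_mono)
      show "B * CP * pn ?k / (B * CP * pn ?k + 1) \<le> 1" using den by (subst divide_le_eq_1_pos) auto
    qed (use e in simp)
    finally show ?case by simp
  qed
qed

section \<open>Size of the derivative of the correction\<close>

context
  fixes l :: real
  assumes l: "l \<in> U"
begin

abbreviation (input) "h \<equiv> sol l - u l"
abbreviation (input) "y \<equiv> P M (DF \<epsilon> (l, sol l) (1, u' l))"

lemma lJ: "l \<in> J"
  using l by simp

lemma step_arith: "\<nu> > 0" "\<mu> > 0" "\<sigma> > 0"
  using \<nu>_pos \<mu> \<sigma> by auto

lemma step_mem:
  shows "h \<in> E M" "y \<in> E M" "sol' l - u' l \<in> E M" "sol l \<in> E M" "u l \<in> E M" "u' l \<in> E M"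
  by (intro E_diff PD_mem M(1) lJ sol_mem sol'_mem uE)+

lemma h_le: "nrm s0 h \<le> nrm s1 h" "nrm s0 (u' l) \<le> nrm s1 (u' l)"
  "nrm s0 (u l) \<le> 1" "nrm s0 (u l + h) \<le> 1" "nrm s0 (sol l) \<le> 1"
  using E_n0[OF M(1) step_mem(1)] E_n0[OF M(1) step_mem(6)] E_n0[OF M(1) step_mem(5)] E_n0[OF M(1) step_mem(4)]
    u_le1[OF lJ] ball_s1[OF lJ sol(1,2)[OF l]] by auto

text \<open>The equation is written for the increment \<open>sol' l - u' l\<close>. Its right-hand
  side is the total parameter derivative evaluated with the old \<open>u' l\<close>, which is small
  whenever \<open>u\<close> nearly solves the differentiated equation.\<close>

lemma L_sol': "L l (sol l) (sol' l - u' l) = - y"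
proof -
  have "y = P M (DF \<epsilon> (l, sol l) (1, 0)) + L l (sol l) (u' l)"
    using PDF_linear(1)[OF lJ step_mem(4) E_zero[OF M(1)] step_mem(6), of 1 0] by (simp add: L_def')
  then show ?thesis
    using L_diff[OF lJ step_mem(4) sol'(1)[OF l] step_mem(6)] sol'(2)[OF l] by simp
qed

text \<open>At \<open>u l\<close> instead of \<open>sol l\<close> the quantity is bounded by
  \<open>Y\<close>. The change carries a factor \<open>nrm s1 h\<close> and a loss
  \<open>M powr \<nu>\<close>, multiplied by \<open>1 + nrm s1 (u' l)\<close>; the exponents of
  these three add up to the second term.\<close>

lemma y_s1: "nrm s1 y \<le> Y + M powr (3 / 4 * \<nu> - 2 - 3 / 4 * \<sigma> + 17 * t)"
proof -
  note Pt = P_tame[OF _ M(1), of s1, simplified]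
  have mem: "x \<in> E M \<Longrightarrow> x \<in> X (s1 + \<nu>)" for x by (rule EX[OF _ s_nonneg(3)])
  have pos: "0 \<le> nrm s1 h" "0 \<le> nrm s0 h" "0 \<le> nrm (s1 + \<nu>) h" "0 \<le> nrm s1 (u' l)" "0 \<le> nrm s0 (u' l)"
    "0 \<le> nrm (s1 + \<nu>) (u' l)" "0 \<le> nrm (s1 + \<nu>) (u l)"
    using E_nrm_nonneg[OF M(1)] step_mem s_nonneg s0_nonneg by auto
  let ?m = "K * M powr \<nu>"
  have m0: "0 \<le> ?m" using K by simp
  have G: "nrm (s1 + \<nu>) x \<le> ?m * nrm s1 x" if "x \<in> E M" for x
    by (rule E_gain[OF _ M(1) that]) simp
  have Gu: "nrm (s1 + \<nu>) (u l) \<le> ?m * 1"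
    using G[OF step_mem(5)] mult_left_mono[OF u_le1[OF lJ] m0] by linarith
  note Gh = G[OF step_mem(1)] and Gu' = G[OF step_mem(6)]
  have split: "P M (DF \<epsilon> (l, w) (1, u' l)) = P M (DF \<epsilon> (l, w) (1, 0)) + L l w (u' l)" if "w \<in> E M" for w
    using PDF_linear(1)[OF lJ that E_zero[OF M(1)] step_mem(6), of 1 0] by (simp add: L_def')
  let ?d1 = "P M (DF \<epsilon> (l, u l + h) (1, 0)) - P M (DF \<epsilon> (l, u l) (1, 0))"
  let ?d2 = "P M (DF \<epsilon> (l, u l + h) (0, u' l)) - P M (DF \<epsilon> (l, u l) (0, u' l))"
  have dE: "?d1 \<in> X s1" "?d2 \<in> X s1"
    by (intro EX[OF _ s_nonneg(1)] E_diff PD_mem E_add E_zero M(1) lJ step_mem)+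
  have "nrm s1 ?d1 \<le> K * K * (3 * nrm (s1 + \<nu>) h + nrm (s1 + \<nu>) (u l) * nrm s0 h)"
    by (rule tame_param_diff[OF \<epsilon>' Pt lJ mem mem h_le(3,4)]) (assumption | rule step_mem)+
  also have "\<dots> \<le> K * K * (3 * (?m * nrm s1 h) + ?m * 1 * nrm s1 h)"
    using K pos m0 by (intro mult_left_mono add_mono mult_mono Gu Gh h_le) auto
  finally have "nrm s1 ?d1 \<le> 4 * (K * K * (?m * nrm s1 h))" by (simp add: algebra_simps)
  moreover have "0 \<le> K * K * (?m * nrm s1 h)" using K by (intro mult_nonneg_nonneg m0 pos) auto
  ultimately have b1: "nrm s1 ?d1 \<le> 5 * (K * K * (?m * nrm s1 h)) * 1" by linarith
  have "nrm s1 ?d2 \<le> K * K * (nrm (s1 + \<nu>) (u l) * nrm s0 h * nrm s0 (u' l)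
      + 3 * nrm (s1 + \<nu>) h * nrm s0 (u' l) + nrm s0 h * nrm (s1 + \<nu>) (u' l))"
    by (rule tame_DF_diff[OF \<epsilon>' Pt lJ mem mem h_le(3,4) mem]) (assumption | rule step_mem)+
  also have "\<dots> \<le> K * K * (?m * 1 * nrm s1 h * nrm s1 (u' l)
      + 3 * (?m * nrm s1 h) * nrm s1 (u' l) + nrm s1 h * (?m * nrm s1 (u' l)))"
    using K pos m0 by (intro mult_left_mono add_mono mult_mono Gu Gh Gu' h_le mult_nonneg_nonneg) auto
  finally have b2: "nrm s1 ?d2 \<le> 5 * (K * K * (?m * nrm s1 h)) * nrm s1 (u' l)"
    by (simp add: algebra_simps)
  let ?r = "P M (DF \<epsilon> (l, u l) (1, u' l))"
  have rE: "?r \<in> X s1" by (intro EX[OF PD_mem] lJ step_mem s_nonneg)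
  have y: "y = ?r + (?d1 + ?d2)"
    using split[OF step_mem(4)] split[OF step_mem(5)] by (simp add: L_def')
  have c1: "nrm s1 y \<le> nrm s1 ?r + nrm s1 (?d1 + ?d2)"
    unfolding y by (rule normed_triangle[OF norms(1) rE normed_add_mem[OF norms(1) dE]])
  have c2: "nrm s1 ?r \<le> Y" by (rule res'[OF l])
  have c3: "nrm s1 (?d1 + ?d2) \<le> nrm s1 ?d1 + nrm s1 ?d2"
    by (rule normed_triangle[OF norms(1) dE])
  have c4: "(K * K * K * 5) * (M powr \<nu> * nrm s1 h * (1 + nrm s1 (u' l))) \<le> M powr (3 / 4 * \<nu> - 2 - 3 / 4 * \<sigma> + 17 * t)"
  proof (rule pw_mult)
    show "K * K * K * 5 \<le> M powr (4 * t)" by (rule pw_mult[OF _ _ pw_K3 pw_num]) (use K in auto)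
    show "M powr \<nu> * nrm s1 h * (1 + nrm s1 (u' l)) \<le> M powr (\<nu> + (- 2 - \<sigma> + 13 * t) + (\<sigma> / 4 - \<nu> / 4))"
      by (rule pw_mult[OF _ _ pw_mult[OF _ _ order_refl sol_s1[OF l] order_refl] u'_s1[OF lJ]]) (use pos in auto)
  qed (use K pos in auto)
  have "(K * K * K * 5) * (M powr \<nu> * nrm s1 h * (1 + nrm s1 (u' l))) =
      5 * (K * K * (?m * nrm s1 h)) * 1 + 5 * (K * K * (?m * nrm s1 h)) * nrm s1 (u' l)"
    by (simp add: algebra_simps)
  with b1 b2 c1 c2 c3 c4 show ?thesis by linarith
qed

text \<open>\<open>Y\<close> stays symbolic because it is merely bounded in the first step and a
  negative power of the scale afterwards. The other term uses
  \<open>4 * (\<mu> + \<nu>) \<le> \<sigma>\<close> to pay for the inverse.\<close>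

lemma sol'_s1: "nrm s1 (sol' l - u' l) \<le> M powr (\<mu> + 3 * t) * Y + M powr (- 2 - \<sigma> / 2 + 20 * t)"
proof -
  obtain a where a: "a \<in> A" "l \<in> J" "\<bar>l - a\<bar> < \<eta>" using U_near[OF l] by blast
  have "nrm s1 (sol' l - u' l) \<le> M powr (\<mu> + 3 * t) * nrm s1 (- y)"
    using L_inverse_s1[OF a sol(1,2)[OF l] step_mem(3)] by (simp add: L_sol')
  also have "nrm s1 (- y) = nrm s1 y" by (rule normed_minus[OF norms(1) EX[OF step_mem(2) s_nonneg(1)]])
  also have "M powr (\<mu> + 3 * t) * nrm s1 y \<le> M powr (\<mu> + 3 * t) * (Y + M powr (3 / 4 * \<nu> - 2 - 3 / 4 * \<sigma> + 17 * t))"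
    by (intro mult_left_mono y_s1) auto
  also have "\<dots> = M powr (\<mu> + 3 * t) * Y + M powr (\<mu> + 3 * t) * M powr (3 / 4 * \<nu> - 2 - 3 / 4 * \<sigma> + 17 * t)"
    by (simp add: distrib_left)
  also have "M powr (\<mu> + 3 * t) * M powr (3 / 4 * \<nu> - 2 - 3 / 4 * \<sigma> + 17 * t) \<le> M powr (- 2 - \<sigma> / 2 + 20 * t)"
    by (rule pw_mult[OF _ _ order_refl order_refl]) (use \<sigma> step_arith in auto)
  finally show ?thesis by simp
qed

text \<open>The leading exponent is \<open>\<nu> / 2 + q\<close>, from the high norm of
  \<open>u' l\<close>. The product of the high norm of \<open>sol l\<close> with the low norm of
  \<open>u' l\<close> stays below it.\<close>

lemma y_S: "nrm S y \<le> M powr (2 * \<mu> + 3 / 2 * \<nu> + 2 + \<sigma> / 2 + 25 * t)"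
proof -
  note Pt = P_tame[OF _ M(1), of S, simplified]
  have mem: "x \<in> E M \<Longrightarrow> x \<in> X (S + \<nu>)" for x by (rule EX[OF _ s_nonneg(4)])
  have pos: "0 \<le> nrm S h" "0 \<le> nrm (S + \<nu>) (sol l)" "0 \<le> nrm s1 (u' l)" "0 \<le> nrm s0 (u' l)"
    "0 \<le> nrm (S + \<nu>) (u' l)"
    using E_nrm_nonneg[OF M(1)] step_mem s_nonneg s0_nonneg by auto
  have "nrm (S + \<nu>) (sol l) \<le> nrm (S + \<nu>) (u l) + nrm (S + \<nu>) h"
    by (rule normed_le_add_diff[OF norms(3)]) (rule mem step_mem)+
  also have "\<dots> \<le> M powr (2 * \<mu> + 2 * \<nu> + 1 + 18 * t)"
  proof (rule pw_add[OF u_S\<nu>[OF lJ]])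
    have "nrm (S + \<nu>) h \<le> K * M powr \<nu> * nrm S h" by (rule E_gain[OF _ M(1) step_mem(1)]) simp
    also have "\<dots> \<le> M powr (2 * \<mu> + 2 * \<nu> + 1 + 17 * t)"
      by (rule pw_mult[OF _ pos(1) pw_mult[OF _ _ M(3) order_refl order_refl] sol_S[OF l]]) (use K in auto)
    finally show "nrm (S + \<nu>) h \<le> M powr (2 * \<mu> + 2 * \<nu> + 1 + 17 * t)" .
  qed (use step_arith t in \<open>auto simp: p field_simps\<close>)
  finally have z: "nrm (S + \<nu>) (sol l) \<le> M powr (2 * \<mu> + 2 * \<nu> + 1 + 18 * t)" .
  have z1: "1 + nrm (S + \<nu>) (sol l) \<le> M powr (2 * \<mu> + 2 * \<nu> + 1 + 19 * t)"
    by (rule pw_add[of _ 0, OF _ z]) (use M step_arith t in auto)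
  have y: "y = P M (DF \<epsilon> (l, sol l) (1, 0)) + P M (DF \<epsilon> (l, sol l) (0, u' l))"
    using PDF_linear(1)[OF lJ step_mem(4) E_zero[OF M(1)] step_mem(6), of 1 0] by simp
  let ?y1 = "P M (DF \<epsilon> (l, sol l) (1, 0))" and ?y2 = "P M (DF \<epsilon> (l, sol l) (0, u' l))"
  have c1: "nrm S y \<le> nrm S ?y1 + nrm S ?y2"
    unfolding y by (intro normed_triangle[OF norms(2)] EX[OF PD_mem] lJ step_mem E_zero M(1) s_nonneg)
  have c2: "nrm S ?y1 \<le> K * K * (1 + nrm (S + \<nu>) (sol l))"
    by (rule tame_param[OF \<epsilon>' Pt lJ mem h_le(5)]) (assumption | rule step_mem)+
  have "nrm S ?y2 \<le> 3 * K * K * (nrm (S + \<nu>) (u' l) + nrm (S + \<nu>) (sol l) * nrm s0 (u' l))"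
    by (rule tame_DF[OF \<epsilon>' Pt lJ mem h_le(5) mem]) (assumption | rule step_mem)+
  also have "\<dots> \<le> 3 * K * K * (nrm (S + \<nu>) (u' l) + (1 + nrm (S + \<nu>) (sol l)) * nrm s1 (u' l))"
    using K pos by (intro mult_left_mono add_left_mono mult_mono h_le) auto
  finally have c3: "nrm S ?y2 \<le> 3 * K * K * (nrm (S + \<nu>) (u' l) + (1 + nrm (S + \<nu>) (sol l)) * nrm s1 (u' l))" .
  have c4: "K * K * (1 + nrm (S + \<nu>) (sol l)) \<le> 3 * K * K * (1 + nrm (S + \<nu>) (sol l))"
    using K pos by (intro mult_right_mono) auto
  have c5: "(K * K * 3) * ((1 + nrm (S + \<nu>) (sol l)) * (1 + nrm s1 (u' l)) + nrm (S + \<nu>) (u' l))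
    = 3 * K * K * (1 + nrm (S + \<nu>) (sol l)) + 3 * K * K * (nrm (S + \<nu>) (u' l) + (1 + nrm (S + \<nu>) (sol l)) * nrm s1 (u' l))"
    by (simp add: algebra_simps)
  have c6: "(K * K * 3) * ((1 + nrm (S + \<nu>) (sol l)) * (1 + nrm s1 (u' l)) + nrm (S + \<nu>) (u' l))
    \<le> M powr (2 * \<mu> + 3 / 2 * \<nu> + 2 + \<sigma> / 2 + 25 * t)"
  proof (rule pw_mult[OF _ _ pw_mult[OF _ _ pw_K2 pw_num order_refl] pw_add[OF _ u'_S\<nu>[OF lJ]]])
    show "(1 + nrm (S + \<nu>) (sol l)) * (1 + nrm s1 (u' l)) \<le> M powr (2 * \<mu> + 2 * \<nu> + 1 + 19 * t + (\<sigma> / 4 - \<nu> / 4))"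
      by (rule pw_mult[OF _ _ z1 u'_s1[OF lJ]]) (use pos in auto)
    show "2 * \<mu> + 2 * \<nu> + 1 + 19 * t + (\<sigma> / 4 - \<nu> / 4) + t \<le> 2 * \<mu> + 3 / 2 * \<nu> + 2 + \<sigma> / 2 + 22 * t"
      using \<sigma> step_arith t by simp
    show "\<nu> / 2 + q + 5 * t + t \<le> 2 * \<mu> + 3 / 2 * \<nu> + 2 + \<sigma> / 2 + 22 * t"
      using t by (simp add: q)
  qed (use K pos in auto)
  show ?thesis using c1 c2 c3 c4 c5 c6 by linarith
qed

text \<open>The exponent stops at \<open>2 * q - 5 / 4\<close> so that the term produced by the
  derivative of the cutoff still fits below \<open>2 * q - 1\<close>.\<close>

lemma sol'_S: "nrm S (sol' l - u' l) \<le> M powr (2 * q - 5 / 4)"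
proof -
  obtain a where a: "a \<in> A" "l \<in> J" "\<bar>l - a\<bar> < \<eta>" using U_near[OF l] by blast
  have pos: "0 \<le> nrm s1 y" "0 \<le> nrm S y" using E_nrm_nonneg[OF M(1) step_mem(2)] s_nonneg by auto
  have nm: "nrm s1 (- y) = nrm s1 y" "nrm S (- y) = nrm S y"
    using normed_minus[OF norms(1) EX[OF step_mem(2) s_nonneg(1)]]
      normed_minus[OF norms(2) EX[OF step_mem(2) s_nonneg(2)]] by auto
  have y1: "nrm s1 y \<le> M powr (18 * t)"
    by (rule order_trans[OF y_s1 pw_add[OF Y(2) order_refl]]) (use \<sigma> step_arith t in auto)
  have "nrm S (sol' l - u' l) \<le> M powr (\<mu> + 2 * t) * nrm S y + M powr (2 * \<mu> + \<sigma> + 2 + \<nu> / 2 + 6 * t) * nrm s1 y"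
    using L_inverse_S[OF a sol(1,2)[OF l] step_mem(3) sol_S[OF l]] by (simp add: L_sol' nm)
  also have "\<dots> \<le> M powr (2 * q - 5 / 4)"
    by (rule pw_add[OF pw_mult[OF _ pos(2) order_refl y_S order_refl] pw_mult[OF _ pos(1) order_refl y1 order_refl]])
       (use t \<sigma> step_arith in \<open>auto simp: q\<close>)
  finally show ?thesis .
qed

end

text \<open>The branch was chosen without reference to \<open>Xh\<close>. The quasi-Newton iteration
  is run once more inside an invariant subspace, and uniqueness identifies its limit with
  \<open>sol l\<close>.\<close>

lemma invariant_sol:
  assumes Xh: "invariant_subscale X nrm E P s0 \<nu> J (F \<epsilon>) Xh"
    and u: "\<And>l s. l \<in> J \<Longrightarrow> 0 \<le> s \<Longrightarrow> u l \<in> Xh s" and l: "l \<in> U" and s: "0 \<le> s"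
  shows "sol l \<in> Xh s"
proof -
  have sub: "\<And>s. 0 \<le> s \<Longrightarrow> subspace (Xh s)" and closed: "\<And>s. 0 \<le> s \<Longrightarrow> closedin (ntopology (X s) (nrm s)) (Xh s)"
    and inv: "\<And>s l w. 0 \<le> s \<Longrightarrow> l \<in> J \<Longrightarrow> w \<in> Xh (s + \<nu>) \<Longrightarrow> w \<in> X (s0 + \<nu>) \<Longrightarrow> F \<epsilon> l w \<in> Xh s"
    and PXh: "\<And>s w. 0 \<le> s \<Longrightarrow> w \<in> Xh s \<Longrightarrow> P M w \<in> Xh s"
    and fin: "\<exists>B. finite B \<and> E M \<inter> Xh 0 \<subseteq> span B"
  proof -
    have D: "subspace (Xh s) \<and> Xh s \<subseteq> X s \<and> closedin (ntopology (X s) (nrm s)) (Xh s) \<and>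
        (\<forall>l\<in>J. \<forall>u \<in> Xh (s + \<nu>) \<inter> X (s0 + \<nu>). F \<epsilon> l u \<in> Xh s) \<and>
        (\<forall>N\<ge>1. (\<forall>u\<in>Xh s. P N u \<in> Xh s) \<and> (\<exists>B. finite B \<and> E N \<inter> Xh s \<subseteq> span B))"
      if "0 \<le> s" for s
      by (rule Xh[unfolded invariant_subscale_def, THEN spec, THEN mp, OF that])
    note D4 = D[THEN conjunct2, THEN conjunct2, THEN conjunct2]
    show "subspace (Xh s)" if "0 \<le> s" for s by (rule D[OF that, THEN conjunct1])
    show "closedin (ntopology (X s) (nrm s)) (Xh s)" if "0 \<le> s" for s
      by (rule D[OF that, THEN conjunct2, THEN conjunct2, THEN conjunct1])
    show "F \<epsilon> l w \<in> Xh s" if "0 \<le> s" "l \<in> J" "w \<in> Xh (s + \<nu>)" "w \<in> X (s0 + \<nu>)" for s l w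
      by (rule D4[OF that(1), THEN conjunct1, THEN bspec, OF that(2), THEN bspec, OF IntI[OF that(3,4)]])
    show "P M w \<in> Xh s" if "0 \<le> s" "w \<in> Xh s" for s w
      by (rule D4[OF that(1), THEN conjunct2, THEN spec, THEN mp, OF M(1), THEN conjunct1, THEN bspec, OF that(2)])
    show "\<exists>B. finite B \<and> E M \<inter> Xh 0 \<subseteq> span B"
      by (rule D4[OF order_refl, THEN conjunct2, THEN spec, THEN mp, OF M(1), THEN conjunct2])
  qed
  \<comment> \<open>All levels are required at once because \<open>F\<close> maps
    \<open>Xh (s + \<nu>)\<close> into \<open>Xh s\<close>: only the intersection over
    \<open>s\<close> is preserved.\<close>
  define W where "W = {x \<in> E M. \<forall>s\<ge>0. x \<in> Xh s}"
  have WE: "W \<subseteq> E M" by (auto simp: W_def)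
  have Wsub: "subspace W"
    using sub E_subspace'[OF M(1)] unfolding W_def subspace_def by blast
  have Wlim: "x \<in> W" if x: "\<And>k. f k \<in> W" "x \<in> E M" "(\<lambda>k. nrm s1 (f k - x)) \<longlonglongrightarrow> 0" for f :: "nat \<Rightarrow> 'a" and x
  proof -
    have "x \<in> Xh s" if s: "0 \<le> s" for s
    proof (rule closedin_ntopology_limit[OF normed_X[OF s] closed[OF s]])
      show "f k \<in> Xh s" for k using x(1)[of k] s by (simp add: W_def)
      show "x \<in> X s" by (rule EX[OF x(2) s])
      obtain C where C: "0 \<le> C" "\<And>u. u \<in> E M \<Longrightarrow> nrm s u \<le> C * nrm s1 u"
        using E_norm_equiv[OF M(1) s s_nonneg(1)] by blast
      have d: "f k - x \<in> E M" for k using x WE by (intro E_diff M(1)) auto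
      show "(\<lambda>k. nrm s (f k - x)) \<longlonglongrightarrow> 0"
      proof (rule tendsto_sandwich[of "\<lambda>_. 0" _ _ "\<lambda>k. C * nrm s1 (f k - x)"])
        show "(\<lambda>k. C * nrm s1 (f k - x)) \<longlonglongrightarrow> 0" using tendsto_mult_left[OF x(3), of C] by simp
      qed (use C(2) d E_nrm_nonneg[OF M(1) _ s] in auto)
    qed
    with x(2) show ?thesis by (simp add: W_def)
  qed
  have Wcomp: "ncomplete (nrm s1) W"
    unfolding ncomplete_def
  proof (intro allI impI)
    fix f :: "nat \<Rightarrow> 'a"
    assume f: "(\<forall>k. f k \<in> W) \<and> (\<forall>e>0. \<exists>k0. \<forall>i\<ge>k0. \<forall>j\<ge>k0. nrm s1 (f i - f j) < e)"
    then obtain x where "x \<in> E M" "(\<lambda>k. nrm s1 (f k - x)) \<longlonglongrightarrow> 0"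
      using ncompleteD[OF E_complete[OF M(1) s_nonneg(1)], of f] WE by blast
    then show "\<exists>x\<in>W. (\<lambda>k. nrm s1 (f k - x)) \<longlonglongrightarrow> 0" using Wlim f by blast
  qed
  have gW: "g l w \<in> W" if "l \<in> J" "w \<in> W" for l w
  proof -
    have w: "w \<in> E M" "\<And>s. 0 \<le> s \<Longrightarrow> w \<in> Xh s" using that(2) by (auto simp: W_def)
    have "P M (F \<epsilon> l w) \<in> Xh s" if "0 \<le> s" for s
      by (intro PXh inv w EX[OF w(1) s0\<nu>] \<open>l \<in> J\<close> that) (use that \<nu>_pos in simp)
    then show ?thesis using g_mem[OF that(1) w(1)] by (simp add: W_def)
  qed
  \<comment> \<open>The linearization is a limit of difference quotients of \<open>g l\<close>,
    which lie in \<open>W\<close>, and \<open>W\<close> is closed since all norms on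
    \<open>E M\<close> are equivalent.\<close>
  have LW: "L l w x \<in> W" if lJ: "l \<in> J" and w: "w \<in> W" and x: "x \<in> W" for l w x
  proof -
    have E: "w \<in> E M" "x \<in> E M" using w x WE by auto
    define c where "c \<theta> = (l, w) + \<theta> *\<^sub>R (0 :: real, x)" for \<theta>
    have c_eq: "c \<theta> = (l, w + \<theta> *\<^sub>R x)" for \<theta> by (simp add: c_def)
    have "nderiv (nrm s1) (\<lambda>\<theta>. P M (FF \<epsilon> (c \<theta>))) (P M (DF \<epsilon> (c 0) (0, x))) 0 UNIV"
    proof (rule nderiv_T_FF[OF \<epsilon>' s_nonneg(1) P_bounded_linear[OF M(1) s0_nonneg s_nonneg(1)]])
      show "nderiv pn c (0, x) 0 UNIV" unfolding c_def by (rule nderiv_affine[OF normed_VV])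
      show "\<theta> \<in> insert 0 UNIV \<Longrightarrow> c \<theta> \<in> DD" for \<theta> using lJ EX[OF E_add[OF M(1) E(1) E_scale[OF M(1) E(2)]] s0\<nu>] by (simp add: c_eq)
      show "(0, x) \<in> VV" using EX[OF E(2) s0\<nu>] by simp
    qed
    then have der: "nderiv (nrm s1) (\<lambda>\<theta>. g l (w + \<theta> *\<^sub>R x)) (L l w x) 0 UNIV"
      by (simp add: c_eq L_def')
    define th where "th k = inverse (real (Suc k))" for k
    have th: "th k > 0" for k by (simp add: th_def)
    have "th \<longlonglongrightarrow> 0" unfolding th_def by (rule LIMSEQ_inverse_real_of_nat)
    moreover have "\<forall>\<^sub>F k in sequentially. th k \<in> UNIV \<and> th k \<noteq> 0"
      using th by (intro always_eventually allI conjI UNIV_I) (metis less_irrefl)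
    ultimately have thlim: "filterlim th (at 0) sequentially" unfolding filterlim_at by blast
    define f where "f k = (1 / th k) *\<^sub>R (g l (w + th k *\<^sub>R x) - g l w)" for k
    have fW: "f k \<in> W" for k
      unfolding f_def by (intro subspace_scale[OF Wsub] subspace_diff[OF Wsub] gW lJ subspace_add[OF Wsub] w x)
    have LE: "L l w x \<in> E M" by (rule L_mem[OF lJ E])
    show ?thesis
    proof (rule Wlim[OF fW LE], rule tendstoI)
      fix e :: real assume e: "e > 0"
      then have "e / 2 > 0" by simp
      from nderivD[OF der this] have "\<forall>\<^sub>F \<theta> in at 0. nrm s1 (g l (w + \<theta> *\<^sub>R x) - g l w - \<theta> *\<^sub>R L l w x) \<le> e / 2 * \<bar>\<theta>\<bar>"
        by simp
      from eventually_compose_filterlim[OF this thlim]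
      show "\<forall>\<^sub>F k in sequentially. dist (nrm s1 (f k - L l w x)) 0 < e"
      proof eventually_elim
        case (elim k)
        let ?d = "g l (w + th k *\<^sub>R x) - g l w - th k *\<^sub>R L l w x"
        have dE: "?d \<in> E M" by (intro E_diff E_scale E_add g_mem M(1) lJ E LE)
        have fd: "f k - L l w x = (1 / th k) *\<^sub>R ?d" using th[of k] by (simp add: f_def algebra_simps)
        have "nrm s1 (f k - L l w x) = \<bar>1 / th k\<bar> * nrm s1 ?d"
          unfolding fd by (rule normed_scale[OF norms(1) EX[OF dE s_nonneg(1)]])
        also have "\<dots> = 1 / th k * nrm s1 ?d" using th[of k] by simp
        also have "\<dots> \<le> 1 / th k * (e / 2 * \<bar>th k\<bar>)"
          using elim th[of k] by (intro mult_left_mono) auto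
        also have "\<dots> < e" using th[of k] e by simp
        finally have "nrm s1 (f k - L l w x) < e" .
        moreover have "0 \<le> nrm s1 (f k - L l w x)"
          using fW[of k] WE by (intro E_nrm_nonneg[OF M(1)] E_diff[OF M(1)] LE s_nonneg) blast
        ultimately show ?case unfolding dist_real_def by linarith
      qed
    qed
  qed
  obtain a where a: "a \<in> A" "l \<in> J" "\<bar>l - a\<bar> < \<eta>" using U_near[OF l] by blast
  have uW: "u r \<in> W" if "r \<in> J" for r using that u uE by (simp add: W_def)
  have aJ': "a \<in> J" by (rule A_sub[OF a(1)])
  obtain B where B: "finite B" "W \<subseteq> span B" using fin by (auto simp: W_def)
  have L0W: "L a (u a) ` W = W"
  proof (rule injective_on_finite_dim_imp_surj[OF Wsub B])
    show "x \<in> W \<Longrightarrow> L a (u a) x \<in> W" for x by (rule LW[OF aJ' uW[OF aJ']])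
    show "x \<in> W \<Longrightarrow> y \<in> W \<Longrightarrow> L a (u a) (x + y) = L a (u a) x + L a (u a) y" for x y
      using L_add[OF aJ' uE(1)[OF aJ']] WE by blast
    show "x \<in> W \<Longrightarrow> L a (u a) (c *\<^sub>R x) = c *\<^sub>R L a (u a) x" for c x
      using L_scale[OF aJ' uE(1)[OF aJ']] WE by blast
    show "inj_on (L a (u a)) W" using L0_bij[OF a] by (intro inj_on_subset[OF _ WE]) (rule bij_betw_imp_inj_on)
  qed
  have TW: "inv_into (E M) (L a (u a)) y \<in> W" if "y \<in> W" for y
  proof -
    have "y \<in> L a (u a) ` W" unfolding L0W by (rule that)
    then obtain x where x: "y = L a (u a) x" "x \<in> W" by (rule imageE)
    then show ?thesis using T0_L0[OF a, of x] WE by auto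
  qed
  have "\<exists>z\<in>W. nrm s1 (z - u l) \<le> \<rho> \<and> g l z = 0"
    by (rule solution_exists[OF a Wsub WE Wcomp uW[OF a(2)] TW gW[OF a(2)]])
  then obtain z where z: "z \<in> W" "nrm s1 (z - u l) \<le> \<rho>" "g l z = 0" by blast
  then have "sol l = z" using sol_eq[OF l] WE by blast
  with z(1) s show ?thesis by (simp add: W_def)
qed

text \<open>The new curve is \<open>u\<close> plus the cutoff times the correction. Differentiating
  the cutoff costs about \<open>M powr (\<sigma> / 2)\<close>, which the size
  \<open>M powr (- 2 - \<sigma>)\<close> of the correction affords; this product contributes to the
  exponent \<open>- 2 - \<sigma> / 2\<close> of the derivative bound.\<close>

lemma step:
  "\<exists>v v'. (\<forall>l\<in>J. v l \<in> E M \<and> v' l \<in> E M \<and> nderiv (nrm s1) v (v' l) l J \<and> ncont (nrm s1) v' l J \<and>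
       nrm s1 (v l - u l) \<le> M powr (- 2 - \<sigma> + 13 * t) \<and>
       nrm s1 (v' l - u' l) \<le> M powr (\<mu> + 3 * t) * Y + M powr (- 2 - \<sigma> / 2 + 22 * t) \<and>
       nrm S (v l - u l) \<le> M powr (2 * p - 1 + 16 * t) \<and> nrm S (v' l - u' l) \<le> M powr (2 * q - 1)) \<and>
     (\<forall>l\<in>open_nbhd A (M powr (- \<sigma> / 2)) \<inter> J. P M (F \<epsilon> l (v l)) = 0) \<and>
     ((\<forall>l\<in>J. F \<epsilon> l 0 = 0 \<and> u l = 0) \<longrightarrow> (\<forall>l\<in>J. v l = 0)) \<and>
     (\<forall>Xh. invariant_subscale X nrm E P s0 \<nu> J (F \<epsilon>) Xh \<longrightarrow> (\<forall>l\<in>J. \<forall>s\<ge>0. u l \<in> Xh s) \<longrightarrow>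
        (\<forall>l\<in>J. \<forall>s\<ge>0. v l \<in> Xh s))"
proof -
  define w where "w = M powr (- \<sigma> / 2)"
  have w: "w > 0" using M by (simp add: w_def)
  obtain \<psi> \<psi>' :: "real \<Rightarrow> real" where \<psi>:
    "\<And>x. (\<psi> has_real_derivative \<psi>' x) (at x)" "\<And>x. isCont \<psi>' x"
    "\<And>x. 0 \<le> \<psi> x" "\<And>x. \<psi> x \<le> 1" "\<And>x. \<bar>\<psi>' x\<bar> \<le> 4 / w"
    "\<And>x. x \<in> open_nbhd A w \<Longrightarrow> \<psi> x = 1"
    "\<And>x y. x \<notin> open_nbhd A (2 * w) \<Longrightarrow> \<bar>y - x\<bar> < w / 4 \<Longrightarrow> \<psi> y = 0"
    using cutoff_function[OF w, of A] by blast
  \<comment> \<open>The cutoff vanishes within \<open>w / 4\<close> of a point outside the wide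
    neighbourhood, so it is locally constant, with zero derivative, within
    \<open>w / 8\<close>.\<close>
  have \<psi>0: "\<psi>' y = 0" if "x \<notin> open_nbhd A (2 * w)" "\<bar>y - x\<bar> < w / 8" for x y
  proof (rule DERIV_local_const[OF \<psi>(1)])
    show "0 < w / 8" using w by simp
    show "\<forall>z. \<bar>y - z\<bar> < w / 8 \<longrightarrow> \<psi> y = \<psi> z"
    proof (intro allI impI)
      fix z assume "\<bar>y - z\<bar> < w / 8"
      then have "\<bar>y - x\<bar> < w / 4" "\<bar>z - x\<bar> < w / 4" using that(2) by linarith+
      then show "\<psi> y = \<psi> z" using \<psi>(7)[OF that(1)] by simp
    qed
  qed
  have \<psi>w: "4 / w = 4 * M powr (\<sigma> / 2)" by (simp add: w_def powr_minus_divide)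
  define h where "h l = sol l - u l" for l
  define h' where "h' l = sol' l - u' l" for l
  define v where "v l = u l + \<psi> l *\<^sub>R h l" for l
  define v' where "v' l = u' l + (\<psi>' l *\<^sub>R h l + \<psi> l *\<^sub>R h' l)" for l
  have hE: "h l \<in> E M" "h' l \<in> E M" if "l \<in> J" for l
    unfolding h_def h'_def by (intro E_diff M(1) sol_mem sol'_mem uE that)+
  have h0: "h l = 0" "h' l = 0" if "l \<notin> U" for l
    unfolding h_def h'_def using that by (auto simp: sol_def sol'_def)
  have X1: "x \<in> E M \<Longrightarrow> x \<in> X s1" for x by (rule EX[OF _ s_nonneg(1)])
  have vE: "v l \<in> E M" "v' l \<in> E M" if "l \<in> J" for l
    unfolding v_def v'_def by (intro E_add E_scale M(1) hE uE that)+
  have smooth: "nderiv (nrm s1) v (v' l) l J \<and> ncont (nrm s1) v' l J" if l: "l \<in> J" for l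
  proof (cases "l \<in> U")
    case True
    have memJ: "r \<in> insert l J \<Longrightarrow> r \<in> J" for r using l by auto
    have dh: "nderiv (nrm s1) h (h' l) l J"
    proof -
      have "nderiv (nrm s1) (\<lambda>r. sol r + (-1) *\<^sub>R u r) (sol' l + (-1) *\<^sub>R u' l) l J"
        by (intro nderiv_add[OF norms(1)] nderiv_cmul[OF norms(1)] sol_nderiv[OF True] nderiv_u s_nonneg l
              X1 E_scale M(1) sol_mem sol'_mem uE conjI; (rule memJ)?)
      then show ?thesis by (simp add: h_def[abs_def] h'_def)
    qed
    have ch': "ncont (nrm s1) h' l J"
    proof -
      have "ncont (nrm s1) (\<lambda>r. sol' r + (-1) *\<^sub>R u' r) l J"
        by (intro ncont_add[OF norms(1)] ncont_scaleR_fun[OF norms(1)] sol'_ncont[OF True] uC1(2) l continuous_const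
              X1 E_scale M(1) sol_mem sol'_mem uE conjI; (rule memJ)?)
      then show ?thesis by (simp add: h'_def[abs_def])
    qed
    have ch: "ncont (nrm s1) h l J"
      by (rule nderiv_imp_ncont[OF norms(1) dh]) (use hE memJ X1 l in auto)
    have "nderiv (nrm s1) v (v' l) l J"
      unfolding v_def v'_def
      by (intro nderiv_add[OF norms(1) nderiv_u[OF s_nonneg(1) l]] nderiv_scaleR_fun[OF norms(1) dh \<psi>(1)] conjI
            X1 E_add E_scale M(1) hE uE l; (rule memJ)?)
    moreover have "ncont (nrm s1) v' l J"
      unfolding v'_def
      by (intro ncont_add[OF norms(1) uC1(2)[OF l]] ncont_add[OF norms(1)] ncont_scaleR_fun[OF norms(1) ch \<psi>(2)]
            ncont_scaleR_fun[OF norms(1) ch' DERIV_isCont[OF \<psi>(1)]] conjI X1 E_add E_scale M(1) hE uE l; (rule memJ)?)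
    ultimately show ?thesis by simp
  next
    case False
    then have nl: "l \<notin> open_nbhd A (2 * w)" using l by (simp add: w_def)
    have "\<forall>\<^sub>F r in at l within J. r \<in> ball l (w / 8)"
      by (intro topological_tendstoD[OF tendsto_ident_at]) (use w in auto)
    \<comment> \<open>At a boundary point of the wide neighbourhood some \<open>r\<close> nearby lie
      in \<open>U\<close> and have a nonzero correction; the cutoff removes it, so the new curve
      agrees with \<open>u\<close> near \<open>l\<close>.\<close>
    then have ev: "\<forall>\<^sub>F r in at l within J. v r = u r \<and> v' r = u' r"
    proof eventually_elim
      case (elim r)
      then have "\<bar>r - l\<bar> < w / 8" by (simp add: dist_real_def abs_minus_commute)
      then show ?case using \<psi>(7)[OF nl, of r] \<psi>0[OF nl, of r] w by (simp add: v_def v'_def)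
    qed
    have vl: "v l = u l" "v' l = u' l" using h0[OF False] by (simp_all add: v_def v'_def)
    have "nderiv (nrm s1) v (u' l) l J"
      by (rule nderiv_cong[OF uC1(1)[OF l]]) (use ev vl in \<open>auto elim: eventually_mono\<close>)
    moreover have "ncont (nrm s1) v' l J"
      by (rule ncont_cong[OF uC1(2)[OF l]]) (use ev vl in \<open>auto elim: eventually_mono\<close>)
    ultimately show ?thesis by (simp add: vl)
  qed
  have vle: "nrm s (v l - u l) \<le> nrm s (h l)" and v'le: "nrm s (v' l - u' l) \<le> 4 / w * nrm s (h l) + nrm s (h' l)"
    if "0 \<le> s" "l \<in> J" for s l
  proof -
    note N = normed_X[OF that(1)] and m = EX[OF hE(1)[OF that(2)] that(1)] EX[OF hE(2)[OF that(2)] that(1)]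
    have pos: "0 \<le> nrm s (h l)" "0 \<le> nrm s (h' l)" using normed_nonneg[OF N] m by auto
    have one: "nrm s (\<psi> l *\<^sub>R x) \<le> nrm s x" if "x \<in> X s" for x
      using normed_scale[OF N that, of "\<psi> l"] \<psi>(3,4)[of l] mult_right_mono[of "\<psi> l" 1 "nrm s x"] normed_nonneg[OF N that]
      by simp
    show "nrm s (v l - u l) \<le> nrm s (h l)" using one[OF m(1)] by (simp add: v_def)
    have "nrm s (v' l - u' l) \<le> nrm s (\<psi>' l *\<^sub>R h l) + nrm s (\<psi> l *\<^sub>R h' l)"
      using normed_triangle[OF N normed_scale_mem[OF N m(1)] normed_scale_mem[OF N m(2)], of "\<psi>' l" "\<psi> l"]
      by (simp add: v'_def)
    also have "nrm s (\<psi>' l *\<^sub>R h l) \<le> 4 / w * nrm s (h l)"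
      using normed_scale[OF N m(1), of "\<psi>' l"] mult_right_mono[OF \<psi>(5)[of l] pos(1)] by simp
    also note one[OF m(2)]
    finally show "nrm s (v' l - u' l) \<le> 4 / w * nrm s (h l) + nrm s (h' l)" by simp
  qed
  have bounds: "nrm s1 (v l - u l) \<le> M powr (- 2 - \<sigma> + 13 * t)
      \<and> nrm s1 (v' l - u' l) \<le> M powr (\<mu> + 3 * t) * Y + M powr (- 2 - \<sigma> / 2 + 22 * t)
      \<and> nrm S (v l - u l) \<le> M powr (2 * p - 1 + 16 * t) \<and> nrm S (v' l - u' l) \<le> M powr (2 * q - 1)"
    if l: "l \<in> J" for l
  proof (cases "l \<in> U")
    case True
    have pos: "0 \<le> nrm s1 (h l)" "0 \<le> nrm S (h l)" using E_nrm_nonneg[OF M(1) hE(1)[OF l]] s_nonneg by auto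
    have a: "nrm s1 (h l) \<le> M powr (- 2 - \<sigma> + 13 * t)" unfolding h_def by (rule sol_s1[OF True])
    have b: "nrm S (h l) \<le> M powr (2 * \<mu> + \<nu> + 1 + 16 * t)" unfolding h_def by (rule sol_S[OF True])
    have pe: "2 * \<mu> + \<nu> + 1 + 16 * t = 2 * p - 1 + 16 * t" by (simp add: p)
    have w4: "4 / w \<le> M powr (t + \<sigma> / 2)"
      unfolding \<psi>w by (rule pw_mult[OF _ _ pw_num order_refl]) auto
    have c: "4 / w * nrm s1 (h l) \<le> M powr (- 2 - \<sigma> / 2 + 14 * t)"
      by (rule pw_mult[OF _ pos(1) w4 a]) (use w in auto)
    have d: "4 / w * nrm S (h l) \<le> M powr (2 * q - 5 / 4)"
      by (rule pw_mult[OF _ pos(2) w4 b]) (use w \<mu> \<nu>_pos \<sigma> t in \<open>auto simp: q\<close>)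
    have "nrm s1 (v' l - u' l) \<le> M powr (- 2 - \<sigma> / 2 + 14 * t) + (M powr (\<mu> + 3 * t) * Y + M powr (- 2 - \<sigma> / 2 + 20 * t))"
      using v'le[OF s_nonneg(1) l] c sol'_s1[OF True] by (simp add: h'_def)
    also have "\<dots> = M powr (\<mu> + 3 * t) * Y + (M powr (- 2 - \<sigma> / 2 + 14 * t) + M powr (- 2 - \<sigma> / 2 + 20 * t))" by simp
    also have "M powr (- 2 - \<sigma> / 2 + 14 * t) + M powr (- 2 - \<sigma> / 2 + 20 * t) \<le> M powr (- 2 - \<sigma> / 2 + 22 * t)"
      by (rule pw_add[OF order_refl order_refl]) (use t in auto)
    finally have e: "nrm s1 (v' l - u' l) \<le> M powr (\<mu> + 3 * t) * Y + M powr (- 2 - \<sigma> / 2 + 22 * t)" by simp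
    have "nrm S (v' l - u' l) \<le> 4 / w * nrm S (h l) + nrm S (h' l)" by (rule v'le[OF s_nonneg(2) l])
    also have "\<dots> \<le> M powr (2 * q - 1)"
      by (rule pw_add[OF d sol'_S[OF True, folded h'_def]]) (use t in auto)
    finally show ?thesis using e vle[OF s_nonneg(1) l] vle[OF s_nonneg(2) l] a b pe by simp
  next
    case False
    then show ?thesis
      using h0[OF False] normed_zero[OF norms(1)] normed_zero[OF norms(2)] Y by (simp add: v_def v'_def)
  qed
  have zero: "P M (F \<epsilon> l (v l)) = 0" if l: "l \<in> open_nbhd A w \<inter> J" for l
  proof -
    obtain x where x: "x \<in> A" "dist x l < w" "l \<in> J" using l by (auto simp: open_nbhd_def)
    then have "dist x l < \<eta>" using w unfolding w_def by linarith
    with x have "l \<in> U" by (auto simp: open_nbhd_def)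
    then show ?thesis using sol(3) \<psi>(6) l by (auto simp: v_def h_def)
  qed
  \<comment> \<open>If 0 solves the equation and \<open>u\<close> vanishes, then 0 is a solution in
    the ball, so uniqueness forces \<open>sol l = 0\<close>. Through this clause the sequence
    vanishes at \<open>\<epsilon> = 0\<close>.\<close>
  have triv: "v l = 0" if l: "l \<in> J" and 0: "\<forall>l\<in>J. F \<epsilon> l 0 = 0 \<and> u l = 0" for l
  proof (cases "l \<in> U")
    case True
    have "P M 0 = 0" using P_diff[OF M(1), of 0 0 0] normed_zero_mem[OF normed_X[of 0]] by simp
    then have "sol l = 0"
      using 0 l normed_zero[OF norms(1)] by (intro sol_eq[OF True] E_zero M(1)) auto
    then show ?thesis using 0 l by (simp add: v_def h_def)
  next
    case False
    then show ?thesis using 0 l h0 by (simp add: v_def)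
  qed
  have inv: "v l \<in> Xh s"
    if Xh: "invariant_subscale X nrm E P s0 \<nu> J (F \<epsilon>) Xh" and ux: "\<forall>l\<in>J. \<forall>s\<ge>0. u l \<in> Xh s" and l: "l \<in> J" and s: "0 \<le> s"
    for Xh l s
  proof -
    have sub: "subspace (Xh s)"
      by (rule Xh[unfolded invariant_subscale_def, THEN spec, THEN mp, OF s, THEN conjunct1])
    have ul: "u l \<in> Xh s" using ux l s by blast
    have "h l \<in> Xh s"
    proof (cases "l \<in> U")
      case True
      have "sol l \<in> Xh s" by (rule invariant_sol[OF Xh _ True s]) (use ux in blast)
      then show ?thesis unfolding h_def by (rule subspace_diff[OF sub _ ul])
    next
      case False
      then show ?thesis using h0(1) subspace_0[OF sub] by simp
    qed
    then show ?thesis unfolding v_def by (intro subspace_add[OF sub] ul subspace_scale[OF sub])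
  qed
  show ?thesis
  proof (rule exI[of _ v], rule exI[of _ v'], intro conjI)
    show "\<forall>l\<in>J. v l \<in> E M \<and> v' l \<in> E M \<and> nderiv (nrm s1) v (v' l) l J \<and> ncont (nrm s1) v' l J \<and>
       nrm s1 (v l - u l) \<le> M powr (- 2 - \<sigma> + 13 * t) \<and>
       nrm s1 (v' l - u' l) \<le> M powr (\<mu> + 3 * t) * Y + M powr (- 2 - \<sigma> / 2 + 22 * t) \<and>
       nrm S (v l - u l) \<le> M powr (2 * p - 1 + 16 * t) \<and> nrm S (v' l - u' l) \<le> M powr (2 * q - 1)"
      by (intro ballI conjI vE) (simp_all only: smooth bounds)
    show "\<forall>l\<in>open_nbhd A (M powr (- \<sigma> / 2)) \<inter> J. P M (F \<epsilon> l (v l)) = 0"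
      by (intro ballI zero[unfolded w_def])
    show "(\<forall>l\<in>J. F \<epsilon> l 0 = 0 \<and> u l = 0) \<longrightarrow> (\<forall>l\<in>J. v l = 0)"
      using triv by blast
    show "\<forall>Xh. invariant_subscale X nrm E P s0 \<nu> J (F \<epsilon>) Xh \<longrightarrow> (\<forall>l\<in>J. \<forall>s\<ge>0. u l \<in> Xh s) \<longrightarrow>
        (\<forall>l\<in>J. \<forall>s\<ge>0. v l \<in> Xh s)"
    proof (intro allI impI ballI)
      fix Xh and l s :: real assume "invariant_subscale X nrm E P s0 \<nu> J (F \<epsilon>) Xh" "\<forall>l\<in>J. \<forall>s\<ge>0. u l \<in> Xh s" "l \<in> J" "0 \<le> s"
      then show "v l \<in> Xh s" by (rule inv)
    qed
  qed
qed

end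

section \<open>The iteration and its limit\<close>

locale nash_moser_iteration = nash_moser +
  fixes \<epsilon> \<epsilon>0 \<tau> \<delta> \<sigma> \<mu> p q N0 t :: real and CJ :: "real \<Rightarrow> real"
  assumes \<epsilon>: "0 \<le> \<epsilon>" "\<epsilon> < \<epsilon>0" "\<epsilon>0 \<le> \<epsilon>s" "\<epsilon>0 * N0 powr S \<le> 1"
    and \<mu>: "\<mu> = \<tau> + \<delta> * s1" "0 < \<mu>" and p: "p = \<mu> + \<nu> / 2 + 1" and q: "q = 2 * \<mu> + \<nu> + 2 + \<sigma> / 2"
    and \<sigma>: "2 * \<mu> + 3 * \<nu> + 2 \<le> \<sigma>" "4 * (\<mu> + \<nu>) \<le> \<sigma>" and \<delta>S: "\<delta> * (S - s1) \<le> \<sigma> + 1"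
    and S_lower: "2 * (2 * \<mu> + \<nu> + 3 + \<sigma>) \<le> S - s1"
    and t: "0 < t" "1000 * t \<le> \<nu>" "1000 * t \<le> 1" "1000 * t \<le> \<mu>"
    and N0: "1 \<le> N0" "10 \<le> N0 powr t" "K \<le> N0 powr t" and CJ: "CJ s1 \<le> K" "CJ S \<le> K"
begin

section \<open>The scales and the induction\<close>

definition NN :: "nat \<Rightarrow> real" where
  "NN n = N0 ^ (2 ^ n)"

abbreviation "good n w \<equiv> good_params nrm E P J DF CJ s1 S \<epsilon>0 \<tau> \<delta> (NN n) w"

lemma N0_ge: "10 \<le> N0"
proof -
  have "N0 powr t \<le> N0 powr 1" using N0 t by (intro powr_mono) auto
  then show ?thesis using N0 by simp
qed

lemma NN_0: "NN 0 = N0"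
  by (simp add: NN_def)

lemma NN_Suc: "NN (Suc n) = NN n * NN n"
  by (simp add: NN_def mult_2 power_add)

text \<open>The growth is doubly exponential; the lower bound by powers of 2 suffices for fitting
  the increments into gaps of size \<open>1 / 2 ^ n\<close>.\<close>

lemma NN_ge: "N0 \<le> NN n" "2 ^ Suc n \<le> NN n"
proof -
  have "N0 ^ 1 \<le> N0 ^ (2 ^ n)" using N0 by (intro power_increasing) auto
  then show "N0 \<le> NN n" by (simp add: NN_def)
  show "2 ^ Suc n \<le> NN n"
  proof (induction n)
    case 0 then show ?case using N0_ge by (simp add: NN_def)
  next
    case (Suc n)
    have "(2::real) \<le> 2 ^ Suc n" using power_increasing[of 1 "Suc n" "2::real"] by simp
    with Suc have "2 \<le> NN n" by linarith
    with Suc have "2 * 2 ^ Suc n \<le> NN n * NN n" by (intro mult_mono) auto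
    then show ?case by (simp add: NN_Suc)
  qed
qed

lemma NN_ge1: "1 \<le> NN n"
  using NN_ge(1)[of n] N0 by linarith

lemma NN_powr_Suc: "NN (Suc n) powr x = NN n powr (2 * x)"
  unfolding NN_Suc mult_2 powr_add by (rule powr_mult)

lemma NN_half: "NN n powr x = NN (Suc n) powr (x / 2)"
  unfolding NN_powr_Suc by simp

lemma N0_half: "0 \<le> x \<Longrightarrow> N0 powr x \<le> NN (Suc n) powr (x / 2)"
  by (subst NN_half[symmetric], intro powr_mono2) (use NN_ge(1)[of n] N0 in auto)

lemma NN_t: "N0 powr t \<le> NN n powr t"
  using NN_ge(1)[of n] N0 t by (intro powr_mono2) auto

lemma power_bounds_NN: "power_bounds (NN n) t"
  using NN_ge1[of n] NN_t[of n] N0 by unfold_locales auto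

lemma K_NN: "K \<le> NN n powr t"
  using N0 NN_t[of n] by linarith

lemma exps: "\<nu> > 0" "\<mu> > 0" "\<sigma> > 0" "0 \<le> \<sigma> / 2 - \<nu>"
  using \<nu>_pos \<mu> \<sigma> by auto

lemma \<epsilon>': "0 \<le> \<epsilon>" "\<epsilon> < \<epsilon>s" "\<epsilon> \<le> N0 powr (- S)" "\<epsilon> \<le> 1"
proof -
  show "0 \<le> \<epsilon>" "\<epsilon> < \<epsilon>s" using \<epsilon> by auto
  have pos: "N0 powr S > 0" using N0 by simp
  have "\<epsilon> * N0 powr S \<le> 1" using \<epsilon> mult_right_mono[of \<epsilon> \<epsilon>0 "N0 powr S"] pos by linarith
  then show 1: "\<epsilon> \<le> N0 powr (- S)" using pos by (simp add: powr_minus_divide pos_le_divide_eq)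
  also have "\<dots> \<le> N0 powr 0" using N0 s_nonneg by (intro powr_mono) auto
  finally show "\<epsilon> \<le> 1" using N0 by simp
qed

text \<open>The induction hypothesis is stronger than the claim. The factors
  \<open>1 - 1 / 2 ^ Suc n\<close> leave room for all later increments, and the derivative bound is
  smaller by \<open>N0 powr (- \<nu>)\<close>. The clauses on vanishing and on \<open>Xh\<close> are
  part of it because the sequence is chosen once, before any \<open>Xh\<close> is given.\<close>

definition approx :: "nat \<Rightarrow> (real \<Rightarrow> 'a) \<Rightarrow> (real \<Rightarrow> 'a) \<Rightarrow> real set \<Rightarrow> bool" where
  "approx n u u' A \<longleftrightarrow> A \<subseteq> J \<and>
     (\<forall>l\<in>J. u l \<in> E (NN n) \<and> u' l \<in> E (NN n) \<and> nderiv (nrm s1) u (u' l) l J \<and> ncont (nrm s1) u' l J \<and>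
        nrm s1 (u l) \<le> 1 - 1 / 2 ^ Suc n \<and> nrm s1 (u' l) \<le> N0 powr (\<sigma> / 2 - \<nu>) * (1 - 1 / 2 ^ Suc n) \<and>
        1 + nrm S (u l) \<le> 2 * NN (Suc n) powr p \<and> nrm S (u' l) \<le> 2 * NN (Suc n) powr q) \<and>
     (\<forall>l\<in>open_nbhd A (NN n powr (- \<sigma> / 2)) \<inter> J. P (NN n) (F \<epsilon> l (u l)) = 0) \<and>
     ((\<forall>l\<in>J. F \<epsilon> l 0 = 0) \<longrightarrow> (\<forall>l\<in>J. u l = 0)) \<and>
     (\<forall>Xh. invariant_subscale X nrm E P s0 \<nu> J (F \<epsilon>) Xh \<longrightarrow> (\<forall>l\<in>J. \<forall>s\<ge>0. u l \<in> Xh s))"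

text \<open>The zero curve solves nothing. Its residual is small because
  \<open>\<epsilon> \<le> N0 powr (- S)\<close>, and the lower bound on \<open>S\<close> makes this
  enough at \<open>s1\<close>. The parameter derivative of the residual is merely bounded, hence the
  value \<open>K * K\<close> for \<open>Y\<close>.\<close>

lemma initial_step:
  "galerkin_step X nrm E P s0 \<nu> \<epsilon>s S' J F DF D2F s1 S K \<epsilon> \<epsilon>0 \<tau> \<delta> \<sigma> \<mu> p q N0 t (K * K) CJ
     (\<lambda>_. 0) (\<lambda>_. 0) (good 0 (\<lambda>_. 0))"
proof -
  interpret power_bounds N0 t using power_bounds_NN[of 0] by (simp add: NN_0)
  note N = normed_X[OF s_nonneg(1)] normed_X[OF s_nonneg(2)] normed_X[OF s_nonneg(4)]
  have n0: "nrm s 0 = 0" if "0 \<le> s" for s by (rule normed_zero[OF normed_X[OF that]])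
  have KK: "K * K \<le> N0 powr (2 * t)" by (rule pw_mult[OF _ _ N0(3) N0(3)]) (use K in auto)
  have PF: "nrm s (P N0 (F \<epsilon> l 0)) \<le> N0 powr (2 * t - S)" if "s \<in> {s1, S}" "l \<in> J" for s l
  proof -
    note Pt = P_tame[OF that(1) N0(1)]
    have "F \<epsilon> l 0 \<in> X s \<and> nrm s (F \<epsilon> l 0) \<le> K * \<epsilon>" by (rule tame_at_F[OF Pt(3) \<epsilon>'(1,2) that(2)])
    then have "nrm s (P N0 (F \<epsilon> l 0)) \<le> K * (K * \<epsilon>)" using Pt(5) mult_left_mono[OF _ Pt(4)] by fastforce
    also have "\<dots> = (K * K) * \<epsilon>" by simp
    also have "\<dots> \<le> N0 powr (2 * t - S)" by (rule pw_mult[OF _ \<epsilon>'(1) KK \<epsilon>'(3)]) (use K in auto)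
    finally show ?thesis .
  qed
  have dl: "nrm s1 (P N0 (DF \<epsilon> (l, 0) (1, 0))) \<le> K * K" if l: "l \<in> J" for l
  proof -
    note Pt = P_tame[OF _ N0(1), of s1, simplified]
    have "nrm s1 (P N0 (DF \<epsilon> (l, 0) (1, 0))) \<le> K * K * (1 + nrm (s1 + \<nu>) 0)"
      using tame_param[OF \<epsilon>'(1,2) Pt l, of 0] normed_zero_mem[OF normed_X[OF s_nonneg(3)]] n0[OF s0_nonneg] by simp
    then show ?thesis using n0[OF s_nonneg(3)] by simp
  qed
  show ?thesis
  proof unfold_locales
    show "a \<in> good 0 (\<lambda>_. 0) \<Longrightarrow> (a, 0) \<in> good_pairs nrm E P J DF CJ s1 S \<epsilon>0 \<tau> \<delta> N0" for a
      by (simp add: good_params_def NN_0)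
    show "l \<in> J \<Longrightarrow> nderiv (nrm s1) (\<lambda>_. 0) 0 l J" "l \<in> J \<Longrightarrow> ncont (nrm s1) (\<lambda>_. 0) l J" for l
      by (simp_all add: nderiv_def ncont_def n0[OF s_nonneg(1)])
    show "nrm s1 0 + N0 powr (- \<sigma> - 1) \<le> 1"
      using powr_mono[of "- \<sigma> - 1" 0 N0] N0 exps by (simp add: n0[OF s_nonneg(1)])
    show "1 + nrm s1 0 \<le> N0 powr (\<sigma> / 4 - \<nu> / 4)"
      using powr_mono[of 0 "\<sigma> / 4 - \<nu> / 4" N0] N0 exps by (simp add: n0[OF s_nonneg(1)])
    show "l \<in> open_nbhd (good 0 (\<lambda>_. 0)) (2 * N0 powr (- \<sigma> / 2)) \<inter> J \<Longrightarrow>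
        nrm s1 (P N0 (F \<epsilon> l 0)) \<le> N0 powr (- 2 - \<sigma> - \<mu> + 10 * t)" for l
      by (rule pw_le[OF PF]) (use S_lower exps s_nonneg t in auto)
    show "l \<in> open_nbhd (good 0 (\<lambda>_. 0)) (2 * N0 powr (- \<sigma> / 2)) \<inter> J \<Longrightarrow>
        nrm S (P N0 (F \<epsilon> l 0)) \<le> N0 powr (\<nu> / 2 + p + 10 * t)" for l
      by (rule pw_le[OF PF]) (use S_lower exps s_nonneg t p in auto)
    show "K * K \<le> N0 powr (10 * t)" by (rule pw_le[OF KK]) (use t in auto)
  qed (use \<epsilon> \<mu> p q \<sigma> \<delta>S t N0 CJ K dl n0 s_nonneg E_zero in auto)
qed

lemma initial_approx: "\<exists>u u'. approx 0 u u' (good 0 (\<lambda>_. 0))"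
proof -
  interpret G: galerkin_step X nrm E P s0 \<nu> \<epsilon>s S' J F DF D2F s1 S K \<epsilon> \<epsilon>0 \<tau> \<delta> \<sigma> \<mu> p q N0 t "K * K" CJ
    "\<lambda>_. 0" "\<lambda>_. 0" "good 0 (\<lambda>_. 0)"
    by (rule initial_step)
  obtain v v' where v: "\<forall>l\<in>J. v l \<in> E N0 \<and> v' l \<in> E N0 \<and> nderiv (nrm s1) v (v' l) l J \<and> ncont (nrm s1) v' l J \<and>
       nrm s1 (v l - 0) \<le> N0 powr (- 2 - \<sigma> + 13 * t) \<and>
       nrm s1 (v' l - 0) \<le> N0 powr (\<mu> + 3 * t) * (K * K) + N0 powr (- 2 - \<sigma> / 2 + 22 * t) \<and>
       nrm S (v l - 0) \<le> N0 powr (2 * p - 1 + 16 * t) \<and> nrm S (v' l - 0) \<le> N0 powr (2 * q - 1)"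
     and sol: "\<forall>l\<in>open_nbhd (good 0 (\<lambda>_. 0)) (N0 powr (- \<sigma> / 2)) \<inter> J. P N0 (F \<epsilon> l (v l)) = 0"
     and triv: "(\<forall>l\<in>J. F \<epsilon> l 0 = 0 \<and> (0::'a) = 0) \<longrightarrow> (\<forall>l\<in>J. v l = 0)"
     and inv: "\<forall>Xh. invariant_subscale X nrm E P s0 \<nu> J (F \<epsilon>) Xh \<longrightarrow> (\<forall>l\<in>J. \<forall>s\<ge>0. 0 \<in> Xh s) \<longrightarrow>
        (\<forall>l\<in>J. \<forall>s\<ge>0. v l \<in> Xh s)"
    using G.step by blast
  have 1: "nrm s1 (v l) \<le> 1 - 1 / 2 ^ Suc 0" if "l \<in> J" for l
    using v that G.pw_half[of "- 2 - \<sigma> + 13 * t"] exps t by fastforce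
  \<comment> \<open>With \<open>Y\<close> only bounded, the first derivative has the size
    \<open>N0 powr \<mu>\<close> of the inverse, up to multiples of \<open>t\<close>. The bound
    \<open>2 * \<mu> + 3 * \<nu> + 2 \<le> \<sigma>\<close> puts this well below
    \<open>N0 powr (\<sigma> / 2 - \<nu>)\<close>.\<close>
  have 2: "nrm s1 (v' l) \<le> N0 powr (\<sigma> / 2 - \<nu>) * (1 - 1 / 2 ^ Suc 0)" if "l \<in> J" for l
  proof -
    have "N0 powr (\<mu> + 3 * t) * (K * K) \<le> N0 powr (\<mu> + 5 * t)"
      by (rule G.pw_mult[OF _ _ order_refl G.pw_K2]) (use K in auto)
    from G.pw_add[OF this order_refl] have "N0 powr (\<mu> + 3 * t) * (K * K) + N0 powr (- 2 - \<sigma> / 2 + 22 * t) \<le> N0 powr (\<mu> + 6 * t)"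
      using exps t by simp
    then have "nrm s1 (v' l) \<le> N0 powr (\<mu> + 6 * t)" using v that by fastforce
    also have "\<dots> = N0 powr (\<sigma> / 2 - \<nu>) * N0 powr (\<mu> + 6 * t - (\<sigma> / 2 - \<nu>))" by (simp flip: powr_add)
    also have "\<dots> \<le> N0 powr (\<sigma> / 2 - \<nu>) * (1 / 2)"
      using \<sigma> exps t by (intro mult_left_mono G.pw_half) auto
    finally show ?thesis by simp
  qed
  have 3: "1 + nrm S (v l) \<le> 2 * NN (Suc 0) powr p" if "l \<in> J" for l
  proof -
    have "1 \<le> N0 powr (2 * p)" using powr_mono[of 0 "2 * p" N0] N0 exps p by simp
    moreover have "nrm S (v l) \<le> N0 powr (2 * p)"
      by (rule G.pw_le[of _ "2 * p - 1 + 16 * t"]) (use v that t in auto)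
    ultimately show ?thesis by (simp add: NN_powr_Suc NN_0)
  qed
  have 4: "nrm S (v' l) \<le> 2 * NN (Suc 0) powr q" if "l \<in> J" for l
  proof -
    have "nrm S (v' l) \<le> N0 powr (2 * q)"
      by (rule G.pw_le[of _ "2 * q - 1"]) (use v that in auto)
    moreover have "0 \<le> N0 powr (2 * q)" by simp
    ultimately show ?thesis unfolding NN_powr_Suc NN_0 by linarith
  qed
  have inv': "\<forall>Xh. invariant_subscale X nrm E P s0 \<nu> J (F \<epsilon>) Xh \<longrightarrow> (\<forall>l\<in>J. \<forall>s\<ge>0. v l \<in> Xh s)"
  proof (intro allI impI)
    fix Xh assume Xh: "invariant_subscale X nrm E P s0 \<nu> J (F \<epsilon>) Xh"
    have "0 \<in> Xh s" if "0 \<le> s" for s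
      by (rule subspace_0, rule Xh[unfolded invariant_subscale_def, THEN spec, THEN mp, OF that, THEN conjunct1])
    with inv Xh show "\<forall>l\<in>J. \<forall>s\<ge>0. v l \<in> Xh s" by simp
  qed
  have "approx 0 v v' (good 0 (\<lambda>_. 0))"
    unfolding approx_def
  proof (intro conjI)
    show "good 0 (\<lambda>_. 0) \<subseteq> J" by (auto simp: good_params_def)
    show "\<forall>l\<in>J. v l \<in> E (NN 0) \<and> v' l \<in> E (NN 0) \<and> nderiv (nrm s1) v (v' l) l J \<and> ncont (nrm s1) v' l J \<and>
        nrm s1 (v l) \<le> 1 - 1 / 2 ^ Suc 0 \<and> nrm s1 (v' l) \<le> N0 powr (\<sigma> / 2 - \<nu>) * (1 - 1 / 2 ^ Suc 0) \<and>
        1 + nrm S (v l) \<le> 2 * NN (Suc 0) powr p \<and> nrm S (v' l) \<le> 2 * NN (Suc 0) powr q"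
      by (intro ballI conjI 1 2 3 4) (use v in \<open>auto simp only: NN_0\<close>)
    show "\<forall>l\<in>open_nbhd (good 0 (\<lambda>_. 0)) (NN 0 powr (- \<sigma> / 2)) \<inter> J. P (NN 0) (F \<epsilon> l (v l)) = 0"
      using sol by (simp only: NN_0)
    show "(\<forall>l\<in>J. F \<epsilon> l 0 = 0) \<longrightarrow> (\<forall>l\<in>J. v l = 0)" using triv by simp
  qed (rule inv')
  then show ?thesis by blast
qed

definition T_rem :: "nat \<Rightarrow> 'a \<Rightarrow> 'a" where
  "T_rem n y = P (NN (Suc n)) (y - P (NN n) y)"

lemma T_rem_linear: "bounded_linear_on (X s0) (nrm s0) (X s1) (nrm s1) (T_rem n)"
proof -
  note N0' = normed_X[OF s0_nonneg]
  note a = P_bounded_linear[OF NN_ge1 s0_nonneg s0_nonneg, of n]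
  note b = P_bounded_linear[OF NN_ge1 s0_nonneg s_nonneg(1), of "Suc n"]
  obtain Ca where Ca: "Ca \<ge> 0" "\<And>y. y \<in> X s0 \<Longrightarrow> nrm s0 (P (NN n) y) \<le> Ca * nrm s0 y"
    using bounded_linear_on_bound[OF a N0'] by blast
  obtain Cb where Cb: "Cb \<ge> 0" "\<And>y. y \<in> X s0 \<Longrightarrow> nrm s1 (P (NN (Suc n)) y) \<le> Cb * nrm s0 y"
    using bounded_linear_on_bound[OF b N0'] by blast
  have m: "y \<in> X s0 \<Longrightarrow> y - P (NN n) y \<in> X s0" for y
    by (intro normed_mem[OF N0'] bounded_linear_on_mem[OF a])
  have bound: "nrm s1 (T_rem n y) \<le> (Cb * (1 + Ca)) * nrm s0 y" if y: "y \<in> X s0" for y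
  proof -
    have "nrm s0 (y - P (NN n) y) \<le> nrm s0 y + nrm s0 (P (NN n) y)"
      by (rule normed_diff_le[OF N0' y bounded_linear_on_mem[OF a y]])
    then have d: "nrm s0 (y - P (NN n) y) \<le> (1 + Ca) * nrm s0 y" using Ca(2)[OF y] by (simp add: distrib_right)
    have "nrm s1 (T_rem n y) \<le> Cb * nrm s0 (y - P (NN n) y)" unfolding T_rem_def by (rule Cb(2)[OF m[OF y]])
    also note mult_left_mono[OF d Cb(1)]
    finally show ?thesis by (simp add: mult.assoc)
  qed
  have add: "T_rem n (x + y) = T_rem n x + T_rem n y" if "x \<in> X s0" "y \<in> X s0" for x y
  proof -
    have "x + y - P (NN n) (x + y) = (x - P (NN n) x) + (y - P (NN n) y)"
      by (simp add: bounded_linear_on_add[OF a that])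
    then show ?thesis unfolding T_rem_def by (simp only: bounded_linear_on_add[OF b m[OF that(1)] m[OF that(2)]])
  qed
  have scale: "T_rem n (c *\<^sub>R x) = c *\<^sub>R T_rem n x" if "x \<in> X s0" for c x
  proof -
    have "c *\<^sub>R x - P (NN n) (c *\<^sub>R x) = c *\<^sub>R (x - P (NN n) x)"
      by (simp add: bounded_linear_on_scale[OF a that] algebra_simps)
    then show ?thesis unfolding T_rem_def by (simp only: bounded_linear_on_scale[OF b m[OF that]])
  qed
  have mem: "T_rem n x \<in> X s1" if "x \<in> X s0" for x
    unfolding T_rem_def by (rule bounded_linear_on_mem[OF b m[OF that]])
  show ?thesis
    unfolding bounded_linear_on_def using bound add scale mem by blast
qed

text \<open>The gain of \<open>S - s1\<close> derivatives takes place at the old scale, the square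
  root of the new one; hence half the exponent.\<close>

lemma T_rem_bound:
  assumes y: "y \<in> X S"
  shows "nrm s1 (T_rem n y) \<le> (K * K * NN (Suc n) powr (- (S - s1) / 2)) * nrm S y"
proof -
  have y1: "y \<in> X s1" using X_mono[OF y] s_nonneg s1S by simp
  have Py: "P (NN n) y \<in> X s1" by (rule E_X[OF NN_ge1 s_nonneg(1) P_mem[OF NN_ge1 s_nonneg(1) y1]])
  have "nrm s1 (T_rem n y) \<le> K * nrm s1 (y - P (NN n) y)"
    unfolding T_rem_def by (rule P_le[OF _ NN_ge1 normed_diff_mem[OF normed_X[OF s_nonneg(1)] y1 Py]]) simp
  also have "\<dots> \<le> K * (K * NN n powr (- (S - s1)) * nrm S y)"
    by (rule mult_left_mono[OF P_rem[OF NN_ge1 y] s_nonneg(7)])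
  also have "\<dots> = (K * K * NN (Suc n) powr (- (S - s1) / 2)) * nrm S y"
    by (subst NN_half) simp
  finally show ?thesis .
qed

lemma T_rem_eq: "P (NN n) y = 0 \<Longrightarrow> T_rem n y = P (NN (Suc n)) y"
  by (simp add: T_rem_def)

text \<open>The Galerkin equation holds on a full neighbourhood of \<open>l\<close> in
  \<open>J\<close>, so it may be differentiated, and points of \<open>J\<close> near
  \<open>l\<close> force the derivative to be 0. This makes \<open>Y\<close> a negative power of the
  scale from the second step on.\<close>

lemma differentiated_equation:
  assumes u: "approx n u u' A" and l: "l \<in> open_nbhd A (NN n powr (- \<sigma> / 2)) \<inter> J"
  shows "P (NN n) (DF \<epsilon> (l, u l) (1, u' l)) = 0"
proof -
  have lJ: "l \<in> J" using l by simp
  note N1 = normed_X[OF s_nonneg(1)] and Pb = P_bounded_linear[OF NN_ge1 s0_nonneg s_nonneg(1), of n]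
  have uE: "u r \<in> E (NN n)" "u' r \<in> E (NN n)" if "r \<in> J" for r
    using u that by (auto simp: approx_def)
  have uX: "u r \<in> X s" "u' r \<in> X s" if "r \<in> J" "0 \<le> s" for r s
    using uE[OF that(1)] E_X[OF NN_ge1 that(2)] by auto
  obtain C where C: "0 \<le> C" "\<And>x. x \<in> E (NN n) \<Longrightarrow> nrm (s0 + \<nu>) x \<le> C * nrm s1 x"
    using E_norm_equiv[OF NN_ge1 s0\<nu> s_nonneg(1)] by blast
  have du: "nderiv (nrm s1) u (u' l) l J" using u lJ by (simp add: approx_def)
  have dc: "nderiv pn (\<lambda>r. (r, u r)) (1, u' l) l J"
  proof (rule nderiv_mono_norm[OF du C(1)])
    fix r assume r: "r \<in> J"
    have "u r - u l - (r - l) *\<^sub>R u' l \<in> E (NN n)"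
      by (intro E_diff E_scale NN_ge1 uE r lJ)
    then show "pn ((r, u r) - (l, u l) - (r - l) *\<^sub>R (1, u' l)) \<le> C * nrm s1 (u r - u l - (r - l) *\<^sub>R u' l)"
      using C(2) by simp
  qed
  have "nderiv (nrm s1) (\<lambda>r. P (NN n) (FF \<epsilon> (r, u r))) (P (NN n) (DF \<epsilon> (l, u l) (1, u' l))) l J"
    by (rule nderiv_T_FF[OF \<epsilon>'(1,2) s_nonneg(1) Pb dc]) (use uX[OF _ s0\<nu>] lJ in auto)
  then have d: "nderiv (nrm s1) (\<lambda>r. P (NN n) (F \<epsilon> r (u r))) (P (NN n) (DF \<epsilon> (l, u l) (1, u' l))) l J" (is "nderiv _ ?f ?d _ _")
    by simp
  have z: "?f r = 0" if "r \<in> open_nbhd A (NN n powr (- \<sigma> / 2))" "r \<in> J" for r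
    using u that by (auto simp: approx_def)
  have "\<forall>\<^sub>F r in at l within J. r \<in> open_nbhd A (NN n powr (- \<sigma> / 2))"
    using l by (intro topological_tendstoD[OF tendsto_ident_at]) (auto simp: open_nbhd_def)
  moreover have "\<forall>\<^sub>F r in at l within J. r \<in> J \<and> r \<noteq> l" by (simp add: eventually_at_filter)
  ultimately have ev: "\<forall>\<^sub>F r in at l within J. ?f r = 0 \<and> r \<noteq> l"
    by eventually_elim (simp add: z)
  have dX: "?d \<in> X s1"
    using T_DF_mem[OF \<epsilon>'(1,2) s_nonneg(1) Pb, of "(l, u l)" "(1, u' l)"] uX[OF lJ s0\<nu>] lJ by simp
  have "nrm s1 ?d \<le> 0 + e" if e: "e > 0" for e
  proof -
    from eventually_happens[OF eventually_conj[OF nderivD[OF d e] ev]] islimpt_J[OF lJ]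
    obtain r where r: "nrm s1 (?f r - ?f l - (r - l) *\<^sub>R ?d) \<le> e * \<bar>r - l\<bar>" "?f r = 0" "r \<noteq> l" by blast
    have "nrm s1 (?f r - ?f l - (r - l) *\<^sub>R ?d) = \<bar>r - l\<bar> * nrm s1 ?d"
      using z[of l] l r(2) normed_scale[OF N1 dX, of "l - r"] by (simp add: abs_minus_commute algebra_simps)
    then have "\<bar>r - l\<bar> * nrm s1 ?d \<le> \<bar>r - l\<bar> * e" using r(1) by (simp add: mult.commute)
    then show ?thesis using r(3) by simp
  qed
  then have "nrm s1 ?d \<le> 0" by (rule field_le_epsilon)
  then show ?thesis using normed_nonneg[OF N1 dX] normed_eq_0[OF N1 dX] by simp
qed

text \<open>\<open>u\<close> satisfies the equation and its derivative at the old scale, so both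
  residuals at the new scale pass through \<open>T_rem n\<close>. Their bounds combine the exponent
  \<open>- (S - s1) / 2\<close> with the growth at \<open>S + \<nu>\<close>, where the derivative
  loss \<open>\<nu>\<close> at the old scale counts as \<open>\<nu> / 2\<close>.\<close>

lemma next_step:
  assumes u: "approx n u u' A"
  defines "M \<equiv> NN (Suc n)"
  shows "galerkin_step X nrm E P s0 \<nu> \<epsilon>s S' J F DF D2F s1 S K \<epsilon> \<epsilon>0 \<tau> \<delta> \<sigma> \<mu> p q M t
     (M powr (\<nu> / 2 + q + 10 * t - (S - s1) / 2)) CJ u u' (A \<inter> good (Suc n) u)"
proof -
  interpret power_bounds M t unfolding M_def by (rule power_bounds_NN)
  note N1 = normed_X[OF s_nonneg(1)]
  have M1: "1 \<le> M" "K \<le> M powr t" unfolding M_def by (rule NN_ge1, rule K_NN)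
  have KK: "K * K \<le> M powr (2 * t)" by (rule pw_mult[OF _ _ M1(2) M1(2)]) (use K in auto)
  have KKK: "K * K * K \<le> M powr (3 * t)" by (rule pw_mult[OF _ _ KK M1(2)]) (use K in auto)
  have uE: "u l \<in> E (NN n)" "u' l \<in> E (NN n)" if "l \<in> J" for l
    using u that by (auto simp: approx_def)
  have uX: "u l \<in> X s" "u' l \<in> X s" if "l \<in> J" "0 \<le> s" for l s
    using uE[OF that(1)] E_X[OF NN_ge1 that(2)] by auto
  have EM: "E (NN n) \<subseteq> E M"
    unfolding M_def NN_Suc by (rule E_mono) (use NN_ge1[of n] in \<open>auto simp: mult_le_cancel_right1\<close>)
  have nS: "nrm S (u l) \<le> M powr (p + t)" "nrm S (u' l) \<le> M powr (q + t)" if l: "l \<in> J" for l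
  proof -
    have "nrm S (u l) \<le> 2 * M powr p" "nrm S (u' l) \<le> 2 * M powr q"
      using u l unfolding M_def by (auto simp: approx_def)
    moreover have "2 * M powr x \<le> M powr (x + t)" for x by (rule pw_mult[OF _ _ pw_num order_refl]) auto
    ultimately show "nrm S (u l) \<le> M powr (p + t)" "nrm S (u' l) \<le> M powr (q + t)" using order_trans by blast+
  qed
  have gain: "nrm (S + \<nu>) x \<le> M powr (\<nu> / 2 + c + 2 * t)" if x: "x \<in> E (NN n)" "nrm S x \<le> M powr (c + t)" for x c
  proof -
    have "nrm (S + \<nu>) x \<le> K * NN n powr \<nu> * nrm S x" by (rule E_gain[OF _ NN_ge1 x(1)]) simp
    also have "\<dots> = K * M powr (\<nu> / 2) * nrm S x" unfolding M_def NN_half[symmetric] ..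
    also have "\<dots> \<le> M powr (\<nu> / 2 + c + 2 * t)"
      by (rule pw_mult[OF _ E_nrm_nonneg[OF NN_ge1 x(1) s_nonneg(2)] pw_mult[OF _ _ M1(2) order_refl order_refl] x(2)])
         (use K in auto)
    finally show ?thesis .
  qed
  have S\<nu>: "nrm (S + \<nu>) (u l) \<le> M powr (\<nu> / 2 + p + 2 * t)" "nrm (S + \<nu>) (u' l) \<le> M powr (\<nu> / 2 + q + 2 * t)"
    if l: "l \<in> J" for l
    by (intro gain uE nS l)+
  have b1: "nrm s1 (u l) \<le> 1 - 1 / 2 ^ Suc n" "nrm s1 (u' l) \<le> N0 powr (\<sigma> / 2 - \<nu>) * (1 - 1 / 2 ^ Suc n)" if "l \<in> J" for l
    using u that by (auto simp: approx_def)
  \<comment> \<open>The ball of the new step then fits into the gap below 1 left by the induction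
    hypothesis.\<close>
  have Minv: "M powr (- \<sigma> - 1) \<le> 1 / 2 ^ Suc n"
  proof -
    have "M powr (- \<sigma> - 1) \<le> M powr (- 1)" using M1 exps by (intro powr_mono) auto
    also have "\<dots> = 1 / M" using M1 by (simp add: powr_minus_divide)
    also have "\<dots> \<le> 1 / 2 ^ Suc n"
    proof (rule divide_left_mono)
      have "(2::real) ^ Suc n \<le> 2 ^ Suc (Suc n)" by (rule power_increasing) auto
      then show "2 ^ Suc n \<le> M" using NN_ge(2)[of "Suc n"] unfolding M_def by linarith
    qed (use M1 in auto)
    finally show ?thesis .
  qed
  have u1: "nrm s1 (u l) + M powr (- \<sigma> - 1) \<le> 1" "nrm s1 (u l) \<le> 1" "nrm s0 (u l) \<le> 1" "nrm s0 (u' l) \<le> nrm s1 (u' l)"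
    if l: "l \<in> J" for l
  proof -
    show "nrm s1 (u l) + M powr (- \<sigma> - 1) \<le> 1" using b1(1)[OF l] Minv by linarith
    then show "nrm s1 (u l) \<le> 1" using powr_ge_zero[of M "- \<sigma> - 1"] by linarith
    then show "nrm s0 (u l) \<le> 1" using E_n0[OF NN_ge1 uE(1)[OF l]] by simp
    show "nrm s0 (u' l) \<le> nrm s1 (u' l)" by (rule E_n0[OF NN_ge1 uE(2)[OF l]])
  qed
  \<comment> \<open>The exponent of the speed is \<open>\<sigma> / 4 - \<nu> / 2\<close> at the new
    scale. Half of the surplus \<open>\<nu> / 2\<close> covers the summand 1, the other half is the
    margin used in \<open>L_perturb_s1\<close>.\<close>
  have u'1: "1 + nrm s1 (u' l) \<le> M powr (\<sigma> / 4 - \<nu> / 4)" if l: "l \<in> J" for l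
  proof -
    have "N0 powr (\<sigma> / 2 - \<nu>) * (1 - 1 / 2 ^ Suc n) \<le> N0 powr (\<sigma> / 2 - \<nu>) * 1" by (intro mult_left_mono) auto
    also have "N0 powr (\<sigma> / 2 - \<nu>) \<le> M powr ((\<sigma> / 2 - \<nu>) / 2)" unfolding M_def by (rule N0_half[OF exps(4)])
    finally have "nrm s1 (u' l) \<le> M powr ((\<sigma> / 2 - \<nu>) / 2)" using b1(2)[OF l] by simp
    from pw_add[OF _ this, of 1 0] show ?thesis using M1 exps t by (simp add: field_simps)
  qed
  \<comment> \<open>In terms of the new scale the old width is
    \<open>M powr (- \<sigma> / 4)\<close>, which exceeds the doubled new width. So the old equation
    holds wherever the new correction is constructed.\<close>
  have nb: "l \<in> open_nbhd A (NN n powr (- \<sigma> / 2)) \<inter> J" if l: "l \<in> open_nbhd (A \<inter> good (Suc n) u) (2 * M powr (- \<sigma> / 2)) \<inter> J" for l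
  proof -
    have "2 * M powr (- \<sigma> / 2) \<le> M powr (- \<sigma> / 2 / 2)"
      by (rule pw_mult[OF _ _ pw_num order_refl]) (use t exps \<sigma> in auto)
    also have "\<dots> = NN n powr (- \<sigma> / 2)" unfolding M_def NN_half[symmetric] ..
    finally have "2 * M powr (- \<sigma> / 2) \<le> NN n powr (- \<sigma> / 2)" .
    moreover obtain a where "a \<in> A" "dist a l < 2 * M powr (- \<sigma> / 2)" "l \<in> J"
      using l by (auto simp: open_nbhd_def)
    ultimately have "a \<in> A" "dist a l < NN n powr (- \<sigma> / 2)" "l \<in> J" by linarith+
    then show ?thesis by (auto simp: open_nbhd_def)
  qed
  let ?b = "K * K * M powr (- (S - s1) / 2)"
  have b0: "0 \<le> ?b" using K by simp
  have bb: "?b * K * 6 \<le> M powr (4 * t - (S - s1) / 2)"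
  proof -
    have "(K * K * K) * 6 * M powr (- (S - s1) / 2) \<le> M powr (4 * t - (S - s1) / 2)"
      by (rule pw_mult[OF _ _ pw_mult[OF _ _ KKK pw_num order_refl] order_refl]) (use K in \<open>simp_all add: field_simps\<close>)
    then show ?thesis by (simp add: mult_ac)
  qed
  note Tr = \<epsilon>'(1,2) s_nonneg(1) T_rem_linear[of n] tame_S[of S, simplified] b0 T_rem_bound[of _ n, folded M_def]
  have eqT: "nrm s1 (P M (F \<epsilon> l (u l))) = nrm s1 (T_rem n (F \<epsilon> l (u l)))" (is ?A)
    and eqT': "nrm s1 (P M (DF \<epsilon> (l, u l) (1, u' l))) = nrm s1 (T_rem n (DF \<epsilon> (l, u l) (1, u' l)))" (is ?B)
    if l: "l \<in> open_nbhd (A \<inter> good (Suc n) u) (2 * M powr (- \<sigma> / 2)) \<inter> J" for l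
  proof -
    have "P (NN n) (F \<epsilon> l (u l)) = 0" using u nb[OF l] by (auto simp: approx_def)
    then show ?A by (simp add: T_rem_eq M_def)
    show ?B using differentiated_equation[OF u nb[OF l]] by (simp add: T_rem_eq M_def)
  qed
  have pos: "0 \<le> nrm (S + \<nu>) (u l)" "0 \<le> nrm (S + \<nu>) (u' l)" "0 \<le> nrm s1 (u' l)" "0 \<le> nrm s0 (u' l)" if l: "l \<in> J" for l
    using E_nrm_nonneg[OF NN_ge1] uE[OF l] s_nonneg s0_nonneg by auto
  have one: "x + nrm (S + \<nu>) (u l) \<le> M powr (\<nu> / 2 + p + 3 * t)" if "l \<in> J" "x \<le> 1" for l x
    by (rule pw_add[of x 0, OF _ S\<nu>(1)[OF that(1)]]) (use that M1 exps t p in auto)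
  show ?thesis
  proof unfold_locales
    show "a \<in> A \<inter> good (Suc n) u \<Longrightarrow> (a, u a) \<in> good_pairs nrm E P J DF CJ s1 S \<epsilon>0 \<tau> \<delta> M" for a
      by (simp add: good_params_def M_def)
    show "10 \<le> M powr t" using base by simp
    show "l \<in> J \<Longrightarrow> u l \<in> E M" "l \<in> J \<Longrightarrow> u' l \<in> E M" for l using uE EM by auto
    show "l \<in> J \<Longrightarrow> nderiv (nrm s1) u (u' l) l J" "l \<in> J \<Longrightarrow> ncont (nrm s1) u' l J" for l
      using u by (auto simp: approx_def)
    show "l \<in> J \<Longrightarrow> nrm (S + \<nu>) (u l) \<le> M powr (\<nu> / 2 + p + 5 * t)" for l
      by (rule pw_le[OF S\<nu>(1)]) (use t in auto)
    show "l \<in> J \<Longrightarrow> nrm (S + \<nu>) (u' l) \<le> M powr (\<nu> / 2 + q + 5 * t)" for l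
      by (rule pw_le[OF S\<nu>(2)]) (use t in auto)
    fix l assume l: "l \<in> open_nbhd (A \<inter> good (Suc n) u) (2 * M powr (- \<sigma> / 2)) \<inter> J"
    then have lJ: "l \<in> J" by simp
    note ux = uX[OF lJ s_nonneg(4)]
    have "nrm s1 (T_rem n (F \<epsilon> l (u l))) \<le> 6 * ?b * K * (\<epsilon> + nrm (S + \<nu>) (u l))"
      by (rule tame_F[OF Tr lJ ux(1) u1(3)[OF lJ]])
    also have "\<dots> = (?b * K * 6) * (\<epsilon> + nrm (S + \<nu>) (u l))" by simp
    also have "\<dots> \<le> M powr (- 2 - \<sigma> - \<mu> + 10 * t)"
    proof (rule pw_mult[OF _ _ bb one[OF lJ \<epsilon>'(4)]])
      \<comment> \<open>Here the lower bound on \<open>S - s1\<close> is consumed: its half, minus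
        \<open>\<nu> / 2 + p\<close>, leaves \<open>2 + \<sigma> + \<mu>\<close>.\<close>
      show "4 * t - (S - s1) / 2 + (\<nu> / 2 + p + 3 * t) \<le> - 2 - \<sigma> - \<mu> + 10 * t"
        using S_lower t unfolding p by argo
    qed (use K \<epsilon>' pos[OF lJ] in auto)
    finally show "nrm s1 (P M (F \<epsilon> l (u l))) \<le> M powr (- 2 - \<sigma> - \<mu> + 10 * t)" by (simp only: eqT[OF l])
    have "nrm S (P M (F \<epsilon> l (u l))) \<le> 6 * K * K * (\<epsilon> + nrm (S + \<nu>) (u l))"
      by (rule tame_F[OF \<epsilon>'(1,2) P_tame[OF _ M1(1)] lJ ux(1) u1(3)[OF lJ]]) auto
    also have "\<dots> = (K * K * 6) * (\<epsilon> + nrm (S + \<nu>) (u l))" by simp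
    also have "\<dots> \<le> M powr (\<nu> / 2 + p + 10 * t)"
      by (rule pw_mult[OF _ _ pw_mult[OF _ _ KK pw_num order_refl] one[OF lJ \<epsilon>'(4)]]) (use K \<epsilon>' pos[OF lJ] t in auto)
    finally show "nrm S (P M (F \<epsilon> l (u l))) \<le> M powr (\<nu> / 2 + p + 10 * t)" .
    let ?t1 = "T_rem n (DF \<epsilon> (l, u l) (1, 0))" and ?t2 = "T_rem n (DF \<epsilon> (l, u l) (0, u' l))"
    have bl: "bounded_linear_on VV pn (X s0) (nrm s0) (DF \<epsilon> (l, u l))"
      by (rule DF_linear[OF \<epsilon>'(1,2)]) (use lJ uX[OF lJ s0\<nu>] in simp)
    have VV: "(1, 0) \<in> VV" "(0, u' l) \<in> VV" using uX[OF lJ s0\<nu>] normed_zero_mem[OF normed_X[OF s0\<nu>]] by auto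
    note dm = bounded_linear_on_mem[OF bl VV(1)] bounded_linear_on_mem[OF bl VV(2)]
    have "DF \<epsilon> (l, u l) (1, u' l) = DF \<epsilon> (l, u l) (1, 0) + DF \<epsilon> (l, u l) (0, u' l)"
      using bounded_linear_on_add[OF bl VV] by simp
    then have "T_rem n (DF \<epsilon> (l, u l) (1, u' l)) = ?t1 + ?t2"
      by (simp add: bounded_linear_on_add[OF T_rem_linear dm])
    then have c1: "nrm s1 (T_rem n (DF \<epsilon> (l, u l) (1, u' l))) \<le> nrm s1 ?t1 + nrm s1 ?t2"
      using normed_triangle[OF N1 bounded_linear_on_mem[OF T_rem_linear dm(1)] bounded_linear_on_mem[OF T_rem_linear dm(2)]]
      by simp
    have c2: "nrm s1 ?t1 \<le> ?b * K * (1 + nrm (S + \<nu>) (u l))"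
      by (rule tame_param[OF Tr lJ ux(1) u1(3)[OF lJ]])
    also have "\<dots> \<le> 6 * ?b * K * (1 + nrm (S + \<nu>) (u l))"
      using b0 K pos[OF lJ] by (intro mult_right_mono) auto
    finally have c2: "nrm s1 ?t1 \<le> 6 * ?b * K * (1 + nrm (S + \<nu>) (u l))" .
    have "nrm s1 ?t2 \<le> 3 * ?b * K * (nrm (S + \<nu>) (u' l) + nrm (S + \<nu>) (u l) * nrm s0 (u' l))"
      by (rule tame_DF[OF Tr lJ ux(1) u1(3)[OF lJ] ux(2)])
    also have "\<dots> \<le> 6 * ?b * K * (nrm (S + \<nu>) (u' l) + (1 + nrm (S + \<nu>) (u l)) * nrm s1 (u' l))"
      using b0 K pos[OF lJ] u1(4)[OF lJ] by (intro mult_mono add_mono mult_right_mono add_nonneg_nonneg mult_nonneg_nonneg) auto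
    finally have c3: "nrm s1 ?t2 \<le> 6 * ?b * K * (nrm (S + \<nu>) (u' l) + (1 + nrm (S + \<nu>) (u l)) * nrm s1 (u' l))" .
    have c4: "(?b * K * 6) * ((1 + nrm (S + \<nu>) (u l)) * (1 + nrm s1 (u' l)) + nrm (S + \<nu>) (u' l)) =
      6 * ?b * K * (1 + nrm (S + \<nu>) (u l)) + 6 * ?b * K * (nrm (S + \<nu>) (u' l) + (1 + nrm (S + \<nu>) (u l)) * nrm s1 (u' l))"
      by (simp add: algebra_simps)
    have "(1 + nrm (S + \<nu>) (u l)) * (1 + nrm s1 (u' l)) \<le> M powr (\<nu> / 2 + p + 3 * t + (\<sigma> / 4 - \<nu> / 4))"
      by (rule pw_mult[OF _ _ one[OF lJ order_refl] u'1[OF lJ]]) (use pos[OF lJ] in auto)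
    from pw_add[OF this S\<nu>(2)[OF lJ]]
    have "(1 + nrm (S + \<nu>) (u l)) * (1 + nrm s1 (u' l)) + nrm (S + \<nu>) (u' l) \<le> M powr (\<nu> / 2 + q + 4 * t)"
      using p q exps t \<sigma> by simp
    from pw_mult[OF _ _ bb this, of "\<nu> / 2 + q + 10 * t - (S - s1) / 2"]
    have "(?b * K * 6) * ((1 + nrm (S + \<nu>) (u l)) * (1 + nrm s1 (u' l)) + nrm (S + \<nu>) (u' l)) \<le> M powr (\<nu> / 2 + q + 10 * t - (S - s1) / 2)"
      using b0 K pos[OF lJ] t by simp
    with c1 c2 c3 c4 show "nrm s1 (P M (DF \<epsilon> (l, u l) (1, u' l))) \<le> M powr (\<nu> / 2 + q + 10 * t - (S - s1) / 2)"
      unfolding eqT'[OF l] by linarith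
  next
    show "M powr (\<nu> / 2 + q + 10 * t - (S - s1) / 2) \<le> M powr (10 * t)"
    proof (rule pw_le[OF order_refl])
      show "\<nu> / 2 + q + 10 * t - (S - s1) / 2 \<le> 10 * t"
        using S_lower exps \<sigma> \<mu> unfolding q by argo
    qed
  qed (use \<epsilon> \<mu> p q \<sigma> \<delta>S t M1 CJ K u1 u'1 nS in auto)
qed

text \<open>In the high-norm bounds the factor 2 splits evenly: since
  \<open>2 * M powr p \<le> M powr (2 * p)\<close>, the old solution takes one copy of
  \<open>M powr (2 * p)\<close> and the correction the other. The same holds with
  \<open>q\<close>.\<close>

lemma approx_step:
  assumes u: "approx n u u' A"
  shows "\<exists>v v'. approx (Suc n) v v' (A \<inter> good (Suc n) u) \<and>
    (\<forall>l\<in>J. nrm s1 (v l - u l) \<le> NN (Suc n) powr (- \<sigma> - 1) / 2 \<and> nrm s1 (v' l - u' l) \<le> NN (Suc n) powr (- 1 - \<nu>))"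
proof -
  define M where "M = NN (Suc n)"
  define Y where "Y = M powr (\<nu> / 2 + q + 10 * t - (S - s1) / 2)"
  interpret G: galerkin_step X nrm E P s0 \<nu> \<epsilon>s S' J F DF D2F s1 S K \<epsilon> \<epsilon>0 \<tau> \<delta> \<sigma> \<mu> p q M t Y CJ u u' "A \<inter> good (Suc n) u"
    unfolding M_def Y_def by (rule next_step[OF u])
  have M1: "1 \<le> M" unfolding M_def by (rule NN_ge1)
  obtain v v' where v: "\<forall>l\<in>J. v l \<in> E M \<and> v' l \<in> E M \<and> nderiv (nrm s1) v (v' l) l J \<and> ncont (nrm s1) v' l J \<and>
       nrm s1 (v l - u l) \<le> M powr (- 2 - \<sigma> + 13 * t) \<and>
       nrm s1 (v' l - u' l) \<le> M powr (\<mu> + 3 * t) * Y + M powr (- 2 - \<sigma> / 2 + 22 * t) \<and>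
       nrm S (v l - u l) \<le> M powr (2 * p - 1 + 16 * t) \<and> nrm S (v' l - u' l) \<le> M powr (2 * q - 1)"
     and sol: "\<forall>l\<in>open_nbhd (A \<inter> good (Suc n) u) (M powr (- \<sigma> / 2)) \<inter> J. P M (F \<epsilon> l (v l)) = 0"
     and triv: "(\<forall>l\<in>J. F \<epsilon> l 0 = 0 \<and> u l = 0) \<longrightarrow> (\<forall>l\<in>J. v l = 0)"
     and inv: "\<forall>Xh. invariant_subscale X nrm E P s0 \<nu> J (F \<epsilon>) Xh \<longrightarrow> (\<forall>l\<in>J. \<forall>s\<ge>0. u l \<in> Xh s) \<longrightarrow>
        (\<forall>l\<in>J. \<forall>s\<ge>0. v l \<in> Xh s)"
    using G.step by blast
  have mem: "u l \<in> X s" "u' l \<in> X s" "v l \<in> X s" "v' l \<in> X s" if "l \<in> J" "0 \<le> s" for l s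
    using G.uE[OF that(1)] v that G.EX by auto
  \<comment> \<open>Half the rate of (S2) is kept so that all later increments together stay within
    the full rate.\<close>
  have d1: "nrm s1 (v l - u l) \<le> M powr (- \<sigma> - 1) / 2" if l: "l \<in> J" for l
  proof -
    have "M powr (- 2 - \<sigma> + 13 * t) = M powr (- 1 + 13 * t) * M powr (- \<sigma> - 1)"
      unfolding powr_add[symmetric] by (rule arg_cong[where f = "(powr) M"]) simp
    also have "\<dots> \<le> 1 / 2 * M powr (- \<sigma> - 1)" using t by (intro mult_right_mono G.pw_half) auto
    finally show ?thesis using v l by fastforce
  qed
  have d2: "nrm s1 (v' l - u' l) \<le> M powr (- 1 - \<nu>)" if l: "l \<in> J" for l
  proof -
    have "M powr (\<mu> + 3 * t) * Y + M powr (- 2 - \<sigma> / 2 + 22 * t) \<le> M powr (- 1 - \<nu>)"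
    proof (rule G.pw_add[OF _ order_refl])
      show "M powr (\<mu> + 3 * t) * Y \<le> M powr (\<mu> + 3 * t + (\<nu> / 2 + q + 10 * t - (S - s1) / 2))"
        unfolding Y_def by (simp only: powr_add)
      \<comment> \<open>The inverse costs \<open>\<mu>\<close>; the lower bounds on
        \<open>S - s1\<close> and on \<open>\<sigma>\<close>, the latter from
        \<open>2 * \<mu> + 3 * \<nu> + 2 \<le> \<sigma>\<close>, leave the exponent
        \<open>- 1 - \<nu>\<close>.\<close>
      show "\<mu> + 3 * t + (\<nu> / 2 + q + 10 * t - (S - s1) / 2) + t \<le> - 1 - \<nu>"
        using S_lower t \<sigma> exps unfolding q by argo
      show "- 2 - \<sigma> / 2 + 22 * t + t \<le> - 1 - \<nu>" using t \<sigma> exps by argo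
    qed
    then show ?thesis using v l by fastforce
  qed
  have uS: "1 + nrm S (u l) \<le> 2 * M powr p" "nrm S (u' l) \<le> 2 * M powr q"
    "nrm s1 (u l) \<le> 1 - 1 / 2 ^ Suc n" "nrm s1 (u' l) \<le> N0 powr (\<sigma> / 2 - \<nu>) * (1 - 1 / 2 ^ Suc n)" if "l \<in> J" for l
    using u that unfolding M_def by (auto simp: approx_def)
  have add: "nrm s (v l) \<le> nrm s (u l) + nrm s (v l - u l)" "nrm s (v' l) \<le> nrm s (u' l) + nrm s (v' l - u' l)"
    if "l \<in> J" "0 \<le> s" for l s
    by (intro normed_le_add_diff[OF normed_X[OF that(2)]] mem that)+
  have Minv: "M powr (- 1) \<le> 1 / 2 ^ Suc (Suc n)"
  proof -
    have "M powr (- 1) = 1 / M" using M1 by (simp add: powr_minus_divide)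
    also have "\<dots> \<le> 1 / 2 ^ Suc (Suc n)"
      using NN_ge(2)[of "Suc n"] M1 unfolding M_def by (intro divide_left_mono) auto
    finally show ?thesis .
  qed
  have half: "(1::real) / 2 ^ Suc n = 1 / 2 ^ Suc (Suc n) + 1 / 2 ^ Suc (Suc n)" by (simp add: field_simps)
  have b1: "nrm s1 (v l) \<le> 1 - 1 / 2 ^ Suc (Suc n)" if l: "l \<in> J" for l
  proof -
    have "M powr (- \<sigma> - 1) \<le> M powr (- 1)" using M1 exps by (intro powr_mono) auto
    then show ?thesis
      using add(1)[OF l s_nonneg(1)] d1[OF l] uS(3)[OF l] Minv half powr_ge_zero[of M "- \<sigma> - 1"] by linarith
  qed
  have b2: "nrm s1 (v' l) \<le> N0 powr (\<sigma> / 2 - \<nu>) * (1 - 1 / 2 ^ Suc (Suc n))" if l: "l \<in> J" for l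
  proof -
    have "M powr (- 1 - \<nu>) \<le> M powr (- 1)" using M1 exps by (intro powr_mono) auto
    then have "nrm s1 (v' l - u' l) \<le> 1 * (1 / 2 ^ Suc (Suc n))" using d2[OF l] Minv by linarith
    also have "\<dots> \<le> N0 powr (\<sigma> / 2 - \<nu>) * (1 / 2 ^ Suc (Suc n))"
      using powr_mono[of 0 "\<sigma> / 2 - \<nu>" N0] N0 exps by (intro mult_right_mono) auto
    finally have "nrm s1 (v' l) \<le> N0 powr (\<sigma> / 2 - \<nu>) * (1 - 1 / 2 ^ Suc n) + N0 powr (\<sigma> / 2 - \<nu>) * (1 / 2 ^ Suc (Suc n))"
      using add(2)[OF l s_nonneg(1)] uS(4)[OF l] by linarith
    also have "\<dots> = N0 powr (\<sigma> / 2 - \<nu>) * (1 - 1 / 2 ^ Suc n + 1 / 2 ^ Suc (Suc n))" by (simp only: distrib_left)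
    also have "1 - 1 / 2 ^ Suc n + 1 / 2 ^ Suc (Suc n) = (1::real) - 1 / 2 ^ Suc (Suc n)" using half by linarith
    finally show ?thesis .
  qed
  have b3: "1 + nrm S (v l) \<le> 2 * NN (Suc (Suc n)) powr p" if l: "l \<in> J" for l
  proof -
    have "2 * M powr p \<le> M powr (2 * p)"
      by (rule G.pw_mult[OF _ _ G.pw_num order_refl]) (use p exps t in auto)
    moreover have "nrm S (v l - u l) \<le> M powr (2 * p)"
      by (rule G.pw_le[of _ "2 * p - 1 + 16 * t"]) (use v l t in auto)
    ultimately show ?thesis
      using add(1)[OF l s_nonneg(2)] uS(1)[OF l] unfolding NN_powr_Suc[of "Suc n"] M_def by linarith
  qed
  have b4: "nrm S (v' l) \<le> 2 * NN (Suc (Suc n)) powr q" if l: "l \<in> J" for l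
  proof -
    have "2 * M powr q \<le> M powr (2 * q)"
      by (rule G.pw_mult[OF _ _ G.pw_num order_refl]) (use q exps t in auto)
    moreover have "nrm S (v' l - u' l) \<le> M powr (2 * q)"
      by (rule G.pw_le[of _ "2 * q - 1"]) (use v l t in auto)
    ultimately show ?thesis
      using add(2)[OF l s_nonneg(2)] uS(2)[OF l] unfolding NN_powr_Suc[of "Suc n"] M_def by linarith
  qed
  have "approx (Suc n) v v' (A \<inter> good (Suc n) u)"
    unfolding approx_def
  proof (intro conjI)
    show "A \<inter> good (Suc n) u \<subseteq> J" by (auto simp: good_params_def)
    show "\<forall>l\<in>J. v l \<in> E (NN (Suc n)) \<and> v' l \<in> E (NN (Suc n)) \<and> nderiv (nrm s1) v (v' l) l J \<and> ncont (nrm s1) v' l J \<and>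
        nrm s1 (v l) \<le> 1 - 1 / 2 ^ Suc (Suc n) \<and> nrm s1 (v' l) \<le> N0 powr (\<sigma> / 2 - \<nu>) * (1 - 1 / 2 ^ Suc (Suc n)) \<and>
        1 + nrm S (v l) \<le> 2 * NN (Suc (Suc n)) powr p \<and> nrm S (v' l) \<le> 2 * NN (Suc (Suc n)) powr q"
      by (intro ballI conjI b1 b2 b3 b4) (use v in \<open>auto simp: M_def\<close>)
    show "\<forall>l\<in>open_nbhd (A \<inter> good (Suc n) u) (NN (Suc n) powr (- \<sigma> / 2)) \<inter> J. P (NN (Suc n)) (F \<epsilon> l (v l)) = 0"
      using sol unfolding M_def .
    show "(\<forall>l\<in>J. F \<epsilon> l 0 = 0) \<longrightarrow> (\<forall>l\<in>J. v l = 0)" using triv u by (simp add: approx_def)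
    show "\<forall>Xh. invariant_subscale X nrm E P s0 \<nu> J (F \<epsilon>) Xh \<longrightarrow> (\<forall>l\<in>J. \<forall>s\<ge>0. v l \<in> Xh s)"
      using inv u unfolding approx_def by blast
  qed
  with d1 d2 show ?thesis unfolding M_def by blast
qed

text \<open>Dependent choice over triples of a curve, its derivative and the set of parameters
  treated so far; the set has to be part of the choice since the next good set depends on the
  current curve.\<close>

lemma approx_sequence:
  "\<exists>u u' A. A 0 = good 0 (\<lambda>_. 0) \<and> (\<forall>n. A (Suc n) = A n \<inter> good (Suc n) (u n)) \<and> (\<forall>n. approx n (u n) (u' n) (A n)) \<and>
    (\<forall>n. \<forall>l\<in>J. nrm s1 (u (Suc n) l - u n l) \<le> NN (Suc n) powr (- \<sigma> - 1) / 2 \<and>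
       nrm s1 (u' (Suc n) l - u' n l) \<le> NN (Suc n) powr (- 1 - \<nu>))"
proof -
  define Q where "Q n x = (approx n (fst x) (fst (snd x)) (snd (snd x)) \<and> (n = 0 \<longrightarrow> snd (snd x) = good 0 (\<lambda>_. 0)))"
    for n and x :: "(real \<Rightarrow> 'a) \<times> (real \<Rightarrow> 'a) \<times> real set"
  define R where "R n x y = (snd (snd y) = snd (snd x) \<inter> good (Suc n) (fst x) \<and>
     (\<forall>l\<in>J. nrm s1 (fst y l - fst x l) \<le> NN (Suc n) powr (- \<sigma> - 1) / 2 \<and>
       nrm s1 (fst (snd y) l - fst (snd x) l) \<le> NN (Suc n) powr (- 1 - \<nu>)))"
    for n and x y :: "(real \<Rightarrow> 'a) \<times> (real \<Rightarrow> 'a) \<times> real set"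
  have "\<exists>f. \<forall>n. Q n (f n) \<and> R n (f n) (f (Suc n))"
  proof (rule dependent_nat_choice)
    obtain u u' where "approx 0 u u' (good 0 (\<lambda>_. 0))" using initial_approx by blast
    then have "Q 0 (u, u', good 0 (\<lambda>_. 0))" by (simp add: Q_def)
    then show "\<exists>x. Q 0 x" ..
    fix x n assume "Q n x"
    then have "approx n (fst x) (fst (snd x)) (snd (snd x))" by (simp add: Q_def)
    from approx_step[OF this] obtain v v' where
      v: "approx (Suc n) v v' (snd (snd x) \<inter> good (Suc n) (fst x))"
        "\<forall>l\<in>J. nrm s1 (v l - fst x l) \<le> NN (Suc n) powr (- \<sigma> - 1) / 2 \<and>
           nrm s1 (v' l - fst (snd x) l) \<le> NN (Suc n) powr (- 1 - \<nu>)" by blast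
    then have "Q (Suc n) (v, v', snd (snd x) \<inter> good (Suc n) (fst x)) \<and> R n x (v, v', snd (snd x) \<inter> good (Suc n) (fst x))"
      unfolding Q_def R_def by simp
    then show "\<exists>y. Q (Suc n) y \<and> R n x y" ..
  qed
  then obtain f where f: "\<And>n. Q n (f n)" "\<And>n. R n (f n) (f (Suc n))" by blast
  have f0: "snd (snd (f 0)) = good 0 (\<lambda>_. 0)" using f(1)[of 0] by (simp add: Q_def)
  have fa: "approx n (fst (f n)) (fst (snd (f n))) (snd (snd (f n)))" for n using f(1)[of n] by (simp add: Q_def)
  show ?thesis
    by (rule exI[of _ "\<lambda>n. fst (f n)"], rule exI[of _ "\<lambda>n. fst (snd (f n))"], rule exI[of _ "\<lambda>n. snd (snd (f n))"])
       (intro conjI allI f0 fa; use f(2) in \<open>simp add: R_def\<close>)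
qed

section \<open>Convergence of the sequence and properties of the limit\<close>

context
  fixes u u' :: "nat \<Rightarrow> real \<Rightarrow> 'a" and A :: "nat \<Rightarrow> real set"
  assumes A0: "A 0 = good 0 (\<lambda>_. 0)" and ASuc: "\<And>n. A (Suc n) = A n \<inter> good (Suc n) (u n)"
    and approx: "\<And>n. approx n (u n) (u' n) (A n)"
    and incr: "\<And>n l. l \<in> J \<Longrightarrow> nrm s1 (u (Suc n) l - u n l) \<le> NN (Suc n) powr (- \<sigma> - 1) / 2"
    and incr': "\<And>n l. l \<in> J \<Longrightarrow> nrm s1 (u' (Suc n) l - u' n l) \<le> NN (Suc n) powr (- 1 - \<nu>)"
begin

lemma A_INT: "A n = (\<Inter>i\<in>{0..n}. good i (if i = 0 then (\<lambda>_. 0) else u (i - 1)))"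
  by (induction n) (simp_all add: A0 ASuc atLeast0_atMost_Suc Int_commute)

lemma seq_E: "l \<in> J \<Longrightarrow> u n l \<in> E (NN n)" "l \<in> J \<Longrightarrow> u' n l \<in> E (NN n)"
  using approx[of n] by (auto simp: approx_def)

lemma seq_X: "l \<in> J \<Longrightarrow> 0 \<le> s \<Longrightarrow> u n l \<in> X s" "l \<in> J \<Longrightarrow> 0 \<le> s \<Longrightarrow> u' n l \<in> X s"
  using seq_E E_X[OF NN_ge1] by blast+

lemma seq_E_Suc: "l \<in> J \<Longrightarrow> u n l \<in> E (NN (Suc n))" "l \<in> J \<Longrightarrow> u' n l \<in> E (NN (Suc n))"
proof -
  have "E (NN n) \<subseteq> E (NN (Suc n))"
    unfolding NN_Suc by (rule E_mono) (use NN_ge1[of n] in \<open>auto simp: mult_le_cancel_right1\<close>)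
  then show "l \<in> J \<Longrightarrow> u n l \<in> E (NN (Suc n))" "l \<in> J \<Longrightarrow> u' n l \<in> E (NN (Suc n))" using seq_E by blast+
qed

lemma seq_C1: "l \<in> J \<Longrightarrow> nderiv (nrm (s1 + \<nu>)) (u n) (u' n l) l J \<and> ncont (nrm (s1 + \<nu>)) (u' n) l J"
proof -
  assume l: "l \<in> J"
  obtain C where C: "0 \<le> C" "\<And>x. x \<in> E (NN n) \<Longrightarrow> nrm (s1 + \<nu>) x \<le> C * nrm s1 x"
    using E_norm_equiv[OF NN_ge1 s_nonneg(3,1)] by blast
  have d: "nderiv (nrm s1) (u n) (u' n l) l J" "ncont (nrm s1) (u' n) l J"
    using approx[of n] l by (auto simp: approx_def)
  have "nderiv (nrm (s1 + \<nu>)) (u n) (u' n l) l J"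
    by (rule nderiv_mono_norm[OF d(1) C(1)]) (intro C(2) E_diff E_scale NN_ge1 seq_E l)
  moreover have "ncont (nrm (s1 + \<nu>)) (u' n) l J"
    by (rule ncont_mono_norm[OF d(2) C(1)]) (intro C(2) E_diff NN_ge1 seq_E l)
  ultimately show ?thesis by blast
qed

text \<open>The spare \<open>\<nu>\<close> in the exponent \<open>- 1 - \<nu>\<close> pays for the
  passage to \<open>s1 + \<nu>\<close>. What remains is below the reciprocal of the old scale, hence
  summable.\<close>

lemma gain_incr:
  assumes l: "l \<in> J" and x: "x \<in> E (NN (Suc n))" "nrm s1 x \<le> NN (Suc n) powr (- 1 - \<nu>)"
  shows "nrm (s1 + \<nu>) x \<le> (1 / 2) ^ n"
proof -
  interpret power_bounds "NN (Suc n)" t by (rule power_bounds_NN)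
  have "nrm (s1 + \<nu>) x \<le> K * NN (Suc n) powr \<nu> * nrm s1 x" by (rule E_gain[OF _ NN_ge1 x(1)]) simp
  also have "\<dots> \<le> NN (Suc n) powr (- 1 / 2)"
    by (rule pw_mult[OF _ E_nrm_nonneg[OF NN_ge1 x(1) s_nonneg(1)] pw_mult[OF _ _ K_NN order_refl order_refl] x(2)])
       (use K t in auto)
  also have "\<dots> = 1 / NN n" using NN_ge1[of n] NN_half[of n "- 1"] by (simp add: powr_minus_divide)
  also have "\<dots> \<le> 1 / 2 ^ n"
  proof (rule divide_left_mono)
    have "(2::real) ^ n \<le> 2 ^ Suc n" by (rule power_increasing) auto
    then show "2 ^ n \<le> NN n" using NN_ge(2)[of n] by linarith
  qed (use NN_ge1[of n] in auto)
  finally show ?thesis by (simp add: power_divide)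
qed

lemma incr_\<nu>:
  assumes l: "l \<in> J"
  shows "nrm (s1 + \<nu>) (u (Suc n) l - u n l) \<le> (1 / 2) ^ n" "nrm (s1 + \<nu>) (u' (Suc n) l - u' n l) \<le> (1 / 2) ^ n"
proof -
  have "NN (Suc n) powr (- \<sigma> - 1) / 2 \<le> NN (Suc n) powr (- \<sigma> - 1)" by simp
  also have "\<dots> \<le> NN (Suc n) powr (- 1 - \<nu>)" using NN_ge1[of "Suc n"] \<sigma> exps by (intro powr_mono) auto
  finally have "nrm s1 (u (Suc n) l - u n l) \<le> NN (Suc n) powr (- 1 - \<nu>)" using incr[OF l, of n] by linarith
  then show "nrm (s1 + \<nu>) (u (Suc n) l - u n l) \<le> (1 / 2) ^ n"
    by (intro gain_incr[OF l] E_diff NN_ge1 seq_E seq_E_Suc l)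
  show "nrm (s1 + \<nu>) (u' (Suc n) l - u' n l) \<le> (1 / 2) ^ n"
    by (intro gain_incr[OF l] E_diff NN_ge1 seq_E seq_E_Suc l incr')
qed

text \<open>The term subtracted on the right makes the induction telescope: each increment is half
  of the current rate, and the next rate is at most the other half.\<close>

lemma incr_s1:
  assumes l: "l \<in> J"
  shows "nrm s1 (u (n + j) l - u n l) \<le> NN (Suc n) powr (- \<sigma> - 1) - NN (Suc (n + j)) powr (- \<sigma> - 1)"
proof (induction j)
  case 0 then show ?case using normed_zero[OF normed_X[OF s_nonneg(1)]] by simp
next
  case (Suc j)
  interpret power_bounds "NN (Suc (n + j))" t by (rule power_bounds_NN)
  let ?a = "NN (Suc (n + j)) powr (- \<sigma> - 1)"
  have "NN (Suc (Suc (n + j))) powr (- \<sigma> - 1) = NN (Suc (n + j)) powr (- \<sigma> - 1) * ?a"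
    unfolding NN_powr_Suc[of "Suc (n + j)"] mult_2 powr_add ..
  also have "\<dots> \<le> 1 / 2 * ?a" using exps t by (intro mult_right_mono pw_half) auto
  finally have h: "NN (Suc (Suc (n + j))) powr (- \<sigma> - 1) \<le> 1 / 2 * ?a" .
  have "nrm s1 (u (n + Suc j) l - u n l) \<le> nrm s1 (u (Suc (n + j)) l - u (n + j) l) + nrm s1 (u (n + j) l - u n l)"
    using normed_triangle_mid[OF normed_X[OF s_nonneg(1)] seq_X(1)[OF l s_nonneg(1), of "n + Suc j"]
      seq_X(1)[OF l s_nonneg(1), of "n + j"] seq_X(1)[OF l s_nonneg(1), of n]] by simp
  then show ?case using incr[OF l, of "n + j"] Suc h by simp
qed

lemma limit_exists:
  obtains w w' where "\<And>l. l \<in> J \<Longrightarrow> w l \<in> X (s1 + \<nu>) \<and> w' l \<in> X (s1 + \<nu>)"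
    "\<And>k l. l \<in> J \<Longrightarrow> nrm (s1 + \<nu>) (u k l - w l) \<le> 2 * (1 / 2) ^ k \<and> nrm (s1 + \<nu>) (u' k l - w' l) \<le> 2 * (1 / 2) ^ k"
proof -
  note V = normed_X[OF s_nonneg(3)] banach_ncomplete[OF banach[OF s_nonneg(3)]]
  have c: "(\<lambda>k. (1 / 2) ^ k) \<longlonglongrightarrow> (0::real)" by (rule LIMSEQ_realpow_zero) auto
  have "\<exists>w. l \<in> J \<longrightarrow> w \<in> X (s1 + \<nu>) \<and> (\<forall>k. nrm (s1 + \<nu>) (u k l - w) \<le> 2 * (1 / 2) ^ k)" for l
  proof (cases "l \<in> J")
    case True
    show ?thesis
      using geometric_limit[OF V seq_X(1)[OF True s_nonneg(3)] incr_\<nu>(1)[OF True] _ _ c] by auto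
  qed simp
  then obtain w where w: "\<And>l. l \<in> J \<Longrightarrow> w l \<in> X (s1 + \<nu>) \<and> (\<forall>k. nrm (s1 + \<nu>) (u k l - w l) \<le> 2 * (1 / 2) ^ k)" by metis
  have "\<exists>w. l \<in> J \<longrightarrow> w \<in> X (s1 + \<nu>) \<and> (\<forall>k. nrm (s1 + \<nu>) (u' k l - w) \<le> 2 * (1 / 2) ^ k)" for l
  proof (cases "l \<in> J")
    case True
    show ?thesis
      using geometric_limit[OF V seq_X(2)[OF True s_nonneg(3)] incr_\<nu>(2)[OF True] _ _ c] by auto
  qed simp
  then obtain w' where w': "\<And>l. l \<in> J \<Longrightarrow> w' l \<in> X (s1 + \<nu>) \<and> (\<forall>k. nrm (s1 + \<nu>) (u' k l - w' l) \<le> 2 * (1 / 2) ^ k)" by metis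
  show ?thesis by (rule that[of w w']) (use w w' in auto)
qed

text \<open>On \<open>A n\<close> the projected equation holds exactly, so \<open>F\<close> equals
  its own high-frequency part, and the gap between \<open>s0\<close> and \<open>s1\<close> turns
  into decay in the weak norm.\<close>

lemma residual_bound:
  "\<exists>C. \<forall>n. \<forall>l. l \<in> A n \<longrightarrow> nrm s0 (F \<epsilon> l (u n l)) \<le> C * NN n powr (- (s1 - s0)) * (\<epsilon> + nrm (s1 + \<nu>) (u n l))"
proof -
  note N0' = normed_X[OF s0_nonneg]
  have d: "0 \<le> s1 - s0" using s1 by simp
  obtain C where C: "C > 0" "\<And>N y. N \<ge> 1 \<Longrightarrow> y \<in> X s1 \<Longrightarrow> nrm s0 (y - P N y) \<le> C * N powr (- (s1 - s0)) * nrm s1 y"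
    using P2[OF s0_nonneg d] by auto
  have "nrm s0 (F \<epsilon> l (u n l)) \<le> (6 * C * K) * NN n powr (- (s1 - s0)) * (\<epsilon> + nrm (s1 + \<nu>) (u n l))"
    if l: "l \<in> A n" for n l
  proof -
    have lJ: "l \<in> J" using approx[of n] l by (auto simp: approx_def)
    have "l \<in> open_nbhd (A n) (NN n powr (- \<sigma> / 2))"
      unfolding open_nbhd_def using l NN_ge1[of n] by (auto intro!: bexI[of _ l])
    then have PF: "P (NN n) (F \<epsilon> l (u n l)) = 0" using approx[of n] lJ by (auto simp: approx_def)
    note a = P_bounded_linear[OF NN_ge1 s0_nonneg s0_nonneg, of n]
    obtain Ca where Ca: "Ca \<ge> 0" "\<And>y. y \<in> X s0 \<Longrightarrow> nrm s0 (P (NN n) y) \<le> Ca * nrm s0 y"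
      using bounded_linear_on_bound[OF a N0'] by blast
    let ?T = "\<lambda>y. y - P (NN n) y"
    have T: "bounded_linear_on (X s0) (nrm s0) (X s0) (nrm s0) ?T"
    proof -
      have "nrm s0 (?T y) \<le> (1 + Ca) * nrm s0 y" if y: "y \<in> X s0" for y
        using normed_diff_le[OF N0' y bounded_linear_on_mem[OF a y]] Ca(2)[OF y] by (simp add: distrib_right)
      moreover have "?T y \<in> X s0" if y: "y \<in> X s0" for y
        by (intro normed_mem[OF N0'] y bounded_linear_on_mem[OF a])
      moreover have "?T (x + y) = ?T x + ?T y" if "x \<in> X s0" "y \<in> X s0" for x y
        by (simp add: bounded_linear_on_add[OF a that])
      moreover have "?T (c *\<^sub>R x) = c *\<^sub>R ?T x" if "x \<in> X s0" for c x
        by (simp add: bounded_linear_on_scale[OF a that] algebra_simps)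
      ultimately show ?thesis unfolding bounded_linear_on_def by blast
    qed
    have u0: "nrm s0 (u n l) \<le> 1"
    proof -
      have "nrm s1 (u n l) \<le> 1 - 1 / 2 ^ Suc n" using approx[of n] lJ by (auto simp: approx_def)
      also have "\<dots> \<le> 1" by simp
      finally show ?thesis using E_n0[OF NN_ge1 seq_E(1)[OF lJ], of n] by linarith
    qed
    have "nrm s0 (?T (F \<epsilon> l (u n l))) \<le> 6 * (C * NN n powr (- (s1 - s0))) * K * (\<epsilon> + nrm (s1 + \<nu>) (u n l))"
      by (rule tame_F[OF \<epsilon>'(1,2) s0_nonneg T tame_S[of s1, simplified] _ _ lJ seq_X(1)[OF lJ s_nonneg(3)] u0])
         (use C NN_ge1 in auto)
    then show ?thesis using PF by (simp add: mult_ac)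
  qed
  then show ?thesis by blast
qed

text \<open>The residuals tend to 0 in \<open>X s0\<close>, and \<open>F\<close> is continuous at
  the limit because it is differentiable there as a map from \<open>X (s0 + \<nu>)\<close>;
  convergence at \<open>s1 + \<nu>\<close> is stronger than that requires.\<close>

lemma limit_solves:
  assumes w: "\<And>l. l \<in> J \<Longrightarrow> w l \<in> X (s1 + \<nu>)" "\<And>k l. l \<in> J \<Longrightarrow> nrm (s1 + \<nu>) (u k l - w l) \<le> 2 * (1 / 2) ^ k"
    and l: "l \<in> (\<Inter>n. A n)"
  shows "F \<epsilon> l (w l) = 0"
proof -
  note N0' = normed_X[OF s0_nonneg] and N1\<nu> = normed_X[OF s_nonneg(3)]
  have lJ: "l \<in> J" using approx[of 0] l by (auto simp: approx_def)
  obtain C where C: "\<And>n. nrm s0 (F \<epsilon> l (u n l)) \<le> C * NN n powr (- (s1 - s0)) * (\<epsilon> + nrm (s1 + \<nu>) (u n l))"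
    using residual_bound l by blast
  have wD: "(l, w l) \<in> DD" using lJ X_mono[OF w(1)[OF lJ] s0\<nu> s_nonneg(8)] by simp
  have uD: "(l, u n l) \<in> DD" for n using lJ seq_X(1)[OF lJ s0\<nu>] by simp
  have half0: "(\<lambda>k. 2 * (1 / 2) ^ k) \<longlonglongrightarrow> (2::real) * 0"
    by (intro tendsto_intros LIMSEQ_realpow_zero) auto
  have pnle: "pn ((l, u n l) - (l, w l)) \<le> 2 * (1 / 2) ^ n" for n
  proof -
    have "u n l - w l \<in> X (s1 + \<nu>)" by (intro normed_mem[OF N1\<nu>] seq_X w lJ s_nonneg)
    then have "nrm (s0 + \<nu>) (u n l - w l) \<le> nrm (s1 + \<nu>) (u n l - w l)"
      by (rule nrm_mono[OF s0\<nu> s_nonneg(8)])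
    then show ?thesis using w(2)[OF lJ, of n] by simp
  qed
  have pn0: "0 \<le> pn ((l, u n l) - (l, w l))" for n
    by (intro normed_nonneg[OF normed_VV] normed_mem[OF normed_VV]) (use uD wD DD_subset in auto)
  have pnlim: "(\<lambda>n. pn ((l, u n l) - (l, w l))) \<longlonglongrightarrow> 0"
    by (rule tendsto_sandwich[OF _ _ tendsto_const half0[unfolded mult_zero_right]]) (use pnle pn0 in auto)
  obtain KD where KD: "KD \<ge> 0" "\<And>x. x \<in> VV \<Longrightarrow> nrm s0 (DF \<epsilon> (l, w l) x) \<le> KD * pn x"
    using bounded_linear_on_bound[OF DF_linear[OF \<epsilon>'(1,2) wD] normed_VV] by blast
  obtain d where d: "d > 0" "\<And>x. x \<in> DD \<Longrightarrow> pn (x - (l, w l)) < d \<Longrightarrow>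
      nrm s0 (FF \<epsilon> x - FF \<epsilon> (l, w l) - DF \<epsilon> (l, w l) (x - (l, w l))) \<le> 1 * pn (x - (l, w l))"
    using FF_fderiv[OF \<epsilon>'(1,2) wD] zero_less_one unfolding fderiv_on_def by blast
  have Fmem: "F \<epsilon> l (w l) \<in> X s0" "F \<epsilon> l (u n l) \<in> X s0" for n
    using FF_mem[OF \<epsilon>'(1,2) wD] FF_mem[OF \<epsilon>'(1,2) uD] by auto
  let ?r = "\<lambda>n. C * NN n powr (- (s1 - s0)) * (\<epsilon> + nrm (s1 + \<nu>) (u n l)) + (1 + KD) * pn ((l, u n l) - (l, w l))"
  have ev: "\<forall>\<^sub>F n in sequentially. nrm s0 (F \<epsilon> l (w l)) \<le> ?r n"
    using order_tendstoD(2)[OF pnlim d(1)]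
  proof eventually_elim
    case (elim n)
    let ?x = "(l, u n l) - (l, w l)"
    have xV: "?x \<in> VV" by (intro normed_mem[OF normed_VV]) (use uD wD DD_subset in auto)
    have Dm: "DF \<epsilon> (l, w l) ?x \<in> X s0" by (rule bounded_linear_on_mem[OF DF_linear[OF \<epsilon>'(1,2) wD] xV])
    have "nrm s0 (F \<epsilon> l (u n l) - F \<epsilon> l (w l)) \<le> nrm s0 (DF \<epsilon> (l, w l) ?x) + nrm s0 (F \<epsilon> l (u n l) - F \<epsilon> l (w l) - DF \<epsilon> (l, w l) ?x)"
      by (intro normed_le_add_diff[OF N0'] normed_mem[OF N0'] Fmem Dm)
    also have "\<dots> \<le> KD * pn ?x + 1 * pn ?x"
      using KD(2)[OF xV] d(2)[OF uD elim] by (intro add_mono) (simp_all only: FF_pair)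
    finally have e1: "nrm s0 (F \<epsilon> l (u n l) - F \<epsilon> l (w l)) \<le> (1 + KD) * pn ?x" by (simp only: distrib_right)
    have "nrm s0 (F \<epsilon> l (w l)) \<le> nrm s0 (F \<epsilon> l (u n l)) + nrm s0 (F \<epsilon> l (w l) - F \<epsilon> l (u n l))"
      by (rule normed_le_add_diff[OF N0' Fmem])
    also have "nrm s0 (F \<epsilon> l (w l) - F \<epsilon> l (u n l)) = nrm s0 (F \<epsilon> l (u n l) - F \<epsilon> l (w l))"
      by (rule normed_commute[OF N0' Fmem])
    finally show ?case using e1 C[of n] by argo
  qed
  have ubound: "nrm (s1 + \<nu>) (u n l) \<le> nrm (s1 + \<nu>) (w l) + 2 * (1 / 2) ^ n" for n
    using normed_le_add_diff[OF N1\<nu> seq_X(1)[OF lJ s_nonneg(3)] w(1)[OF lJ], of n] w(2)[OF lJ, of n] by linarith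
  have NNlim: "(\<lambda>n. NN n powr (- (s1 - s0))) \<longlonglongrightarrow> 0"
  proof (rule tendsto_neg_powr)
    show "filterlim NN at_top sequentially"
    proof (rule filterlim_at_top_mono)
      show "filterlim real at_top sequentially" by (rule filterlim_real_sequentially)
      have "real n \<le> NN n" for n
        using of_nat_less_two_power[of "Suc n", where 'a = real] NN_ge(2)[of n] by simp
      then show "\<forall>\<^sub>F n in sequentially. real n \<le> NN n" by simp
    qed
  qed (use s1 in simp)
  \<comment> \<open>The sign of \<open>C\<close> is unknown; with its absolute value the majorant is
    monotone in the norm of \<open>u n l\<close> and has an evident limit.\<close>
  let ?b = "\<lambda>n. \<bar>C\<bar> * NN n powr (- (s1 - s0)) * (\<epsilon> + (nrm (s1 + \<nu>) (w l) + 2 * (1 / 2) ^ n)) + (1 + KD) * pn ((l, u n l) - (l, w l))"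
  have "(\<lambda>n. ?b n) \<longlonglongrightarrow> \<bar>C\<bar> * 0 * (\<epsilon> + (nrm (s1 + \<nu>) (w l) + 2 * 0)) + (1 + KD) * 0"
    by (intro tendsto_intros NNlim half0 pnlim)
  then have blim: "(\<lambda>n. ?b n) \<longlonglongrightarrow> 0" by simp
  have rb: "?r n \<le> ?b n" for n
  proof (intro add_right_mono mult_mono)
    show "0 \<le> \<epsilon> + nrm (s1 + \<nu>) (u n l)"
      using \<epsilon>' normed_nonneg[OF N1\<nu> seq_X(1)[OF lJ s_nonneg(3)]] by simp
  qed (use ubound in auto)
  have "nrm s0 (F \<epsilon> l (w l)) \<le> 0"
  proof (rule tendsto_lowerbound[OF blim])
    show "\<forall>\<^sub>F n in sequentially. nrm s0 (F \<epsilon> l (w l)) \<le> ?b n"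
      using ev by eventually_elim (use rb order_trans in blast)
  qed simp
  then show ?thesis using normed_nonneg[OF N0' Fmem(1)] normed_eq_0[OF N0' Fmem(1)] by simp
qed

text \<open>The convergence at \<open>s1 + \<nu>\<close> is only geometric; the superexponential
  rate comes from \<open>incr_s1\<close> by sending \<open>j\<close> to infinity.\<close>

lemma limit_rate:
  assumes w: "\<And>l. l \<in> J \<Longrightarrow> w l \<in> X (s1 + \<nu>)" "\<And>k l. l \<in> J \<Longrightarrow> nrm (s1 + \<nu>) (u k l - w l) \<le> 2 * (1 / 2) ^ k"
    and l: "l \<in> J"
  shows "nrm s1 (w l - u n l) \<le> NN (Suc n) powr (- \<sigma> - 1)"
proof (rule LIMSEQ_le_const[of "\<lambda>j. 2 * (1 / 2) ^ (n + j) + NN (Suc n) powr (- \<sigma> - 1)"])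
  note N1 = normed_X[OF s_nonneg(1)] and N1\<nu> = normed_X[OF s_nonneg(3)]
  have "(\<lambda>k. 2 * (1 / 2) ^ k) \<longlonglongrightarrow> (2::real) * 0"
    by (intro tendsto_intros LIMSEQ_realpow_zero) auto
  then have "(\<lambda>j. 2 * (1 / 2) ^ (j + n)) \<longlonglongrightarrow> (2::real) * 0" by (rule LIMSEQ_ignore_initial_segment)
  from tendsto_add[OF this tendsto_const, of "NN (Suc n) powr (- \<sigma> - 1)"]
  show "(\<lambda>j. 2 * (1 / 2) ^ (n + j) + NN (Suc n) powr (- \<sigma> - 1)) \<longlonglongrightarrow> NN (Suc n) powr (- \<sigma> - 1)"
    by (simp add: add.commute)
  have wX: "w l \<in> X s1" using X_mono[OF w(1)[OF l] s_nonneg(1)] \<nu>_pos by simp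
  have "nrm s1 (w l - u n l) \<le> 2 * (1 / 2) ^ (n + j) + NN (Suc n) powr (- \<sigma> - 1)" for j
  proof -
    note m = seq_X(1)[OF l s_nonneg(1)]
    have d: "u (n + j) l - w l \<in> X (s1 + \<nu>)" by (intro normed_mem[OF N1\<nu>] seq_X w l s_nonneg)
    have "nrm s1 (w l - u n l) \<le> nrm s1 (w l - u (n + j) l) + nrm s1 (u (n + j) l - u n l)"
      by (rule normed_triangle_mid[OF N1 wX m m])
    also have "nrm s1 (w l - u (n + j) l) = nrm s1 (u (n + j) l - w l)" by (rule normed_commute[OF N1 wX m])
    finally have "nrm s1 (w l - u n l) \<le> nrm s1 (u (n + j) l - w l) + nrm s1 (u (n + j) l - u n l)" .
    moreover have "nrm s1 (u (n + j) l - w l) \<le> nrm (s1 + \<nu>) (u (n + j) l - w l)"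
      by (rule nrm_mono[OF s_nonneg(1) _ d]) (use \<nu>_pos in simp)
    moreover note w(2)[OF l, of "n + j"] incr_s1[OF l, of n j]
    moreover have "0 \<le> NN (Suc (n + j)) powr (- \<sigma> - 1)" by simp
    ultimately show ?thesis by linarith
  qed
  then show "\<exists>N. \<forall>j\<ge>N. nrm s1 (w l - u n l) \<le> 2 * (1 / 2) ^ (n + j) + NN (Suc n) powr (- \<sigma> - 1)" by blast
qed

end

text \<open>After unfolding, this and \<open>galerkin_limit\<close> are literally the two halves of
  the conclusion. The factor \<open>1\<close> stands in the place of the constant
  \<open>K0\<close>.\<close>

definition galerkin_curves :: "(nat \<Rightarrow> real \<Rightarrow> 'a) \<Rightarrow> (nat \<Rightarrow> real \<Rightarrow> 'a) \<Rightarrow> (nat \<Rightarrow> real set) \<Rightarrow> bool" where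
  "galerkin_curves u u' A \<longleftrightarrow> (\<forall>n.
      C1_curve J (X (s1 + \<nu>)) (nrm (s1 + \<nu>)) (u n) (u' n) \<and>
      (\<forall>l\<in>J. u n l \<in> E (NN n) \<and> u' n l \<in> E (NN n) \<and> (\<epsilon> = 0 \<longrightarrow> u n l = 0) \<and>
         nrm s1 (u n l) \<le> 1 \<and> nrm s1 (u' n l) \<le> 1 * N0 powr (\<sigma> / 2)) \<and>
      (\<forall>Xh. invariant_subscale X nrm E P s0 \<nu> J (F \<epsilon>) Xh \<longrightarrow>
         (\<forall>l\<in>J. \<forall>s\<ge>0. u n l \<in> E (NN n) \<inter> Xh s)) \<and>
      (\<forall>i. 1 \<le> i \<and> i \<le> n \<longrightarrow> (\<forall>l\<in>J.
         nrm s1 (u i l - u (i - 1) l) \<le> NN i powr (- \<sigma> - 1) \<and>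
         nrm s1 (u' i l - u' (i - 1) l) \<le> NN i powr (- 1 - \<nu>))) \<and>
      (\<forall>l \<in> open_nbhd (A n) (NN n powr (- \<sigma> / 2)) \<inter> J. P (NN n) (F \<epsilon> l (u n l)) = 0) \<and>
      (\<forall>l\<in>J. 1 + nrm S (u n l) \<le> 2 * NN (n + 1) powr p \<and>
         nrm S (u' n l) \<le> 2 * NN (n + 1) powr q))"

definition galerkin_limit :: "(nat \<Rightarrow> real \<Rightarrow> 'a) \<Rightarrow> (nat \<Rightarrow> real \<Rightarrow> 'a) \<Rightarrow> (nat \<Rightarrow> real set) \<Rightarrow> bool" where
  "galerkin_limit u u' A \<longleftrightarrow> (\<exists>w w'.
      C1_curve J (X (s1 + \<nu>)) (nrm (s1 + \<nu>)) w w' \<and>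
      (\<forall>e>0. \<forall>\<^sub>F n in sequentially. \<forall>l\<in>J.
         nrm (s1 + \<nu>) (u n l - w l) < e \<and> nrm (s1 + \<nu>) (u' n l - w' l) < e) \<and>
      (\<epsilon> = 0 \<longrightarrow> (\<forall>l\<in>J. w l = 0)) \<and>
      (\<forall>n. \<forall>l\<in>J. nrm s1 (w l - u n l) \<le> NN (n + 1) powr (- \<sigma> - 1)) \<and>
      (\<forall>l \<in> (\<Inter>n. A n). F \<epsilon> l (w l) = 0) \<and>
      (\<forall>Xh. invariant_subscale X nrm E P s0 \<nu> J (F \<epsilon>) Xh \<longrightarrow>
         (\<forall>l\<in>J. w l \<in> Xh (s1 + \<nu>))))"

lemma iteration:
  "\<exists>u u'. galerkin_curves u u' (\<lambda>n. \<Inter>i\<in>{0..n}. good i (if i = 0 then (\<lambda>_. 0) else u (i - 1))) \<and>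
    galerkin_limit u u' (\<lambda>n. \<Inter>i\<in>{0..n}. good i (if i = 0 then (\<lambda>_. 0) else u (i - 1)))"
proof -
  obtain u u' A where A0: "A 0 = good 0 (\<lambda>_. 0)" and ASuc: "\<And>n. A (Suc n) = A n \<inter> good (Suc n) (u n)"
    and ap: "\<And>n. approx n (u n) (u' n) (A n)"
    and incr: "\<And>n l. l \<in> J \<Longrightarrow> nrm s1 (u (Suc n) l - u n l) \<le> NN (Suc n) powr (- \<sigma> - 1) / 2"
    and incr': "\<And>n l. l \<in> J \<Longrightarrow> nrm s1 (u' (Suc n) l - u' n l) \<le> NN (Suc n) powr (- 1 - \<nu>)"
    using approx_sequence by blast
  note seq = A0 ASuc ap incr incr'
  have Aeq: "A n = (\<Inter>i\<in>{0..n}. good i (if i = 0 then (\<lambda>_. 0) else u (i - 1)))" for n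
    by (rule A_INT[OF seq])
  obtain w w' where w: "\<And>l. l \<in> J \<Longrightarrow> w l \<in> X (s1 + \<nu>) \<and> w' l \<in> X (s1 + \<nu>)"
    "\<And>k l. l \<in> J \<Longrightarrow> nrm (s1 + \<nu>) (u k l - w l) \<le> 2 * (1 / 2) ^ k \<and> nrm (s1 + \<nu>) (u' k l - w' l) \<le> 2 * (1 / 2) ^ k"
    using limit_exists[OF seq] by blast
  note V = normed_X[OF s_nonneg(3)]
  have uX: "u n l \<in> X (s1 + \<nu>)" "u' n l \<in> X (s1 + \<nu>)" if "l \<in> J" for n l
    using seq_X[OF seq that s_nonneg(3)] by auto
  have half0: "(\<lambda>k. 2 * (1 / 2) ^ k) \<longlonglongrightarrow> (0::real)"
    using tendsto_mult[OF tendsto_const LIMSEQ_realpow_zero[of "1 / 2 :: real"], of 2] by simp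
  have C1: "C1_curve J (X (s1 + \<nu>)) (nrm (s1 + \<nu>)) (u n) (u' n)" for n
    unfolding C1_curve_iff[OF V] using uX seq_C1[OF seq] by blast
  have C1w: "C1_curve J (X (s1 + \<nu>)) (nrm (s1 + \<nu>)) w w'"
    unfolding C1_curve_iff[OF V]
  proof (intro ballI)
    fix l assume l: "l \<in> J"
    have h: "\<And>k l. l \<in> J \<Longrightarrow> u k l \<in> X (s1 + \<nu>) \<and> u' k l \<in> X (s1 + \<nu>) \<and>
        nderiv (nrm (s1 + \<nu>)) (u k) (u' k l) l J \<and> ncont (nrm (s1 + \<nu>)) (u' k) l J"
      using uX seq_C1[OF seq] by blast
    note lim = C1_limit[OF V J_interval l h w(1) w(2) half0]
    show "w l \<in> X (s1 + \<nu>) \<and> w' l \<in> X (s1 + \<nu>) \<and> nderiv (nrm (s1 + \<nu>)) w (w' l) l J \<and> ncont (nrm (s1 + \<nu>)) w' l J"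
      using w(1)[OF l] lim by blast
  qed
  have w1: "\<And>l. l \<in> J \<Longrightarrow> w l \<in> X (s1 + \<nu>)" and w2: "\<And>k l. l \<in> J \<Longrightarrow> nrm (s1 + \<nu>) (u k l - w l) \<le> 2 * (1 / 2) ^ k"
    using w by auto
  have zero: "u n l = 0" if "\<epsilon> = 0" "l \<in> J" for n l
  proof -
    have "(\<forall>l\<in>J. F \<epsilon> l 0 = 0) \<longrightarrow> (\<forall>l\<in>J. u n l = 0)" using ap[of n] unfolding approx_def by blast
    moreover have "\<forall>l\<in>J. F \<epsilon> l 0 = 0" unfolding that(1) using F0 by blast
    ultimately show ?thesis using that(2) by blast
  qed
  have S1: "u n l \<in> E (NN n) \<and> u' n l \<in> E (NN n) \<and> (\<epsilon> = 0 \<longrightarrow> u n l = 0) \<and>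
       nrm s1 (u n l) \<le> 1 \<and> nrm s1 (u' n l) \<le> 1 * N0 powr (\<sigma> / 2)" if l: "l \<in> J" for n l
  proof -
    have "nrm s1 (u n l) \<le> 1 - 1 / 2 ^ Suc n" "nrm s1 (u' n l) \<le> N0 powr (\<sigma> / 2 - \<nu>) * (1 - 1 / 2 ^ Suc n)"
      using ap[of n] l by (auto simp: approx_def)
    moreover have "(0::real) \<le> 1 / 2 ^ Suc n" by simp
    moreover have "N0 powr (\<sigma> / 2 - \<nu>) * (1 - 1 / 2 ^ Suc n) \<le> N0 powr (\<sigma> / 2) * 1"
    proof (rule mult_mono)
      show "N0 powr (\<sigma> / 2 - \<nu>) \<le> N0 powr (\<sigma> / 2)" using N0 \<nu>_pos by (intro powr_mono) auto
      show "(0::real) \<le> 1 - 1 / 2 ^ Suc n" using one_le_power[of "2::real" "Suc n"] by (simp add: divide_le_eq)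
    qed auto
    ultimately have "nrm s1 (u n l) \<le> 1" "nrm s1 (u' n l) \<le> 1 * N0 powr (\<sigma> / 2)" by linarith+
    then show ?thesis using zero l seq_E[OF seq l] by simp
  qed
  have inv: "u n l \<in> Xh s" if "invariant_subscale X nrm E P s0 \<nu> J (F \<epsilon>) Xh" "l \<in> J" "0 \<le> s" for Xh n l s
    using ap[of n] that unfolding approx_def by blast
  have S2: "nrm s1 (u i l - u (i - 1) l) \<le> NN i powr (- \<sigma> - 1) \<and> nrm s1 (u' i l - u' (i - 1) l) \<le> NN i powr (- 1 - \<nu>)"
    if i: "1 \<le> i" and l: "l \<in> J" for i l
  proof -
    obtain k where k: "i = Suc k" using i by (cases i) auto
    have "NN (Suc k) powr (- \<sigma> - 1) / 2 \<le> NN (Suc k) powr (- \<sigma> - 1)" by simp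
    with incr[OF l, of k] have "nrm s1 (u (Suc k) l - u k l) \<le> NN (Suc k) powr (- \<sigma> - 1)" by (rule order_trans)
    with incr'[OF l, of k] show ?thesis unfolding k by simp
  qed
  have S3: "P (NN n) (F \<epsilon> l (u n l)) = 0" if "l \<in> open_nbhd (A n) (NN n powr (- \<sigma> / 2)) \<inter> J" for n l
    using ap[of n] that unfolding approx_def by blast
  have S4: "1 + nrm S (u n l) \<le> 2 * NN (n + 1) powr p \<and> nrm S (u' n l) \<le> 2 * NN (n + 1) powr q" if "l \<in> J" for n l
    using ap[of n] that by (simp add: approx_def)
  have conv: "\<forall>\<^sub>F n in sequentially. \<forall>l\<in>J. nrm (s1 + \<nu>) (u n l - w l) < e \<and> nrm (s1 + \<nu>) (u' n l - w' l) < e"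
    if "e > 0" for e
    using order_tendstoD(2)[OF half0 that]
  proof eventually_elim
    case (elim n)
    then show ?case using w(2)[of _ n] by (meson le_less_trans)
  qed
  have wlim: "(\<lambda>n. nrm (s1 + \<nu>) (u n l - w l)) \<longlonglongrightarrow> 0" if l: "l \<in> J" for l
    by (rule tendsto_sandwich[OF _ _ tendsto_const half0])
       (use w2[OF l] normed_nonneg[OF V normed_diff_mem[OF V uX(1)[OF l] w1[OF l]]] in auto)
  have w0: "w l = 0" if "\<epsilon> = 0" "l \<in> J" for l
  proof -
    have "(\<lambda>n::nat. nrm (s1 + \<nu>) (- w l)) \<longlonglongrightarrow> 0" using wlim[OF that(2)] zero[OF that] by simp
    then have "nrm (s1 + \<nu>) (- w l) = 0" by (simp add: LIMSEQ_const_iff)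
    then show ?thesis using normed_eq_0[OF V normed_minus_mem[OF V w1[OF that(2)]]] by simp
  qed
  have winv: "w l \<in> Xh (s1 + \<nu>)" if Xh: "invariant_subscale X nrm E P s0 \<nu> J (F \<epsilon>) Xh" and l: "l \<in> J" for Xh l
  proof (rule closedin_ntopology_limit[OF V _ inv[OF Xh l s_nonneg(3)] w1[OF l] wlim[OF l]])
    show "closedin (ntopology (X (s1 + \<nu>)) (nrm (s1 + \<nu>))) (Xh (s1 + \<nu>))"
      by (rule Xh[unfolded invariant_subscale_def, THEN spec, THEN mp, OF s_nonneg(3), THEN conjunct2, THEN conjunct2, THEN conjunct1])
  qed
  have rate: "nrm s1 (w l - u n l) \<le> NN (n + 1) powr (- \<sigma> - 1)" if "l \<in> J" for n l
    using limit_rate[OF seq w1 w2 that] by simp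
  have Fw: "F \<epsilon> l (w l) = 0" if "l \<in> (\<Inter>n. A n)" for l
    by (rule limit_solves[OF seq w1 w2 that])
  have "galerkin_curves u u' A"
    unfolding galerkin_curves_def
  proof (rule allI, intro conjI)
    fix n
    show "C1_curve J (X (s1 + \<nu>)) (nrm (s1 + \<nu>)) (u n) (u' n)" by (rule C1)
    show "\<forall>Xh. invariant_subscale X nrm E P s0 \<nu> J (F \<epsilon>) Xh \<longrightarrow> (\<forall>l\<in>J. \<forall>s\<ge>0. u n l \<in> E (NN n) \<inter> Xh s)"
    proof (intro allI impI ballI IntI)
      fix Xh and l s :: real
      assume "invariant_subscale X nrm E P s0 \<nu> J (F \<epsilon>) Xh" "l \<in> J" "0 \<le> s"
      then show "u n l \<in> Xh s" by (rule inv)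
      show "u n l \<in> E (NN n)" by (rule seq_E(1)[OF seq \<open>l \<in> J\<close>])
    qed
  qed (use S1 S2 S3 S4 in blast)+
  moreover have "galerkin_limit u u' A"
    unfolding galerkin_limit_def
    by (rule exI[of _ w], rule exI[of _ w'], intro conjI C1w) (use conv w0 rate Fw winv in blast)+
  moreover have "A = (\<lambda>n. \<Inter>i\<in>{0..n}. good i (if i = 0 then (\<lambda>_. 0) else u (i - 1)))"
    by (rule ext) (rule Aeq)
  ultimately show ?thesis by blast
qed

end

section \<open>Choice of the constants\<close>

theorem theorem2:
  fixes X :: "real \<Rightarrow> 'a::real_vector set" and nrm :: "real \<Rightarrow> 'a \<Rightarrow> real"
    and E :: "real \<Rightarrow> 'a set" and P :: "real \<Rightarrow> 'a \<Rightarrow> 'a"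
    and s0 \<nu> \<epsilon>s S' :: real and J :: "real set"
    and F :: "real \<Rightarrow> real \<Rightarrow> 'a \<Rightarrow> 'a"
    and DF :: "real \<Rightarrow> real \<times> 'a \<Rightarrow> real \<times> 'a \<Rightarrow> 'a"
    and D2F :: "real \<Rightarrow> real \<times> 'a \<Rightarrow> real \<times> 'a \<Rightarrow> real \<times> 'a \<Rightarrow> 'a"
    and \<tau> \<delta> \<sigma> s1 S \<mu> p q :: real and CJ :: "real \<Rightarrow> real"
  assumes scale: "smoothing_scale X nrm E P"
    and tame: "tame_family X nrm s0 \<nu> \<epsilon>s S' J F DF D2F"
    and small: "small_at_zero X nrm s0 \<epsilon>s S' J F"
    and \<tau>: "0 < \<tau>" and \<delta>: "0 < \<delta>" "\<delta> < 1/4" and s1: "s0 < s1" and S: "S < S'"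
    and \<mu>: "\<mu> = \<tau> + \<delta> * s1"
    and p: "p = \<mu> + \<nu> / 2 + 1"
    and q: "q = 2 * \<mu> + \<nu> + 2 + \<sigma> / 2"
    and \<sigma>: "\<sigma> \<ge> max (2 * (\<tau> + \<delta> * s1) + 3 * \<nu> + 2) (4 * (\<tau> + \<delta> * s1 + \<nu>))"
    and S_lower: "2 * (2 * (\<tau> + \<delta> * s1) + \<nu> + 3 + \<sigma>) \<le> S - s1"
    and S_upper: "S - s1 \<le> 4 * (\<sigma> + 1)"
  shows "\<exists>c>0. \<exists>Nbar>0. \<exists>K0>0. \<forall>N0\<ge>Nbar. \<forall>\<epsilon>0\<in>{0<..\<epsilon>s}. \<epsilon>0 * N0 powr S \<le> c \<longrightarrow>
    (\<forall>\<epsilon>\<in>{0..<\<epsilon>0}. \<exists>(u :: nat \<Rightarrow> real \<Rightarrow> 'a) (u' :: nat \<Rightarrow> real \<Rightarrow> 'a).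
      let N = (\<lambda>n::nat. N0 ^ (2 ^ n));
          A = (\<lambda>n. \<Inter>i\<in>{0..n}. good_params nrm E P J DF CJ s1 S \<epsilon>0 \<tau> \<delta> (N i)
                        (if i = 0 then (\<lambda>_. 0) else u (i - 1)))
      in
      (\<forall>n.
        C1_curve J (X (s1 + \<nu>)) (nrm (s1 + \<nu>)) (u n) (u' n) \<and>
        \<comment> \<open>(S1)\<close>
        (\<forall>l\<in>J. u n l \<in> E (N n) \<and> u' n l \<in> E (N n) \<and> (\<epsilon> = 0 \<longrightarrow> u n l = 0) \<and>
           nrm s1 (u n l) \<le> 1 \<and> nrm s1 (u' n l) \<le> K0 * N0 powr (\<sigma> / 2)) \<and>
        \<comment> \<open>(S1-hat)\<close>
        (\<forall>Xh. invariant_subscale X nrm E P s0 \<nu> J (F \<epsilon>) Xh \<longrightarrow>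
           (\<forall>l\<in>J. \<forall>s\<ge>0. u n l \<in> E (N n) \<inter> Xh s)) \<and>
        \<comment> \<open>(S2)\<close>
        (\<forall>i. 1 \<le> i \<and> i \<le> n \<longrightarrow> (\<forall>l\<in>J.
           nrm s1 (u i l - u (i - 1) l) \<le> N i powr (- \<sigma> - 1) \<and>
           nrm s1 (u' i l - u' (i - 1) l) \<le> N i powr (- 1 - \<nu>))) \<and>
        \<comment> \<open>(S3)\<close>
        (\<forall>l \<in> open_nbhd (A n) (N n powr (- \<sigma> / 2)) \<inter> J. P (N n) (F \<epsilon> l (u n l)) = 0) \<and>
        \<comment> \<open>(S4)\<close>
        (\<forall>l\<in>J. 1 + nrm S (u n l) \<le> 2 * N (n + 1) powr p \<and>
           nrm S (u' n l) \<le> 2 * N (n + 1) powr q)) \<and>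
      (\<exists>w w'.
        C1_curve J (X (s1 + \<nu>)) (nrm (s1 + \<nu>)) w w' \<and>
        (\<forall>e>0. \<forall>\<^sub>F n in sequentially. \<forall>l\<in>J.
           nrm (s1 + \<nu>) (u n l - w l) < e \<and> nrm (s1 + \<nu>) (u' n l - w' l) < e) \<and>
        (\<epsilon> = 0 \<longrightarrow> (\<forall>l\<in>J. w l = 0)) \<and>
        (\<forall>n. \<forall>l\<in>J. nrm s1 (w l - u n l) \<le> N (n + 1) powr (- \<sigma> - 1)) \<and>
        (\<forall>l \<in> (\<Inter>n. A n). F \<epsilon> l (w l) = 0) \<and>
        (\<forall>Xh. invariant_subscale X nrm E P s0 \<nu> J (F \<epsilon>) Xh \<longrightarrow>
           (\<forall>l\<in>J. w l \<in> Xh (s1 + \<nu>)))))"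
proof -
  interpret smoothing_scale X nrm E P by (rule scale)
  interpret tame_family X nrm s0 \<nu> \<epsilon>s S' J F DF D2F by (rule tame)
  have s1_pos: "0 < s1" using s1 s0_nonneg by linarith
  have \<mu>_pos: "0 < \<mu>" unfolding \<mu> using \<tau> \<delta> s1_pos by (simp add: add_pos_pos)
  have \<sigma>1: "2 * \<mu> + 3 * \<nu> + 2 \<le> \<sigma>" and \<sigma>2: "4 * (\<mu> + \<nu>) \<le> \<sigma>" using \<sigma> unfolding \<mu> by auto
  have Sl: "2 * (2 * \<mu> + \<nu> + 3 + \<sigma>) \<le> S - s1" using S_lower unfolding \<mu> .
  have s1S: "s1 < S" using Sl \<mu>_pos \<nu>_pos \<sigma>1 by argo
  \<comment> \<open>The bound \<open>\<delta> < 1/4\<close> and the upper bound on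
    \<open>S - s1\<close> meet in this inequality, which limits the loss of the inverse at
    \<open>S\<close>.\<close>
  have \<delta>S: "\<delta> * (S - s1) \<le> \<sigma> + 1"
  proof -
    have "\<delta> * (S - s1) \<le> 1 / 4 * (S - s1)" using \<delta> s1S by (intro mult_right_mono) auto
    also have "\<dots> \<le> \<sigma> + 1" using S_upper by simp
    finally show ?thesis .
  qed
  obtain Ka where Ka: "\<And>K. Ka \<le> K \<Longrightarrow> tame_at s1 K"
    using tame_at_exists[OF small, of s1] s1 s1S S by auto
  obtain Kb where Kb: "\<And>K. Kb \<le> K \<Longrightarrow> tame_at S K"
    using tame_at_exists[OF small, of S] s1 s1S S by auto
  have S_pos: "0 \<le> S" using s1_pos s1S by linarith
  have P1s: "\<exists>C>0. \<forall>N\<ge>1. \<forall>y\<in>X s. nrm s (P N y) \<le> C * nrm s y" if "0 \<le> s" for s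
    using P1[OF that order_refl] by (auto simp: powr_zero_eq_one)
  obtain C1 where C1: "C1 > 0" "\<And>N y. N \<ge> 1 \<Longrightarrow> y \<in> X s1 \<Longrightarrow> nrm s1 (P N y) \<le> C1 * nrm s1 y"
    using P1s[of s1] s1_pos by auto
  obtain C2 where C2: "C2 > 0" "\<And>N y. N \<ge> 1 \<Longrightarrow> y \<in> X S \<Longrightarrow> nrm S (P N y) \<le> C2 * nrm S y"
    using P1s[of S] S_pos by auto
  obtain C3 where C3: "C3 > 0" "\<And>N y. N \<ge> 1 \<Longrightarrow> y \<in> X s1 \<Longrightarrow> nrm (s1 + \<nu>) (P N y) \<le> C3 * N powr \<nu> * nrm s1 y"
    using P1[of s1 \<nu>] s1_pos \<nu>_pos by auto
  obtain C4 where C4: "C4 > 0" "\<And>N y. N \<ge> 1 \<Longrightarrow> y \<in> X S \<Longrightarrow> nrm (S + \<nu>) (P N y) \<le> C4 * N powr \<nu> * nrm S y"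
    using P1[of S \<nu>] S_pos \<nu>_pos by auto
  obtain C5 where C5: "C5 > 0" "\<And>N y. N \<ge> 1 \<Longrightarrow> y \<in> X S \<Longrightarrow> nrm s1 (y - P N y) \<le> C5 * N powr (- (S - s1)) * nrm S y"
    using P2[of s1 "S - s1"] s1_pos s1S by auto
  \<comment> \<open>One constant for everything that does not depend on \<open>N0\<close> or
    \<open>\<epsilon>\<close>. The inverse estimate is applied at \<open>s1\<close> and at
    \<open>S\<close>, hence the two values of \<open>CJ\<close>.\<close>
  define K where "K = 1 + \<bar>Ka\<bar> + \<bar>Kb\<bar> + C1 + C2 + C3 + C4 + C5 + \<bar>CJ s1\<bar> + \<bar>CJ S\<bar>"
  have K_bounds: "1 \<le> K" "Ka \<le> K" "Kb \<le> K" "C1 \<le> K" "C2 \<le> K" "C3 \<le> K" "C4 \<le> K" "C5 \<le> K" "CJ s1 \<le> K" "CJ S \<le> K"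
    using C1(1) C2(1) C3(1) C4(1) C5(1) by (auto simp: K_def)
  have nn: "0 \<le> nrm s y" if "0 \<le> s" "y \<in> X s" for s y by (rule normed_nonneg[OF normed_X[OF that(1)] that(2)])
  have up: "a \<le> C * c * b \<Longrightarrow> C \<le> K \<Longrightarrow> 0 \<le> c \<Longrightarrow> 0 \<le> b \<Longrightarrow> a \<le> K * c * b" for a b c C :: real
    by (meson mult_right_mono order_trans)
  have nm: "nash_moser X nrm E P s0 \<nu> \<epsilon>s S' J F DF D2F s1 S K"
  proof unfold_locales
    show "s0 < s1" "s1 < S" "1 \<le> K" by (rule s1, rule s1S, rule K_bounds(1))
    show "s \<in> {s1, S} \<Longrightarrow> tame_at s K" for s using Ka Kb K_bounds by auto
    show "nrm s (P N y) \<le> K * nrm s y" if "s \<in> {s1, S}" "1 \<le> N" "y \<in> X s" for s N y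
    proof -
      have "0 \<le> s" using that(1) s1_pos S_pos by auto
      then show ?thesis
        using that C1(2)[OF that(2)] C2(2)[OF that(2)] up[of _ C1 1] up[of _ C2 1] K_bounds nn[of s y] by auto
    qed
    show "nrm (s + \<nu>) (P N y) \<le> K * N powr \<nu> * nrm s y" if "s \<in> {s1, S}" "1 \<le> N" "y \<in> X s" for s N y
    proof -
      have "0 \<le> s" using that(1) s1_pos S_pos by auto
      then show ?thesis
        using that C3(2)[OF that(2)] C4(2)[OF that(2)] up[OF _ K_bounds(6)] up[OF _ K_bounds(7)] nn[of s y] by auto
    qed
    show "nrm s1 (y - P N y) \<le> K * N powr (- (S - s1)) * nrm S y" if "1 \<le> N" "y \<in> X S" for N y
      by (rule up[OF C5(2)[OF that] K_bounds(8)]) (use nn[OF S_pos that(2)] in auto)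
  qed
  \<comment> \<open>A few dozen multiples of \<open>t\<close> accumulate in the estimates and have
    to stay below fixed fractions of \<open>\<nu>\<close>, 1 and \<open>\<mu>\<close>; the divisor
    1000 is generous.\<close>
  define t where "t = min \<nu> (min 1 \<mu>) / 1000"
  have t: "0 < t" "1000 * t \<le> \<nu>" "1000 * t \<le> 1" "1000 * t \<le> \<mu>"
    using \<nu>_pos \<mu>_pos by (auto simp: t_def)
  \<comment> \<open>Chosen so that \<open>N0 powr t\<close> exceeds both \<open>K\<close> and 10;
    every later scale inherits this.\<close>
  define Nbar where "Nbar = (K + 10) powr (1 / t)"
  have Nbar_t: "Nbar powr t = K + 10" using t K_bounds by (simp add: Nbar_def powr_powr)
  have Nbar1: "1 \<le> Nbar" unfolding Nbar_def using K_bounds t by (intro ge_one_powr_ge_zero) auto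
  have Nbar0: "0 < Nbar" using Nbar1 by linarith
  show ?thesis
    \<comment> \<open>All constants are absorbed by powers of \<open>N0\<close>, so both
      \<open>c\<close> and \<open>K0\<close> can be 1.\<close>
    apply (rule exI[of _ "1::real"], rule conjI[OF zero_less_one], rule exI[of _ Nbar], rule conjI[OF Nbar0],
        rule exI[of _ "1::real"], rule conjI[OF zero_less_one], intro allI impI ballI)
    subgoal premises prems for N0 \<epsilon>0 \<epsilon>
    proof -
      have N0: "1 \<le> N0" using prems(1) Nbar1 by linarith
      have "Nbar powr t \<le> N0 powr t" using prems(1) Nbar0 t by (intro powr_mono2) auto
      then have N0t: "10 \<le> N0 powr t" "K \<le> N0 powr t" using Nbar_t K_bounds(1) by auto
      have \<epsilon>: "0 \<le> \<epsilon>" "\<epsilon> < \<epsilon>0" "\<epsilon>0 \<le> \<epsilon>s" using prems by auto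
      interpret nash_moser X nrm E P s0 \<nu> \<epsilon>s S' J F DF D2F s1 S K by (rule nm)
      interpret I: nash_moser_iteration X nrm E P s0 \<nu> \<epsilon>s S' J F DF D2F s1 S K \<epsilon> \<epsilon>0 \<tau> \<delta> \<sigma> \<mu> p q N0 t CJ
        by unfold_locales (fact \<epsilon> prems(3) \<mu> \<mu>_pos p q \<sigma>1 \<sigma>2 \<delta>S Sl t N0 N0t K_bounds(9,10))+
      obtain u u' where R: "I.galerkin_curves u u' (\<lambda>n. \<Inter>i\<in>{0..n}. I.good i (if i = 0 then (\<lambda>_. 0) else u (i - 1)))"
        "I.galerkin_limit u u' (\<lambda>n. \<Inter>i\<in>{0..n}. I.good i (if i = 0 then (\<lambda>_. 0) else u (i - 1)))"
        using I.iteration by blast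
      show ?thesis
        unfolding Let_def
        by (rule exI[of _ u], rule exI[of _ u'],
            rule conjI[OF R(1)[unfolded I.galerkin_curves_def I.NN_def] R(2)[unfolded I.galerkin_limit_def I.NN_def]])
    qed
    done
qed

end
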